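(* Let $\Lambda$ be a finite dimensional algebra over a field $k$. Let $\mathcal{L}$ be a full subcategory of $\mathrm{mod}(\Lambda)$ closed under extensions and direct summands, and let $L$ be an indecomposable module in $\mathcal{L}$ such that $\mathrm{Ext}^{1}_{\Lambda}(\tilde{L},L)\neq 0$ for some $\tilde{L}$ in $\mathcal{L}$. Then the following are equivalent: (i) $\mathrm{Tr}\mathrm{D}L$ has an $\overline{\mathcal{L}}$-preenvelope in the projective stable category $\overline{\mathrm{mod}}(\Lambda)$; (ii) there exists an Auslander-Reiten sequence $0\to L\to B\to A\to 0$ in $\mathcal{L}$.
   Context: $\mathrm{mod}(\Lambda)$ is the category of finitely generated left $\Lambda$-modules, and $\mathrm{mod}(\Lambda^{op})$ that of finitely generated right $\Lambda$-modules. $\mathrm{D}=\mathrm{Hom}_k(-,k)$ is the $k$-duality, and $(-)^*=\mathrm{Hom}(-,\Lambda)$. Transpose: for a finitely generated (left or right) $\Lambda$-module $N$, take a projective resolution $\cdots\to P_1\to P_0\to N\to 0$ by finitely generated projectives. $\mathrm{Tr}N$ is the cokernel of the induced map $P_0^*\to P_1^*$ (a module on the other side). Thus $\mathrm{Tr}\mathrm{D}L=\mathrm{Tr}(\mathrm{D}L)$, formed from a projective resolution of the right module $\mathrm{D}L$, is a finitely generated left $\Lambda$-module. Projective stable category: $\overline{\mathrm{mod}}(\Lambda)$ has the same objects as $\mathrm{mod}(\Lambda)$, and its morphism sets are $\overline{\mathrm{Hom}}(A,B)=\mathrm{Hom}_\Lambda(A,B)/\mathcal{P}(A,B)$, where $\mathcal{P}(A,B)$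 is the set of homomorphisms $A\to B$ which factor through a projective module. (Note: here the overline refers to factoring out projectives.) $\overline{\mathcal{L}}$ denotes the full subcategory of $\overline{\mathrm{mod}}(\Lambda)$ whose objects are those of $\mathcal{L}$. Preenvelope: for a full subcategory $\mathcal{C}'$ of a category $\mathcal{T}$, a $\mathcal{C}'$-preenvelope of an object $T$ of $\mathcal{T}$ is a morphism $c':T\to C'$ with $C'$ in $\mathcal{C}'$ such that for every $X$ in $\mathcal{C}'$ each morphism $T\to X$ factors through $c'$. Auslander-Reiten sequences: a morphism $g:B\to C$ in $\mathcal{L}$ is right almost split in $\mathcal{L}$ if it is not a split epimorphism and every morphism $h:C'\to C$ in $\mathcal{L}$ which is not a split epimorphism is of the form $h=gh'$ for some $h':C'\to B$. Dually, $g:A\to B$ in $\mathcal{L}$ is left almost split in $\mathcal{L}$ if it is not a split monomorphism and every morphism $h:A\to A'$ in $\mathcal{L}$ which is not a split monomorphism is of the form $h=h'g$ for some $h':B\to A'$. An exact sequence $0\to A\xrightarrow{g}B\xrightarrow{f}C\to 0$ with $A,B,C$ in $\mathcal{L}$ is an Auslander-Reiten sequence in $\mathcal{L}$ if $g$ is left almost split in $\mathcal{L}$ and $f$ is right almost split in $\mathcal{L}$. *)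

theory Defs
  imports "HOL-Algebra.Algebra" "HOL-Library.FuncSet" "HOL-Library.Equipollence"
begin

section \<open>Modules over a not necessarily commutative ring\<close>

text \<open>
  The locale \<^locale>\<open>module\<close> of the library requires a commutative ring of scalars. We keep its
  record type and drop commutativity. The fields \<^term>\<open>mult\<close> and \<^term>\<open>one\<close> of that record play no
  role for a module; the constructions below leave them undefined.
\<close>

locale left_module = R?: ring R + M?: abelian_group M
  for R :: "('a, 'c) ring_scheme" (structure) and M :: "('a, 'b, 'd) module_scheme" (structure) +
  assumes smult_closed:
      "\<lbrakk>a \<in> carrier R; x \<in> carrier M\<rbrakk> \<Longrightarrow> a \<odot>\<^bsub>M\<^esub> x \<in> carrier M"
    and smult_l_distr:
      "\<lbrakk>a \<in> carrier R; b \<in> carrier R; x \<in> carrier M\<rbrakk> \<Longrightarrow>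
        (a \<oplus>\<^bsub>R\<^esub> b) \<odot>\<^bsub>M\<^esub> x = a \<odot>\<^bsub>M\<^esub> x \<oplus>\<^bsub>M\<^esub> b \<odot>\<^bsub>M\<^esub> x"
    and smult_r_distr:
      "\<lbrakk>a \<in> carrier R; x \<in> carrier M; y \<in> carrier M\<rbrakk> \<Longrightarrow>
        a \<odot>\<^bsub>M\<^esub> (x \<oplus>\<^bsub>M\<^esub> y) = a \<odot>\<^bsub>M\<^esub> x \<oplus>\<^bsub>M\<^esub> a \<odot>\<^bsub>M\<^esub> y"
    and smult_assoc1:
      "\<lbrakk>a \<in> carrier R; b \<in> carrier R; x \<in> carrier M\<rbrakk> \<Longrightarrow>
        (a \<otimes>\<^bsub>R\<^esub> b) \<odot>\<^bsub>M\<^esub> x = a \<odot>\<^bsub>M\<^esub> (b \<odot>\<^bsub>M\<^esub> x)"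
    and smult_one:
      "x \<in> carrier M \<Longrightarrow> \<one>\<^bsub>R\<^esub> \<odot>\<^bsub>M\<^esub> x = x"

definition mk_module :: "'b set \<Rightarrow> ('b \<Rightarrow> 'b \<Rightarrow> 'b) \<Rightarrow> 'b \<Rightarrow> ('a \<Rightarrow> 'b \<Rightarrow> 'b) \<Rightarrow> ('a, 'b) module"
  where "mk_module C pl z sm =
    \<lparr>carrier = C, monoid.mult = undefined, monoid.one = undefined, ring.zero = z, ring.add = pl, module.smult = sm\<rparr>"

definition finitely_generated :: "('a, 'c) ring_scheme \<Rightarrow> ('a, 'b, 'd) module_scheme \<Rightarrow> bool"
  where "finitely_generated R M \<longleftrightarrow>
    (\<exists>S. finite S \<and> S \<subseteq> carrier M \<and>
      (\<forall>x\<in>carrier M. \<exists>a\<in>S \<rightarrow> carrier R. x = (\<Oplus>\<^bsub>M\<^esub>s\<in>S. a s \<odot>\<^bsub>M\<^esub> s)))"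

definition fg_module :: "('a, 'c) ring_scheme \<Rightarrow> ('a, 'b) module \<Rightarrow> bool"
  where "fg_module R M \<longleftrightarrow> left_module R M \<and> finitely_generated R M"

text \<open>Homomorphisms are extensional functions, so that equality of homomorphisms is equality of
  functions and composition is \<^const>\<open>compose\<close>.\<close>

definition mod_hom :: "('a, 'c) ring_scheme \<Rightarrow> ('a, 'b) module \<Rightarrow> ('a, 'd) module \<Rightarrow> ('b \<Rightarrow> 'd) set"
  where "mod_hom R M N =
    {f \<in> carrier M \<rightarrow>\<^sub>E carrier N.
      (\<forall>x\<in>carrier M. \<forall>y\<in>carrier M. f (x \<oplus>\<^bsub>M\<^esub> y) = f x \<oplus>\<^bsub>N\<^esub> f y) \<and>
      (\<forall>a\<in>carrier R. \<forall>x\<in>carrier M. f (a \<odot>\<^bsub>M\<^esub> x) = a \<odot>\<^bsub>N\<^esub> f x)}"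

definition mod_id :: "('a, 'b) module \<Rightarrow> 'b \<Rightarrow> 'b"
  where "mod_id M = (\<lambda>x\<in>carrier M. x)"

definition hom_group :: "('a, 'c) ring_scheme \<Rightarrow> ('a, 'b) module \<Rightarrow> ('a, 'd) module \<Rightarrow> ('b \<Rightarrow> 'd) monoid"
  where "hom_group R M N =
    \<lparr>carrier = mod_hom R M N,
     monoid.mult = (\<lambda>f g. \<lambda>x\<in>carrier M. f x \<oplus>\<^bsub>N\<^esub> g x),
     monoid.one = (\<lambda>x\<in>carrier M. \<zero>\<^bsub>N\<^esub>)\<rparr>"

definition mod_iso :: "('a, 'c) ring_scheme \<Rightarrow> ('a, 'b) module \<Rightarrow> ('a, 'd) module \<Rightarrow> bool"
  where "mod_iso R M N \<longleftrightarrow> left_module R M \<and> left_module R N \<and>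
    (\<exists>f\<in>mod_hom R M N. bij_betw f (carrier M) (carrier N))"

definition split_mono :: "('a, 'c) ring_scheme \<Rightarrow> ('a, 'b) module \<Rightarrow> ('a, 'd) module \<Rightarrow> ('b \<Rightarrow> 'd) \<Rightarrow> bool"
  where "split_mono R M N f \<longleftrightarrow> f \<in> mod_hom R M N \<and>
    (\<exists>r\<in>mod_hom R N M. compose (carrier M) r f = mod_id M)"

definition split_epi :: "('a, 'c) ring_scheme \<Rightarrow> ('a, 'b) module \<Rightarrow> ('a, 'd) module \<Rightarrow> ('b \<Rightarrow> 'd) \<Rightarrow> bool"
  where "split_epi R M N f \<longleftrightarrow> f \<in> mod_hom R M N \<and>
    (\<exists>s\<in>mod_hom R N M. compose (carrier N) f s = mod_id N)"

definition direct_sum :: "('a, 'b) module \<Rightarrow> ('a, 'd) module \<Rightarrow> ('a, 'b \<times> 'd) module"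
  where "direct_sum U V = mk_module (carrier U \<times> carrier V)
    (\<lambda>(x, y) (x', y'). (x \<oplus>\<^bsub>U\<^esub> x', y \<oplus>\<^bsub>V\<^esub> y')) (\<zero>\<^bsub>U\<^esub>, \<zero>\<^bsub>V\<^esub>)
    (\<lambda>a (x, y). (a \<odot>\<^bsub>U\<^esub> x, a \<odot>\<^bsub>V\<^esub> y))"

definition indecomposable :: "('a, 'c) ring_scheme \<Rightarrow> ('a, 'b) module \<Rightarrow> bool"
  where "indecomposable R M \<longleftrightarrow> left_module R M \<and> carrier M \<noteq> {\<zero>\<^bsub>M\<^esub>} \<and>
    (\<forall>(U :: ('a, 'b) module) (V :: ('a, 'b) module). left_module R U \<and> left_module R V \<and> mod_iso R M (direct_sum U V) \<longrightarrow>
      carrier U = {\<zero>\<^bsub>U\<^esub>} \<or> carrier V = {\<zero>\<^bsub>V\<^esub>})"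

definition direct_summand :: "('a, 'c) ring_scheme \<Rightarrow> ('a, 'b) module \<Rightarrow> ('a, 'b) module \<Rightarrow> bool"
  where "direct_summand R U M \<longleftrightarrow> left_module R U \<and>
    (\<exists>V :: ('a, 'b) module. left_module R V \<and> mod_iso R M (direct_sum U V))"

definition short_exact :: "('a, 'c) ring_scheme \<Rightarrow> ('a, 'b) module \<Rightarrow> ('b \<Rightarrow> 'd) \<Rightarrow> ('a, 'd) module \<Rightarrow>
    ('d \<Rightarrow> 'e) \<Rightarrow> ('a, 'e) module \<Rightarrow> bool"
  where "short_exact R A g B f C \<longleftrightarrow> g \<in> mod_hom R A B \<and> f \<in> mod_hom R B C \<and>
    inj_on g (carrier A) \<and> g ` carrier A = a_kernel B C f \<and> f ` carrier B = carrier C"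

section \<open>Projective modules, projective resolutions and Ext\<close>

text \<open>The lifting property is tested on modules carried by the same type as \<open>P\<close>. This is the usual
  notion as soon as that type is large enough to carry a copy of every finitely generated module.\<close>

definition projective :: "('a, 'c) ring_scheme \<Rightarrow> ('a, 'b) module \<Rightarrow> bool"
  where "projective R P \<longleftrightarrow> left_module R P \<and>
    (\<forall>(M :: ('a, 'b) module) (N :: ('a, 'b) module). left_module R M \<and> left_module R N \<longrightarrow>
      (\<forall>g\<in>mod_hom R M N. g ` carrier M = carrier N \<longrightarrow>
        (\<forall>f\<in>mod_hom R P N. \<exists>h\<in>mod_hom R P M. f = compose (carrier P) g h)))"

text \<open>The resolution is \<open>\<cdots> \<rightarrow> P 2 \<rightarrow> P 1 \<rightarrow> P 0 \<rightarrow> N \<rightarrow> 0\<close> with differentials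
  \<open>d n : P (n + 1) \<rightarrow> P n\<close> and augmentation \<open>\<epsilon> : P 0 \<rightarrow> N\<close>.\<close>

definition projective_resolution :: "('a, 'c) ring_scheme \<Rightarrow> (nat \<Rightarrow> ('a, 'b) module) \<Rightarrow> (nat \<Rightarrow> 'b \<Rightarrow> 'b) \<Rightarrow>
    ('b \<Rightarrow> 'd) \<Rightarrow> ('a, 'd) module \<Rightarrow> bool"
  where "projective_resolution R P d \<epsilon> N \<longleftrightarrow>
    (\<forall>n. fg_module R (P n) \<and> projective R (P n)) \<and>
    (\<forall>n. d n \<in> mod_hom R (P (Suc n)) (P n)) \<and>
    \<epsilon> \<in> mod_hom R (P 0) N \<and>
    (\<forall>n. d (Suc n) ` carrier (P (Suc (Suc n))) = a_kernel (P (Suc n)) (P n) (d n)) \<and>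
    d 0 ` carrier (P 1) = a_kernel (P 0) N \<epsilon> \<and>
    \<epsilon> ` carrier (P 0) = carrier N"

text \<open>The first cohomology group of \<open>Hom (P, N)\<close>. If \<open>P\<close> with differentials \<open>d\<close> is a projective
  resolution of \<open>M\<close>, this is \<open>Ext\<^sup>1 (M, N)\<close>.\<close>

definition Ext1 :: "('a, 'c) ring_scheme \<Rightarrow> (nat \<Rightarrow> ('a, 'b) module) \<Rightarrow> (nat \<Rightarrow> 'b \<Rightarrow> 'b) \<Rightarrow>
    ('a, 'd) module \<Rightarrow> ('b \<Rightarrow> 'd) set monoid"
  where "Ext1 R P d N =
    (hom_group R (P 1) N)
      \<lparr>carrier := {f \<in> mod_hom R (P 1) N. compose (carrier (P 2)) f (d 1) = \<one>\<^bsub>hom_group R (P 2) N\<^esub>}\<rparr>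
    Mod ((\<lambda>g. compose (carrier (P 1)) g (d 0)) ` mod_hom R (P 0) N)"

section \<open>Right modules and the transpose\<close>

text \<open>Right \<open>R\<close>-modules are left modules over the opposite ring.\<close>

definition opp :: "('a, 'c) ring_scheme \<Rightarrow> ('a, 'c) ring_scheme"
  where "opp R = R\<lparr>monoid.mult := \<lambda>x y. y \<otimes>\<^bsub>R\<^esub> x\<rparr>"

lemma opp_opp: "opp (opp R) = R"
  by (simp add: opp_def)

definition regular :: "('a, 'c) ring_scheme \<Rightarrow> ('a, 'a) module"
  where "regular R = mk_module (carrier R) (ring.add R) \<zero>\<^bsub>R\<^esub> (monoid.mult R)"

text \<open>\<open>N\<^sup>* = Hom\<^sub>R (N, R)\<close> with the right \<open>R\<close>-action \<open>(f r) (x) = f (x) r\<close>.\<close>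

definition ring_dual :: "('a, 'c) ring_scheme \<Rightarrow> ('a, 'b) module \<Rightarrow> ('a, 'b \<Rightarrow> 'a) module"
  where "ring_dual R N = mk_module (mod_hom R N (regular R))
    (monoid.mult (hom_group R N (regular R))) \<one>\<^bsub>hom_group R N (regular R)\<^esub>
    (\<lambda>r f. \<lambda>x\<in>carrier N. f x \<otimes>\<^bsub>R\<^esub> r)"

definition ring_dual_map :: "('a, 'c) ring_scheme \<Rightarrow> ('a, 'b) module \<Rightarrow> ('a, 'd) module \<Rightarrow>
    ('b \<Rightarrow> 'd) \<Rightarrow> ('d \<Rightarrow> 'a) \<Rightarrow> 'b \<Rightarrow> 'a"
  where "ring_dual_map R M N f = (\<lambda>g\<in>mod_hom R N (regular R). compose (carrier M) g f)"

definition cokernel :: "('a, 'b) module \<Rightarrow> ('a, 'd) module \<Rightarrow> ('b \<Rightarrow> 'd) \<Rightarrow> ('a, 'd set) module"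
  where "cokernel M N f = (let I = f ` carrier M in
    mk_module (a_rcosets\<^bsub>N\<^esub> I) (\<lambda>U V. U <+>\<^bsub>N\<^esub> V) I (\<lambda>a U. \<Union>x\<in>U. I +>\<^bsub>N\<^esub> (a \<odot>\<^bsub>N\<^esub> x)))"

text \<open>The transpose depends on the chosen resolution, so it is a relation:
  \<open>T\<close> is a transpose of \<open>N\<close> if it is isomorphic to the cokernel of \<open>(P 0)\<^sup>* \<rightarrow> (P 1)\<^sup>*\<close> for some
  resolution \<open>P\<close> of \<open>N\<close>.\<close>

definition is_transpose :: "('a, 'c) ring_scheme \<Rightarrow> ('a, 'd) module \<Rightarrow> ('a, 'b) module \<Rightarrow> bool"
  where "is_transpose R N T \<longleftrightarrow> fg_module (opp R) T \<and>
    (\<exists>(P :: nat \<Rightarrow> ('a, 'b) module) d \<epsilon>. projective_resolution R P d \<epsilon> N \<and>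
      mod_iso (opp R) T
        (cokernel (ring_dual R (P 0)) (ring_dual R (P 1)) (ring_dual_map R (P 1) (P 0) (d 0))))"

section \<open>Finite dimensional algebras and the duality\<close>

locale fd_algebra = K?: field K + A?: ring A + KA?: Module.module K A
  for K :: "('k, 'c) ring_scheme" (structure) and A :: "('k, 'a, 'd) module_scheme" (structure) +
  assumes smult_mult_left:
      "\<lbrakk>c \<in> carrier K; x \<in> carrier A; y \<in> carrier A\<rbrakk> \<Longrightarrow>
        (c \<odot>\<^bsub>A\<^esub> x) \<otimes>\<^bsub>A\<^esub> y = c \<odot>\<^bsub>A\<^esub> (x \<otimes>\<^bsub>A\<^esub> y)"
    and smult_mult_right:
      "\<lbrakk>c \<in> carrier K; x \<in> carrier A; y \<in> carrier A\<rbrakk> \<Longrightarrow>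
        x \<otimes>\<^bsub>A\<^esub> (c \<odot>\<^bsub>A\<^esub> y) = c \<odot>\<^bsub>A\<^esub> (x \<otimes>\<^bsub>A\<^esub> y)"
    and finite_dimensional: "finitely_generated K A"

definition underlying_space :: "('k, 'a) module \<Rightarrow> ('a, 'b) module \<Rightarrow> ('k, 'b) module"
  where "underlying_space A M = mk_module (carrier M) (ring.add M) \<zero>\<^bsub>M\<^esub> (\<lambda>c x. (c \<odot>\<^bsub>A\<^esub> \<one>\<^bsub>A\<^esub>) \<odot>\<^bsub>M\<^esub> x)"

text \<open>\<open>D M = Hom\<^sub>K (M, K)\<close> for a left \<open>A\<close>-module \<open>M\<close>, with the right \<open>A\<close>-action
  \<open>(f a) (x) = f (a x)\<close>.\<close>

definition kdual :: "('k, 'c) ring_scheme \<Rightarrow> ('k, 'a) module \<Rightarrow> ('a, 'b) module \<Rightarrow> ('a, 'b \<Rightarrow> 'k) module"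
  where "kdual K A M =
    (let H = hom_group K (underlying_space A M) (regular K)
     in mk_module (carrier H) (monoid.mult H) \<one>\<^bsub>H\<^esub> (\<lambda>a f. \<lambda>x\<in>carrier M. f (a \<odot>\<^bsub>M\<^esub> x)))"

section \<open>Preenvelopes and the projective stable category\<close>

record ('o, 'h) category =
  Obj :: "'o set"
  Mor :: "'o \<Rightarrow> 'o \<Rightarrow> 'h set"
  Comp :: "'o \<Rightarrow> 'o \<Rightarrow> 'o \<Rightarrow> 'h \<Rightarrow> 'h \<Rightarrow> 'h"

text \<open>Here \<open>\<C>\<close> is the set of objects of the full subcategory, and \<open>Comp \<T> A B C g f\<close> is the
  composite of \<open>f : A \<rightarrow> B\<close> and \<open>g : B \<rightarrow> C\<close>.\<close>

definition preenvelope :: "('o, 'h) category \<Rightarrow> 'o set \<Rightarrow> 'o \<Rightarrow> 'o \<Rightarrow> 'h \<Rightarrow> bool"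
  where "preenvelope \<T> \<C> T C c \<longleftrightarrow> \<C> \<subseteq> Obj \<T> \<and> T \<in> Obj \<T> \<and> C \<in> \<C> \<and> c \<in> Mor \<T> T C \<and>
    (\<forall>U\<in>\<C>. \<forall>h\<in>Mor \<T> T U. \<exists>h'\<in>Mor \<T> C U. h = Comp \<T> T C U h' c)"

definition proj_factor :: "('a, 'c) ring_scheme \<Rightarrow> ('a, 'b) module \<Rightarrow> ('a, 'b) module \<Rightarrow> ('b \<Rightarrow> 'b) set"
  where "proj_factor R A B =
    {f. \<exists>Q :: ('a, 'b) module. fg_module R Q \<and> projective R Q \<and>
      (\<exists>u\<in>mod_hom R A Q. \<exists>v\<in>mod_hom R Q B. f = compose (carrier A) v u)}"

text \<open>Morphisms are cosets of homomorphisms modulo those factoring through projectives; all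
  representatives yield the same coset in the union defining the composite.\<close>

definition stable_category :: "('a, 'c) ring_scheme \<Rightarrow> (('a, 'b) module, ('b \<Rightarrow> 'b) set) category"
  where "stable_category R =
    \<lparr>Obj = {M. fg_module R M},
     Mor = (\<lambda>A B. carrier (hom_group R A B Mod proj_factor R A B)),
     Comp = (\<lambda>A B C \<psi> \<phi>. \<Union>g\<in>\<psi>. \<Union>f\<in>\<phi>.
       proj_factor R A C #>\<^bsub>hom_group R A C\<^esub> compose (carrier A) g f)\<rparr>"

section \<open>Subcategories and Auslander-Reiten sequences\<close>

text \<open>A full subcategory is given by its set \<open>\<L>\<close> of objects.\<close>

definition closed_under_extensions :: "('a, 'c) ring_scheme \<Rightarrow> ('a, 'b) module set \<Rightarrow> bool"
  where "closed_under_extensions R \<L> \<longleftrightarrow>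
    (\<forall>A\<in>\<L>. \<forall>C\<in>\<L>. \<forall>B g f. fg_module R B \<and> short_exact R A g B f C \<longrightarrow> B \<in> \<L>)"

definition closed_under_summands :: "('a, 'c) ring_scheme \<Rightarrow> ('a, 'b) module set \<Rightarrow> bool"
  where "closed_under_summands R \<L> \<longleftrightarrow> (\<forall>M\<in>\<L>. \<forall>U. direct_summand R U M \<longrightarrow> U \<in> \<L>)"

definition right_almost_split :: "('a, 'c) ring_scheme \<Rightarrow> ('a, 'b) module set \<Rightarrow>
    ('a, 'b) module \<Rightarrow> ('a, 'b) module \<Rightarrow> ('b \<Rightarrow> 'b) \<Rightarrow> bool"
  where "right_almost_split R \<L> B C g \<longleftrightarrow>
    B \<in> \<L> \<and> C \<in> \<L> \<and> g \<in> mod_hom R B C \<and> \<not> split_epi R B C g \<and>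
    (\<forall>C'\<in>\<L>. \<forall>h\<in>mod_hom R C' C. \<not> split_epi R C' C h \<longrightarrow>
      (\<exists>h'\<in>mod_hom R C' B. h = compose (carrier C') g h'))"

definition left_almost_split :: "('a, 'c) ring_scheme \<Rightarrow> ('a, 'b) module set \<Rightarrow>
    ('a, 'b) module \<Rightarrow> ('a, 'b) module \<Rightarrow> ('b \<Rightarrow> 'b) \<Rightarrow> bool"
  where "left_almost_split R \<L> A B g \<longleftrightarrow>
    A \<in> \<L> \<and> B \<in> \<L> \<and> g \<in> mod_hom R A B \<and> \<not> split_mono R A B g \<and>
    (\<forall>A'\<in>\<L>. \<forall>h\<in>mod_hom R A A'. \<not> split_mono R A A' h \<longrightarrow>
      (\<exists>h'\<in>mod_hom R B A'. h = compose (carrier A) h' g))"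

definition AR_sequence :: "('a, 'c) ring_scheme \<Rightarrow> ('a, 'b) module set \<Rightarrow> ('a, 'b) module \<Rightarrow> ('b \<Rightarrow> 'b) \<Rightarrow>
    ('a, 'b) module \<Rightarrow> ('b \<Rightarrow> 'b) \<Rightarrow> ('a, 'b) module \<Rightarrow> bool"
  where "AR_sequence R \<L> A g B f C \<longleftrightarrow>
    A \<in> \<L> \<and> B \<in> \<L> \<and> C \<in> \<L> \<and> short_exact R A g B f C \<and>
    left_almost_split R \<L> A B g \<and> right_almost_split R \<L> B C f"

end

theory Submission
  imports Defs
begin

text \<open>Write \<open>T = Tr D L\<close>. The proof rests on a concrete form of the Auslander-Reiten formula, which
  describes the extensions of a module \<open>M\<close> by \<open>L\<close> through functionals on \<open>Hom (T, M)\<close>. Let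
  \<open>P1 \<rightarrow> P0 \<rightarrow> D L \<rightarrow> 0\<close> be the presentation that defines \<open>T\<close>, so that \<open>P0\<^sup>* \<rightarrow> P1\<^sup>* \<rightarrow> T \<rightarrow> 0\<close> is exact.
  The map \<open>\<epsilon> : P0 \<rightarrow> D L\<close> is a pairing of \<open>P0\<close> with \<open>L\<close>. Since \<open>Hom (P\<^sup>*, W)\<close> is \<open>P \<otimes> W\<close> for a
  finitely generated projective \<open>P\<close>, it induces a functional \<open>tr\<close> on \<open>Hom (P0\<^sup>*, L)\<close>. Given a short
  exact sequence \<open>0 \<rightarrow> L \<rightarrow> W \<rightarrow> M \<rightarrow> 0\<close> and \<open>t : T \<rightarrow> M\<close>, lift the composite \<open>P1\<^sup>* \<rightarrow> T \<rightarrow> M\<close> to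
  \<open>\<rho> : P1\<^sup>* \<rightarrow> W\<close>. Restricted to \<open>P0\<^sup>*\<close>, the map \<open>\<rho>\<close> takes values in \<open>L\<close>, and the image of this
  restriction under \<open>tr\<close> depends on \<open>t\<close> only. So the sequence has a connecting functional \<open>\<xi>\<close> on
  \<open>Hom (T, M)\<close> (\<open>connecting_exists\<close>). It is natural in the sequence (\<open>connecting_natural\<close>), and it
  vanishes only if the sequence splits (\<open>connecting_zero_split\<close>). Hence a map \<open>b : N \<rightarrow> M\<close> lifts to
  \<open>W\<close> as soon as \<open>\<xi> (b t) = 0\<close> for all \<open>t : T \<rightarrow> N\<close> (\<open>connecting_lift\<close>). Finally, every functional
  that vanishes on the maps factoring through projectives is the connecting functional of some
  extension (\<open>connecting_realize\<close>).

  From an Auslander-Reiten sequence \<open>0 \<rightarrow> L \<rightarrow> B \<rightarrow> C \<rightarrow> 0\<close> with connecting functional \<open>\<delta>\<close> to a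
  preenvelope: as the sequence does not split, \<open>\<delta> (c) \<noteq> 0\<close> for some \<open>c : T \<rightarrow> C\<close>, and \<open>c\<close> is the
  preenvelope (\<open>preenvelope_of_AR_sequence\<close>). If \<open>h : T \<rightarrow> U\<close> were not of the form \<open>p + a c\<close> with \<open>p\<close>
  factoring through a projective, some functional \<open>\<xi>\<close> on \<open>Hom (T, U)\<close> would vanish on all maps of
  this form but not on \<open>h\<close>. It belongs to a non-split extension \<open>0 \<rightarrow> L \<rightarrow> Z \<rightarrow> U \<rightarrow> 0\<close>. The map \<open>L \<rightarrow> Z\<close>
  factors through \<open>L \<rightarrow> B\<close>, which induces \<open>a : C \<rightarrow> U\<close> with \<open>\<xi> (a c) = \<delta> (c) \<noteq> 0\<close>, a contradiction.

  From a preenvelope \<open>c : T \<rightarrow> C\<close> to an Auslander-Reiten sequence: since \<open>Ext\<^sup>1 (L', L) \<noteq> 0\<close>, there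
  is a nonzero functional on \<open>Hom (T, L')\<close> that vanishes on maps through projectives, and composing
  it with a suitable map \<open>C \<rightarrow> L'\<close> gives one on \<open>Hom (T, C)\<close>. Among all such functionals on
  \<open>Hom (T, C)\<close> choose \<open>\<delta>\<close> with \<open>\<delta> End (C)\<close> of minimal dimension. Then every \<open>b : M \<rightarrow> C\<close> with
  \<open>\<delta> (b -) \<noteq> 0\<close> and \<open>M\<close> in \<open>\<L>\<close> has an \<open>a : C \<rightarrow> M\<close> with \<open>\<delta> (b a -) = \<delta>\<close>: the preenvelope property
  yields \<open>a\<close> with \<open>\<delta> (b a c) \<noteq> 0\<close>, and by minimality \<open>\<delta> (b a -)\<close> generates the same subspace as \<open>\<delta>\<close>
  (\<open>recurrent_exists\<close>). Replacing \<open>C\<close> by a Fitting summand, one may also assume that only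
  automorphisms \<open>\<phi>\<close> of \<open>C\<close> satisfy \<open>\<delta> (\<phi> -) = \<delta>\<close> (\<open>recurrent_minimal\<close>). The extension
  \<open>0 \<rightarrow> L \<rightarrow> B \<rightarrow> C \<rightarrow> 0\<close> with connecting functional \<open>\<delta>\<close> is then an Auslander-Reiten sequence
  (\<open>AR_sequence_of_recurrent\<close>). Indeed, if \<open>h : C' \<rightarrow> C\<close> does not lift to \<open>B\<close>, then \<open>\<delta> (h -) \<noteq> 0\<close>, so
  \<open>h a\<close> is an automorphism for some \<open>a\<close>, and \<open>h\<close> is a split epimorphism. If \<open>h : L \<rightarrow> A'\<close> is not a
  split monomorphism, let \<open>\<pi> : B' \<rightarrow> C\<close> be the pushout of the sequence along \<open>h\<close>. As \<open>End (L)\<close> is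
  local, \<open>\<pi>\<close> does not lift to \<open>B\<close>, so \<open>\<delta> (\<pi> a -) = \<delta>\<close> for some \<open>a : C \<rightarrow> B'\<close>. Thus \<open>1 - \<pi> a\<close> lifts to
  \<open>B\<close>, which makes \<open>\<pi>\<close> a split epimorphism, and \<open>h\<close> extends to \<open>B\<close>.

  Free modules, cokernels and pushouts are constructed on types other than the carrier type of the
  given modules. The cardinality assumption on that type provides isomorphic copies on it
  (\<open>copy_module\<close>).\<close>

section \<open>Modules, submodules and homomorphisms\<close>

lemma mk_module_simps [simp]:
  "carrier (mk_module C pl z sm) = C" "ring.add (mk_module C pl z sm) = pl"
  "ring.zero (mk_module C pl z sm) = z" "module.smult (mk_module C pl z sm) = sm"
  by (simp_all add: mk_module_def)

lemma left_module_iff: "left_module R M \<longleftrightarrow> ring R \<and> abelian_group M \<and> left_module_axioms R M"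
  by (auto simp: left_module_def)

text \<open>The inverse of \<open>x\<close> is \<open>(-1) x\<close>, so a module obtained by a construction need not exhibit inverses
  separately.\<close>

lemma left_module_mkI:
  assumes "ring R"
    and "\<And>x y. \<lbrakk>x \<in> carrier M; y \<in> carrier M\<rbrakk> \<Longrightarrow> x \<oplus>\<^bsub>M\<^esub> y \<in> carrier M"
    and "\<zero>\<^bsub>M\<^esub> \<in> carrier M"
    and "\<And>x y z. \<lbrakk>x \<in> carrier M; y \<in> carrier M; z \<in> carrier M\<rbrakk> \<Longrightarrow>
      (x \<oplus>\<^bsub>M\<^esub> y) \<oplus>\<^bsub>M\<^esub> z = x \<oplus>\<^bsub>M\<^esub> (y \<oplus>\<^bsub>M\<^esub> z)"
    and "\<And>x y. \<lbrakk>x \<in> carrier M; y \<in> carrier M\<rbrakk> \<Longrightarrow> x \<oplus>\<^bsub>M\<^esub> y = y \<oplus>\<^bsub>M\<^esub> x"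
    and "\<And>x. x \<in> carrier M \<Longrightarrow> \<zero>\<^bsub>M\<^esub> \<oplus>\<^bsub>M\<^esub> x = x"
    and neg: "\<And>x. x \<in> carrier M \<Longrightarrow> ((\<ominus>\<^bsub>R\<^esub> \<one>\<^bsub>R\<^esub>) \<odot>\<^bsub>M\<^esub> x) \<oplus>\<^bsub>M\<^esub> x = \<zero>\<^bsub>M\<^esub>"
    and sm: "\<And>a x. \<lbrakk>a \<in> carrier R; x \<in> carrier M\<rbrakk> \<Longrightarrow> a \<odot>\<^bsub>M\<^esub> x \<in> carrier M"
    and "\<And>a b x. \<lbrakk>a \<in> carrier R; b \<in> carrier R; x \<in> carrier M\<rbrakk> \<Longrightarrow>
        (a \<oplus>\<^bsub>R\<^esub> b) \<odot>\<^bsub>M\<^esub> x = a \<odot>\<^bsub>M\<^esub> x \<oplus>\<^bsub>M\<^esub> b \<odot>\<^bsub>M\<^esub> x"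
    and "\<And>a x y. \<lbrakk>a \<in> carrier R; x \<in> carrier M; y \<in> carrier M\<rbrakk> \<Longrightarrow>
        a \<odot>\<^bsub>M\<^esub> (x \<oplus>\<^bsub>M\<^esub> y) = a \<odot>\<^bsub>M\<^esub> x \<oplus>\<^bsub>M\<^esub> a \<odot>\<^bsub>M\<^esub> y"
    and "\<And>a b x. \<lbrakk>a \<in> carrier R; b \<in> carrier R; x \<in> carrier M\<rbrakk> \<Longrightarrow>
        (a \<otimes>\<^bsub>R\<^esub> b) \<odot>\<^bsub>M\<^esub> x = a \<odot>\<^bsub>M\<^esub> (b \<odot>\<^bsub>M\<^esub> x)"
    and "\<And>x. x \<in> carrier M \<Longrightarrow> \<one>\<^bsub>R\<^esub> \<odot>\<^bsub>M\<^esub> x = x"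
  shows "left_module R M"
proof -
  interpret R: ring R by fact
  have "abelian_group M"
  proof (rule abelian_groupI)
    show "\<exists>y\<in>carrier M. y \<oplus>\<^bsub>M\<^esub> x = \<zero>\<^bsub>M\<^esub>" if "x \<in> carrier M" for x
      using neg[OF that] sm[OF R.a_inv_closed[OF R.one_closed] that] by blast
  qed (use assms in auto)
  then show ?thesis
    unfolding left_module_iff left_module_axioms_def using assms by auto
qed

lemma left_module_laws:
  assumes "left_module R M"
  shows smult_zero: "a \<in> carrier R \<Longrightarrow> a \<odot>\<^bsub>M\<^esub> \<zero>\<^bsub>M\<^esub> = \<zero>\<^bsub>M\<^esub>"
    and zero_smult: "x \<in> carrier M \<Longrightarrow> \<zero>\<^bsub>R\<^esub> \<odot>\<^bsub>M\<^esub> x = \<zero>\<^bsub>M\<^esub>"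
    and minus_one_smult: "x \<in> carrier M \<Longrightarrow> (\<ominus>\<^bsub>R\<^esub> \<one>\<^bsub>R\<^esub>) \<odot>\<^bsub>M\<^esub> x = \<ominus>\<^bsub>M\<^esub> x"
proof -
  interpret left_module R M by fact
  show z: "a \<odot>\<^bsub>M\<^esub> \<zero>\<^bsub>M\<^esub> = \<zero>\<^bsub>M\<^esub>" if a: "a \<in> carrier R" for a
  proof -
    have "a \<odot>\<^bsub>M\<^esub> \<zero>\<^bsub>M\<^esub> \<oplus>\<^bsub>M\<^esub> a \<odot>\<^bsub>M\<^esub> \<zero>\<^bsub>M\<^esub> = a \<odot>\<^bsub>M\<^esub> \<zero>\<^bsub>M\<^esub>"
      using smult_r_distr[OF a M.zero_closed M.zero_closed] by simp
    then show ?thesis using smult_closed[OF a M.zero_closed] by simp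
  qed
  show z': "\<zero>\<^bsub>R\<^esub> \<odot>\<^bsub>M\<^esub> x = \<zero>\<^bsub>M\<^esub>" if x: "x \<in> carrier M" for x
  proof -
    have "\<zero>\<^bsub>R\<^esub> \<odot>\<^bsub>M\<^esub> x \<oplus>\<^bsub>M\<^esub> \<zero>\<^bsub>R\<^esub> \<odot>\<^bsub>M\<^esub> x = \<zero>\<^bsub>R\<^esub> \<odot>\<^bsub>M\<^esub> x"
      using smult_l_distr[OF R.zero_closed R.zero_closed x] by simp
    then show ?thesis using smult_closed[OF R.zero_closed x] by simp
  qed
  show "(\<ominus>\<^bsub>R\<^esub> \<one>\<^bsub>R\<^esub>) \<odot>\<^bsub>M\<^esub> x = \<ominus>\<^bsub>M\<^esub> x" if x: "x \<in> carrier M"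
  proof -
    have "((\<ominus>\<^bsub>R\<^esub> \<one>\<^bsub>R\<^esub>) \<odot>\<^bsub>M\<^esub> x) \<oplus>\<^bsub>M\<^esub> x = \<zero>\<^bsub>M\<^esub>"
      using smult_l_distr[OF R.a_inv_closed[OF R.one_closed] R.one_closed x] smult_one[OF x] z'[OF x]
      by (simp add: R.l_neg)
    then show ?thesis using smult_closed[OF R.a_inv_closed[OF R.one_closed] x] x
      by (metis M.minus_equality)
  qed
qed

lemma diff_eq_zeroD:
  assumes "left_module R M" "x \<in> carrier M" "y \<in> carrier M" "x \<ominus>\<^bsub>M\<^esub> y = \<zero>\<^bsub>M\<^esub>"
  shows "x = y"
proof -
  interpret left_module R M by fact
  have "\<ominus>\<^bsub>M\<^esub> (\<ominus>\<^bsub>M\<^esub> y) = x"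
    by (rule M.minus_equality) (use assms in \<open>auto simp: a_minus_def\<close>)
  then show ?thesis using assms by simp
qed

lemma smult_minus:
  assumes "left_module R M" "a \<in> carrier R" "x \<in> carrier M"
  shows "a \<odot>\<^bsub>M\<^esub> (\<ominus>\<^bsub>M\<^esub> x) = \<ominus>\<^bsub>M\<^esub> (a \<odot>\<^bsub>M\<^esub> x)"
proof -
  interpret left_module R M by fact
  have "a \<odot>\<^bsub>M\<^esub> (\<ominus>\<^bsub>M\<^esub> x) \<oplus>\<^bsub>M\<^esub> a \<odot>\<^bsub>M\<^esub> x = \<zero>\<^bsub>M\<^esub>"
    using smult_r_distr[of a "\<ominus>\<^bsub>M\<^esub> x" x] assms smult_zero[OF assms(1)] by (simp add: M.l_neg)
  then show ?thesis using assms smult_closed M.minus_equality by simp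
qed

text \<open>Closure under negation follows from \<open>-x = (-1) x\<close>.\<close>

definition submod :: "('a, 'c) ring_scheme \<Rightarrow> ('a, 'b, 'd) module_scheme \<Rightarrow> 'b set \<Rightarrow> bool"
  where "submod R M N \<longleftrightarrow> N \<subseteq> carrier M \<and> \<zero>\<^bsub>M\<^esub> \<in> N \<and>
    (\<forall>x\<in>N. \<forall>y\<in>N. x \<oplus>\<^bsub>M\<^esub> y \<in> N) \<and> (\<forall>a\<in>carrier R. \<forall>x\<in>N. a \<odot>\<^bsub>M\<^esub> x \<in> N)"

lemma submodI:
  assumes "\<And>x. x \<in> N \<Longrightarrow> x \<in> carrier M" "\<zero>\<^bsub>M\<^esub> \<in> N"
    "\<And>x y. x \<in> N \<Longrightarrow> y \<in> N \<Longrightarrow> x \<oplus>\<^bsub>M\<^esub> y \<in> N"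
    "\<And>a x. a \<in> carrier R \<Longrightarrow> x \<in> N \<Longrightarrow> a \<odot>\<^bsub>M\<^esub> x \<in> N"
  shows "submod R M N"
  using assms by (auto simp: submod_def)

lemma submodD:
  assumes "submod R M N"
  shows submod_sub: "x \<in> N \<Longrightarrow> x \<in> carrier M" and submod_zero: "\<zero>\<^bsub>M\<^esub> \<in> N"
    and submod_add: "x \<in> N \<Longrightarrow> y \<in> N \<Longrightarrow> x \<oplus>\<^bsub>M\<^esub> y \<in> N"
    and submod_smult: "a \<in> carrier R \<Longrightarrow> x \<in> N \<Longrightarrow> a \<odot>\<^bsub>M\<^esub> x \<in> N"
  using assms by (auto simp: submod_def)

lemma submod_carrier: "left_module R M \<Longrightarrow> submod R M (carrier M)"
  by (auto simp: submod_def left_module_iff left_module_axioms_def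
      intro: abelian_groupE)

lemma submod_minus:
  assumes "left_module R M" "submod R M N" "x \<in> N" shows "\<ominus>\<^bsub>M\<^esub> x \<in> N"
proof -
  interpret left_module R M by fact
  show ?thesis
    using submod_smult[OF assms(2) R.a_inv_closed[OF R.one_closed] assms(3)]
      minus_one_smult[OF assms(1)] submod_sub[OF assms(2,3)] by simp
qed

lemma submod_diff:
  assumes "left_module R M" "submod R M N" "x \<in> N" "y \<in> N" shows "x \<ominus>\<^bsub>M\<^esub> y \<in> N"
  using assms submod_minus by (metis a_minus_def submod_add)

lemma left_module_submod:
  assumes "left_module R M" "submod R M N"
  shows "left_module R (M\<lparr>carrier := N\<rparr>)"
proof -
  interpret left_module R M by fact
  note s = submodD[OF assms(2)]
  show ?thesis
    by (rule left_module_mkI)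
      (auto simp: s M.a_assoc M.a_comm M.a_lcomm M.r_neg smult_l_distr smult_r_distr smult_assoc1 smult_one
        minus_one_smult[OF assms(1)] M.l_neg R.ring_axioms intro: s)
qed

lemma submod_Int: "\<lbrakk>submod R M N; submod R M N'\<rbrakk> \<Longrightarrow> submod R M (N \<inter> N')"
  by (auto simp: submod_def)

lemma submod_sum:
  assumes M: "left_module R M" and I: "submod R M I" and J: "submod R M J"
  defines "S \<equiv> {x \<oplus>\<^bsub>M\<^esub> y | x y. x \<in> I \<and> y \<in> J}"
  shows "submod R M S" "x \<in> I \<Longrightarrow> x \<in> S" "y \<in> J \<Longrightarrow> y \<in> S"
proof -
  interpret left_module R M by fact
  note i = submodD[OF I] and j = submodD[OF J]
  have mem: "x \<oplus>\<^bsub>M\<^esub> y \<in> S" if "x \<in> I" "y \<in> J" for x y using that by (auto simp: S_def)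
  show 1: "x \<in> I \<Longrightarrow> x \<in> S" for x using mem[of x "\<zero>\<^bsub>M\<^esub>"] i(1) j(2) by simp
  show "y \<in> J \<Longrightarrow> y \<in> S" using mem[of "\<zero>\<^bsub>M\<^esub>" y] j(1) i(2) by simp
  show "submod R M S"
  proof (rule submodI)
    show "x \<in> S \<Longrightarrow> x \<in> carrier M" for x using i(1) j(1) by (auto simp: S_def)
    show "\<zero>\<^bsub>M\<^esub> \<in> S" by (rule 1[OF i(2)])
  next
    fix u v assume "u \<in> S" "v \<in> S"
    then obtain x y x' y' where *: "u = x \<oplus>\<^bsub>M\<^esub> y" "v = x' \<oplus>\<^bsub>M\<^esub> y'" "x \<in> I" "x' \<in> I" "y \<in> J" "y' \<in> J"
      by (auto simp: S_def)
    then have "u \<oplus>\<^bsub>M\<^esub> v = (x \<oplus>\<^bsub>M\<^esub> x') \<oplus>\<^bsub>M\<^esub> (y \<oplus>\<^bsub>M\<^esub> y')" using i(1) j(1) by (simp add: M.a_ac)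
    then show "u \<oplus>\<^bsub>M\<^esub> v \<in> S" using mem[OF i(3) j(3)] * by simp
  next
    fix a u assume a: "a \<in> carrier R" and "u \<in> S"
    then obtain x y where *: "u = x \<oplus>\<^bsub>M\<^esub> y" "x \<in> I" "y \<in> J" by (auto simp: S_def)
    then have "a \<odot>\<^bsub>M\<^esub> u = a \<odot>\<^bsub>M\<^esub> x \<oplus>\<^bsub>M\<^esub> a \<odot>\<^bsub>M\<^esub> y" using i(1) j(1) a by (simp add: smult_r_distr)
    then show "a \<odot>\<^bsub>M\<^esub> u \<in> S" using mem[OF i(4)[OF a] j(4)[OF a]] * by simp
  qed
qed

lemma mod_homI:
  assumes "\<And>x. x \<in> carrier M \<Longrightarrow> F x \<in> carrier N"
    "\<And>x y. x \<in> carrier M \<Longrightarrow> y \<in> carrier M \<Longrightarrow> F (x \<oplus>\<^bsub>M\<^esub> y) = F x \<oplus>\<^bsub>N\<^esub> F y"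
    "\<And>a x. a \<in> carrier R \<Longrightarrow> x \<in> carrier M \<Longrightarrow> F (a \<odot>\<^bsub>M\<^esub> x) = a \<odot>\<^bsub>N\<^esub> F x"
    "left_module R M"
  shows "(\<lambda>x\<in>carrier M. F x) \<in> mod_hom R M N"
proof -
  interpret left_module R M by fact
  show ?thesis unfolding mod_hom_def using assms by (auto simp: smult_closed)
qed

lemma mod_homD:
  assumes "f \<in> mod_hom R M N"
  shows mod_hom_closed: "x \<in> carrier M \<Longrightarrow> f x \<in> carrier N"
    and mod_hom_add: "x \<in> carrier M \<Longrightarrow> y \<in> carrier M \<Longrightarrow> f (x \<oplus>\<^bsub>M\<^esub> y) = f x \<oplus>\<^bsub>N\<^esub> f y"
    and mod_hom_smult: "a \<in> carrier R \<Longrightarrow> x \<in> carrier M \<Longrightarrow> f (a \<odot>\<^bsub>M\<^esub> x) = a \<odot>\<^bsub>N\<^esub> f x"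
    and mod_hom_extensional: "f \<in> extensional (carrier M)"
    and mod_hom_funcset: "f \<in> carrier M \<rightarrow>\<^sub>E carrier N"
  using assms by (auto simp: mod_hom_def PiE_def)

lemma mod_hom_eqI:
  assumes "f \<in> mod_hom R M N" "g \<in> mod_hom R' M N'" "\<And>x. x \<in> carrier M \<Longrightarrow> f x = g x"
  shows "f = g"
  using assms mod_hom_extensional by (meson extensionalityI)

lemma mod_hom_zero:
  assumes "left_module R M" "left_module R N" "f \<in> mod_hom R M N"
  shows "f \<zero>\<^bsub>M\<^esub> = \<zero>\<^bsub>N\<^esub>"
proof -
  interpret M: left_module R M by fact
  interpret N: left_module R N by fact
  have "f (\<zero>\<^bsub>R\<^esub> \<odot>\<^bsub>M\<^esub> \<zero>\<^bsub>M\<^esub>) = \<zero>\<^bsub>R\<^esub> \<odot>\<^bsub>N\<^esub> f \<zero>\<^bsub>M\<^esub>"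
    by (rule mod_hom_smult[OF assms(3)]) auto
  then show ?thesis
    using mod_hom_closed[OF assms(3)] by (simp add: smult_zero[OF assms(1)] zero_smult[OF assms(2)])
qed

lemma mod_hom_minus:
  assumes "left_module R M" "left_module R N" "f \<in> mod_hom R M N" "x \<in> carrier M"
  shows "f (\<ominus>\<^bsub>M\<^esub> x) = \<ominus>\<^bsub>N\<^esub> f x"
proof -
  interpret M: left_module R M by fact
  interpret N: left_module R N by fact
  show ?thesis
    using mod_hom_smult[OF assms(3) M.R.a_inv_closed[OF M.R.one_closed] assms(4)]
      minus_one_smult[OF assms(1,4)] minus_one_smult[OF assms(2) mod_hom_closed[OF assms(3,4)]] by simp
qed

lemma mod_hom_diff:
  assumes "left_module R M" "left_module R N" "f \<in> mod_hom R M N" "x \<in> carrier M" "y \<in> carrier M"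
  shows "f (x \<ominus>\<^bsub>M\<^esub> y) = f x \<ominus>\<^bsub>N\<^esub> f y"
proof -
  interpret M: left_module R M by fact
  show ?thesis
    using assms mod_hom_add[OF assms(3,4) M.M.a_inv_closed[OF assms(5)]] mod_hom_minus[OF assms(1-3)]
    by (simp add: a_minus_def)
qed

lemma mod_hom_compose:
  assumes "left_module R M" "f \<in> mod_hom R M N" "g \<in> mod_hom R N P"
  shows "compose (carrier M) g f \<in> mod_hom R M P"
  unfolding compose_def
  by (rule mod_homI) (use assms in \<open>auto simp: mod_homD\<close>)

lemma compose_assoc_hom:
  assumes "f \<in> mod_hom R M N"
  shows "compose (carrier M) h (compose (carrier M) g f) = compose (carrier M) (compose (carrier N) h g) f"
  using mod_hom_closed[OF assms] by (auto simp: compose_def)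

lemma mod_hom_id: "left_module R M \<Longrightarrow> mod_id M \<in> mod_hom R M M"
  unfolding mod_id_def by (rule mod_homI) auto

lemma mod_id_apply: "x \<in> carrier M \<Longrightarrow> mod_id M x = x"
  by (simp add: mod_id_def)

lemma mod_hom_into_submod:
  assumes "f \<in> mod_hom R M N" "\<And>x. x \<in> carrier M \<Longrightarrow> f x \<in> N'"
  shows "f \<in> mod_hom R M (N\<lparr>carrier := N'\<rparr>)"
  using assms by (auto simp: mod_hom_def)

lemma mod_hom_restrict:
  assumes "left_module R M" "submod R M M'" "f \<in> mod_hom R M N"
  shows "restrict f M' \<in> mod_hom R (M\<lparr>carrier := M'\<rparr>) N"
  using mod_homI[of "M\<lparr>carrier := M'\<rparr>" f N R] left_module_submod[OF assms(1,2)] assms(3)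
    submodD[OF assms(2)]
  by (auto simp: mod_homD)

lemma mod_hom_incl:
  assumes "left_module R M" "submod R M M'"
  shows "(\<lambda>x\<in>M'. x) \<in> mod_hom R (M\<lparr>carrier := M'\<rparr>) M"
  using mod_homI[of "M\<lparr>carrier := M'\<rparr>" "\<lambda>x. x" M R] left_module_submod[OF assms(1,2)]
    submodD[OF assms(2)]
  by auto

lemma submod_kernel:
  assumes "left_module R M" "left_module R N" "f \<in> mod_hom R M N"
  shows "submod R M (a_kernel M N f)"
proof -
  interpret M: left_module R M by fact
  interpret N: left_module R N by fact
  show ?thesis
    by (rule submodI) (auto simp: a_kernel_def' mod_homD[OF assms(3)] mod_hom_zero[OF assms]
        M.smult_closed smult_zero[OF assms(2)])
qed

lemma submod_image:
  assumes "left_module R M" "left_module R N" "f \<in> mod_hom R M N" "submod R M M'"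
  shows "submod R N (f ` M')"
proof (rule submodI)
  note s = submodD[OF assms(4)] note f = mod_homD[OF assms(3)]
  show "\<zero>\<^bsub>N\<^esub> \<in> f ` M'" using mod_hom_zero[OF assms(1-3)] s(2) by force
  show "x \<in> f ` M' \<Longrightarrow> x \<in> carrier N" for x using s(1) f(1) by auto
  fix x y assume "x \<in> f ` M'" "y \<in> f ` M'"
  then obtain u v where "u \<in> M'" "v \<in> M'" "x = f u" "y = f v" by auto
  then show "x \<oplus>\<^bsub>N\<^esub> y \<in> f ` M'" using s f(2) by (metis image_eqI)
next
  note s = submodD[OF assms(4)] note f = mod_homD[OF assms(3)]
  fix a x assume a: "a \<in> carrier R" and "x \<in> f ` M'"
  then obtain u where "u \<in> M'" "x = f u" by auto
  then show "a \<odot>\<^bsub>N\<^esub> x \<in> f ` M'" using s f(3) a by (metis image_eqI)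
qed

lemma mod_hom_inverse:
  assumes "left_module R M" "left_module R N" "f \<in> mod_hom R M N" "bij_betw f (carrier M) (carrier N)"
  obtains h where "h \<in> mod_hom R N M" "\<And>x. x \<in> carrier M \<Longrightarrow> h (f x) = x"
    "\<And>y. y \<in> carrier N \<Longrightarrow> f (h y) = y" "bij_betw h (carrier N) (carrier M)"
proof -
  interpret M: left_module R M by fact
  interpret N: left_module R N by fact
  define h where "h = (\<lambda>y\<in>carrier N. inv_into (carrier M) f y)"
  have inj: "inj_on f (carrier M)" and im: "f ` carrier M = carrier N"
    using assms(4) by (auto simp: bij_betw_def)
  have hf: "h (f x) = x" if "x \<in> carrier M" for x
    using that inj im by (auto simp: h_def)
  have fh: "f (h y) = y" and hc: "h y \<in> carrier M" if "y \<in> carrier N" for y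
    using that im by (auto simp: h_def f_inv_into_f inv_into_into)
  have "h \<in> mod_hom R N M"
    unfolding h_def
  proof (rule mod_homI)
    have *: "inv_into (carrier M) f z = x" if "x \<in> carrier M" "f x = z" for x z
      using that inj by auto
    fix x y assume xy: "x \<in> carrier N" "y \<in> carrier N"
    show "inv_into (carrier M) f (x \<oplus>\<^bsub>N\<^esub> y) = inv_into (carrier M) f x \<oplus>\<^bsub>M\<^esub> inv_into (carrier M) f y"
      using fh[OF xy(1)] fh[OF xy(2)] hc[OF xy(1)] hc[OF xy(2)] xy
      by (intro *) (auto simp: h_def mod_homD[OF assms(3)])
  next
    have *: "inv_into (carrier M) f z = x" if "x \<in> carrier M" "f x = z" for x z
      using that inj by auto
    fix a x assume ax: "a \<in> carrier R" "x \<in> carrier N"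
    show "inv_into (carrier M) f (a \<odot>\<^bsub>N\<^esub> x) = a \<odot>\<^bsub>M\<^esub> inv_into (carrier M) f x"
      using fh[OF ax(2)] hc[OF ax(2)] ax
      by (intro *) (auto simp: h_def mod_homD[OF assms(3)] M.smult_closed)
  qed (use hc assms in \<open>auto simp: h_def\<close>)
  moreover have "bij_betw h (carrier N) (carrier M)"
    by (rule bij_betw_byWitness[where f'=f]) (use hf fh hc mod_hom_closed[OF assms(3)] in auto)
  ultimately show thesis using that hf fh by blast
qed

lemma mod_hom_finsum:
  assumes "left_module R M" "left_module R N" "f \<in> mod_hom R M N" "finite S" "y \<in> S \<rightarrow> carrier M"
  shows "f (\<Oplus>\<^bsub>M\<^esub>s\<in>S. y s) = (\<Oplus>\<^bsub>N\<^esub>s\<in>S. f (y s))"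
  using assms(4,5)
proof (induction S)
  case empty
  interpret M: left_module R M by fact
  interpret N: left_module R N by fact
  show ?case using mod_hom_zero[OF assms(1-3)] by simp
next
  case (insert s S)
  interpret M: left_module R M by fact
  interpret N: left_module R N by fact
  have "\<And>t. t \<in> S \<Longrightarrow> f (y t) \<in> carrier N" "f (y s) \<in> carrier N" using insert mod_hom_closed[OF assms(3)] by auto
  then show ?case using insert
    by (simp add: M.M.finsum_insert N.M.finsum_insert Pi_iff mod_hom_add[OF assms(3)] M.M.finsum_closed)
qed

lemma submod_finsum:
  assumes "left_module R M" "submod R M N" "finite S" "y \<in> S \<rightarrow> N"
  shows "(\<Oplus>\<^bsub>M\<^esub>s\<in>S. y s) \<in> N"
  using assms(3,4)
proof (induction S)
  case empty
  interpret M: left_module R M by fact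
  show ?case using submod_zero[OF assms(2)] by simp
next
  case (insert s S)
  interpret M: left_module R M by fact
  have "y \<in> S \<rightarrow> carrier M" "y s \<in> carrier M" using insert submod_sub[OF assms(2)] by auto
  then show ?case using insert
    by (subst M.finsum_insert) (auto intro: submod_add[OF assms(2)])
qed

section \<open>Constructions\<close>

text \<open>Functions on \<open>I\<close> serve two purposes: with \<open>B\<close> the regular module this is the free module on \<open>I\<close>,
  and homomorphisms into \<open>B\<close> form a subspace of it.\<close>

definition pow_mod :: "'i set \<Rightarrow> ('a, 'b, 'd) module_scheme \<Rightarrow> ('a, 'i \<Rightarrow> 'b) module"
  where "pow_mod I B = mk_module (I \<rightarrow>\<^sub>E carrier B) (\<lambda>f g. \<lambda>i\<in>I. f i \<oplus>\<^bsub>B\<^esub> g i) (\<lambda>i\<in>I. \<zero>\<^bsub>B\<^esub>)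
    (\<lambda>a f. \<lambda>i\<in>I. a \<odot>\<^bsub>B\<^esub> f i)"

lemma pow_mod_simps [simp]:
  "carrier (pow_mod I B) = I \<rightarrow>\<^sub>E carrier B"
  "f \<oplus>\<^bsub>pow_mod I B\<^esub> g = (\<lambda>i\<in>I. f i \<oplus>\<^bsub>B\<^esub> g i)"
  "\<zero>\<^bsub>pow_mod I B\<^esub> = (\<lambda>i\<in>I. \<zero>\<^bsub>B\<^esub>)"
  "a \<odot>\<^bsub>pow_mod I B\<^esub> f = (\<lambda>i\<in>I. a \<odot>\<^bsub>B\<^esub> f i)"
  by (simp_all add: pow_mod_def)

lemma left_module_pow_mod:
  assumes "left_module R B" shows "left_module R (pow_mod I B)"
proof -
  interpret left_module R B by fact
  have mem: "f i \<in> carrier B" if "f \<in> carrier (pow_mod I B)" "i \<in> I" for f i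
    using that by auto
  show ?thesis
  proof (rule left_module_mkI)
    show "ring R" by (rule R.ring_axioms)
    fix f assume f: "f \<in> carrier (pow_mod I B)"
    then show "\<zero>\<^bsub>pow_mod I B\<^esub> \<oplus>\<^bsub>pow_mod I B\<^esub> f = f" "\<one>\<^bsub>R\<^esub> \<odot>\<^bsub>pow_mod I B\<^esub> f = f"
      using mem[of f] PiE_arb[of f I "\<lambda>_. carrier B"] by (auto simp: fun_eq_iff smult_one)
    show "((\<ominus>\<^bsub>R\<^esub> \<one>\<^bsub>R\<^esub>) \<odot>\<^bsub>pow_mod I B\<^esub> f) \<oplus>\<^bsub>pow_mod I B\<^esub> f = \<zero>\<^bsub>pow_mod I B\<^esub>"
      by (auto simp: fun_eq_iff mem[OF f] minus_one_smult[OF assms mem[OF f]] M.l_neg)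
    show "a \<odot>\<^bsub>pow_mod I B\<^esub> f \<in> carrier (pow_mod I B)" if "a \<in> carrier R" for a
      using that mem[OF f] by (auto simp: smult_closed)
    show "(a \<oplus>\<^bsub>R\<^esub> b) \<odot>\<^bsub>pow_mod I B\<^esub> f = a \<odot>\<^bsub>pow_mod I B\<^esub> f \<oplus>\<^bsub>pow_mod I B\<^esub> b \<odot>\<^bsub>pow_mod I B\<^esub> f"
      "(a \<otimes>\<^bsub>R\<^esub> b) \<odot>\<^bsub>pow_mod I B\<^esub> f = a \<odot>\<^bsub>pow_mod I B\<^esub> (b \<odot>\<^bsub>pow_mod I B\<^esub> f)"
      if "a \<in> carrier R" "b \<in> carrier R" for a b
      using that mem[OF f] by (auto simp: fun_eq_iff smult_l_distr smult_assoc1)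
    fix g assume g: "g \<in> carrier (pow_mod I B)"
    show "f \<oplus>\<^bsub>pow_mod I B\<^esub> g \<in> carrier (pow_mod I B)" "f \<oplus>\<^bsub>pow_mod I B\<^esub> g = g \<oplus>\<^bsub>pow_mod I B\<^esub> f"
      using mem[OF f] mem[OF g] by (auto simp: fun_eq_iff M.a_comm)
    show "a \<odot>\<^bsub>pow_mod I B\<^esub> (f \<oplus>\<^bsub>pow_mod I B\<^esub> g) = a \<odot>\<^bsub>pow_mod I B\<^esub> f \<oplus>\<^bsub>pow_mod I B\<^esub> a \<odot>\<^bsub>pow_mod I B\<^esub> g"
      if "a \<in> carrier R" for a
      using that mem[OF f] mem[OF g] by (auto simp: fun_eq_iff smult_r_distr)
    fix h assume h: "h \<in> carrier (pow_mod I B)"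
    show "(f \<oplus>\<^bsub>pow_mod I B\<^esub> g) \<oplus>\<^bsub>pow_mod I B\<^esub> h = f \<oplus>\<^bsub>pow_mod I B\<^esub> (g \<oplus>\<^bsub>pow_mod I B\<^esub> h)"
      using mem[OF f] mem[OF g] mem[OF h] by (auto simp: fun_eq_iff M.a_assoc)
  qed auto
qed

lemma pow_mod_eval:
  assumes "left_module R B" "i \<in> I" shows "(\<lambda>f\<in>carrier (pow_mod I B). f i) \<in> mod_hom R (pow_mod I B) B"
proof (rule mod_homI)
  show "left_module R (pow_mod I B)" by (rule left_module_pow_mod[OF assms(1)])
qed (use assms(2) in auto)

lemma direct_sum_simps [simp]:
  "carrier (direct_sum U V) = carrier U \<times> carrier V"
  "\<zero>\<^bsub>direct_sum U V\<^esub> = (\<zero>\<^bsub>U\<^esub>, \<zero>\<^bsub>V\<^esub>)"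
  "(x, y) \<oplus>\<^bsub>direct_sum U V\<^esub> (x', y') = (x \<oplus>\<^bsub>U\<^esub> x', y \<oplus>\<^bsub>V\<^esub> y')"
  "a \<odot>\<^bsub>direct_sum U V\<^esub> (x, y) = (a \<odot>\<^bsub>U\<^esub> x, a \<odot>\<^bsub>V\<^esub> y)"
  by (simp_all add: direct_sum_def)

lemma left_module_direct_sum:
  assumes "left_module R U" "left_module R V" shows "left_module R (direct_sum U V)"
proof -
  interpret U: left_module R U by fact
  interpret V: left_module R V by fact
  show ?thesis
    by (rule left_module_mkI)
      (auto simp: U.R.ring_axioms U.M.a_ac V.M.a_ac U.M.r_neg V.M.r_neg U.smult_l_distr V.smult_l_distr
        U.smult_r_distr V.smult_r_distr U.smult_assoc1 V.smult_assoc1 U.smult_one V.smult_one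
        U.smult_closed V.smult_closed minus_one_smult[OF assms(1)] minus_one_smult[OF assms(2)]
        U.M.l_neg V.M.l_neg)
qed

lemma left_module_regular:
  assumes "ring R" shows "left_module R (regular R)"
proof -
  interpret ring R by fact
  show ?thesis unfolding regular_def
    by (rule left_module_mkI) (auto simp: ring_axioms a_ac r_neg l_distr r_distr m_assoc l_minus l_neg)
qed

lemma regular_simps [simp]:
  "carrier (regular R) = carrier R" "ring.add (regular R) = ring.add R" "\<zero>\<^bsub>regular R\<^esub> = \<zero>\<^bsub>R\<^esub>"
  "module.smult (regular R) = monoid.mult R"
  by (simp_all add: regular_def)

text \<open>Modules constructed on an auxiliary type are moved to the type under consideration along an
  injection of their carrier.\<close>

lemma transport_module:
  assumes "left_module R W" "inj_on i (carrier W)"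
  obtains Y where "left_module R Y" "carrier Y = i ` carrier W" "(\<lambda>x\<in>carrier W. i x) \<in> mod_hom R W Y"
    "bij_betw (\<lambda>x\<in>carrier W. i x) (carrier W) (carrier Y)"
proof -
  interpret W: left_module R W by fact
  let ?j = "inv_into (carrier W) i"
  define Y where "Y = mk_module (i ` carrier W) (\<lambda>x y. i (?j x \<oplus>\<^bsub>W\<^esub> ?j y)) (i \<zero>\<^bsub>W\<^esub>) (\<lambda>a x. i (a \<odot>\<^bsub>W\<^esub> ?j x))"
  have j: "?j (i x) = x" if "x \<in> carrier W" for x using that assms(2) by auto
  have "left_module R Y"
    unfolding Y_def
    by (rule left_module_mkI)
      (auto simp: j W.R.ring_axioms W.M.a_ac W.M.r_neg W.smult_l_distr W.smult_r_distr W.smult_assoc1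
        W.smult_one W.smult_closed minus_one_smult[OF assms(1)] W.M.l_neg)
  moreover have "(\<lambda>x\<in>carrier W. i x) \<in> mod_hom R W Y"
    by (rule mod_homI) (auto simp: Y_def j assms)
  moreover have "bij_betw (\<lambda>x\<in>carrier W. i x) (carrier W) (carrier Y)"
    using assms(2) by (auto simp: Y_def bij_betw_def inj_on_def)
  ultimately show thesis using that by (simp add: Y_def)
qed

section \<open>Finite spans and dimension\<close>

text \<open>Spans of lists, rather than of sets, allow induction on the number of generators by splitting off
  one vector at a time.\<close>

primrec lspan :: "('a, 'c) ring_scheme \<Rightarrow> ('a, 'b, 'd) module_scheme \<Rightarrow> 'b list \<Rightarrow> 'b set"
  where "lspan R M [] = {\<zero>\<^bsub>M\<^esub>}"
  | "lspan R M (v # vs) = {(c \<odot>\<^bsub>M\<^esub> v) \<oplus>\<^bsub>M\<^esub> u | c u. c \<in> carrier R \<and> u \<in> lspan R M vs}"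

definition fin_span :: "('a, 'c) ring_scheme \<Rightarrow> ('a, 'b, 'd) module_scheme \<Rightarrow> 'b set \<Rightarrow> bool"
  where "fin_span R M N \<longleftrightarrow> (\<exists>vs. set vs \<subseteq> carrier M \<and> lspan R M vs = N)"

lemma lspan_cong:
  assumes "module.smult M = module.smult M'" "ring.add M = ring.add M'" "\<zero>\<^bsub>M\<^esub> = \<zero>\<^bsub>M'\<^esub>"
  shows "lspan R M vs = lspan R M' vs"
  using assms by (induction vs) auto

lemma submod_lspan:
  assumes "left_module R M" "set vs \<subseteq> carrier M"
  shows "submod R M (lspan R M vs)"
  using assms(2)
proof (induction vs)
  case Nil
  interpret left_module R M by fact
  show ?case by (auto simp: submod_def smult_zero[OF assms(1)])
next
  case (Cons v vs)
  interpret left_module R M by fact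
  have v: "v \<in> carrier M" using Cons by simp
  have IH: "submod R M (lspan R M vs)" using Cons by simp
  note s = submodD[OF IH]
  show ?case
  proof (rule submodI)
    fix x assume "x \<in> lspan R M (v # vs)"
    then show "x \<in> carrier M" using s v by (auto simp: smult_closed)
  next
    show "\<zero>\<^bsub>M\<^esub> \<in> lspan R M (v # vs)"
      using s(2) v zero_smult[OF assms(1) v] by (auto intro!: exI[of _ "\<zero>\<^bsub>R\<^esub>"] exI[of _ "\<zero>\<^bsub>M\<^esub>"])
  next
    fix x y assume "x \<in> lspan R M (v # vs)" "y \<in> lspan R M (v # vs)"
    then obtain c u d w where *: "x = c \<odot>\<^bsub>M\<^esub> v \<oplus>\<^bsub>M\<^esub> u" "y = d \<odot>\<^bsub>M\<^esub> v \<oplus>\<^bsub>M\<^esub> w" "c \<in> carrier R" "d \<in> carrier R"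
      "u \<in> lspan R M vs" "w \<in> lspan R M vs" by auto
    then have "x \<oplus>\<^bsub>M\<^esub> y = (c \<oplus>\<^bsub>R\<^esub> d) \<odot>\<^bsub>M\<^esub> v \<oplus>\<^bsub>M\<^esub> (u \<oplus>\<^bsub>M\<^esub> w)"
      using v s(1) by (simp add: smult_l_distr M.a_ac smult_closed)
    then show "x \<oplus>\<^bsub>M\<^esub> y \<in> lspan R M (v # vs)" using * s(3) by auto
  next
    fix a x assume a: "a \<in> carrier R" and "x \<in> lspan R M (v # vs)"
    then obtain c u where *: "x = c \<odot>\<^bsub>M\<^esub> v \<oplus>\<^bsub>M\<^esub> u" "c \<in> carrier R" "u \<in> lspan R M vs" by auto
    then have "a \<odot>\<^bsub>M\<^esub> x = (a \<otimes>\<^bsub>R\<^esub> c) \<odot>\<^bsub>M\<^esub> v \<oplus>\<^bsub>M\<^esub> (a \<odot>\<^bsub>M\<^esub> u)"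
      using v s(1) a by (simp add: smult_r_distr smult_assoc1 smult_closed)
    then show "a \<odot>\<^bsub>M\<^esub> x \<in> lspan R M (v # vs)" using * s(4) a by auto
  qed
qed

lemma lspan_superset:
  assumes "left_module R M" "set vs \<subseteq> carrier M" shows "set vs \<subseteq> lspan R M vs"
  using assms(2)
proof (induction vs)
  case (Cons v vs)
  interpret left_module R M by fact
  have vs: "set vs \<subseteq> carrier M" and v: "v \<in> carrier M" using Cons by auto
  note s = submodD[OF submod_lspan[OF assms(1) vs]]
  have "v \<in> lspan R M (v # vs)"
    using s(2) v by (auto intro!: exI[of _ "\<one>\<^bsub>R\<^esub>"] exI[of _ "\<zero>\<^bsub>M\<^esub>"] simp: smult_one)
  moreover have "u \<in> lspan R M (v # vs)" if "u \<in> lspan R M vs" for u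
    using that v zero_smult[OF assms(1) v] s(1)[OF that]
    by (auto intro!: exI[of _ "\<zero>\<^bsub>R\<^esub>"] exI[of _ u])
  ultimately show ?case using Cons.IH[OF vs] by auto
qed simp

lemma lspan_least:
  assumes "submod R M N" "set vs \<subseteq> N" shows "lspan R M vs \<subseteq> N"
  using assms(2) by (induction vs) (use submodD[OF assms(1)] in auto)

lemma lspan_image:
  assumes "left_module R M" "left_module R N" "f \<in> mod_hom R M N" "set vs \<subseteq> carrier M"
  shows "f ` lspan R M vs = lspan R N (map f vs)"
  using assms(4)
proof (induction vs)
  case Nil then show ?case using mod_hom_zero[OF assms(1-3)] by simp
next
  case (Cons v vs)
  interpret M: left_module R M by fact
  have vs: "set vs \<subseteq> carrier M" and v: "v \<in> carrier M" using Cons by auto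
  note s = submod_sub[OF submod_lspan[OF assms(1) vs]]
  have "f (c \<odot>\<^bsub>M\<^esub> v \<oplus>\<^bsub>M\<^esub> u) = c \<odot>\<^bsub>N\<^esub> f v \<oplus>\<^bsub>N\<^esub> f u" if "c \<in> carrier R" "u \<in> lspan R M vs" for c u
    using that s v by (simp add: mod_hom_add[OF assms(3)] mod_hom_smult[OF assms(3)] M.smult_closed)
  then show ?case
    using Cons.IH[OF vs] by (fastforce simp flip: Cons.IH[OF vs] simp: image_iff)
qed

lemma fin_span_image:
  assumes "left_module R M" "left_module R N" "f \<in> mod_hom R M N" "fin_span R M U"
  shows "fin_span R N (f ` U)"
proof -
  obtain vs where "set vs \<subseteq> carrier M" "lspan R M vs = U" using assms(4) by (auto simp: fin_span_def)
  then show ?thesis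
    using lspan_image[OF assms(1-3)] mod_hom_closed[OF assms(3)]
    by (auto simp: fin_span_def subset_iff intro!: exI[of _ "map f vs"])
qed

lemma fin_span_subm:
  assumes "fin_span R M U" "left_module R M" "U \<subseteq> N"
  shows "fin_span R (M\<lparr>carrier := N\<rparr>) U"
proof -
  obtain vs where vs: "set vs \<subseteq> carrier M" "lspan R M vs = U" using assms(1) by (auto simp: fin_span_def)
  then have "set vs \<subseteq> N" using lspan_superset[OF assms(2) vs(1)] assms(3) by auto
  moreover have "lspan R (M\<lparr>carrier := N\<rparr>) vs = lspan R M vs" by (rule lspan_cong) auto
  ultimately show ?thesis using vs by (auto simp: fin_span_def)
qed

text \<open>Generators of \<open>U\<close> are generators of the kernel together with preimages of generators of the image.\<close>

lemma fin_span_extension: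
  assumes M: "left_module R M" and N: "left_module R N" and f: "f \<in> mod_hom R M N"
    and U: "submod R M U" and im: "fin_span R N (f ` U)" and ke: "fin_span R M {x \<in> U. f x = \<zero>\<^bsub>N\<^esub>}"
  shows "fin_span R M U"
proof -
  interpret M: left_module R M by fact
  interpret N: left_module R N by fact
  obtain ws where ws: "set ws \<subseteq> carrier N" "lspan R N ws = f ` U" using im by (auto simp: fin_span_def)
  obtain ks where ks: "set ks \<subseteq> carrier M" "lspan R M ks = {x \<in> U. f x = \<zero>\<^bsub>N\<^esub>}"
    using ke by (auto simp: fin_span_def)
  have "set ws \<subseteq> f ` U" using lspan_superset[OF N ws(1)] ws(2) by simp
  then have "\<exists>us. set us \<subseteq> U \<and> ws = map f us"
  proof (induction ws)
    case (Cons w ws)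
    then obtain us u where "set us \<subseteq> U" "ws = map f us" "u \<in> U" "w = f u" by auto
    then show ?case by (intro exI[of _ "u # us"]) auto
  qed simp
  then obtain us where us: "set us \<subseteq> U" "ws = map f us" by auto
  note s = submodD[OF U]
  have usM: "set us \<subseteq> carrier M" using us s by auto
  have all: "set (us @ ks) \<subseteq> carrier M" using usM ks by auto
  have ksU: "set ks \<subseteq> U" using lspan_superset[OF M ks(1)] ks(2) by auto
  note A = submod_lspan[OF M all]
  have inc: "lspan R M us \<subseteq> lspan R M (us @ ks)" "lspan R M ks \<subseteq> lspan R M (us @ ks)"
    by (rule lspan_least[OF A]; use lspan_superset[OF M all] in auto)+
  have "x \<in> lspan R M (us @ ks)" if x: "x \<in> U" for x
  proof -
    have "f x \<in> f ` lspan R M us" using ws us(2) x lspan_image[OF M N f usM] by auto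
    then obtain y where y: "y \<in> lspan R M us" "f x = f y" by auto
    have yU: "y \<in> U" using y(1) lspan_least[OF U us(1)] by auto
    have xy: "x \<in> carrier M" "y \<in> carrier M" using s(1) x yU by auto
    have "f (x \<ominus>\<^bsub>M\<^esub> y) = \<zero>\<^bsub>N\<^esub>"
      using mod_hom_diff[OF M N f xy] y(2) mod_hom_closed[OF f xy(2)]
      by (simp add: a_minus_def N.M.r_neg)
    then have "x \<ominus>\<^bsub>M\<^esub> y \<in> lspan R M ks" using submod_diff[OF M U x yU] ks(2) by auto
    moreover have "x = y \<oplus>\<^bsub>M\<^esub> (x \<ominus>\<^bsub>M\<^esub> y)" using xy by (simp add: a_minus_def M.M.a_ac M.M.r_neg)
    ultimately show ?thesis using inc y(1) submod_add[OF A] by (metis subsetD)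
  qed
  moreover have "lspan R M (us @ ks) \<subseteq> U" by (rule lspan_least[OF U]) (use us ksU in auto)
  ultimately show ?thesis using all by (auto simp: fin_span_def intro!: exI[of _ "us @ ks"])
qed

lemma lincomb_hom:
  assumes "left_module R M" "finite S" "y \<in> S \<rightarrow> carrier M"
  shows "(\<lambda>a\<in>carrier (pow_mod S (regular R)). \<Oplus>\<^bsub>M\<^esub>s\<in>S. a s \<odot>\<^bsub>M\<^esub> y s) \<in> mod_hom R (pow_mod S (regular R)) M"
proof (rule mod_homI)
  interpret M: left_module R M by fact
  show "left_module R (pow_mod S (regular R))"
    by (rule left_module_pow_mod[OF left_module_regular[OF M.R.ring_axioms]])
  have cl: "a s \<odot>\<^bsub>M\<^esub> y s \<in> carrier M" if "a \<in> S \<rightarrow>\<^sub>E carrier R" "s \<in> S" for a s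
    using that assms(3) by (intro M.smult_closed) auto
  show "(\<Oplus>\<^bsub>M\<^esub>s\<in>S. a s \<odot>\<^bsub>M\<^esub> y s) \<in> carrier M" if "a \<in> carrier (pow_mod S (regular R))" for a
    using that cl by (intro M.M.finsum_closed) auto
  have ys: "y s \<in> carrier M" if "s \<in> S" for s using that assms(3) by auto
  fix a assume a: "a \<in> carrier (pow_mod S (regular R))"
  then have a': "a s \<in> carrier R" if "s \<in> S" for s using that by auto
  show "(\<Oplus>\<^bsub>M\<^esub>s\<in>S. (a \<oplus>\<^bsub>pow_mod S (regular R)\<^esub> b) s \<odot>\<^bsub>M\<^esub> y s) =
      (\<Oplus>\<^bsub>M\<^esub>s\<in>S. a s \<odot>\<^bsub>M\<^esub> y s) \<oplus>\<^bsub>M\<^esub> (\<Oplus>\<^bsub>M\<^esub>s\<in>S. b s \<odot>\<^bsub>M\<^esub> y s)"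
    if b: "b \<in> carrier (pow_mod S (regular R))" for b
  proof -
    have b': "b s \<in> carrier R" if "s \<in> S" for s using that b by auto
    have "(\<Oplus>\<^bsub>M\<^esub>s\<in>S. (a \<oplus>\<^bsub>pow_mod S (regular R)\<^esub> b) s \<odot>\<^bsub>M\<^esub> y s) =
        (\<Oplus>\<^bsub>M\<^esub>s\<in>S. a s \<odot>\<^bsub>M\<^esub> y s \<oplus>\<^bsub>M\<^esub> b s \<odot>\<^bsub>M\<^esub> y s)"
      by (rule M.M.finsum_cong') (auto simp: M.smult_l_distr a' b' ys M.smult_closed)
    also have "\<dots> = (\<Oplus>\<^bsub>M\<^esub>s\<in>S. a s \<odot>\<^bsub>M\<^esub> y s) \<oplus>\<^bsub>M\<^esub> (\<Oplus>\<^bsub>M\<^esub>s\<in>S. b s \<odot>\<^bsub>M\<^esub> y s)"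
      by (rule M.M.finsum_addf) (auto simp: a' b' ys M.smult_closed)
    finally show ?thesis .
  qed
  fix r assume r: "r \<in> carrier R"
  have "(\<Oplus>\<^bsub>M\<^esub>s\<in>T. r \<odot>\<^bsub>M\<^esub> (a s \<odot>\<^bsub>M\<^esub> y s)) = r \<odot>\<^bsub>M\<^esub> (\<Oplus>\<^bsub>M\<^esub>s\<in>T. a s \<odot>\<^bsub>M\<^esub> y s)" if "finite T" "T \<subseteq> S" for T
    using that
  proof (induction T)
    case empty then show ?case by (simp add: smult_zero[OF assms(1) r])
  next
    case (insert t T)
    have c: "\<And>s. s \<in> insert t T \<Longrightarrow> a s \<odot>\<^bsub>M\<^esub> y s \<in> carrier M" using insert.prems a cl by auto
    then have "(\<lambda>s. a s \<odot>\<^bsub>M\<^esub> y s) \<in> T \<rightarrow> carrier M" by auto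
    then show ?case using insert c
      by (simp add: M.M.finsum_insert Pi_iff M.smult_closed r M.smult_r_distr)
  qed
  from this[OF assms(2)] have "r \<odot>\<^bsub>M\<^esub> (\<Oplus>\<^bsub>M\<^esub>s\<in>S. a s \<odot>\<^bsub>M\<^esub> y s) = (\<Oplus>\<^bsub>M\<^esub>s\<in>S. r \<odot>\<^bsub>M\<^esub> (a s \<odot>\<^bsub>M\<^esub> y s))" by simp
  also have "\<dots> = (\<Oplus>\<^bsub>M\<^esub>s\<in>S. (r \<odot>\<^bsub>pow_mod S (regular R)\<^esub> a) s \<odot>\<^bsub>M\<^esub> y s)"
    using cl a r by (intro M.M.finsum_cong') (auto simp: M.smult_assoc1 a' ys M.smult_closed)
  finally show "(\<Oplus>\<^bsub>M\<^esub>s\<in>S. (r \<odot>\<^bsub>pow_mod S (regular R)\<^esub> a) s \<odot>\<^bsub>M\<^esub> y s) = r \<odot>\<^bsub>M\<^esub> (\<Oplus>\<^bsub>M\<^esub>s\<in>S. a s \<odot>\<^bsub>M\<^esub> y s)"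
    by simp
qed

lemma lincomb_unit:
  assumes "left_module R M" "finite S" "y \<in> S \<rightarrow> carrier M" "s \<in> S"
  shows "(\<Oplus>\<^bsub>M\<^esub>t\<in>S. (\<lambda>t\<in>S. if t = s then \<one>\<^bsub>R\<^esub> else \<zero>\<^bsub>R\<^esub>) t \<odot>\<^bsub>M\<^esub> y t) = y s"
proof -
  interpret M: left_module R M by fact
  have ys: "y t \<in> carrier M" if "t \<in> S" for t using that assms(3) by auto
  have "(\<Oplus>\<^bsub>M\<^esub>t\<in>S. (\<lambda>t\<in>S. if t = s then \<one>\<^bsub>R\<^esub> else \<zero>\<^bsub>R\<^esub>) t \<odot>\<^bsub>M\<^esub> y t) = (\<Oplus>\<^bsub>M\<^esub>t\<in>S. if s = t then y t else \<zero>\<^bsub>M\<^esub>)"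
    by (rule M.M.finsum_cong') (auto simp: M.smult_one zero_smult[OF assms(1)] ys)
  also have "\<dots> = y s" using assms by (intro M.M.finsum_singleton) auto
  finally show ?thesis .
qed

text \<open>Linear combinations indexed by a finite set turn into spans of lists, to which induction applies.\<close>

lemma finitely_generated_iff:
  fixes M :: "('a, 'b) module"
  assumes "left_module R M"
  shows "finitely_generated R M \<longleftrightarrow> fin_span R M (carrier M)"
proof
  interpret M: left_module R M by fact
  assume "finitely_generated R M"
  then obtain S where S: "finite S" "S \<subseteq> carrier M"
    and gen: "\<forall>x\<in>carrier M. \<exists>a\<in>S \<rightarrow> carrier R. x = (\<Oplus>\<^bsub>M\<^esub>s\<in>S. a s \<odot>\<^bsub>M\<^esub> s)"
    unfolding finitely_generated_def by blast
  obtain vs where vs: "set vs = S" using finite_list[OF S(1)] by metis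
  have "x \<in> lspan R M vs" if x: "x \<in> carrier M" for x
  proof -
    obtain a where a: "a \<in> S \<rightarrow> carrier R" "x = (\<Oplus>\<^bsub>M\<^esub>s\<in>S. a s \<odot>\<^bsub>M\<^esub> s)"
      using bspec[OF gen x] by blast
    have vsM: "set vs \<subseteq> carrier M" using vs S by simp
    show ?thesis unfolding a(2)
    proof (rule submod_finsum[OF assms submod_lspan[OF assms vsM] S(1)], rule Pi_I)
      fix s assume s: "s \<in> S"
      then have "s \<in> lspan R M vs" using lspan_superset[OF assms vsM] vs by blast
      moreover have "a s \<in> carrier R" using a(1) s by blast
      ultimately show "a s \<odot>\<^bsub>M\<^esub> s \<in> lspan R M vs"
        by (rule submod_smult[OF submod_lspan[OF assms vsM], rotated])
    qed
  qed
  moreover have "lspan R M vs \<subseteq> carrier M"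
    using submod_sub[OF submod_lspan[OF assms, of vs]] vs S by blast
  ultimately have "lspan R M vs = carrier M" by blast
  then show "fin_span R M (carrier M)"
    unfolding fin_span_def using vs S by (intro exI[of _ vs]) simp
next
  interpret M: left_module R M by fact
  assume "fin_span R M (carrier M)"
  then obtain vs where vs: "set vs \<subseteq> carrier M" "lspan R M vs = carrier M" by (auto simp: fin_span_def)
  let ?S = "set vs" and ?f = "\<lambda>a\<in>carrier (pow_mod (set vs) (regular R)). \<Oplus>\<^bsub>M\<^esub>s\<in>set vs. a s \<odot>\<^bsub>M\<^esub> s"
  have S: "(\<lambda>s. s) \<in> ?S \<rightarrow> carrier M" using vs by auto
  note f = lincomb_hom[OF assms, of "set vs" "\<lambda>s. s", OF finite_set S]
  note P = left_module_pow_mod[OF left_module_regular[OF M.R.ring_axioms]]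
  have sub: "submod R M (?f ` carrier (pow_mod ?S (regular R)))"
    by (rule submod_image[OF P assms f submod_carrier[OF P]])
  have "set vs \<subseteq> ?f ` carrier (pow_mod ?S (regular R))"
  proof
    fix s assume s: "s \<in> set vs"
    let ?d = "\<lambda>t\<in>set vs. if t = s then \<one>\<^bsub>R\<^esub> else \<zero>\<^bsub>R\<^esub>"
    have 1: "s = ?f ?d" using lincomb_unit[OF assms, of "set vs" "\<lambda>s. s", OF finite_set S s] by simp
    have 2: "?d \<in> carrier (pow_mod ?S (regular R))" by auto
    show "s \<in> ?f ` carrier (pow_mod ?S (regular R))" by (rule image_eqI[where f = ?f and x = ?d, OF 1 2])
  qed
  from lspan_least[OF sub this] vs(2)
  have "carrier M \<subseteq> ?f ` carrier (pow_mod ?S (regular R))" by simp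
  have "\<exists>a\<in>?S \<rightarrow> carrier R. x = (\<Oplus>\<^bsub>M\<^esub>s\<in>?S. a s \<odot>\<^bsub>M\<^esub> s)" if x: "x \<in> carrier M" for x
  proof -
    obtain a where a: "a \<in> carrier (pow_mod ?S (regular R))" "x = ?f a"
      using subsetD[OF \<open>carrier M \<subseteq> _\<close> x] by (rule imageE)
    then have "a \<in> ?S \<rightarrow> carrier R" "x = (\<Oplus>\<^bsub>M\<^esub>s\<in>?S. a s \<odot>\<^bsub>M\<^esub> s)" by auto
    then show ?thesis by (intro bexI[of _ a])
  qed
  then show "finitely_generated R M"
    unfolding finitely_generated_def using vs(1) by (intro exI[of _ ?S]) auto
qed

text \<open>The least length of a spanning list. It equals the dimension, but monotonicity is all that is
  asked of it, so bases never enter. For a subspace of infinite dimension the value is unspecified.\<close>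

definition vdim :: "('a, 'c) ring_scheme \<Rightarrow> ('a, 'b, 'd) module_scheme \<Rightarrow> 'b set \<Rightarrow> nat"
  where "vdim K V U = (LEAST n. \<exists>vs. length vs = n \<and> set vs \<subseteq> carrier V \<and> lspan K V vs = U)"

lemma vdim_attained:
  assumes "fin_span K V U"
  obtains vs where "length vs = vdim K V U" "set vs \<subseteq> carrier V" "lspan K V vs = U"
  using assms LeastI_ex[of "\<lambda>n. \<exists>vs. length vs = n \<and> set vs \<subseteq> carrier V \<and> lspan K V vs = U"]
  unfolding fin_span_def vdim_def by blast

lemma vdim_le: "\<lbrakk>set vs \<subseteq> carrier V; lspan K V vs = U\<rbrakk> \<Longrightarrow> vdim K V U \<le> length vs"
  unfolding vdim_def by (rule Least_le) blast

text \<open>Induction on the spanning list \<open>v # vs\<close>. If \<open>U\<close> is not contained in the span of \<open>vs\<close>, it contains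
  some \<open>u0 = c v + w\<close> with \<open>c \<noteq> 0\<close> and \<open>w\<close> in that span. Then \<open>U\<close> is spanned by \<open>u0\<close> and its
  intersection with the span of \<open>vs\<close>. This intersection is proper, because otherwise \<open>w\<close>, hence \<open>v\<close>,
  would lie in \<open>U\<close>, and \<open>U\<close> would be everything.\<close>

lemma proper_subspace_spanned_by_fewer:
  assumes "field K" "left_module K V" "set vs \<subseteq> carrier V" "submod K V U" "U \<subset> lspan K V vs"
  shows "\<exists>us. set us \<subseteq> carrier V \<and> length us < length vs \<and> lspan K V us = U"
  using assms(3-5)
proof (induction vs arbitrary: U)
  case Nil
  then show ?case using submod_zero[OF Nil(2)] by auto
next
  case (Cons v vs)
  interpret K: field K by fact
  interpret V: left_module K V by fact
  let ?W = "lspan K V vs"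
  have vs: "set vs \<subseteq> carrier V" and v: "v \<in> carrier V" using Cons by auto
  note W = submod_lspan[OF assms(2) vs] and U = Cons.prems(2)
  show ?case
  proof (cases "U \<subseteq> ?W")
    case True
    then consider "U = ?W" | "U \<subset> ?W" by auto
    then show ?thesis
    proof cases
      case 1 then show ?thesis using vs by (intro exI[of _ vs]) auto
    next
      case 2 then show ?thesis using Cons.IH[OF vs U] by auto
    qed
  next
    case False
    then obtain u0 where u0: "u0 \<in> U" "u0 \<notin> ?W" by auto
    have "u0 \<in> lspan K V (v # vs)" using u0(1) Cons.prems(3) by blast
    then obtain c w where cw: "u0 = c \<odot>\<^bsub>V\<^esub> v \<oplus>\<^bsub>V\<^esub> w" "c \<in> carrier K" "w \<in> ?W" by auto
    have u0c: "u0 \<in> carrier V" using submod_sub[OF U u0(1)] .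
    have wc: "w \<in> carrier V" using submod_sub[OF W cw(3)] .
    have "c \<noteq> \<zero>\<^bsub>K\<^esub>" using u0(2) cw wc zero_smult[OF assms(2) v] by auto
    then have ic: "inv\<^bsub>K\<^esub> c \<in> carrier K" "inv\<^bsub>K\<^esub> c \<otimes>\<^bsub>K\<^esub> c = \<one>\<^bsub>K\<^esub>" "c \<otimes>\<^bsub>K\<^esub> inv\<^bsub>K\<^esub> c = \<one>\<^bsub>K\<^esub>"
      using cw(2) K.field_Units by (auto simp: K.Units_l_inv K.Units_r_inv)
    have UW: "submod K V (U \<inter> ?W)" by (rule submod_Int[OF U W])
    have "U \<inter> ?W \<noteq> ?W"
    proof
      assume "U \<inter> ?W = ?W"
      then have WU: "?W \<subseteq> U" by auto
      have "u0 \<ominus>\<^bsub>V\<^esub> w \<in> U" using submod_diff[OF assms(2) U u0(1)] WU cw(3) by auto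
      moreover have "u0 \<ominus>\<^bsub>V\<^esub> w = c \<odot>\<^bsub>V\<^esub> v"
        using cw v wc by (simp add: a_minus_def V.M.a_assoc V.M.r_neg V.smult_closed)
      ultimately have "inv\<^bsub>K\<^esub> c \<odot>\<^bsub>V\<^esub> (c \<odot>\<^bsub>V\<^esub> v) \<in> U" using submod_smult[OF U ic(1)] by simp
      then have "v \<in> U" using V.smult_assoc1[OF ic(1) cw(2) v] ic(2) V.smult_one[OF v] by simp
      then have "lspan K V (v # vs) \<subseteq> U"
        using WU lspan_superset[OF assms(2) vs] by (intro lspan_least[OF U]) auto
      then show False using Cons.prems(3) by auto
    qed
    then obtain us where us: "set us \<subseteq> carrier V" "length us < length vs" "lspan K V us = U \<inter> ?W"
      using Cons.IH[OF vs UW] by auto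
    have "lspan K V (u0 # us) = U"
    proof
      show "lspan K V (u0 # us) \<subseteq> U"
        using u0 us lspan_superset[OF assms(2) us(1)] by (intro lspan_least[OF U]) auto
      show "U \<subseteq> lspan K V (u0 # us)"
      proof
        fix x assume x: "x \<in> U"
        then have "x \<in> lspan K V (v # vs)" using Cons.prems(3) by blast
        then obtain d z where dz: "x = d \<odot>\<^bsub>V\<^esub> v \<oplus>\<^bsub>V\<^esub> z" "d \<in> carrier K" "z \<in> ?W" by auto
        have zc: "z \<in> carrier V" using submod_sub[OF W dz(3)] .
        let ?e = "d \<otimes>\<^bsub>K\<^esub> inv\<^bsub>K\<^esub> c"
        have e: "?e \<in> carrier K" using dz ic by simp
        have "?e \<odot>\<^bsub>V\<^esub> (c \<odot>\<^bsub>V\<^esub> v) = d \<odot>\<^bsub>V\<^esub> v"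
          using V.smult_assoc1[OF e cw(2) v] K.m_assoc[OF dz(2) ic(1) cw(2)] ic dz(2) by simp
        then have eu: "?e \<odot>\<^bsub>V\<^esub> u0 = d \<odot>\<^bsub>V\<^esub> v \<oplus>\<^bsub>V\<^esub> ?e \<odot>\<^bsub>V\<^esub> w"
          unfolding cw(1) using V.smult_r_distr[OF e V.smult_closed[OF cw(2) v] wc] by simp
        have zw: "z \<ominus>\<^bsub>V\<^esub> ?e \<odot>\<^bsub>V\<^esub> w \<in> ?W"
          using submod_diff[OF assms(2) W dz(3) submod_smult[OF W e cw(3)]] .
        have "x = ?e \<odot>\<^bsub>V\<^esub> u0 \<oplus>\<^bsub>V\<^esub> (z \<ominus>\<^bsub>V\<^esub> ?e \<odot>\<^bsub>V\<^esub> w)"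
        proof -
          let ?p = "d \<odot>\<^bsub>V\<^esub> v" and ?q = "?e \<odot>\<^bsub>V\<^esub> w"
          have "?p \<in> carrier V" "?q \<in> carrier V" using V.smult_closed dz(2) v e wc by auto
          then show ?thesis unfolding eu dz(1) using zc
            by (simp add: a_minus_def V.M.a_ac V.M.r_neg)
        qed
        moreover have "z \<ominus>\<^bsub>V\<^esub> ?e \<odot>\<^bsub>V\<^esub> w \<in> U"
        proof -
          have "z \<ominus>\<^bsub>V\<^esub> ?e \<odot>\<^bsub>V\<^esub> w = x \<ominus>\<^bsub>V\<^esub> ?e \<odot>\<^bsub>V\<^esub> u0"
          proof -
            let ?p = "d \<odot>\<^bsub>V\<^esub> v" and ?q = "?e \<odot>\<^bsub>V\<^esub> w"
            have "?p \<in> carrier V" "?q \<in> carrier V" using V.smult_closed dz(2) v e wc by auto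
            then show ?thesis unfolding eu dz(1) using zc
              by (simp add: a_minus_def V.M.a_ac V.M.r_neg V.M.minus_add V.M.r_neg1 V.M.r_neg2)
          qed
          then show ?thesis using submod_diff[OF assms(2) U x submod_smult[OF U e u0(1)]] by simp
        qed
        ultimately show "x \<in> lspan K V (u0 # us)" using zw us(3) e by auto
      qed
    qed
    then show ?thesis using u0c us by (intro exI[of _ "u0 # us"]) auto
  qed
qed

lemma fin_span_subspace:
  assumes "field K" "left_module K V" "fin_span K V W" "submod K V U" "U \<subseteq> W"
  shows "fin_span K V U"
proof (cases "U = W")
  case False
  obtain vs where "set vs \<subseteq> carrier V" "lspan K V vs = W" using assms(3) by (auto simp: fin_span_def)
  then show ?thesis
    using proper_subspace_spanned_by_fewer[OF assms(1,2) _ assms(4), of vs] assms(5) False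
    by (auto simp: fin_span_def)
qed (use assms in simp)

lemma vdim_proper_subspace:
  assumes "field K" "left_module K V" "fin_span K V W" "submod K V U" "U \<subset> W"
  shows "vdim K V U < vdim K V W"
proof -
  obtain vs where vs: "length vs = vdim K V W" "set vs \<subseteq> carrier V" "lspan K V vs = W"
    using vdim_attained[OF assms(3)] .
  then obtain us where us: "set us \<subseteq> carrier V" "length us < length vs" "lspan K V us = U"
    using proper_subspace_spanned_by_fewer[OF assms(1,2) _ assms(4), of vs] assms(5) by auto
  show ?thesis using vdim_le[OF us(1,3)] us(2) vs(1) by simp
qed

lemma vdim_image_le:
  assumes "left_module K V" "left_module K W" "f \<in> mod_hom K V W" "fin_span K V U"
  shows "vdim K W (f ` U) \<le> vdim K V U"
proof -
  obtain vs where vs: "length vs = vdim K V U" "set vs \<subseteq> carrier V" "lspan K V vs = U"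
    using vdim_attained[OF assms(4)] .
  then have "lspan K W (map f vs) = f ` U" using lspan_image[OF assms(1-3)] by auto
  then show ?thesis
    using vdim_le[of "map f vs" W K "f ` U"] vs mod_hom_closed[OF assms(3)] by auto
qed

text \<open>One of the maps splits off a finite dimensional image, and the remaining ones still separate the
  points of its kernel. With evaluations at generators as the maps this bounds spaces of
  homomorphisms and dual spaces.\<close>

lemma fin_span_separated:
  assumes K: "field K" and Y: "left_module K Y" and W: "left_module K W" "fin_span K W (carrier W)"
    and es: "set es \<subseteq> mod_hom K Y W" and H: "submod K Y H"
    and sep: "\<And>h. h \<in> H \<Longrightarrow> \<forall>e\<in>set es. e h = \<zero>\<^bsub>W\<^esub> \<Longrightarrow> h = \<zero>\<^bsub>Y\<^esub>"
  shows "fin_span K Y H"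
  using es H sep
proof (induction es arbitrary: H)
  case Nil
  have "h = \<zero>\<^bsub>Y\<^esub>" if "h \<in> H" for h by (rule Nil(3)[OF that]) simp
  then have "H = {\<zero>\<^bsub>Y\<^esub>}" using submod_zero[OF Nil(2)] by blast
  then show ?case by (auto simp: fin_span_def intro!: exI[of _ "[]"])
next
  case (Cons e es)
  have e: "e \<in> mod_hom K Y W" using Cons by simp
  let ?H = "{h \<in> H. e h = \<zero>\<^bsub>W\<^esub>}"
  have eq: "?H = H \<inter> a_kernel Y W e" using submod_sub[OF Cons.prems(2)] by (auto simp: a_kernel_def')
  have "fin_span K Y ?H"
  proof (rule Cons.IH)
    show "submod K Y ?H" unfolding eq by (rule submod_Int[OF Cons.prems(2) submod_kernel[OF Y W(1) e]])
    show "set es \<subseteq> mod_hom K Y W" using Cons.prems(1) by simp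
    fix h assume "h \<in> ?H" "\<forall>e\<in>set es. e h = \<zero>\<^bsub>W\<^esub>"
    then show "h = \<zero>\<^bsub>Y\<^esub>" by (intro Cons.prems(3)) auto
  qed
  moreover have "fin_span K W (e ` H)"
  proof (rule fin_span_subspace[OF K W submod_image[OF Y W(1) e Cons.prems(2)]])
    show "e ` H \<subseteq> carrier W" using mod_hom_closed[OF e] submod_sub[OF Cons.prems(2)] by auto
  qed
  ultimately show ?case by (intro fin_span_extension[OF Y W(1) e Cons.prems(2)])
qed

section \<open>Linear functionals\<close>

lemma submod_Union_chain:
  assumes "\<C> \<noteq> {}" "\<And>H. H \<in> \<C> \<Longrightarrow> submod R M H" "subset.chain A \<C>"
  shows "submod R M (\<Union>\<C>)"
proof (rule submodI)
  show "x \<in> \<Union>\<C> \<Longrightarrow> x \<in> carrier M" for x using submod_sub[OF assms(2)] by blast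
  show "\<zero>\<^bsub>M\<^esub> \<in> \<Union>\<C>" using submod_zero[OF assms(2)] assms(1) by blast
  show "a \<in> carrier R \<Longrightarrow> x \<in> \<Union>\<C> \<Longrightarrow> a \<odot>\<^bsub>M\<^esub> x \<in> \<Union>\<C>" for a x
    using submod_smult[OF assms(2)] by blast
  fix x y assume "x \<in> \<Union>\<C>" "y \<in> \<Union>\<C>"
  then obtain H H' where H: "H \<in> \<C>" "H' \<in> \<C>" "x \<in> H" "y \<in> H'" by blast
  then have "H \<subseteq> H' \<or> H' \<subseteq> H" using assms(3) by (auto simp: subset.chain_def)
  then show "x \<oplus>\<^bsub>M\<^esub> y \<in> \<Union>\<C>"
    using H submod_add[OF assms(2)[OF H(1)]] submod_add[OF assms(2)[OF H(2)]] by blast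
qed

text \<open>Partial functionals are represented by their graphs, the subspaces \<open>G\<close> of \<open>V \<oplus> K\<close> that meet
  \<open>0 \<oplus> K\<close> trivially. By Zorn's lemma there is a maximal graph above \<open>G\<close>, and it is total because a
  vector outside its domain could be assigned the value \<open>0\<close>.\<close>

lemma functional_extension:
  assumes K: "field K" and V: "left_module K V"
    and G: "submod K (direct_sum V (regular K)) G"
    and single: "\<And>k. (\<zero>\<^bsub>V\<^esub>, k) \<in> G \<Longrightarrow> k = \<zero>\<^bsub>K\<^esub>"
  obtains \<xi> where "\<xi> \<in> mod_hom K V (regular K)" "\<And>v k. (v, k) \<in> G \<Longrightarrow> \<xi> v = k"
proof -
  interpret K: field K by fact
  interpret V: left_module K V by fact
  let ?D = "direct_sum V (regular K)"
  have D: "left_module K ?D" by (rule left_module_direct_sum[OF V left_module_regular[OF K.ring_axioms]])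
  define \<A> where "\<A> = {H. submod K ?D H \<and> G \<subseteq> H \<and> (\<forall>k. (\<zero>\<^bsub>V\<^esub>, k) \<in> H \<longrightarrow> k = \<zero>\<^bsub>K\<^esub>)}"
  have "\<exists>H\<in>\<A>. \<forall>H'\<in>\<A>. H \<subseteq> H' \<longrightarrow> H' = H"
  proof (rule subset_Zorn_nonempty)
    show "\<A> \<noteq> {}" using G single by (auto simp: \<A>_def)
    fix \<C> assume C: "\<C> \<noteq> {}" "subset.chain \<A> \<C>"
    then have sub: "\<C> \<subseteq> \<A>" by (auto simp: subset.chain_def)
    have "submod K ?D (\<Union>\<C>)"
      by (rule submod_Union_chain[OF C(1) _ C(2)]) (use sub in \<open>auto simp: \<A>_def\<close>)
    then show "\<Union>\<C> \<in> \<A>" using sub C(1) by (auto simp: \<A>_def)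
  qed
  then obtain H where H: "H \<in> \<A>" and max: "\<And>H'. H' \<in> \<A> \<Longrightarrow> H \<subseteq> H' \<Longrightarrow> H' = H" by blast
  have HD: "submod K ?D H" and GH: "G \<subseteq> H" and H0: "\<And>k. (\<zero>\<^bsub>V\<^esub>, k) \<in> H \<Longrightarrow> k = \<zero>\<^bsub>K\<^esub>"
    using H by (auto simp: \<A>_def)
  have Hc: "v \<in> carrier V" "k \<in> carrier K" if "(v, k) \<in> H" for v k
    using submod_sub[OF HD that] by auto
  have Ha: "(v \<oplus>\<^bsub>V\<^esub> v', k \<oplus>\<^bsub>K\<^esub> k') \<in> H" if "(v, k) \<in> H" "(v', k') \<in> H" for v k v' k'
    using submod_add[OF HD that] by simp
  have Hs: "(c \<odot>\<^bsub>V\<^esub> v, c \<otimes>\<^bsub>K\<^esub> k) \<in> H" if "c \<in> carrier K" "(v, k) \<in> H" for c v k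
    using submod_smult[OF HD that] by simp
  have Hz: "(\<zero>\<^bsub>V\<^esub>, \<zero>\<^bsub>K\<^esub>) \<in> H" using submod_zero[OF HD] by simp
  have tot: "\<exists>k. (x, k) \<in> H" if x: "x \<in> carrier V" for x
  proof (rule ccontr)
    assume no: "\<nexists>k. (x, k) \<in> H"
    \<comment> \<open>the graph extended by \<open>x \<mapsto> 0\<close>\<close>
    define H' where "H' = {(v \<oplus>\<^bsub>V\<^esub> c \<odot>\<^bsub>V\<^esub> x, k) | v c k. (v, k) \<in> H \<and> c \<in> carrier K}"
    have H'I: "(v \<oplus>\<^bsub>V\<^esub> c \<odot>\<^bsub>V\<^esub> x, k) \<in> H'" if "(v, k) \<in> H" "c \<in> carrier K" for v c k
      using that by (auto simp: H'_def)
    have HH': "H \<subseteq> H'"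
    proof (clarify)
      fix v k assume vk: "(v, k) \<in> H"
      show "(v, k) \<in> H'"
        using H'I[OF vk K.zero_closed] zero_smult[OF V x] Hc[OF vk] by simp
    qed
    have "H' \<in> \<A>"
    proof -
      have "submod K ?D H'"
      proof (rule submodI)
        show "p \<in> H' \<Longrightarrow> p \<in> carrier ?D" for p using Hc x by (auto simp: H'_def V.smult_closed)
        show "\<zero>\<^bsub>?D\<^esub> \<in> H'" using Hz HH' by auto
      next
        fix p q assume "p \<in> H'" "q \<in> H'"
        then obtain v c k w d l where pq: "p = (v \<oplus>\<^bsub>V\<^esub> c \<odot>\<^bsub>V\<^esub> x, k)" "q = (w \<oplus>\<^bsub>V\<^esub> d \<odot>\<^bsub>V\<^esub> x, l)"
          "(v, k) \<in> H" "(w, l) \<in> H" "c \<in> carrier K" "d \<in> carrier K" by (auto simp: H'_def)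
        have "p \<oplus>\<^bsub>?D\<^esub> q = ((v \<oplus>\<^bsub>V\<^esub> w) \<oplus>\<^bsub>V\<^esub> (c \<oplus>\<^bsub>K\<^esub> d) \<odot>\<^bsub>V\<^esub> x, k \<oplus>\<^bsub>K\<^esub> l)"
          using pq Hc x by (simp add: V.smult_l_distr V.smult_closed V.M.a_ac)
        then show "p \<oplus>\<^bsub>?D\<^esub> q \<in> H'" using H'I[OF Ha[OF pq(3,4)]] pq by simp
      next
        fix a p assume a: "a \<in> carrier K" and "p \<in> H'"
        then obtain v c k where p: "p = (v \<oplus>\<^bsub>V\<^esub> c \<odot>\<^bsub>V\<^esub> x, k)" "(v, k) \<in> H" "c \<in> carrier K"
          by (auto simp: H'_def)
        have "a \<odot>\<^bsub>?D\<^esub> p = (a \<odot>\<^bsub>V\<^esub> v \<oplus>\<^bsub>V\<^esub> (a \<otimes>\<^bsub>K\<^esub> c) \<odot>\<^bsub>V\<^esub> x, a \<otimes>\<^bsub>K\<^esub> k)"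
          using p Hc x a by (simp add: V.smult_r_distr V.smult_closed V.smult_assoc1)
        then show "a \<odot>\<^bsub>?D\<^esub> p \<in> H'" using H'I[OF Hs[OF a p(2)]] p a by simp
      qed
      moreover have "k = \<zero>\<^bsub>K\<^esub>" if k: "(\<zero>\<^bsub>V\<^esub>, k) \<in> H'" for k
      proof -
        obtain v c where v: "\<zero>\<^bsub>V\<^esub> = v \<oplus>\<^bsub>V\<^esub> c \<odot>\<^bsub>V\<^esub> x" "(v, k) \<in> H" "c \<in> carrier K"
          using k by (auto simp: H'_def)
        show ?thesis
        proof (cases "c = \<zero>\<^bsub>K\<^esub>")
          case True
          then have "\<zero>\<^bsub>V\<^esub> = v" using v(1) zero_smult[OF V x] Hc[OF v(2)] by simp
          then show ?thesis using H0 v(2) by simp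
        next
          case False
          then have ic: "inv\<^bsub>K\<^esub> c \<in> carrier K" "inv\<^bsub>K\<^esub> c \<otimes>\<^bsub>K\<^esub> c = \<one>\<^bsub>K\<^esub>"
            using v(3) K.field_Units by (auto simp: K.Units_l_inv)
          have cx: "c \<odot>\<^bsub>V\<^esub> x \<in> carrier V" using v x V.smult_closed by simp
          have "c \<odot>\<^bsub>V\<^esub> x = \<ominus>\<^bsub>V\<^esub> v"
            using v(1) cx Hc(1)[OF v(2)] V.M.minus_equality[of "c \<odot>\<^bsub>V\<^esub> x" v] V.M.a_comm by metis
          also have "\<dots> = (\<ominus>\<^bsub>K\<^esub> \<one>\<^bsub>K\<^esub>) \<odot>\<^bsub>V\<^esub> v" using minus_one_smult[OF V] Hc[OF v(2)] by simp
          finally have "(c \<odot>\<^bsub>V\<^esub> x, (\<ominus>\<^bsub>K\<^esub> \<one>\<^bsub>K\<^esub>) \<otimes>\<^bsub>K\<^esub> k) \<in> H" using Hs[OF _ v(2), of "\<ominus>\<^bsub>K\<^esub> \<one>\<^bsub>K\<^esub>"] by simp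
          from Hs[OF ic(1) this] have "(inv\<^bsub>K\<^esub> c \<odot>\<^bsub>V\<^esub> (c \<odot>\<^bsub>V\<^esub> x), inv\<^bsub>K\<^esub> c \<otimes>\<^bsub>K\<^esub> ((\<ominus>\<^bsub>K\<^esub> \<one>\<^bsub>K\<^esub>) \<otimes>\<^bsub>K\<^esub> k)) \<in> H" .
          then have "\<exists>k. (x, k) \<in> H"
            using V.smult_assoc1[OF ic(1) v(3) x] V.smult_one[OF x] ic(2) by auto
          then show ?thesis using no by simp
        qed
      qed
      ultimately show ?thesis using GH HH' by (auto simp: \<A>_def)
    qed
    then have "H' = H" using max HH' by simp
    moreover have "(x, \<zero>\<^bsub>K\<^esub>) \<in> H'"
      using H'I[OF Hz K.one_closed] V.smult_one[OF x] x by simp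
    ultimately show False using no by blast
  qed
  have uniq: "k = l" if "(x, k) \<in> H" "(x, l) \<in> H" for x k l
  proof -
    have m: "((\<ominus>\<^bsub>K\<^esub> \<one>\<^bsub>K\<^esub>) \<odot>\<^bsub>V\<^esub> x, (\<ominus>\<^bsub>K\<^esub> \<one>\<^bsub>K\<^esub>) \<otimes>\<^bsub>K\<^esub> l) \<in> H" using Hs[OF _ that(2)] by simp
    have "(\<zero>\<^bsub>V\<^esub>, k \<oplus>\<^bsub>K\<^esub> (\<ominus>\<^bsub>K\<^esub> \<one>\<^bsub>K\<^esub>) \<otimes>\<^bsub>K\<^esub> l) \<in> H"
      using Ha[OF that(1) m] minus_one_smult[OF V Hc(1)[OF that(1)]] Hc(1)[OF that(1)]
      by (simp add: V.M.r_neg)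
    then have "k \<oplus>\<^bsub>K\<^esub> (\<ominus>\<^bsub>K\<^esub> \<one>\<^bsub>K\<^esub>) \<otimes>\<^bsub>K\<^esub> l = \<zero>\<^bsub>K\<^esub>" by (rule H0)
    then have "k \<ominus>\<^bsub>K\<^esub> l = \<zero>\<^bsub>K\<^esub>" using Hc(2)[OF that(2)] by (simp add: K.l_minus a_minus_def)
    then show ?thesis using Hc(2)[OF that(1)] Hc(2)[OF that(2)] by (simp add: K.r_right_minus_eq)
  qed
  define \<xi> where "\<xi> = (\<lambda>x\<in>carrier V. THE k. (x, k) \<in> H)"
  have val: "\<xi> x = k" if "(x, k) \<in> H" for x k
    unfolding \<xi>_def using that uniq Hc(1)[OF that] by (auto intro!: the_equality)
  have inH: "(x, \<xi> x) \<in> H" if "x \<in> carrier V" for x using tot[OF that] val by blast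
  have "(\<lambda>x\<in>carrier V. \<xi> x) \<in> mod_hom K V (regular K)"
    using inH Hc(2) val Ha Hs by (intro mod_homI V) (simp_all, blast+)
  moreover have "(\<lambda>x\<in>carrier V. \<xi> x) = \<xi>" by (auto simp: \<xi>_def)
  ultimately show thesis using that val GH by auto
qed

text \<open>The prescribed values \<open>a y \<mapsto> \<beta> y\<close> and \<open>b z \<mapsto> 0\<close> are consistent if \<open>\<beta>\<close> vanishes on every \<open>y\<close> whose
  image under \<open>a\<close> lies in the image of \<open>b\<close>. The graph to be extended consists of the pairs
  \<open>(a y + b z, \<beta> y)\<close>. Taking \<open>b = 0\<close> says that a functional descends along \<open>a\<close> if it vanishes on the
  kernel.\<close>

lemma functional_glue:
  assumes K: "field K" and V: "left_module K V" and Y: "left_module K Y" and Z: "left_module K Z"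
    and a: "a \<in> mod_hom K Y V" and b: "b \<in> mod_hom K Z V" and \<beta>: "\<beta> \<in> mod_hom K Y (regular K)"
    and compat: "\<And>y z. \<lbrakk>y \<in> carrier Y; z \<in> carrier Z; a y = b z\<rbrakk> \<Longrightarrow> \<beta> y = \<zero>\<^bsub>K\<^esub>"
  obtains \<xi> where "\<xi> \<in> mod_hom K V (regular K)" "\<And>y. y \<in> carrier Y \<Longrightarrow> \<xi> (a y) = \<beta> y"
    "\<And>z. z \<in> carrier Z \<Longrightarrow> \<xi> (b z) = \<zero>\<^bsub>K\<^esub>"
proof -
  interpret K: field K by fact
  interpret V: left_module K V by fact
  interpret Y: left_module K Y by fact
  interpret Z: left_module K Z by fact
  note KK = left_module_regular[OF K.ring_axioms]
  let ?D = "direct_sum Y Z" and ?E = "direct_sum V (regular K)"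
  have D: "left_module K ?D" by (rule left_module_direct_sum[OF Y Z])
  have E: "left_module K ?E" by (rule left_module_direct_sum[OF V KK])
  have ac: "a y \<in> carrier V" and bc: "b z \<in> carrier V" and \<beta>c: "\<beta> y \<in> carrier K"
    if "y \<in> carrier Y" "z \<in> carrier Z" for y z
    using that mod_hom_closed[OF a] mod_hom_closed[OF b] mod_hom_closed[OF \<beta>] by auto
  let ?\<gamma> = "\<lambda>p\<in>carrier ?D. (a (fst p) \<oplus>\<^bsub>V\<^esub> b (snd p), \<beta> (fst p))"
  have \<gamma>: "?\<gamma> \<in> mod_hom K ?D ?E"
    by (rule mod_homI[OF _ _ _ D])
      (auto simp: ac bc \<beta>c mod_hom_add[OF a] mod_hom_add[OF b] mod_hom_add[OF \<beta>] mod_hom_smult[OF a]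
        mod_hom_smult[OF b] mod_hom_smult[OF \<beta>] V.smult_r_distr V.M.a_ac)
  let ?G = "?\<gamma> ` carrier ?D"
  have G: "submod K ?E ?G" by (rule submod_image[OF D E \<gamma> submod_carrier[OF D]])
  have GI: "(a y \<oplus>\<^bsub>V\<^esub> b z, \<beta> y) \<in> ?G" if "y \<in> carrier Y" "z \<in> carrier Z" for y z
    using that by (intro image_eqI[of _ _ "(y, z)"]) simp_all
  have single: "k = \<zero>\<^bsub>K\<^esub>" if "(\<zero>\<^bsub>V\<^esub>, k) \<in> ?G" for k
  proof -
    from that obtain y z where yz: "y \<in> carrier Y" "z \<in> carrier Z" "\<zero>\<^bsub>V\<^esub> = a y \<oplus>\<^bsub>V\<^esub> b z" "k = \<beta> y" by auto
    have "a y = \<ominus>\<^bsub>V\<^esub> b z" using V.M.minus_equality[of "a y" "b z"] ac[OF yz(1,2)] bc[OF yz(1,2)] yz(3) by simp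
    then have "a y = b (\<ominus>\<^bsub>Z\<^esub> z)" using mod_hom_minus[OF Z V b yz(2)] by simp
    then show ?thesis using compat[OF yz(1) Z.M.a_inv_closed[OF yz(2)]] yz(4) by simp
  qed
  obtain \<xi> where \<xi>: "\<xi> \<in> mod_hom K V (regular K)" "\<And>v k. (v, k) \<in> ?G \<Longrightarrow> \<xi> v = k"
    by (rule functional_extension[OF K V G single]) (assumption | rule that)+
  have "\<xi> (a y) = \<beta> y" if y: "y \<in> carrier Y" for y
    using \<xi>(2)[OF GI[OF y Z.M.zero_closed]] mod_hom_zero[OF Z V b] ac[OF y Z.M.zero_closed] by simp
  moreover have "\<xi> (b z) = \<zero>\<^bsub>K\<^esub>" if z: "z \<in> carrier Z" for z
    using \<xi>(2)[OF GI[OF Y.M.zero_closed z]] mod_hom_zero[OF Y V a] mod_hom_zero[OF Y KK \<beta>]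
      bc[OF Y.M.zero_closed z] by simp
  ultimately show thesis using that \<xi>(1) by blast
qed

lemma functional_factor:
  assumes K: "field K" and V: "left_module K V" and Y: "left_module K Y"
    and a: "a \<in> mod_hom K Y V" and \<beta>: "\<beta> \<in> mod_hom K Y (regular K)"
    and ker: "\<And>y. \<lbrakk>y \<in> carrier Y; a y = \<zero>\<^bsub>V\<^esub>\<rbrakk> \<Longrightarrow> \<beta> y = \<zero>\<^bsub>K\<^esub>"
  obtains \<xi> where "\<xi> \<in> mod_hom K V (regular K)" "\<And>y. y \<in> carrier Y \<Longrightarrow> \<xi> (a y) = \<beta> y"
proof -
  interpret V: left_module K V by fact
  have z: "(\<lambda>y\<in>carrier Y. \<zero>\<^bsub>V\<^esub>) \<in> mod_hom K Y V"
    by (rule mod_homI[OF _ _ _ Y]) (simp_all add: smult_zero[OF V])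
  show thesis
    by (rule functional_glue[OF K V Y Y a z \<beta>]) (use ker that in auto)
qed

text \<open>Glue the coordinate \<open>c x \<mapsto> c\<close> on the line through \<open>x\<close> with zero on \<open>W\<close>.\<close>

lemma functional_separating:
  assumes K: "field K" and V: "left_module K V" and W: "submod K V W" and x: "x \<in> carrier V" "x \<notin> W"
  obtains \<xi> where "\<xi> \<in> mod_hom K V (regular K)" "\<And>w. w \<in> W \<Longrightarrow> \<xi> w = \<zero>\<^bsub>K\<^esub>" "\<xi> x = \<one>\<^bsub>K\<^esub>"
proof -
  interpret K: field K by fact
  interpret V: left_module K V by fact
  note KK = left_module_regular[OF K.ring_axioms]
  let ?a = "\<lambda>c\<in>carrier (regular K). c \<odot>\<^bsub>V\<^esub> x"
  have a: "?a \<in> mod_hom K (regular K) V"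
    by (rule mod_homI[OF _ _ _ KK]) (simp_all add: x V.smult_closed V.smult_l_distr V.smult_assoc1)
  have compat: "mod_id (regular K) c = \<zero>\<^bsub>K\<^esub>"
    if c: "c \<in> carrier (regular K)" and w: "w \<in> carrier (V\<lparr>carrier := W\<rparr>)" "?a c = (\<lambda>x\<in>W. x) w" for c w
  proof (rule ccontr)
    assume "mod_id (regular K) c \<noteq> \<zero>\<^bsub>K\<^esub>"
    then have ic: "inv\<^bsub>K\<^esub> c \<in> carrier K" "inv\<^bsub>K\<^esub> c \<otimes>\<^bsub>K\<^esub> c = \<one>\<^bsub>K\<^esub>"
      using c K.field_Units by (auto simp: K.Units_l_inv mod_id_def)
    have "c \<odot>\<^bsub>V\<^esub> x \<in> W" using w c by simp
    then have "inv\<^bsub>K\<^esub> c \<odot>\<^bsub>V\<^esub> (c \<odot>\<^bsub>V\<^esub> x) \<in> W" by (rule submod_smult[OF W ic(1)])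
    then show False using V.smult_assoc1[OF ic(1) _ x(1), of c] V.smult_one[OF x(1)] ic(2) x(2) c by simp
  qed
  obtain \<xi> where \<xi>: "\<xi> \<in> mod_hom K V (regular K)" "\<And>c. c \<in> carrier (regular K) \<Longrightarrow> \<xi> (?a c) = mod_id (regular K) c"
    "\<And>w. w \<in> carrier (V\<lparr>carrier := W\<rparr>) \<Longrightarrow> \<xi> ((\<lambda>x\<in>W. x) w) = \<zero>\<^bsub>K\<^esub>"
    by (rule functional_glue[OF K V KK left_module_submod[OF V W] a mod_hom_incl[OF V W] mod_hom_id[OF KK] compat])
      (assumption | rule that)+
  show thesis
    using that[OF \<xi>(1)] \<xi>(2)[of "\<one>\<^bsub>K\<^esub>"] \<xi>(3) V.smult_one[OF x(1)] by (simp add: mod_id_def)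
qed

text \<open>\<open>F\<close> is a combination of the functionals \<open>\<beta> - v\<close>, for \<open>v\<close> in \<open>vs\<close>, because it vanishes on their
  common kernel. By induction on \<open>vs\<close>, \<open>F\<close> is the evaluation at some \<open>l\<close> on the subspace where
  \<open>\<beta> - v\<close> vanishes for the first \<open>v\<close>; then \<open>l + e v\<close>, for a suitable scalar \<open>e\<close>, also gives the
  right value at a vector \<open>y1\<close> with \<open>\<beta> y1 v = 1\<close>.\<close>

lemma functional_is_evaluation:
  assumes K: "field K" and Y: "left_module K Y" and L: "left_module K L" and vs: "set vs \<subseteq> carrier L"
    and \<beta>1: "\<And>y. y \<in> carrier Y \<Longrightarrow> \<beta> y \<in> mod_hom K L (regular K)"
    and \<beta>2: "\<And>v. v \<in> carrier L \<Longrightarrow> (\<lambda>y\<in>carrier Y. \<beta> y v) \<in> mod_hom K Y (regular K)"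
    and F: "F \<in> mod_hom K Y (regular K)"
    and van: "\<And>y. y \<in> carrier Y \<Longrightarrow> \<forall>v\<in>set vs. \<beta> y v = \<zero>\<^bsub>K\<^esub> \<Longrightarrow> F y = \<zero>\<^bsub>K\<^esub>"
  shows "\<exists>l\<in>carrier L. \<forall>y\<in>carrier Y. F y = \<beta> y l"
proof -
  interpret K: field K by fact
  interpret Y: left_module K Y by fact
  interpret L: left_module K L by fact
  have Fc: "F y \<in> carrier K" if "y \<in> carrier Y" for y using mod_hom_closed[OF F that] by simp
  have bc: "\<beta> y v \<in> carrier K" if "y \<in> carrier Y" "v \<in> carrier L" for y v
    using mod_hom_closed[OF \<beta>1[OF that(1)] that(2)] by simp
  have ba: "\<beta> (y \<oplus>\<^bsub>Y\<^esub> z) v = \<beta> y v \<oplus>\<^bsub>K\<^esub> \<beta> z v" if "y \<in> carrier Y" "z \<in> carrier Y" "v \<in> carrier L" for y z v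
    using mod_hom_add[OF \<beta>2[OF that(3)] that(1,2)] that by simp
  have bs: "\<beta> (c \<odot>\<^bsub>Y\<^esub> y) v = c \<otimes>\<^bsub>K\<^esub> \<beta> y v" if "c \<in> carrier K" "y \<in> carrier Y" "v \<in> carrier L" for y c v
    using mod_hom_smult[OF \<beta>2[OF that(3)] that(1,2)] that by (simp add: Y.smult_closed)
  have ba': "\<beta> y (v \<oplus>\<^bsub>L\<^esub> w) = \<beta> y v \<oplus>\<^bsub>K\<^esub> \<beta> y w" if "y \<in> carrier Y" "w \<in> carrier L" "v \<in> carrier L" for y w v
    using mod_hom_add[OF \<beta>1[OF that(1)] that(3,2)] by simp
  have bs': "\<beta> y (c \<odot>\<^bsub>L\<^esub> v) = c \<otimes>\<^bsub>K\<^esub> \<beta> y v" if "c \<in> carrier K" "y \<in> carrier Y" "v \<in> carrier L" for y c v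
    using mod_hom_smult[OF \<beta>1[OF that(2)] that(1,3)] by simp
  have b0: "\<beta> \<zero>\<^bsub>Y\<^esub> v = \<zero>\<^bsub>K\<^esub>" if "v \<in> carrier L" for v
    using mod_hom_zero[OF Y left_module_regular[OF K.ring_axioms] \<beta>2[OF that]] by simp
  have b0': "\<beta> y \<zero>\<^bsub>L\<^esub> = \<zero>\<^bsub>K\<^esub>" if "y \<in> carrier Y" for y
    using mod_hom_zero[OF L left_module_regular[OF K.ring_axioms] \<beta>1[OF that]] by simp
  have "\<exists>l\<in>carrier L. \<forall>y\<in>U. F y = \<beta> y l"
    if "submod K Y U" "\<And>y. y \<in> U \<Longrightarrow> \<forall>v\<in>set vs. \<beta> y v = \<zero>\<^bsub>K\<^esub> \<Longrightarrow> F y = \<zero>\<^bsub>K\<^esub>" for U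
    using vs that
  proof (induction vs arbitrary: U)
    case Nil
    have "F y = \<beta> y \<zero>\<^bsub>L\<^esub>" if y: "y \<in> U" for y
      using Nil(3)[OF y] b0'[OF submod_sub[OF Nil(2) y]] by simp
    then show ?case using L.M.zero_closed by blast
  next
    case (Cons v vs)
    have v: "v \<in> carrier L" and vs: "set vs \<subseteq> carrier L" using Cons.prems(1) by auto
    note U = submodD[OF Cons.prems(2)]
    let ?U = "{y \<in> U. \<beta> y v = \<zero>\<^bsub>K\<^esub>}"
    have U': "submod K Y ?U"
    proof (rule submodI)
      show "\<zero>\<^bsub>Y\<^esub> \<in> ?U" using b0[OF v] U(2) by simp
    next
      fix x y assume "x \<in> ?U" "y \<in> ?U"
      then show "x \<oplus>\<^bsub>Y\<^esub> y \<in> ?U" using ba[of x y v] v U(1,3) by simp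
    next
      fix a x assume "a \<in> carrier K" "x \<in> ?U"
      then show "a \<odot>\<^bsub>Y\<^esub> x \<in> ?U" using bs[of a x v] v U(1,4) by simp
    qed (use U(1) in blast)
    have "F y = \<zero>\<^bsub>K\<^esub>" if "y \<in> ?U" "\<forall>v\<in>set vs. \<beta> y v = \<zero>\<^bsub>K\<^esub>" for y
      using that by (intro Cons.prems(3)) auto
    then obtain l where l: "l \<in> carrier L" "\<And>y. y \<in> ?U \<Longrightarrow> F y = \<beta> y l"
      using Cons.IH[OF vs U'] by blast
    show ?case
    proof (cases "?U = U")
      case True
      then show ?thesis using l by blast
    next
      case False
      then obtain y0 where y0: "y0 \<in> U" "\<beta> y0 v \<noteq> \<zero>\<^bsub>K\<^esub>" by blast
      let ?b = "inv\<^bsub>K\<^esub> (\<beta> y0 v)"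
      have ib: "?b \<in> carrier K" "?b \<otimes>\<^bsub>K\<^esub> \<beta> y0 v = \<one>\<^bsub>K\<^esub>"
        using bc[OF U(1)[OF y0(1)] v] y0(2) K.field_Units by (auto simp: K.Units_l_inv)
      define y1 where "y1 = ?b \<odot>\<^bsub>Y\<^esub> y0"
      have y1: "y1 \<in> U" "\<beta> y1 v = \<one>\<^bsub>K\<^esub>" "y1 \<in> carrier Y"
        using U(4)[OF ib(1) y0(1)] bs[OF ib(1) U(1)[OF y0(1)] v] ib(2) U(1) by (auto simp: y1_def)
      define e where "e = F y1 \<ominus>\<^bsub>K\<^esub> \<beta> y1 l"
      have ec: "e \<in> carrier K" using Fc[OF y1(3)] bc[OF y1(3) l(1)] by (simp add: e_def)
      have Fy1: "F y1 = \<beta> y1 l \<oplus>\<^bsub>K\<^esub> e"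
        using Fc[OF y1(3)] bc[OF y1(3) l(1)] by (simp add: e_def a_minus_def K.a_ac K.r_neg)
      have evc: "e \<odot>\<^bsub>L\<^esub> v \<in> carrier L" using L.smult_closed[OF ec v] .
      have "F y = \<beta> y (l \<oplus>\<^bsub>L\<^esub> e \<odot>\<^bsub>L\<^esub> v)" if y: "y \<in> U" for y
      proof -
        have yc: "y \<in> carrier Y" using U(1)[OF y] .
        define c where "c = \<beta> y v"
        have c: "c \<in> carrier K" using bc[OF yc v] by (simp add: c_def)
        define z where "z = y \<oplus>\<^bsub>Y\<^esub> (\<ominus>\<^bsub>K\<^esub> c) \<odot>\<^bsub>Y\<^esub> y1"
        have zU: "z \<in> U" using U(3)[OF y U(4)[OF K.a_inv_closed[OF c] y1(1)]] by (simp add: z_def)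
        have zc: "z \<in> carrier Y" using U(1)[OF zU] .
        have mc: "(\<ominus>\<^bsub>K\<^esub> c) \<odot>\<^bsub>Y\<^esub> y1 \<in> carrier Y" "c \<odot>\<^bsub>Y\<^esub> y1 \<in> carrier Y" using c y1(3) Y.smult_closed by auto
        have "\<beta> z v = c \<oplus>\<^bsub>K\<^esub> (\<ominus>\<^bsub>K\<^esub> c)"
          unfolding z_def using ba[OF yc mc(1) v] bs[OF K.a_inv_closed[OF c] y1(3) v] y1(2) c
          by (simp add: c_def)
        then have "\<beta> z v = \<zero>\<^bsub>K\<^esub>" using c by (simp add: K.r_neg)
        then have Fz: "F z = \<beta> z l" using l(2) zU by simp
        have "(\<ominus>\<^bsub>K\<^esub> c) \<odot>\<^bsub>Y\<^esub> y1 \<oplus>\<^bsub>Y\<^esub> c \<odot>\<^bsub>Y\<^esub> y1 = \<zero>\<^bsub>Y\<^esub>"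
          using Y.smult_l_distr[OF K.a_inv_closed[OF c] c y1(3)] c zero_smult[OF Y y1(3)] by (simp add: K.l_neg)
        then have yz: "y = z \<oplus>\<^bsub>Y\<^esub> c \<odot>\<^bsub>Y\<^esub> y1" unfolding z_def using yc mc by (simp add: Y.M.a_assoc)
        have "F y = F z \<oplus>\<^bsub>K\<^esub> c \<otimes>\<^bsub>K\<^esub> F y1"
          by (subst yz, subst mod_hom_add[OF F zc mc(2)], subst mod_hom_smult[OF F c y1(3)]) simp
        also have "\<dots> = (\<beta> z l \<oplus>\<^bsub>K\<^esub> c \<otimes>\<^bsub>K\<^esub> \<beta> y1 l) \<oplus>\<^bsub>K\<^esub> c \<otimes>\<^bsub>K\<^esub> e"
          unfolding Fz Fy1 using bc[OF zc l(1)] bc[OF y1(3) l(1)] c ec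
          by (simp add: K.r_distr K.a_assoc)
        also have "\<beta> z l \<oplus>\<^bsub>K\<^esub> c \<otimes>\<^bsub>K\<^esub> \<beta> y1 l = \<beta> y l"
          using arg_cong[OF yz, of "\<lambda>y. \<beta> y l"] ba[OF zc mc(2) l(1)] bs[OF c y1(3) l(1)] by simp
        also have "c \<otimes>\<^bsub>K\<^esub> e = \<beta> y (e \<odot>\<^bsub>L\<^esub> v)"
          using bs'[OF ec yc v] c ec by (simp add: c_def K.m_comm)
        also have "\<beta> y l \<oplus>\<^bsub>K\<^esub> \<beta> y (e \<odot>\<^bsub>L\<^esub> v) = \<beta> y (l \<oplus>\<^bsub>L\<^esub> e \<odot>\<^bsub>L\<^esub> v)" by (rule ba'[OF yc evc l(1), symmetric])
        finally show ?thesis .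
      qed
      then show ?thesis using L.M.a_closed[OF l(1) evc] by blast
    qed
  qed
  from this[OF submod_carrier[OF Y] van] show ?thesis .
qed

section \<open>Surjective endomorphisms and Fitting's lemma\<close>

text \<open>If \<open>f\<close> killed some \<open>x \<noteq> 0\<close>, then a hyperplane complementary to \<open>x\<close> would still be mapped onto \<open>V\<close>,
  although its dimension is smaller.\<close>

lemma surjective_endo_injective:
  assumes K: "field K" and V: "left_module K V" and fd: "fin_span K V (carrier V)"
    and f: "f \<in> mod_hom K V V" and surj: "f ` carrier V = carrier V"
    and x: "x \<in> carrier V" "f x = \<zero>\<^bsub>V\<^esub>"
  shows "x = \<zero>\<^bsub>V\<^esub>"
proof (rule ccontr)
  interpret K: field K by fact
  interpret V: left_module K V by fact
  note KK = left_module_regular[OF K.ring_axioms]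
  assume nz: "x \<noteq> \<zero>\<^bsub>V\<^esub>"
  have "submod K V {\<zero>\<^bsub>V\<^esub>}" by (auto simp: submod_def smult_zero[OF V])
  then obtain \<xi> where \<xi>: "\<xi> \<in> mod_hom K V (regular K)" "\<xi> x = \<one>\<^bsub>K\<^esub>"
    using functional_separating[OF K V _ x(1), of "{\<zero>\<^bsub>V\<^esub>}"] nz by blast
  let ?U = "a_kernel V (regular K) \<xi>"
  have U: "submod K V ?U" by (rule submod_kernel[OF V KK \<xi>(1)])
  have "x \<notin> ?U" using \<xi>(2) by (auto simp: a_kernel_def')
  then have psub: "?U \<subset> carrier V" using x by (auto simp: a_kernel_def')
  have "y \<in> f ` ?U" if y: "y \<in> carrier V" for y
  proof -
    obtain z where z: "z \<in> carrier V" "y = f z" using y surj by blast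
    let ?c = "\<ominus>\<^bsub>K\<^esub> \<xi> z"
    have xz: "\<xi> z \<in> carrier K" using mod_hom_closed[OF \<xi>(1) z(1)] by simp
    then have c: "?c \<in> carrier K" by simp
    have cx: "?c \<odot>\<^bsub>V\<^esub> x \<in> carrier V" using V.smult_closed[OF c x(1)] .
    have "\<xi> (z \<oplus>\<^bsub>V\<^esub> ?c \<odot>\<^bsub>V\<^esub> x) = \<xi> z \<oplus>\<^bsub>K\<^esub> ?c"
      using mod_hom_add[OF \<xi>(1) z(1) cx] mod_hom_smult[OF \<xi>(1) c x(1)] \<xi>(2) c by simp
    then have "z \<oplus>\<^bsub>V\<^esub> ?c \<odot>\<^bsub>V\<^esub> x \<in> ?U" using xz z cx by (simp add: a_kernel_def' K.r_neg)
    moreover have "f (z \<oplus>\<^bsub>V\<^esub> ?c \<odot>\<^bsub>V\<^esub> x) = y"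
      using mod_hom_add[OF f z(1) cx] mod_hom_smult[OF f c x(1)] x(2) z smult_zero[OF V c]
        mod_hom_closed[OF f z(1)] by simp
    ultimately show ?thesis by blast
  qed
  moreover have "f ` ?U \<subseteq> carrier V" using mod_hom_closed[OF f] by (auto simp: a_kernel_def')
  ultimately have "f ` ?U = carrier V" by blast
  then have "vdim K V (carrier V) \<le> vdim K V ?U"
    using vdim_image_le[OF V V f fin_span_subspace[OF K V fd U]] psub by auto
  then show False using vdim_proper_subspace[OF K V fd U psub] by simp
qed

lemma mod_hom_funpow:
  assumes "left_module R M" "f \<in> mod_hom R M M"
  shows "(\<lambda>x\<in>carrier M. (f ^^ n) x) \<in> mod_hom R M M"
proof (induction n)
  case 0
  have eq: "(\<lambda>x\<in>carrier M. (f ^^ 0) x) = mod_id M" by (auto simp: mod_id_def)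
  show ?case unfolding eq by (rule mod_hom_id[OF assms(1)])
next
  case (Suc n)
  have eq: "(\<lambda>x\<in>carrier M. (f ^^ Suc n) x) = compose (carrier M) f (\<lambda>x\<in>carrier M. (f ^^ n) x)"
    by (auto simp: compose_def)
  show ?case unfolding eq by (rule mod_hom_compose[OF assms(1) Suc assms(2)])
qed

text \<open>Choose \<open>n\<close> such that the image of \<open>f\<^sup>n\<close> has minimal dimension. Then \<open>f\<close> maps this image onto
  itself, hence bijectively, and so it is a complement of the kernel of \<open>f\<^sup>n\<close>. The complement is
  expressed by the last two conclusions.\<close>

lemma fitting:
  assumes K: "field K" and V: "left_module K V" and fd: "fin_span K V (carrier V)"
    and f: "f \<in> mod_hom K V V"
  obtains n where "bij_betw f ((f ^^ n) ` carrier V) ((f ^^ n) ` carrier V)"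
    "\<And>x. x \<in> carrier V \<Longrightarrow> \<exists>y\<in>(f ^^ n) ` carrier V. (f ^^ n) (x \<ominus>\<^bsub>V\<^esub> y) = \<zero>\<^bsub>V\<^esub>"
    "\<And>y. \<lbrakk>y \<in> (f ^^ n) ` carrier V; (f ^^ n) y = \<zero>\<^bsub>V\<^esub>\<rbrakk> \<Longrightarrow> y = \<zero>\<^bsub>V\<^esub>"
proof -
  interpret V: left_module K V by fact
  define I where "I n = (f ^^ n) ` carrier V" for n
  define p where "p n = (\<lambda>x\<in>carrier V. (f ^^ n) x)" for n
  have p: "p n \<in> mod_hom K V V" for n unfolding p_def by (rule mod_hom_funpow[OF V f])
  have I_p: "I n = p n ` carrier V" for n by (auto simp: I_def p_def)
  have subI: "submod K V (I n)" for n unfolding I_p by (rule submod_image[OF V V p submod_carrier[OF V]])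
  have fdI: "fin_span K V (I n)" for n unfolding I_p by (rule fin_span_image[OF V V p fd])
  obtain n where n: "\<And>m. vdim K V (I n) \<le> vdim K V (I m)"
    using ex_has_least_nat[of "\<lambda>_. True" _ "\<lambda>n. vdim K V (I n)"] by blast
  have fI: "f ` I n = I (Suc n)" by (auto simp: I_def image_image)
  have "I (Suc n) \<subseteq> I n"
  proof
    fix x assume "x \<in> I (Suc n)"
    then obtain y where "y \<in> carrier V" "x = (f ^^ Suc n) y" by (auto simp: I_def)
    then show "x \<in> I n" using mod_hom_closed[OF f] by (auto simp: I_def funpow_swap1)
  qed
  then have eq: "f ` I n = I n"
    using n[of "Suc n"] vdim_proper_subspace[OF K V fdI[of n] subI[of "Suc n"]] fI by fastforce
  let ?W = "V\<lparr>carrier := I n\<rparr>"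
  have W: "left_module K ?W" by (rule left_module_submod[OF V subI])
  have Ic: "I n \<subseteq> carrier V" using submod_sub[OF subI] by blast
  have fW: "restrict f (I n) \<in> mod_hom K ?W ?W"
    by (rule mod_hom_into_submod[OF mod_hom_restrict[OF V subI f]]) (use eq in auto)
  have fdW: "fin_span K ?W (carrier ?W)" using fin_span_subm[OF fdI V] by simp
  have inj0: "x = \<zero>\<^bsub>V\<^esub>" if "x \<in> I n" "f x = \<zero>\<^bsub>V\<^esub>" for x
    using surjective_endo_injective[OF K W fdW fW, of x] that eq by simp
  have "inj_on f (I n)"
  proof (rule inj_onI)
    fix x y assume xy: "x \<in> I n" "y \<in> I n" "f x = f y"
    then have c: "x \<in> carrier V" "y \<in> carrier V" using Ic by auto
    have "f (x \<ominus>\<^bsub>V\<^esub> y) = \<zero>\<^bsub>V\<^esub>"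
      using mod_hom_diff[OF V V f c] xy(3) mod_hom_closed[OF f c(2)] by (simp add: a_minus_def V.M.r_neg)
    then have "x \<ominus>\<^bsub>V\<^esub> y = \<zero>\<^bsub>V\<^esub>" using inj0 submod_diff[OF V subI xy(1,2)] by blast
    then show "x = y" using diff_eq_zeroD[OF V c] by simp
  qed
  then have bij: "bij_betw f (I n) (I n)" using eq by (simp add: bij_betw_def)
  have bijp: "bij_betw (f ^^ m) (I n) (I n)" for m
  proof (induction m)
    case 0 then show ?case by (simp add: bij_betw_def)
  next
    case (Suc m) then show ?case using bij_betw_trans[OF Suc bij] by (simp add: comp_def)
  qed
  have 2: "\<exists>y\<in>I n. (f ^^ n) (x \<ominus>\<^bsub>V\<^esub> y) = \<zero>\<^bsub>V\<^esub>" if x: "x \<in> carrier V" for x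
  proof -
    have "(f ^^ n) x \<in> I n" using x by (auto simp: I_def)
    then obtain y where y: "y \<in> I n" "(f ^^ n) y = (f ^^ n) x"
      using bijp[of n] by (metis bij_betw_imp_surj_on imageE)
    have yc: "y \<in> carrier V" using y(1) Ic by blast
    have "p n (x \<ominus>\<^bsub>V\<^esub> y) = p n x \<ominus>\<^bsub>V\<^esub> p n y" by (rule mod_hom_diff[OF V V p x yc])
    then have "(f ^^ n) (x \<ominus>\<^bsub>V\<^esub> y) = \<zero>\<^bsub>V\<^esub>"
      using x yc y(2) mod_hom_closed[OF p x, of n] by (simp add: p_def a_minus_def V.M.r_neg)
    then show ?thesis using y(1) by blast
  qed
  have 3: "y = \<zero>\<^bsub>V\<^esub>" if "y \<in> I n" "(f ^^ n) y = \<zero>\<^bsub>V\<^esub>" for y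
  proof -
    have "(f ^^ n) \<zero>\<^bsub>V\<^esub> = \<zero>\<^bsub>V\<^esub>" using mod_hom_zero[OF V V p, of n] by (simp add: p_def)
    then have "(f ^^ n) y = (f ^^ n) \<zero>\<^bsub>V\<^esub>" using that(2) by simp
    then show ?thesis
      by (rule inj_onD[OF bij_betw_imp_inj_on[OF bijp[of n]] _ that(1) submod_zero[OF subI[of n]]])
  qed
  show thesis using that[of n] bij 2 3 unfolding I_def by blast
qed

section \<open>Quotients\<close>

lemma a_r_coset_char: "I +>\<^bsub>N\<^esub> x = {i \<oplus>\<^bsub>N\<^esub> x | i. i \<in> I}"
  by (auto simp: a_r_coset_def')

lemma a_r_coset_eq_iff:
  assumes N: "left_module R N" and I: "submod R N I" and x: "x \<in> carrier N" and y: "y \<in> carrier N"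
  shows "I +>\<^bsub>N\<^esub> x = I +>\<^bsub>N\<^esub> y \<longleftrightarrow> x \<ominus>\<^bsub>N\<^esub> y \<in> I"
proof
  interpret left_module R N by fact
  note s = submodD[OF I]
  assume "I +>\<^bsub>N\<^esub> x = I +>\<^bsub>N\<^esub> y"
  moreover have "x \<in> I +>\<^bsub>N\<^esub> x" using s(2) x unfolding a_r_coset_char by force
  ultimately obtain i where i: "i \<in> I" "x = i \<oplus>\<^bsub>N\<^esub> y" unfolding a_r_coset_char by blast
  then have "x \<ominus>\<^bsub>N\<^esub> y = i" using s(1) y by (simp add: a_minus_def M.a_assoc M.r_neg)
  then show "x \<ominus>\<^bsub>N\<^esub> y \<in> I" using i by simp
next
  interpret left_module R N by fact
  note s = submodD[OF I]
  have *: "I +>\<^bsub>N\<^esub> x \<subseteq> I +>\<^bsub>N\<^esub> y" if "x \<ominus>\<^bsub>N\<^esub> y \<in> I" "x \<in> carrier N" "y \<in> carrier N" for x y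
  proof
    fix z assume "z \<in> I +>\<^bsub>N\<^esub> x"
    then obtain i where i: "i \<in> I" "z = i \<oplus>\<^bsub>N\<^esub> x" unfolding a_r_coset_char by blast
    then have "z = (i \<oplus>\<^bsub>N\<^esub> (x \<ominus>\<^bsub>N\<^esub> y)) \<oplus>\<^bsub>N\<^esub> y"
      using s(1) that by (simp add: a_minus_def M.a_assoc M.l_neg)
    then show "z \<in> I +>\<^bsub>N\<^esub> y" using s(3)[OF i(1) that(1)] unfolding a_r_coset_char by blast
  qed
  assume d: "x \<ominus>\<^bsub>N\<^esub> y \<in> I"
  have "y \<ominus>\<^bsub>N\<^esub> x = \<ominus>\<^bsub>N\<^esub> (x \<ominus>\<^bsub>N\<^esub> y)" using x y by (simp add: a_minus_def M.minus_add M.a_comm)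
  then have "y \<ominus>\<^bsub>N\<^esub> x \<in> I" using submod_minus[OF N I d] by simp
  then show "I +>\<^bsub>N\<^esub> x = I +>\<^bsub>N\<^esub> y" using *[OF d x y] *[OF _ y x] by blast
qed

text \<open>The operations on cosets are unions over representatives. In terms of the projection \<open>p\<close> they
  become \<open>p x + p y = p (x + y)\<close> and \<open>a (p x) = p (a x)\<close>, and the module laws are inherited from
  \<open>N\<close>.\<close>

lemma cokernel_module:
  assumes M: "left_module R M" and N: "left_module R N" and f: "f \<in> mod_hom R M N"
  defines "I \<equiv> f ` carrier M" and "pr \<equiv> \<lambda>x\<in>carrier N. (f ` carrier M) +>\<^bsub>N\<^esub> x"
  shows cokernel_left_module: "left_module R (cokernel M N f)"
    and cokernel_proj: "pr \<in> mod_hom R N (cokernel M N f)"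
    and cokernel_proj_surj: "pr ` carrier N = carrier (cokernel M N f)"
    and cokernel_proj_eq: "\<And>x y. x \<in> carrier N \<Longrightarrow> y \<in> carrier N \<Longrightarrow> pr x = pr y \<longleftrightarrow> x \<ominus>\<^bsub>N\<^esub> y \<in> I"
    and cokernel_kernel: "a_kernel N (cokernel M N f) pr = I"
proof -
  interpret N: left_module R N by fact
  have I: "submod R N I" unfolding I_def by (rule submod_image[OF M N f submod_carrier[OF M]])
  note s = submodD[OF I]
  define Q where "Q = cokernel M N f"
  have Q: "Q = mk_module (a_rcosets\<^bsub>N\<^esub> I) (\<lambda>U V. U <+>\<^bsub>N\<^esub> V) I (\<lambda>a U. \<Union>x\<in>U. I +>\<^bsub>N\<^esub> (a \<odot>\<^bsub>N\<^esub> x))"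
    by (simp add: Q_def cokernel_def I_def Let_def)
  define p where "p x = I +>\<^bsub>N\<^esub> x" for x
  have pr: "pr = (\<lambda>x\<in>carrier N. p x)" by (simp add: pr_def p_def I_def)
  have pe: "p x = p y \<longleftrightarrow> x \<ominus>\<^bsub>N\<^esub> y \<in> I" if "x \<in> carrier N" "y \<in> carrier N" for x y
    unfolding p_def by (rule a_r_coset_eq_iff[OF N I that])
  have Qc: "carrier Q = p ` carrier N" by (auto simp: Q A_RCOSETS_def' p_def)
  have Qz: "\<zero>\<^bsub>Q\<^esub> = p \<zero>\<^bsub>N\<^esub>"
    using s(1) by (force simp: Q p_def a_r_coset_char)
  have Qa: "p x \<oplus>\<^bsub>Q\<^esub> p y = p (x \<oplus>\<^bsub>N\<^esub> y)" if xy: "x \<in> carrier N" "y \<in> carrier N" for x y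
  proof -
    have "(i \<oplus>\<^bsub>N\<^esub> x) \<oplus>\<^bsub>N\<^esub> (j \<oplus>\<^bsub>N\<^esub> y) = (i \<oplus>\<^bsub>N\<^esub> j) \<oplus>\<^bsub>N\<^esub> (x \<oplus>\<^bsub>N\<^esub> y)" if "i \<in> I" "j \<in> I" for i j
      using that s(1) xy by (simp add: N.M.a_ac)
    moreover have "i \<oplus>\<^bsub>N\<^esub> (x \<oplus>\<^bsub>N\<^esub> y) = (i \<oplus>\<^bsub>N\<^esub> x) \<oplus>\<^bsub>N\<^esub> (\<zero>\<^bsub>N\<^esub> \<oplus>\<^bsub>N\<^esub> y)" if "i \<in> I" for i
      using that s(1) xy by (simp add: N.M.a_ac)
    ultimately show ?thesis
      using s(2,3) unfolding Q mk_module_simps p_def a_r_coset_char set_add_def' by blast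
  qed
  have Qs: "a \<odot>\<^bsub>Q\<^esub> p x = p (a \<odot>\<^bsub>N\<^esub> x)" if a: "a \<in> carrier R" and x: "x \<in> carrier N" for a x
  proof -
    have "p (a \<odot>\<^bsub>N\<^esub> z) = p (a \<odot>\<^bsub>N\<^esub> x)" if z: "z \<in> p x" for z
    proof -
      obtain i where i: "i \<in> I" "z = i \<oplus>\<^bsub>N\<^esub> x" using z by (auto simp: p_def a_r_coset_char)
      have c: "a \<odot>\<^bsub>N\<^esub> i \<in> carrier N" "a \<odot>\<^bsub>N\<^esub> x \<in> carrier N" "a \<odot>\<^bsub>N\<^esub> z \<in> carrier N"
        using N.smult_closed a x i s(1) by auto
      have "a \<odot>\<^bsub>N\<^esub> z = a \<odot>\<^bsub>N\<^esub> i \<oplus>\<^bsub>N\<^esub> a \<odot>\<^bsub>N\<^esub> x" using i s(1) x a by (simp add: N.smult_r_distr)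
      then have "a \<odot>\<^bsub>N\<^esub> z \<ominus>\<^bsub>N\<^esub> a \<odot>\<^bsub>N\<^esub> x = a \<odot>\<^bsub>N\<^esub> i" using c by (simp add: a_minus_def N.M.a_assoc N.M.r_neg)
      then show ?thesis using pe[OF c(3,2)] s(4)[OF a i(1)] by simp
    qed
    moreover have "x \<in> p x" using s(2) x unfolding p_def a_r_coset_char by force
    ultimately have "(\<Union>z\<in>p x. p (a \<odot>\<^bsub>N\<^esub> z)) = p (a \<odot>\<^bsub>N\<^esub> x)" by blast
    then show ?thesis by (simp add: Q p_def)
  qed
  have lm: "left_module R Q"
  proof (rule left_module_mkI)
    show "ring R" by (rule N.R.ring_axioms)
    show "\<zero>\<^bsub>Q\<^esub> \<in> carrier Q" unfolding Qz Qc by simp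
    fix x assume "x \<in> carrier Q"
    then obtain u where u: "u \<in> carrier N" "x = p u" unfolding Qc by blast
    show "\<zero>\<^bsub>Q\<^esub> \<oplus>\<^bsub>Q\<^esub> x = x" "\<one>\<^bsub>R\<^esub> \<odot>\<^bsub>Q\<^esub> x = x"
      unfolding u(2) Qz using u(1) by (simp_all add: Qa Qs N.smult_one)
    show "((\<ominus>\<^bsub>R\<^esub> \<one>\<^bsub>R\<^esub>) \<odot>\<^bsub>Q\<^esub> x) \<oplus>\<^bsub>Q\<^esub> x = \<zero>\<^bsub>Q\<^esub>"
      unfolding u(2) Qz using u(1) by (simp add: Qs minus_one_smult[OF N] Qa N.M.l_neg)
    show "a \<odot>\<^bsub>Q\<^esub> x \<in> carrier Q" if "a \<in> carrier R" for a
      using that u by (simp add: Qs Qc N.smult_closed)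
    show "(a \<oplus>\<^bsub>R\<^esub> b) \<odot>\<^bsub>Q\<^esub> x = a \<odot>\<^bsub>Q\<^esub> x \<oplus>\<^bsub>Q\<^esub> b \<odot>\<^bsub>Q\<^esub> x" "(a \<otimes>\<^bsub>R\<^esub> b) \<odot>\<^bsub>Q\<^esub> x = a \<odot>\<^bsub>Q\<^esub> (b \<odot>\<^bsub>Q\<^esub> x)"
      if "a \<in> carrier R" "b \<in> carrier R" for a b
      using that u by (simp_all add: Qs Qa N.smult_closed N.smult_l_distr N.smult_assoc1)
    fix y assume "y \<in> carrier Q"
    then obtain v where v: "v \<in> carrier N" "y = p v" unfolding Qc by blast
    show "x \<oplus>\<^bsub>Q\<^esub> y \<in> carrier Q" "x \<oplus>\<^bsub>Q\<^esub> y = y \<oplus>\<^bsub>Q\<^esub> x"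
      using u v by (simp_all add: Qa Qc N.M.a_comm)
    show "a \<odot>\<^bsub>Q\<^esub> (x \<oplus>\<^bsub>Q\<^esub> y) = a \<odot>\<^bsub>Q\<^esub> x \<oplus>\<^bsub>Q\<^esub> a \<odot>\<^bsub>Q\<^esub> y" if "a \<in> carrier R" for a
      using that u v by (simp add: Qa Qs N.smult_closed N.smult_r_distr)
    fix z assume "z \<in> carrier Q"
    then obtain w where w: "w \<in> carrier N" "z = p w" unfolding Qc by blast
    show "(x \<oplus>\<^bsub>Q\<^esub> y) \<oplus>\<^bsub>Q\<^esub> z = x \<oplus>\<^bsub>Q\<^esub> (y \<oplus>\<^bsub>Q\<^esub> z)" using u v w by (simp add: Qa N.M.a_assoc)
  qed
  have ph: "pr \<in> mod_hom R N Q"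
    unfolding pr by (rule mod_homI) (auto simp: Qa Qs Qc N N.smult_closed)
  show "left_module R (cokernel M N f)" "pr \<in> mod_hom R N (cokernel M N f)"
    using lm ph by (simp_all add: Q_def)
  show "pr ` carrier N = carrier (cokernel M N f)" using Qc by (simp add: Q_def pr)
  show "pr x = pr y \<longleftrightarrow> x \<ominus>\<^bsub>N\<^esub> y \<in> I" if "x \<in> carrier N" "y \<in> carrier N" for x y
    using that pe by (simp add: pr)
  have "pr x = \<zero>\<^bsub>Q\<^esub> \<longleftrightarrow> x \<in> I" if "x \<in> carrier N" for x
    using pe[OF that N.M.zero_closed] that N.M.minus_equality[of "\<zero>\<^bsub>N\<^esub>" "\<zero>\<^bsub>N\<^esub>"]
    by (simp add: pr Qz a_minus_def)
  then show "a_kernel N (cokernel M N f) pr = I"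
    using s(1) by (auto simp: a_kernel_def' Q_def)
qed

section \<open>Homomorphisms over a finite dimensional algebra\<close>

locale fin_dim_algebra = fd_algebra K A
  for K :: "('k, 'c) ring_scheme" and A :: "('k, 'a) module"
begin

abbreviation (input) ksp :: "('a, 'b) module \<Rightarrow> ('k, 'b) module"
  where "ksp M \<equiv> underlying_space A M"

abbreviation (input) emb :: "'k \<Rightarrow> 'a"
  where "emb c \<equiv> c \<odot>\<^bsub>A\<^esub> \<one>\<^bsub>A\<^esub>"

lemma field_K: "field K" by unfold_locales

lemma ring_A: "ring A" by unfold_locales

lemma left_module_KA: "left_module K A"
proof -
  have "abelian_group A" by unfold_locales
  then show ?thesis
  unfolding left_module_iff left_module_axioms_def
  using KA.smult_closed KA.smult_l_distr KA.smult_r_distr KA.smult_assoc1 KA.smult_one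
    K.ring_axioms by blast
qed

lemmas regular_K_module = left_module_regular[OF K.ring_axioms]
lemmas regular_A_module = left_module_regular[OF ring_A]

lemma emb_closed: "c \<in> carrier K \<Longrightarrow> emb c \<in> carrier A"
  by (simp add: KA.smult_closed)

lemma emb_mult_left: "c \<in> carrier K \<Longrightarrow> a \<in> carrier A \<Longrightarrow> emb c \<otimes>\<^bsub>A\<^esub> a = c \<odot>\<^bsub>A\<^esub> a"
  by (simp add: smult_mult_left)

lemma emb_mult_right: "c \<in> carrier K \<Longrightarrow> a \<in> carrier A \<Longrightarrow> a \<otimes>\<^bsub>A\<^esub> emb c = c \<odot>\<^bsub>A\<^esub> a"
  by (simp add: smult_mult_right)

lemma emb_add: "c \<in> carrier K \<Longrightarrow> d \<in> carrier K \<Longrightarrow> emb (c \<oplus>\<^bsub>K\<^esub> d) = emb c \<oplus>\<^bsub>A\<^esub> emb d"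
  by (simp add: KA.smult_l_distr)

lemma emb_mult: "c \<in> carrier K \<Longrightarrow> d \<in> carrier K \<Longrightarrow> emb (c \<otimes>\<^bsub>K\<^esub> d) = emb c \<otimes>\<^bsub>A\<^esub> emb d"
  by (simp add: KA.smult_assoc1 emb_mult_left emb_closed)

lemma emb_one: "emb \<one>\<^bsub>K\<^esub> = \<one>\<^bsub>A\<^esub>"
  by (simp add: KA.smult_one)

lemma ksp_simps [simp]:
  "carrier (ksp M) = carrier M" "ring.add (ksp M) = ring.add M" "\<zero>\<^bsub>ksp M\<^esub> = \<zero>\<^bsub>M\<^esub>"
  "c \<odot>\<^bsub>ksp M\<^esub> x = emb c \<odot>\<^bsub>M\<^esub> x"
  by (simp_all add: underlying_space_def)

lemma ksp_carrier_update: "ksp (M\<lparr>carrier := N\<rparr>) = (ksp M)\<lparr>carrier := N\<rparr>"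
  by (simp add: underlying_space_def mk_module_def)

lemma left_module_ksp:
  assumes "left_module A M" shows "left_module K (ksp M)"
proof -
  interpret M: left_module A M by fact
  have "abelian_group (ksp M)"
  proof (rule abelian_groupI)
    show "\<exists>y\<in>carrier (ksp M). y \<oplus>\<^bsub>ksp M\<^esub> x = \<zero>\<^bsub>ksp M\<^esub>" if "x \<in> carrier (ksp M)" for x
      using that M.M.a_inv_closed M.M.l_neg by force
  qed (auto simp: M.M.a_ac)
  then show ?thesis
    unfolding left_module_iff left_module_axioms_def
    by (auto simp: K.ring_axioms M.smult_closed emb_closed emb_add M.smult_l_distr M.smult_r_distr
        emb_mult M.smult_assoc1 emb_one M.smult_one)
qed

lemma submod_ksp: "submod A M N \<Longrightarrow> submod K (ksp M) N"
  by (auto simp: submod_def emb_closed)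

lemma mod_hom_ksp:
  assumes "f \<in> mod_hom A M N" shows "f \<in> mod_hom K (ksp M) (ksp N)"
  using assms by (auto simp: mod_hom_def emb_closed)

lemma ksp_smult_central:
  assumes "left_module A M" "c \<in> carrier K" "a \<in> carrier A" "x \<in> carrier M"
  shows "emb c \<odot>\<^bsub>M\<^esub> (a \<odot>\<^bsub>M\<^esub> x) = a \<odot>\<^bsub>M\<^esub> (emb c \<odot>\<^bsub>M\<^esub> x)"
proof -
  interpret M: left_module A M by fact
  show ?thesis
    using assms emb_mult_left emb_mult_right emb_closed by (simp flip: M.smult_assoc1)
qed

definition hom_space :: "('a, 'b) module \<Rightarrow> ('a, 'd) module \<Rightarrow> ('k, 'b \<Rightarrow> 'd) module"
  where "hom_space M N = (pow_mod (carrier M) (ksp N))\<lparr>carrier := mod_hom A M N\<rparr>"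

lemma hom_space_simps [simp]:
  "carrier (hom_space M N) = mod_hom A M N"
  "f \<oplus>\<^bsub>hom_space M N\<^esub> g = (\<lambda>x\<in>carrier M. f x \<oplus>\<^bsub>N\<^esub> g x)"
  "\<zero>\<^bsub>hom_space M N\<^esub> = (\<lambda>x\<in>carrier M. \<zero>\<^bsub>N\<^esub>)"
  "c \<odot>\<^bsub>hom_space M N\<^esub> f = (\<lambda>x\<in>carrier M. emb c \<odot>\<^bsub>N\<^esub> f x)"
  by (simp_all add: hom_space_def)

lemma submod_hom_space:
  assumes M: "left_module A M" and N: "left_module A N"
  shows "submod K (pow_mod (carrier M) (ksp N)) (mod_hom A M N)"
proof -
  interpret M: left_module A M by fact
  interpret N: left_module A N by fact
  show ?thesis
  proof (rule submodI)
    show "f \<in> mod_hom A M N \<Longrightarrow> f \<in> carrier (pow_mod (carrier M) (ksp N))" for f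
      using mod_hom_funcset by simp
    show "\<zero>\<^bsub>pow_mod (carrier M) (ksp N)\<^esub> \<in> mod_hom A M N"
      unfolding pow_mod_simps ksp_simps by (rule mod_homI) (auto simp: M smult_zero[OF N])
  next
    fix f g assume f: "f \<in> mod_hom A M N" and g: "g \<in> mod_hom A M N"
    show "f \<oplus>\<^bsub>pow_mod (carrier M) (ksp N)\<^esub> g \<in> mod_hom A M N"
      unfolding pow_mod_simps ksp_simps
      by (rule mod_homI) (auto simp: M mod_homD[OF f] mod_homD[OF g] N.smult_r_distr N.M.a_ac)
  next
    fix c f assume c: "c \<in> carrier K" and f: "f \<in> mod_hom A M N"
    show "c \<odot>\<^bsub>pow_mod (carrier M) (ksp N)\<^esub> f \<in> mod_hom A M N"
      unfolding pow_mod_simps ksp_simps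
      by (rule mod_homI)
        (use c in \<open>auto simp: M mod_homD[OF f] N.smult_r_distr N.smult_closed emb_closed ksp_smult_central[OF N]\<close>)
  qed
qed

lemma left_module_hom_space:
  assumes "left_module A M" "left_module A N" shows "left_module K (hom_space M N)"
  unfolding hom_space_def
  by (rule left_module_submod[OF left_module_pow_mod[OF left_module_ksp[OF assms(2)]] submod_hom_space[OF assms]])

lemma hom_space_eval:
  assumes "left_module A M" "left_module A N" "x \<in> carrier M"
  shows "(\<lambda>f\<in>mod_hom A M N. f x) \<in> mod_hom K (hom_space M N) (ksp N)"
  using mod_homI[of "hom_space M N" "\<lambda>f. f x" "ksp N" K] left_module_hom_space[OF assms(1,2)] assms(3)
  by (auto simp: mod_homD)

lemma hom_add_in: "\<lbrakk>left_module A M; left_module A N; f \<in> mod_hom A M N; g \<in> mod_hom A M N\<rbrakk> \<Longrightarrow>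
    (\<lambda>x\<in>carrier M. f x \<oplus>\<^bsub>N\<^esub> g x) \<in> mod_hom A M N"
  using submod_add[OF submod_hom_space] by fastforce

lemma hom_scale_in: "\<lbrakk>left_module A M; left_module A N; f \<in> mod_hom A M N; c \<in> carrier K\<rbrakk> \<Longrightarrow>
    (\<lambda>x\<in>carrier M. emb c \<odot>\<^bsub>N\<^esub> f x) \<in> mod_hom A M N"
  using submod_smult[OF submod_hom_space] by fastforce

lemma hom_zero_in: "\<lbrakk>left_module A M; left_module A N\<rbrakk> \<Longrightarrow> (\<lambda>x\<in>carrier M. \<zero>\<^bsub>N\<^esub>) \<in> mod_hom A M N"
  using submod_zero[OF submod_hom_space] by fastforce

lemma hom_diff_in:
  assumes M: "left_module A M" and N: "left_module A N" and f: "f \<in> mod_hom A M N" and g: "g \<in> mod_hom A M N"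
  shows "(\<lambda>x\<in>carrier M. f x \<ominus>\<^bsub>N\<^esub> g x) \<in> mod_hom A M N"
proof -
  interpret N: left_module A N by fact
  have m: "emb (\<ominus>\<^bsub>K\<^esub> \<one>\<^bsub>K\<^esub>) \<odot>\<^bsub>N\<^esub> y = \<ominus>\<^bsub>N\<^esub> y" if "y \<in> carrier N" for y
    using minus_one_smult[OF left_module_ksp[OF N], of y] that by (simp add: a_inv_def m_inv_def)
  have "(\<lambda>x\<in>carrier M. f x \<oplus>\<^bsub>N\<^esub> (\<lambda>x\<in>carrier M. emb (\<ominus>\<^bsub>K\<^esub> \<one>\<^bsub>K\<^esub>) \<odot>\<^bsub>N\<^esub> g x) x) \<in> mod_hom A M N"
    by (rule hom_add_in[OF M N f hom_scale_in[OF M N g]]) simp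
  also have "(\<lambda>x\<in>carrier M. f x \<oplus>\<^bsub>N\<^esub> (\<lambda>x\<in>carrier M. emb (\<ominus>\<^bsub>K\<^esub> \<one>\<^bsub>K\<^esub>) \<odot>\<^bsub>N\<^esub> g x) x)
      = (\<lambda>x\<in>carrier M. f x \<ominus>\<^bsub>N\<^esub> g x)"
    using mod_hom_closed[OF g] by (auto simp: m a_minus_def)
  finally show ?thesis .
qed

end

lemma factor_through_surj:
  assumes D: "left_module R D" and Q: "left_module R Q" and M: "left_module R M"
    and p: "p \<in> mod_hom R D Q" "p ` carrier D = carrier Q" and h: "h \<in> mod_hom R D M"
    and ker: "\<And>d. d \<in> carrier D \<Longrightarrow> p d = \<zero>\<^bsub>Q\<^esub> \<Longrightarrow> h d = \<zero>\<^bsub>M\<^esub>"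
  obtains f where "f \<in> mod_hom R Q M" "\<And>d. d \<in> carrier D \<Longrightarrow> f (p d) = h d"
proof -
  interpret D: left_module R D by fact
  interpret Q: left_module R Q by fact
  interpret M: left_module R M by fact
  have wd: "h d = h e" if "d \<in> carrier D" "e \<in> carrier D" "p d = p e" for d e
  proof -
    have "p (d \<ominus>\<^bsub>D\<^esub> e) = \<zero>\<^bsub>Q\<^esub>"
      using mod_hom_diff[OF D Q p(1) that(1,2)] that mod_hom_closed[OF p(1)] by (simp add: a_minus_def Q.M.r_neg)
    then have "h d \<ominus>\<^bsub>M\<^esub> h e = \<zero>\<^bsub>M\<^esub>"
      using ker mod_hom_diff[OF D M h that(1,2)] that by (simp add: a_minus_def)
    then show ?thesis using diff_eq_zeroD[OF M] mod_hom_closed[OF h] that by blast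
  qed
  define f where "f = (\<lambda>x\<in>carrier Q. h (SOME d. d \<in> carrier D \<and> p d = x))"
  have fp: "f (p d) = h d" if d: "d \<in> carrier D" for d
  proof -
    define e where "e = (SOME e. e \<in> carrier D \<and> p e = p d)"
    have e: "e \<in> carrier D \<and> p e = p d"
      unfolding e_def by (rule someI_ex) (use d in blast)
    have "f (p d) = h e" using mod_hom_closed[OF p(1) d] by (simp add: f_def e_def)
    then show ?thesis using wd[of e d] e d by simp
  qed
  have "(\<lambda>x\<in>carrier Q. f x) \<in> mod_hom R Q M"
  proof (rule mod_homI)
    fix x assume "x \<in> carrier Q"
    then obtain d where d: "d \<in> carrier D" "x = p d" using p(2) by blast
    show "f x \<in> carrier M" using fp d mod_hom_closed[OF h] by simp
    show "f (a \<odot>\<^bsub>Q\<^esub> x) = a \<odot>\<^bsub>M\<^esub> f x" if "a \<in> carrier R" for a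
      using fp[OF D.smult_closed[OF that d(1)]] d that fp[OF d(1)]
      by (simp add: mod_hom_smult[OF p(1)] mod_hom_smult[OF h])
    fix y assume "y \<in> carrier Q"
    then obtain e where e: "e \<in> carrier D" "y = p e" using p(2) by blast
    show "f (x \<oplus>\<^bsub>Q\<^esub> y) = f x \<oplus>\<^bsub>M\<^esub> f y"
      using fp[OF D.M.a_closed[OF d(1) e(1)]] d e fp[OF d(1)] fp[OF e(1)]
      by (simp add: mod_hom_add[OF p(1)] mod_hom_add[OF h])
  qed (rule Q)
  moreover have "(\<lambda>x\<in>carrier Q. f x) = f" by (auto simp: f_def)
  ultimately show thesis using that fp by simp
qed

lemma short_exactD:
  assumes "short_exact R N g W f M"
  shows "g \<in> mod_hom R N W" "f \<in> mod_hom R W M" "inj_on g (carrier N)"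
    "\<And>n. n \<in> carrier N \<Longrightarrow> f (g n) = \<zero>\<^bsub>M\<^esub>"
    "\<And>x. x \<in> carrier W \<Longrightarrow> f x = \<zero>\<^bsub>M\<^esub> \<Longrightarrow> \<exists>n\<in>carrier N. x = g n"
    "\<And>m. m \<in> carrier M \<Longrightarrow> \<exists>x\<in>carrier W. f x = m"
    "f ` carrier W = carrier M"
proof -
  have *: "g \<in> mod_hom R N W" "f \<in> mod_hom R W M" "inj_on g (carrier N)"
    "g ` carrier N = {x \<in> carrier W. f x = \<zero>\<^bsub>M\<^esub>}" "f ` carrier W = carrier M"
    using assms unfolding short_exact_def a_kernel_def' by simp_all
  then show "g \<in> mod_hom R N W" "f \<in> mod_hom R W M" "inj_on g (carrier N)" "f ` carrier W = carrier M"
    by simp_all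
  show "f (g n) = \<zero>\<^bsub>M\<^esub>" if "n \<in> carrier N" for n using *(4) that by blast
  show "\<exists>n\<in>carrier N. x = g n" if "x \<in> carrier W" "f x = \<zero>\<^bsub>M\<^esub>" for x using *(4) that by blast
  show "\<exists>x\<in>carrier W. f x = m" if "m \<in> carrier M" for m
    using *(5) that by (metis imageE)
qed

lemma kernel_short_exact:
  assumes F: "left_module R F" and M: "left_module R M" and \<pi>: "\<pi> \<in> mod_hom R F M" "\<pi> ` carrier F = carrier M"
  shows "short_exact R (F\<lparr>carrier := a_kernel F M \<pi>\<rparr>) (\<lambda>x\<in>a_kernel F M \<pi>. x) F \<pi> M"
  unfolding short_exact_def using mod_hom_incl[OF F submod_kernel[OF F M \<pi>(1)]] \<pi> by (auto simp: inj_on_def)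

lemma short_exact_kernel_lift:
  assumes N: "left_module R N" and W: "left_module R W" and M: "left_module R M" and Z: "left_module R Z"
    and E: "short_exact R N g W f M"
    and h: "h \<in> mod_hom R Z W" and fh: "\<And>z. z \<in> carrier Z \<Longrightarrow> f (h z) = \<zero>\<^bsub>M\<^esub>"
  obtains k where "k \<in> mod_hom R Z N" "\<And>z. z \<in> carrier Z \<Longrightarrow> g (k z) = h z"
proof -
  interpret N: left_module R N by fact
  interpret Z: left_module R Z by fact
  note E = short_exactD[OF E]
  have "\<forall>z\<in>carrier Z. \<exists>n\<in>carrier N. g n = h z" using E(5) mod_hom_closed[OF h] fh by metis
  then obtain k where k: "\<And>z. z \<in> carrier Z \<Longrightarrow> k z \<in> carrier N" "\<And>z. z \<in> carrier Z \<Longrightarrow> g (k z) = h z"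
    by metis
  have inj: "a = b" if "g a = g b" "a \<in> carrier N" "b \<in> carrier N" for a b
    using E(3) that by (auto dest: inj_onD)
  have "(\<lambda>z\<in>carrier Z. k z) \<in> mod_hom R Z N"
  proof (rule mod_homI)
    fix x assume x: "x \<in> carrier Z"
    show "k x \<in> carrier N" using k x by simp
    show "k (a \<odot>\<^bsub>Z\<^esub> x) = a \<odot>\<^bsub>N\<^esub> k x" if "a \<in> carrier R" for a
      by (rule inj) (use that x k in \<open>simp_all add: Z.smult_closed N.smult_closed mod_hom_smult[OF E(1)] mod_hom_smult[OF h]\<close>)
    fix y assume y: "y \<in> carrier Z"
    show "k (x \<oplus>\<^bsub>Z\<^esub> y) = k x \<oplus>\<^bsub>N\<^esub> k y"
      by (rule inj) (use x y k in \<open>simp_all add: mod_hom_add[OF E(1)] mod_hom_add[OF h]\<close>)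
  qed (rule Z)
  then show thesis using that[of "\<lambda>z\<in>carrier Z. k z"] k by simp
qed

context fin_dim_algebra begin

text \<open>The map \<open>x \<mapsto> x - s (f x)\<close> is killed by \<open>f\<close>, hence takes values in \<open>N\<close>.\<close>

lemma retraction_of_section:
  assumes N: "left_module A N" and W: "left_module A W" and M: "left_module A M"
    and E: "short_exact A N g W f M"
    and s: "s \<in> mod_hom A M W" "\<And>m. m \<in> carrier M \<Longrightarrow> f (s m) = m"
  obtains r where "r \<in> mod_hom A W N" "\<And>n. n \<in> carrier N \<Longrightarrow> r (g n) = n"
proof -
  interpret N: left_module A N by fact
  interpret W: left_module A W by fact
  interpret M: left_module A M by fact
  note e = short_exactD[OF E]
  let ?h = "\<lambda>x\<in>carrier W. mod_id W x \<ominus>\<^bsub>W\<^esub> compose (carrier W) s f x"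
  have sf: "compose (carrier W) s f \<in> mod_hom A W W" by (rule mod_hom_compose[OF W e(2) s(1)])
  have h: "?h \<in> mod_hom A W W" by (rule hom_diff_in[OF W W mod_hom_id[OF W] sf])
  have "f (?h x) = \<zero>\<^bsub>M\<^esub>" if x: "x \<in> carrier W" for x
  proof -
    have c: "s (f x) \<in> carrier W" "f x \<in> carrier M" using mod_homD[OF s(1)] mod_homD[OF e(2)] x by auto
    show ?thesis using mod_hom_diff[OF W M e(2) x c(1)] s(2)[OF c(2)] c x
      by (simp add: mod_id_def compose_def a_minus_def M.M.r_neg)
  qed
  then obtain r where r: "r \<in> mod_hom A W N" "\<And>x. x \<in> carrier W \<Longrightarrow> g (r x) = ?h x"
    using short_exact_kernel_lift[OF N W M W E h] by blast
  have "r (g n) = n" if n: "n \<in> carrier N" for n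
  proof -
    have c: "g n \<in> carrier W" using mod_hom_closed[OF e(1) n] .
    have "s (f (g n)) = \<zero>\<^bsub>W\<^esub>" using e(4)[OF n] mod_hom_zero[OF M W s(1)] by simp
    then have "g (r (g n)) = g n"
      using r(2)[OF c] c W.M.minus_equality[of "\<zero>\<^bsub>W\<^esub>" "\<zero>\<^bsub>W\<^esub>"] by (simp add: mod_id_def compose_def a_minus_def)
    then show ?thesis using e(3) n mod_hom_closed[OF r(1) c] by (auto dest: inj_onD)
  qed
  then show thesis using that r(1) by blast
qed

text \<open>The map \<open>x \<mapsto> x - g (r x)\<close> vanishes on the image of \<open>g\<close>, hence factors through \<open>f\<close>.\<close>

lemma section_of_retraction:
  assumes N: "left_module A N" and W: "left_module A W" and M: "left_module A M"
    and E: "short_exact A N g W f M"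
    and r: "r \<in> mod_hom A W N" "\<And>n. n \<in> carrier N \<Longrightarrow> r (g n) = n"
  obtains s where "s \<in> mod_hom A M W" "\<And>m. m \<in> carrier M \<Longrightarrow> f (s m) = m"
proof -
  interpret W: left_module A W by fact
  interpret M: left_module A M by fact
  note e = short_exactD[OF E]
  let ?h = "\<lambda>x\<in>carrier W. mod_id W x \<ominus>\<^bsub>W\<^esub> compose (carrier W) g r x"
  have gr: "compose (carrier W) g r \<in> mod_hom A W W" by (rule mod_hom_compose[OF W r(1) e(1)])
  have h: "?h \<in> mod_hom A W W" by (rule hom_diff_in[OF W W mod_hom_id[OF W] gr])
  have "?h x = \<zero>\<^bsub>W\<^esub>" if x: "x \<in> carrier W" "f x = \<zero>\<^bsub>M\<^esub>" for x
  proof -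
    obtain n where n: "n \<in> carrier N" "x = g n" using e(5)[OF x] by blast
    then show ?thesis using x r(2)[OF n(1)] by (simp add: mod_id_def compose_def a_minus_def W.M.r_neg)
  qed
  then obtain s where s: "s \<in> mod_hom A M W" "\<And>x. x \<in> carrier W \<Longrightarrow> s (f x) = ?h x"
    using factor_through_surj[OF W M W e(2) e(7) h] by blast
  have "f (s m) = m" if m: "m \<in> carrier M" for m
  proof -
    obtain x where x: "x \<in> carrier W" "m = f x" using e(6)[OF m] by blast
    have c: "r x \<in> carrier N" "g (r x) \<in> carrier W" using mod_homD[OF r(1)] mod_homD[OF e(1)] x by auto
    have "f (s m) = f (x \<ominus>\<^bsub>W\<^esub> g (r x))" using s(2)[OF x(1)] x by (simp add: mod_id_def compose_def)
    also have "\<dots> = m"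
      using mod_hom_diff[OF W M e(2) x(1) c(2)] e(4)[OF c(1)] x m M.M.minus_equality[of "\<zero>\<^bsub>M\<^esub>" "\<zero>\<^bsub>M\<^esub>"]
      by (simp add: a_minus_def)
    finally show ?thesis .
  qed
  then show thesis using that s(1) by blast
qed

section \<open>Finite dimensionality\<close>

lemma fin_span_ksp_regular: "fin_span K (ksp (regular A)) (carrier (regular A))"
proof -
  have 1: "fin_span K A (carrier A)" using finite_dimensional finitely_generated_iff[OF left_module_KA] by simp
  have 2: "(\<lambda>x\<in>carrier A. x) \<in> mod_hom K A (ksp (regular A))"
    by (rule mod_homI) (auto simp: emb_mult_left left_module_KA)
  show ?thesis using fin_span_image[OF left_module_KA left_module_ksp[OF regular_A_module] 2 1] by simp
qed

lemma fin_span_ksp_pow: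
  assumes "finite S"
  shows "fin_span K (ksp (pow_mod S (regular A))) (carrier (pow_mod S (regular A)))"
proof -
  let ?P = "pow_mod S (regular A)"
  let ?e = "\<lambda>s. \<lambda>f\<in>carrier ?P. f s"
  obtain ss where ss: "set ss = S" using finite_list[OF assms] by metis
  note P = left_module_pow_mod[OF regular_A_module, of S]
  show ?thesis
  proof (rule fin_span_separated[OF field_K left_module_ksp[OF P] left_module_ksp[OF regular_A_module]])
    show "fin_span K (ksp (regular A)) (carrier (ksp (regular A)))" using fin_span_ksp_regular by simp
    show "set (map ?e ss) \<subseteq> mod_hom K (ksp ?P) (ksp (regular A))"
      using mod_hom_ksp[OF pow_mod_eval[OF regular_A_module]] ss by auto
    show "submod K (ksp ?P) (carrier ?P)" using submod_carrier[OF left_module_ksp[OF P]] by simp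
    fix h assume h: "h \<in> carrier ?P" "\<forall>e\<in>set (map ?e ss). e h = \<zero>\<^bsub>ksp (regular A)\<^esub>"
    have "h s = \<zero>\<^bsub>A\<^esub>" if "s \<in> S" for s
    proof -
      have "?e s h = \<zero>\<^bsub>ksp (regular A)\<^esub>" using h(2) ss that by auto
      then show ?thesis using h(1) by simp
    qed
    then show "h = \<zero>\<^bsub>ksp ?P\<^esub>"
      using h(1) by (auto simp: fun_eq_iff PiE_arb[of h S "\<lambda>_. carrier A"])
  qed
qed

lemma fg_left_module: "fg_module A M \<Longrightarrow> left_module A M" by (simp add: fg_module_def)

lemma fg_module_cover:
  assumes "fg_module A M"
  obtains S where "finite S" "S \<subseteq> carrier M"
    "(\<lambda>a\<in>carrier (pow_mod S (regular A)). \<Oplus>\<^bsub>M\<^esub>s\<in>S. a s \<odot>\<^bsub>M\<^esub> s) ` carrier (pow_mod S (regular A)) = carrier M"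
proof -
  have M: "left_module A M" using assms by (rule fg_left_module)
  obtain S where S: "finite S" "S \<subseteq> carrier M"
    and gen: "\<forall>x\<in>carrier M. \<exists>a\<in>S \<rightarrow> carrier A. x = (\<Oplus>\<^bsub>M\<^esub>s\<in>S. a s \<odot>\<^bsub>M\<^esub> s)"
    using assms unfolding fg_module_def finitely_generated_def by blast
  let ?P = "pow_mod S (regular A)"
  let ?f = "\<lambda>a\<in>carrier ?P. \<Oplus>\<^bsub>M\<^esub>s\<in>S. a s \<odot>\<^bsub>M\<^esub> s"
  interpret M: left_module A M by fact
  have id: "(\<lambda>s. s) \<in> S \<rightarrow> carrier M" using S by auto
  have f: "?f \<in> mod_hom A ?P M" using lincomb_hom[OF M S(1) id] .
  have "x \<in> ?f ` carrier ?P" if x: "x \<in> carrier M" for x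
  proof -
    obtain a where a: "a \<in> S \<rightarrow> carrier A" "x = (\<Oplus>\<^bsub>M\<^esub>s\<in>S. a s \<odot>\<^bsub>M\<^esub> s)" using bspec[OF gen x] by blast
    have 1: "restrict a S \<in> carrier ?P" using a by auto
    have "(\<Oplus>\<^bsub>M\<^esub>s\<in>S. restrict a S s \<odot>\<^bsub>M\<^esub> s) = (\<Oplus>\<^bsub>M\<^esub>s\<in>S. a s \<odot>\<^bsub>M\<^esub> s)"
      by (rule M.M.finsum_cong') (use a S in \<open>auto intro!: M.smult_closed\<close>)
    then have 2: "x = ?f (restrict a S)" unfolding a(2) restrict_apply'[OF 1] by (rule sym)
    show ?thesis by (rule image_eqI[where f = ?f and x = "restrict a S", OF 2 1])
  qed
  then have "?f ` carrier ?P = carrier M" using mod_hom_closed[OF f] by blast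
  then show thesis by (rule that[OF S])
qed

text \<open>Together with \<open>fg_moduleI\<close> below this identifies the finitely generated modules with those of
  finite dimension over \<open>K\<close>.\<close>

lemma fin_span_ksp:
  assumes "fg_module A M"
  shows "fin_span K (ksp M) (carrier M)"
proof -
  have M: "left_module A M" using assms by (rule fg_left_module)
  obtain S where S: "finite S" "S \<subseteq> carrier M"
    and im: "(\<lambda>a\<in>carrier (pow_mod S (regular A)). \<Oplus>\<^bsub>M\<^esub>s\<in>S. a s \<odot>\<^bsub>M\<^esub> s) ` carrier (pow_mod S (regular A)) = carrier M"
    by (rule fg_module_cover[OF assms]) (rule that)
  have id: "(\<lambda>s. s) \<in> S \<rightarrow> carrier M" using S by auto
  show ?thesis
    using fin_span_image[OF left_module_ksp[OF left_module_pow_mod[OF regular_A_module]] left_module_ksp[OF M]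
        mod_hom_ksp[OF lincomb_hom[OF M S(1) id]] fin_span_ksp_pow[OF S(1)]] im by simp
qed

lemma fg_moduleI:
  assumes M: "left_module A M" and fin: "fin_span K (ksp M) (carrier M)"
  shows "fg_module A M"
proof -
  obtain vs where vs: "set vs \<subseteq> carrier M" "lspan K (ksp M) vs = carrier M" using fin by (auto simp: fin_span_def)
  have "lspan K (ksp M) vs \<subseteq> lspan A M vs"
    by (rule lspan_least[OF submod_ksp[OF submod_lspan[OF M vs(1)]] lspan_superset[OF M vs(1)]])
  then have "lspan A M vs = carrier M" using vs submod_sub[OF submod_lspan[OF M vs(1)]] by blast
  then show ?thesis using M vs(1) finitely_generated_iff[OF M] by (auto simp: fg_module_def fin_span_def)
qed

lemma fg_image:
  assumes "fg_module A M" "left_module A N" "f \<in> mod_hom A M N" "f ` carrier M = carrier N"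
  shows "fg_module A N"
  using fg_moduleI[OF assms(2)] fin_span_image[OF left_module_ksp[OF fg_left_module[OF assms(1)]]
      left_module_ksp[OF assms(2)] mod_hom_ksp[OF assms(3)] fin_span_ksp[OF assms(1)]] assms(4)
  by simp

lemma fg_pow: "finite S \<Longrightarrow> fg_module A (pow_mod S (regular A))"
  by (rule fg_moduleI[OF left_module_pow_mod[OF regular_A_module] fin_span_ksp_pow])

lemma fg_direct_sum:
  assumes "fg_module A M" "fg_module A N" shows "fg_module A (direct_sum M N)"
proof -
  have M: "left_module A M" and N: "left_module A N" using assms by (auto intro: fg_left_module)
  interpret M: left_module A M by fact
  interpret N: left_module A N by fact
  note D = left_module_direct_sum[OF M N]
  let ?D = "direct_sum M N"
  let ?i = "\<lambda>y\<in>carrier N. (\<zero>\<^bsub>M\<^esub>, y)" and ?p = "\<lambda>z\<in>carrier ?D. fst z"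
  have i: "?i \<in> mod_hom A N ?D" by (rule mod_homI) (auto simp: N smult_zero[OF M])
  have p: "?p \<in> mod_hom A ?D M" by (rule mod_homI[OF _ _ _ D]) auto
  have "fin_span K (ksp ?D) (carrier ?D)"
  proof (rule fin_span_extension[OF left_module_ksp[OF D] left_module_ksp[OF M] mod_hom_ksp[OF p]])
    show "submod K (ksp ?D) (carrier ?D)" using submod_carrier[OF left_module_ksp[OF D]] by simp
    have "?p ` carrier ?D = carrier M" using N.M.zero_closed by (force simp: image_iff)
    then show "fin_span K (ksp M) (?p ` carrier ?D)" using fin_span_ksp[OF assms(1)] by simp
    have "{x \<in> carrier ?D. ?p x = \<zero>\<^bsub>ksp M\<^esub>} = ?i ` carrier N" by auto
    then show "fin_span K (ksp ?D) {x \<in> carrier ?D. ?p x = \<zero>\<^bsub>ksp M\<^esub>}"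
      using fin_span_image[OF left_module_ksp[OF N] left_module_ksp[OF D] mod_hom_ksp[OF i] fin_span_ksp[OF assms(2)]]
      by simp
  qed
  then show ?thesis by (rule fg_moduleI[OF D])
qed

text \<open>A homomorphism is determined by its values on finitely many generators.\<close>

lemma fin_span_hom_space:
  assumes "fg_module A M" "fg_module A N"
  shows "fin_span K (hom_space M N) (mod_hom A M N)"
proof -
  have M: "left_module A M" and N: "left_module A N" using assms by (auto intro: fg_left_module)
  note H = left_module_hom_space[OF M N]
  obtain vs where vs: "set vs \<subseteq> carrier M" "lspan K (ksp M) vs = carrier M"
    using fin_span_ksp[OF assms(1)] by (auto simp: fin_span_def)
  let ?e = "\<lambda>x. \<lambda>f\<in>mod_hom A M N. f x"
  show ?thesis
  proof (rule fin_span_separated[OF field_K H left_module_ksp[OF N]])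
    show "fin_span K (ksp N) (carrier (ksp N))" using fin_span_ksp[OF assms(2)] by simp
    show "set (map ?e vs) \<subseteq> mod_hom K (hom_space M N) (ksp N)"
      using hom_space_eval[OF M N] vs(1) by auto
    show "submod K (hom_space M N) (mod_hom A M N)" using submod_carrier[OF H] by simp
    fix h assume h: "h \<in> mod_hom A M N" "\<forall>e\<in>set (map ?e vs). e h = \<zero>\<^bsub>ksp N\<^esub>"
    have v0: "h v = \<zero>\<^bsub>N\<^esub>" if "v \<in> set vs" for v
    proof -
      have "?e v h = \<zero>\<^bsub>ksp N\<^esub>" using h(2) that by auto
      then show ?thesis using h(1) by simp
    qed
    have "lspan K (ksp M) vs \<subseteq> a_kernel M N h"
      by (rule lspan_least[OF submod_ksp[OF submod_kernel[OF M N h(1)]]])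
        (use v0 vs(1) in \<open>auto simp: a_kernel_def'\<close>)
    then have "h x = \<zero>\<^bsub>N\<^esub>" if "x \<in> carrier M" for x using that vs(2) by (auto simp: a_kernel_def')
    then show "h = \<zero>\<^bsub>hom_space M N\<^esub>"
      using mod_hom_eqI[OF h(1) hom_zero_in[OF M N]] by simp
  qed
qed

definition dual_space :: "('k, 'b) module \<Rightarrow> ('k, 'b \<Rightarrow> 'k) module"
  where "dual_space V = (pow_mod (carrier V) (regular K))\<lparr>carrier := mod_hom K V (regular K)\<rparr>"

lemma dual_space_simps [simp]:
  "carrier (dual_space V) = mod_hom K V (regular K)"
  "f \<oplus>\<^bsub>dual_space V\<^esub> g = (\<lambda>x\<in>carrier V. f x \<oplus>\<^bsub>K\<^esub> g x)"
  "\<zero>\<^bsub>dual_space V\<^esub> = (\<lambda>x\<in>carrier V. \<zero>\<^bsub>K\<^esub>)"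
  "c \<odot>\<^bsub>dual_space V\<^esub> f = (\<lambda>x\<in>carrier V. c \<otimes>\<^bsub>K\<^esub> f x)"
  by (simp_all add: dual_space_def)

lemma left_module_dual_space:
  assumes V: "left_module K V" shows "left_module K (dual_space V)"
proof -
  interpret V: left_module K V by fact
  have "submod K (pow_mod (carrier V) (regular K)) (mod_hom K V (regular K))"
  proof (rule submodI)
    show "f \<in> mod_hom K V (regular K) \<Longrightarrow> f \<in> carrier (pow_mod (carrier V) (regular K))" for f
      using mod_hom_funcset by fastforce
    show "\<zero>\<^bsub>pow_mod (carrier V) (regular K)\<^esub> \<in> mod_hom K V (regular K)"
      unfolding pow_mod_simps by (rule mod_homI) (auto simp: V)
  next
    fix f g assume f: "f \<in> mod_hom K V (regular K)" and g: "g \<in> mod_hom K V (regular K)"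
    have c: "f x \<in> carrier K" "g x \<in> carrier K" if "x \<in> carrier V" for x
      using mod_hom_closed[OF f] mod_hom_closed[OF g] that by auto
    show "f \<oplus>\<^bsub>pow_mod (carrier V) (regular K)\<^esub> g \<in> mod_hom K V (regular K)"
      unfolding pow_mod_simps
      by (rule mod_homI) (auto simp: V c mod_hom_add[OF f] mod_hom_add[OF g] mod_hom_smult[OF f]
          mod_hom_smult[OF g] K.r_distr K.a_ac)
  next
    fix a f assume a: "a \<in> carrier K" and f: "f \<in> mod_hom K V (regular K)"
    have c: "f x \<in> carrier K" if "x \<in> carrier V" for x
      using mod_hom_closed[OF f] that by auto
    show "a \<odot>\<^bsub>pow_mod (carrier V) (regular K)\<^esub> f \<in> mod_hom K V (regular K)"
      unfolding pow_mod_simps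
      by (rule mod_homI) (use a in \<open>auto simp: V c mod_hom_add[OF f] mod_hom_smult[OF f] K.r_distr K.m_ac\<close>)
  qed
  then show ?thesis
    unfolding dual_space_def by (rule left_module_submod[OF left_module_pow_mod[OF regular_K_module]])
qed

lemma fin_span_dual_space:
  assumes V: "left_module K V" and fin: "fin_span K V (carrier V)"
  shows "fin_span K (dual_space V) (mod_hom K V (regular K))"
proof -
  note D = left_module_dual_space[OF V]
  obtain vs where vs: "set vs \<subseteq> carrier V" "lspan K V vs = carrier V" using fin by (auto simp: fin_span_def)
  let ?e = "\<lambda>x. \<lambda>f\<in>mod_hom K V (regular K). f x"
  have K1: "fin_span K (regular K) (carrier (regular K))"
  proof -
    have "x \<in> lspan K (regular K) [\<one>\<^bsub>K\<^esub>]" if x: "x \<in> carrier K" for x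
    proof -
      have "x = x \<otimes>\<^bsub>K\<^esub> \<one>\<^bsub>K\<^esub> \<oplus>\<^bsub>K\<^esub> \<zero>\<^bsub>K\<^esub>" using x by simp
      then show ?thesis using x unfolding lspan.simps regular_simps by blast
    qed
    moreover have "lspan K (regular K) [\<one>\<^bsub>K\<^esub>] \<subseteq> carrier K" by auto
    ultimately have "lspan K (regular K) [\<one>\<^bsub>K\<^esub>] = carrier K" by blast
    then show ?thesis unfolding fin_span_def by (intro exI[of _ "[\<one>\<^bsub>K\<^esub>]"]) auto
  qed
  show ?thesis
  proof (rule fin_span_separated[OF field_K D regular_K_module K1])
    have "?e x \<in> mod_hom K (dual_space V) (regular K)" if "x \<in> carrier V" for x
      using mod_homI[of "dual_space V" "\<lambda>f. f x" "regular K" K] D that mod_hom_closed by fastforce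
    then show "set (map ?e vs) \<subseteq> mod_hom K (dual_space V) (regular K)" using vs(1) by auto
    show "submod K (dual_space V) (mod_hom K V (regular K))" using submod_carrier[OF D] by simp
    fix h assume h: "h \<in> mod_hom K V (regular K)" "\<forall>e\<in>set (map ?e vs). e h = \<zero>\<^bsub>regular K\<^esub>"
    have v0: "h v = \<zero>\<^bsub>K\<^esub>" if "v \<in> set vs" for v
    proof -
      have "?e v h = \<zero>\<^bsub>regular K\<^esub>" using h(2) that by auto
      then show ?thesis using h(1) by simp
    qed
    have "lspan K V vs \<subseteq> a_kernel V (regular K) h"
      by (rule lspan_least[OF submod_kernel[OF V regular_K_module h(1)]])
        (use v0 vs(1) in \<open>auto simp: a_kernel_def'\<close>)
    then have z: "h x = \<zero>\<^bsub>K\<^esub>" if "x \<in> carrier V" for x using that vs(2) by (auto simp: a_kernel_def')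
    show "h = \<zero>\<^bsub>dual_space V\<^esub>"
      by (rule extensionalityI[of _ "carrier V"]) (use z mod_hom_extensional[OF h(1)] in auto)
  qed
qed

end

section \<open>Free modules\<close>

definition unit_vec :: "('a, 'c) ring_scheme \<Rightarrow> 'i set \<Rightarrow> 'i \<Rightarrow> 'i \<Rightarrow> 'a"
  where "unit_vec R S s = (\<lambda>t\<in>S. if t = s then \<one>\<^bsub>R\<^esub> else \<zero>\<^bsub>R\<^esub>)"

lemma unit_vec_closed: "ring R \<Longrightarrow> unit_vec R S s \<in> carrier (pow_mod S (regular R))"
  by (auto simp: unit_vec_def ring.ring_simprules)

lemma pow_mod_expand:
  assumes R: "ring R" and S: "finite S" and a: "a \<in> carrier (pow_mod S (regular R))"
  shows "(\<Oplus>\<^bsub>pow_mod S (regular R)\<^esub>s\<in>S. a s \<odot>\<^bsub>pow_mod S (regular R)\<^esub> unit_vec R S s) = a"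
proof -
  interpret R: ring R by fact
  let ?P = "pow_mod S (regular R)"
  note RR = left_module_regular[OF R]
  note P = left_module_pow_mod[OF RR, of S]
  interpret RR: left_module R "regular R" by (rule RR)
  interpret P: left_module R ?P by (rule P)
  have ac: "a s \<in> carrier R" if "s \<in> S" for s using a that by auto
  let ?v = "\<lambda>s. a s \<odot>\<^bsub>?P\<^esub> unit_vec R S s"
  have v: "?v \<in> S \<rightarrow> carrier ?P" by (intro Pi_I P.smult_closed ac unit_vec_closed[OF R])
  have cl: "(\<Oplus>\<^bsub>?P\<^esub>s\<in>S. ?v s) \<in> carrier ?P" by (rule P.M.finsum_closed[OF v])
  have "(\<Oplus>\<^bsub>?P\<^esub>s\<in>S. ?v s) t = a t" if t: "t \<in> S" for t
  proof -
    let ?e = "\<lambda>f\<in>carrier ?P. f t"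
    have e: "?e \<in> mod_hom R ?P (regular R)" by (rule pow_mod_eval[OF RR t])
    have "(\<Oplus>\<^bsub>?P\<^esub>s\<in>S. ?v s) t = ?e (\<Oplus>\<^bsub>?P\<^esub>s\<in>S. ?v s)" using cl by simp
    also have "\<dots> = (\<Oplus>\<^bsub>regular R\<^esub>s\<in>S. ?e (?v s))" by (rule mod_hom_finsum[OF P RR e S v])
    also have "\<dots> = (\<Oplus>\<^bsub>regular R\<^esub>s\<in>S. if t = s then a s else \<zero>\<^bsub>regular R\<^esub>)"
    proof (rule RR.M.finsum_cong')
      fix s assume s: "s \<in> S"
      have "?e (?v s) = ?v s t" by (rule restrict_apply'[OF funcset_mem[OF v s]])
      also have "\<dots> = (if t = s then a s else \<zero>\<^bsub>regular R\<^esub>)"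
        using t s ac by (simp add: unit_vec_def)
      finally show "?e (?v s) = (if t = s then a s else \<zero>\<^bsub>regular R\<^esub>)" .
    qed (use ac in auto)
    also have "\<dots> = a t" by (rule RR.M.finsum_singleton[OF t S]) (use ac in auto)
    finally show ?thesis .
  qed
  then show ?thesis using cl a by (intro extensionalityI[of _ S]) (auto simp: PiE_def)
qed

lemma pow_mod_hom_expand:
  assumes R: "ring R" and S: "finite S" and N: "left_module R N"
    and f: "f \<in> mod_hom R (pow_mod S (regular R)) N" and a: "a \<in> carrier (pow_mod S (regular R))"
  shows "f a = (\<Oplus>\<^bsub>N\<^esub>s\<in>S. a s \<odot>\<^bsub>N\<^esub> f (unit_vec R S s))"
proof -
  let ?P = "pow_mod S (regular R)"
  note P = left_module_pow_mod[OF left_module_regular[OF R], of S]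
  interpret P: left_module R ?P by (rule P)
  interpret N: left_module R N by fact
  have ac: "a s \<in> carrier R" if "s \<in> S" for s using a that by auto
  note u = unit_vec_closed[OF R, of S]
  have v: "(\<lambda>s. a s \<odot>\<^bsub>?P\<^esub> unit_vec R S s) \<in> S \<rightarrow> carrier ?P" by (intro Pi_I P.smult_closed ac u)
  have "f a = f (\<Oplus>\<^bsub>?P\<^esub>s\<in>S. a s \<odot>\<^bsub>?P\<^esub> unit_vec R S s)" by (simp only: pow_mod_expand[OF R S a])
  also have "\<dots> = (\<Oplus>\<^bsub>N\<^esub>s\<in>S. f (a s \<odot>\<^bsub>?P\<^esub> unit_vec R S s))" by (rule mod_hom_finsum[OF P N f S v])
  also have "\<dots> = (\<Oplus>\<^bsub>N\<^esub>s\<in>S. a s \<odot>\<^bsub>N\<^esub> f (unit_vec R S s))"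
    using mod_hom_closed[OF f u] ac
    by (intro N.M.finsum_cong') (auto simp: mod_hom_smult[OF f _ u] N.smult_closed simp del: pow_mod_simps)
  finally show ?thesis .
qed

text \<open>Coefficient lists parametrise a span, which bounds the cardinality of a finite dimensional module.\<close>

lemma lspan_image_lists: "\<exists>g. lspan K V vs \<subseteq> g ` lists (carrier K)"
proof (induction vs)
  case Nil
  show ?case by (rule exI[of _ "\<lambda>_. \<zero>\<^bsub>V\<^esub>"]) auto
next
  case (Cons v vs)
  then obtain g where g: "lspan K V vs \<subseteq> g ` lists (carrier K)" by blast
  let ?g = "\<lambda>cs. hd cs \<odot>\<^bsub>V\<^esub> v \<oplus>\<^bsub>V\<^esub> g (tl cs)"
  have "lspan K V (v # vs) \<subseteq> ?g ` lists (carrier K)"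
  proof
    fix x assume "x \<in> lspan K V (v # vs)"
    then obtain c w where c: "x = c \<odot>\<^bsub>V\<^esub> v \<oplus>\<^bsub>V\<^esub> w" "c \<in> carrier K" "w \<in> lspan K V vs" by auto
    then obtain cs where "w = g cs" "cs \<in> lists (carrier K)" using g by blast
    with c show "x \<in> ?g ` lists (carrier K)" by (intro image_eqI[of _ _ "c # cs"]) auto
  qed
  then show ?case by (intro exI[of _ ?g])
qed

section \<open>Copies of modules, dual bases and pushouts\<close>

text \<open>The argument of type \<open>'m itself\<close> makes the type \<open>'m\<close>, on which copies of all finitely generated
  modules are to be found, a parameter of the locale.\<close>

locale algebra_with_universe = fin_dim_algebra K A
  for K :: "('k, 'c) ring_scheme" and A :: "('k, 'a) module" +
  fixes universe_type :: "'m itself"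
  assumes universe: "lists (carrier K) \<lesssim> (UNIV :: 'm set)"
begin

text \<open>Projectivity and membership in a class of modules are tested on the type \<open>'m\<close> only; a finite
  dimensional module is no larger than the set of lists over \<open>K\<close> and so has a copy there.\<close>

lemma copy_module:
  fixes M :: "('a, 'b) module"
  assumes "fg_module A M"
  obtains Y :: "('a, 'm) module" and i j where "fg_module A Y" "i \<in> mod_hom A M Y" "j \<in> mod_hom A Y M"
    "\<And>x. x \<in> carrier M \<Longrightarrow> j (i x) = x" "\<And>y. y \<in> carrier Y \<Longrightarrow> i (j y) = y"
proof -
  have M: "left_module A M" using assms by (rule fg_left_module)
  obtain vs where "lspan K (ksp M) vs = carrier M"
    using fin_span_ksp[OF assms] by (auto simp: fin_span_def)
  then obtain g where "carrier M \<subseteq> g ` lists (carrier K)" using lspan_image_lists[of K "ksp M" vs] by auto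
  then have "carrier M \<lesssim> (UNIV :: 'm set)"
    by (meson image_lepoll lepoll_trans subset_imp_lepoll universe)
  then obtain \<iota> :: "'b \<Rightarrow> 'm" where \<iota>: "inj_on \<iota> (carrier M)" by (auto simp: lepoll_def)
  obtain Y where Y: "left_module A Y" "(\<lambda>x\<in>carrier M. \<iota> x) \<in> mod_hom A M Y"
    "bij_betw (\<lambda>x\<in>carrier M. \<iota> x) (carrier M) (carrier Y)"
    using transport_module[OF M \<iota>] by metis
  let ?i = "\<lambda>x\<in>carrier M. \<iota> x"
  have "fg_module A Y" by (rule fg_image[OF assms Y(1,2)]) (use Y(3) in \<open>simp add: bij_betw_def\<close>)
  moreover obtain j where "j \<in> mod_hom A Y M" "\<And>x. x \<in> carrier M \<Longrightarrow> j (?i x) = x" "\<And>y. y \<in> carrier Y \<Longrightarrow> ?i (j y) = y"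
    using mod_hom_inverse[OF M Y] by metis
  ultimately show thesis using that Y(2) by blast
qed

text \<open>\<open>F\<close> is a copy of \<open>A\<^sup>S\<close>, and it is projective because the unit vectors can be sent to arbitrary
  preimages. The coordinate functions \<open>c\<close> of \<open>F\<close> are recorded since they turn into a dual basis of
  any direct summand.\<close>

lemma free_cover:
  fixes M :: "('a, 'b) module"
  assumes "fg_module A M"
  obtains S :: "'b set" and F :: "('a, 'm) module" and \<pi> y c where "finite S" "fg_module A F" "projective A F"
    "\<pi> \<in> mod_hom A F M" "\<pi> ` carrier F = carrier M" "y \<in> S \<rightarrow> carrier M"
    "\<And>s. s \<in> S \<Longrightarrow> c s \<in> mod_hom A F (regular A)"
    "\<And>x. x \<in> carrier F \<Longrightarrow> \<pi> x = (\<Oplus>\<^bsub>M\<^esub>s\<in>S. c s x \<odot>\<^bsub>M\<^esub> y s)"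
proof -
  have M: "left_module A M" using assms by (rule fg_left_module)
  interpret M: left_module A M by fact
  obtain S where S: "finite S" "S \<subseteq> carrier M"
    and im: "(\<lambda>a\<in>carrier (pow_mod S (regular A)). \<Oplus>\<^bsub>M\<^esub>s\<in>S. a s \<odot>\<^bsub>M\<^esub> s) ` carrier (pow_mod S (regular A)) = carrier M"
    by (rule fg_module_cover[OF assms]) (rule that)
  let ?P = "pow_mod S (regular A)"
  note P = left_module_pow_mod[OF regular_A_module, of S]
  let ?f = "\<lambda>a\<in>carrier ?P. \<Oplus>\<^bsub>M\<^esub>s\<in>S. a s \<odot>\<^bsub>M\<^esub> s"
  have id: "(\<lambda>s. s) \<in> S \<rightarrow> carrier M" using S by auto
  have f: "?f \<in> mod_hom A ?P M" using lincomb_hom[OF M S(1) id] .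
  obtain F :: "('a, 'm) module" and i j where F: "fg_module A F" and i: "i \<in> mod_hom A ?P F" and j: "j \<in> mod_hom A F ?P"
    and ji: "\<And>x. x \<in> carrier ?P \<Longrightarrow> j (i x) = x" and ij: "\<And>y. y \<in> carrier F \<Longrightarrow> i (j y) = y"
    by (rule copy_module[OF fg_pow[OF S(1)]]) (rule that)
  have FL: "left_module A F" using F by (rule fg_left_module)
  let ?\<pi> = "compose (carrier F) ?f j" and ?c = "\<lambda>s. compose (carrier F) (\<lambda>f\<in>carrier ?P. f s) j"
  have jc: "j x \<in> carrier ?P" if "x \<in> carrier F" for x by (rule mod_hom_closed[OF j that])
  have \<pi>: "?\<pi> \<in> mod_hom A F M" by (rule mod_hom_compose[OF FL j f])
  have \<pi>s: "?\<pi> ` carrier F = carrier M"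
  proof
    show "?\<pi> ` carrier F \<subseteq> carrier M" using mod_hom_closed[OF \<pi>] by blast
    show "carrier M \<subseteq> ?\<pi> ` carrier F"
    proof
      fix x assume "x \<in> carrier M"
      then have "x \<in> ?f ` carrier ?P" unfolding im .
      then obtain a where a: "a \<in> carrier ?P" "x = ?f a" by (rule imageE)
      have ia: "i a \<in> carrier F" by (rule mod_hom_closed[OF i a(1)])
      have "x = ?\<pi> (i a)" unfolding compose_eq[OF ia] ji[OF a(1)] by (rule a(2))
      then show "x \<in> ?\<pi> ` carrier F" using ia by blast
    qed
  qed
  have c: "?c s \<in> mod_hom A F (regular A)" if "s \<in> S" for s
    by (rule mod_hom_compose[OF FL j pow_mod_eval[OF regular_A_module that]])
  have exp: "?\<pi> x = (\<Oplus>\<^bsub>M\<^esub>s\<in>S. ?c s x \<odot>\<^bsub>M\<^esub> s)" if x: "x \<in> carrier F" for x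
    using jc[OF x] x by (simp add: compose_eq del: pow_mod_simps)
  have proj: "projective A F"
    unfolding projective_def
  proof (intro conjI allI impI ballI FL)
    fix M1 N1 :: "('a, 'm) module" and g h
    assume lm: "left_module A M1 \<and> left_module A N1" and g: "g \<in> mod_hom A M1 N1"
      and gs: "g ` carrier M1 = carrier N1" and h: "h \<in> mod_hom A F N1"
    then have M1: "left_module A M1" and N1: "left_module A N1" by auto
    interpret M1: left_module A M1 by fact
    interpret N1: left_module A N1 by fact
    let ?u = "unit_vec A S"
    have u: "?u s \<in> carrier ?P" for s by (rule unit_vec_closed[OF ring_A])
    have hi: "compose (carrier ?P) h i \<in> mod_hom A ?P N1" by (rule mod_hom_compose[OF P i h])
    have "\<exists>z. z \<in> carrier M1 \<and> g z = h (i (?u s))" for s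
      using mod_hom_closed[OF h mod_hom_closed[OF i u]] gs by (metis imageE)
    then obtain z where z: "\<And>s. z s \<in> carrier M1" "\<And>s. g (z s) = h (i (?u s))" by metis
    let ?\<psi> = "\<lambda>a\<in>carrier ?P. \<Oplus>\<^bsub>M1\<^esub>s\<in>S. a s \<odot>\<^bsub>M1\<^esub> z s"
    have \<psi>: "?\<psi> \<in> mod_hom A ?P M1" by (rule lincomb_hom[OF M1 S(1)]) (use z in auto)
    have "h x = compose (carrier F) g (compose (carrier F) ?\<psi> j) x" if x: "x \<in> carrier F" for x
    proof -
      let ?a = "j x"
      have ac: "?a s \<in> carrier A" if "s \<in> S" for s using jc[OF x] that by auto
      have "h x = compose (carrier ?P) h i ?a" using jc[OF x] ij[OF x] by (simp add: compose_eq)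
      also have "\<dots> = (\<Oplus>\<^bsub>N1\<^esub>s\<in>S. ?a s \<odot>\<^bsub>N1\<^esub> compose (carrier ?P) h i (?u s))"
        by (rule pow_mod_hom_expand[OF ring_A S(1) N1 hi jc[OF x]])
      also have "\<dots> = (\<Oplus>\<^bsub>N1\<^esub>s\<in>S. g (?a s \<odot>\<^bsub>M1\<^esub> z s))"
        by (rule N1.M.finsum_cong')
          (use ac z u in \<open>auto simp: compose_eq mod_hom_smult[OF g] M1.smult_closed N1.smult_closed mod_hom_closed[OF g]
            simp del: pow_mod_simps simp flip: z(2)\<close>)
      also have "\<dots> = g (\<Oplus>\<^bsub>M1\<^esub>s\<in>S. ?a s \<odot>\<^bsub>M1\<^esub> z s)"
        by (rule mod_hom_finsum[OF M1 N1 g S(1), symmetric]) (use ac z M1.smult_closed in auto)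
      also have "\<dots> = g (?\<psi> ?a)" using jc[OF x] by (simp del: pow_mod_simps)
      finally show ?thesis using x by (simp add: compose_eq)
    qed
    then have "h = compose (carrier F) g (compose (carrier F) ?\<psi> j)"
      using mod_hom_extensional[OF h] by (intro extensionalityI[of _ "carrier F"]) auto
    then show "\<exists>k\<in>mod_hom A F M1. h = compose (carrier F) g k"
      using mod_hom_compose[OF FL j \<psi>] by blast
  qed
  show thesis using that[OF S(1) F proj \<pi> \<pi>s id c exp] .
qed

lemma projectiveD:
  fixes P M N :: "('a, 'b) module"
  assumes "projective A P" "left_module A M" "left_module A N" "g \<in> mod_hom A M N" "g ` carrier M = carrier N"
    "f \<in> mod_hom A P N"
  obtains h where "h \<in> mod_hom A P M" "f = compose (carrier P) g h"
  using assms unfolding projective_def by blast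

text \<open>Identify a projective module with a direct summand of its free cover and restrict the coordinate
  functions.\<close>

lemma dual_basis:
  fixes P :: "('a, 'm) module"
  assumes P: "fg_module A P" "projective A P"
  obtains S :: "'m set" and y c where "finite S" "y \<in> S \<rightarrow> carrier P" "\<And>s. s \<in> S \<Longrightarrow> c s \<in> mod_hom A P (regular A)"
    "\<And>x. x \<in> carrier P \<Longrightarrow> x = (\<Oplus>\<^bsub>P\<^esub>s\<in>S. c s x \<odot>\<^bsub>P\<^esub> y s)"
proof -
  have PL: "left_module A P" using P(1) by (rule fg_left_module)
  obtain S :: "'m set" and F :: "('a, 'm) module" and \<pi> y c where *: "finite S" "fg_module A F"
    "\<pi> \<in> mod_hom A F P" "\<pi> ` carrier F = carrier P" "y \<in> S \<rightarrow> carrier P"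
    "\<And>s. s \<in> S \<Longrightarrow> c s \<in> mod_hom A F (regular A)"
    "\<And>x. x \<in> carrier F \<Longrightarrow> \<pi> x = (\<Oplus>\<^bsub>P\<^esub>s\<in>S. c s x \<odot>\<^bsub>P\<^esub> y s)"
    by (rule free_cover[OF P(1)]) (rule that)
  obtain h where h: "h \<in> mod_hom A P F" "mod_id P = compose (carrier P) \<pi> h"
    by (rule projectiveD[OF P(2) fg_left_module[OF *(2)] PL *(3,4) mod_hom_id[OF PL]]) (rule that)
  let ?c = "\<lambda>s. compose (carrier P) (c s) h"
  have 1: "?c s \<in> mod_hom A P (regular A)" if "s \<in> S" for s by (rule mod_hom_compose[OF PL h(1) *(6)[OF that]])
  have 2: "x = (\<Oplus>\<^bsub>P\<^esub>s\<in>S. ?c s x \<odot>\<^bsub>P\<^esub> y s)" if x: "x \<in> carrier P" for x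
  proof -
    have "x = \<pi> (h x)" using fun_cong[OF h(2), of x] x by (simp add: mod_id_def compose_eq)
    then show ?thesis using *(7)[OF mod_hom_closed[OF h(1) x]] x by (simp add: compose_eq)
  qed
  show thesis using that[OF *(1,5) 1 2] .
qed

text \<open>\<open>Z\<close> is a copy of the quotient of \<open>N \<oplus> F\<close> by the elements \<open>(w x, - i x)\<close>.\<close>

lemma pushout:
  fixes N :: "('a, 'n) module" and F :: "('a, 'f) module" and W :: "('a, 'w) module" and M :: "('a, 'b) module"
  assumes N: "fg_module A N" and F: "fg_module A F" and W: "left_module A W" and M: "left_module A M"
    and E: "short_exact A W i F \<pi> M" and w: "w \<in> mod_hom A W N"
  obtains Z :: "('a, 'm) module" and g u f where "fg_module A Z" "short_exact A N g Z f M"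
    "u \<in> mod_hom A F Z" "\<And>y. y \<in> carrier F \<Longrightarrow> f (u y) = \<pi> y" "\<And>x. x \<in> carrier W \<Longrightarrow> u (i x) = g (w x)"
proof -
  have NL: "left_module A N" and FL: "left_module A F" using N F by (auto intro: fg_left_module)
  interpret N: left_module A N by fact
  interpret F: left_module A F by fact
  interpret M: left_module A M by fact
  interpret W: left_module A W by fact
  note E = short_exactD[OF E]
  let ?D = "direct_sum N F"
  have D: "left_module A ?D" by (rule left_module_direct_sum[OF NL FL])
  have Dg: "fg_module A ?D" by (rule fg_direct_sum[OF N F])
  have nz: "\<ominus>\<^bsub>N\<^esub> \<zero>\<^bsub>N\<^esub> = \<zero>\<^bsub>N\<^esub>" using N.M.minus_equality[of "\<zero>\<^bsub>N\<^esub>" "\<zero>\<^bsub>N\<^esub>"] by simp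
  have fz: "\<ominus>\<^bsub>F\<^esub> \<zero>\<^bsub>F\<^esub> = \<zero>\<^bsub>F\<^esub>" using F.M.minus_equality[of "\<zero>\<^bsub>F\<^esub>" "\<zero>\<^bsub>F\<^esub>"] by simp
  have Dm: "\<ominus>\<^bsub>?D\<^esub> (a, b) = (\<ominus>\<^bsub>N\<^esub> a, \<ominus>\<^bsub>F\<^esub> b)" if "a \<in> carrier N" "b \<in> carrier F" for a b
    using minus_one_smult[OF D, of "(a, b)"] minus_one_smult[OF NL that(1)] minus_one_smult[OF FL that(2)] that
    by simp
  let ?\<theta> = "\<lambda>x\<in>carrier W. (w x, \<ominus>\<^bsub>F\<^esub> i x)"
  have ic: "i x \<in> carrier F" and wc: "w x \<in> carrier N" if "x \<in> carrier W" for x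
    using mod_hom_closed[OF E(1) that] mod_hom_closed[OF w that] by auto
  have \<theta>: "?\<theta> \<in> mod_hom A W ?D"
  proof (rule mod_homI[OF _ _ _ W])
    fix a x assume "a \<in> carrier A" "x \<in> carrier W"
    then show "(w (a \<odot>\<^bsub>W\<^esub> x), \<ominus>\<^bsub>F\<^esub> i (a \<odot>\<^bsub>W\<^esub> x)) = a \<odot>\<^bsub>?D\<^esub> (w x, \<ominus>\<^bsub>F\<^esub> i x)"
      using smult_minus[OF FL, of a "i x"] ic by (simp add: mod_hom_smult[OF E(1)] mod_hom_smult[OF w])
  qed (auto simp: mod_hom_add[OF E(1)] mod_hom_add[OF w] ic wc F.M.minus_add)
  define Q where "Q = cokernel W ?D ?\<theta>"
  define pr where "pr = (\<lambda>x\<in>carrier ?D. (?\<theta> ` carrier W) +>\<^bsub>?D\<^esub> x)"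
  note q = cokernel_module[OF W D \<theta>, folded pr_def Q_def]
  have Qg: "fg_module A Q" by (rule fg_image[OF Dg q(1-3)])
  obtain Z :: "('a, 'm) module" and \<iota> \<kappa> where Z: "fg_module A Z" and \<iota>: "\<iota> \<in> mod_hom A Q Z" and \<kappa>: "\<kappa> \<in> mod_hom A Z Q"
    and \<kappa>\<iota>: "\<And>x. x \<in> carrier Q \<Longrightarrow> \<kappa> (\<iota> x) = x" and \<iota>\<kappa>: "\<And>y. y \<in> carrier Z \<Longrightarrow> \<iota> (\<kappa> y) = y"
    by (rule copy_module[OF Qg]) (rule that)
  have ZL: "left_module A Z" using Z by (rule fg_left_module)
  interpret Z: left_module A Z by fact
  define p where "p = compose (carrier ?D) \<iota> pr"
  have p: "p \<in> mod_hom A ?D Z" unfolding p_def by (rule mod_hom_compose[OF D q(2) \<iota>])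
  have ps: "p ` carrier ?D = carrier Z"
  proof
    show "p ` carrier ?D \<subseteq> carrier Z" using mod_hom_closed[OF p] by blast
    show "carrier Z \<subseteq> p ` carrier ?D"
    proof
      fix z assume z: "z \<in> carrier Z"
      then obtain d where d: "d \<in> carrier ?D" "pr d = \<kappa> z" using q(3) mod_hom_closed[OF \<kappa> z] by (metis imageE)
      then have "z = p d" using \<iota>\<kappa>[OF z] unfolding p_def by (simp only: compose_eq)
      then show "z \<in> p ` carrier ?D" using d by blast
    qed
  qed
  have pk: "\<exists>x\<in>carrier W. d = (w x, \<ominus>\<^bsub>F\<^esub> i x)" if d: "d \<in> carrier ?D" "p d = \<zero>\<^bsub>Z\<^esub>" for d
  proof -
    have prd: "pr d \<in> carrier Q" by (rule mod_hom_closed[OF q(2) d(1)])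
    have "\<iota> (pr d) = \<zero>\<^bsub>Z\<^esub>" using d unfolding p_def by (simp only: compose_eq)
    then have "pr d = \<kappa> \<zero>\<^bsub>Z\<^esub>" using \<kappa>\<iota>[OF prd] by simp
    then have "pr d = \<zero>\<^bsub>Q\<^esub>" using mod_hom_zero[OF ZL q(1) \<kappa>] by simp
    then have "d \<in> ?\<theta> ` carrier W" using q(5) d(1) by (auto simp: a_kernel_def')
    then show ?thesis by auto
  qed
  have p0: "p (w x, \<ominus>\<^bsub>F\<^esub> i x) = \<zero>\<^bsub>Z\<^esub>" if x: "x \<in> carrier W" for x
  proof -
    have d: "(w x, \<ominus>\<^bsub>F\<^esub> i x) \<in> carrier ?D" using ic[OF x] wc[OF x] by simp
    have "(w x, \<ominus>\<^bsub>F\<^esub> i x) \<in> ?\<theta> ` carrier W" using x by (intro image_eqI[of _ _ x]) auto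
    then have "pr (w x, \<ominus>\<^bsub>F\<^esub> i x) = \<zero>\<^bsub>Q\<^esub>" using q(5) by (auto simp: a_kernel_def')
    then show ?thesis using mod_hom_zero[OF q(1) ZL \<iota>] d unfolding p_def by (simp only: compose_eq)
  qed
  let ?g = "\<lambda>n\<in>carrier N. p (n, \<zero>\<^bsub>F\<^esub>)" and ?u = "\<lambda>y\<in>carrier F. p (\<zero>\<^bsub>N\<^esub>, y)"
  have padd: "p (a \<oplus>\<^bsub>N\<^esub> a', b \<oplus>\<^bsub>F\<^esub> b') = p (a, b) \<oplus>\<^bsub>Z\<^esub> p (a', b')"
    if "a \<in> carrier N" "a' \<in> carrier N" "b \<in> carrier F" "b' \<in> carrier F" for a a' b b'
    using mod_hom_add[OF p, of "(a, b)" "(a', b')"] that by simp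
  have psm: "p (r \<odot>\<^bsub>N\<^esub> a, r \<odot>\<^bsub>F\<^esub> b) = r \<odot>\<^bsub>Z\<^esub> p (a, b)"
    if "a \<in> carrier N" "b \<in> carrier F" "r \<in> carrier A" for a b r
    using mod_hom_smult[OF p, of r "(a, b)"] that by simp
  have pc: "p (a, b) \<in> carrier Z" if "a \<in> carrier N" "b \<in> carrier F" for a b
    using mod_hom_closed[OF p, of "(a, b)"] that by simp
  have g: "?g \<in> mod_hom A N Z"
  proof (rule mod_homI[OF _ _ _ NL])
    show "p (x \<oplus>\<^bsub>N\<^esub> y, \<zero>\<^bsub>F\<^esub>) = p (x, \<zero>\<^bsub>F\<^esub>) \<oplus>\<^bsub>Z\<^esub> p (y, \<zero>\<^bsub>F\<^esub>)" if "x \<in> carrier N" "y \<in> carrier N" for x y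
      using padd[OF that F.M.zero_closed F.M.zero_closed] by simp
    show "p (r \<odot>\<^bsub>N\<^esub> x, \<zero>\<^bsub>F\<^esub>) = r \<odot>\<^bsub>Z\<^esub> p (x, \<zero>\<^bsub>F\<^esub>)" if "r \<in> carrier A" "x \<in> carrier N" for r x
      using psm[OF that(2) F.M.zero_closed that(1)] smult_zero[OF FL that(1)] by simp
  qed (use pc in auto)
  have u: "?u \<in> mod_hom A F Z"
  proof (rule mod_homI[OF _ _ _ FL])
    show "p (\<zero>\<^bsub>N\<^esub>, x \<oplus>\<^bsub>F\<^esub> y) = p (\<zero>\<^bsub>N\<^esub>, x) \<oplus>\<^bsub>Z\<^esub> p (\<zero>\<^bsub>N\<^esub>, y)" if "x \<in> carrier F" "y \<in> carrier F" for x y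
      using padd[OF N.M.zero_closed N.M.zero_closed that] by simp
    show "p (\<zero>\<^bsub>N\<^esub>, r \<odot>\<^bsub>F\<^esub> x) = r \<odot>\<^bsub>Z\<^esub> p (\<zero>\<^bsub>N\<^esub>, x)" if "r \<in> carrier A" "x \<in> carrier F" for r x
      using psm[OF N.M.zero_closed that(2) that(1)] smult_zero[OF NL that(1)] by simp
  qed (use pc in auto)
  let ?h = "\<lambda>d\<in>carrier ?D. \<pi> (snd d)"
  have h: "?h \<in> mod_hom A ?D M"
    by (rule mod_homI[OF _ _ _ D]) (auto simp: mod_homD[OF E(2)])
  have "?h d = \<zero>\<^bsub>M\<^esub>" if d: "d \<in> carrier ?D" "p d = \<zero>\<^bsub>Z\<^esub>" for d
  proof -
    obtain x where x: "x \<in> carrier W" "d = (w x, \<ominus>\<^bsub>F\<^esub> i x)" using pk[OF d] by blast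
    have "\<pi> (\<ominus>\<^bsub>F\<^esub> i x) = \<ominus>\<^bsub>M\<^esub> \<zero>\<^bsub>M\<^esub>" using mod_hom_minus[OF FL M E(2) ic[OF x(1)]] E(4)[OF x(1)] by simp
    then show ?thesis using d(1) x(2) M.M.minus_equality[of "\<zero>\<^bsub>M\<^esub>" "\<zero>\<^bsub>M\<^esub>"] by simp
  qed
  then obtain f where f: "f \<in> mod_hom A Z M" "\<And>d. d \<in> carrier ?D \<Longrightarrow> f (p d) = ?h d"
    by (rule factor_through_surj[OF D ZL M p ps h]) (assumption | rule that)+
  have fp: "f (p (n, y)) = \<pi> y" if "n \<in> carrier N" "y \<in> carrier F" for n y
    using f(2)[of "(n, y)"] that by simp
  have ui: "?u (i x) = ?g (w x)" if x: "x \<in> carrier W" for x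
  proof -
    have "p (w x, \<zero>\<^bsub>F\<^esub>) = p (w x \<oplus>\<^bsub>N\<^esub> \<zero>\<^bsub>N\<^esub>, \<ominus>\<^bsub>F\<^esub> i x \<oplus>\<^bsub>F\<^esub> i x)"
      using ic[OF x] wc[OF x] by (simp add: F.M.l_neg)
    also have "\<dots> = p (w x, \<ominus>\<^bsub>F\<^esub> i x) \<oplus>\<^bsub>Z\<^esub> p (\<zero>\<^bsub>N\<^esub>, i x)" by (rule padd) (use ic[OF x] wc[OF x] in auto)
    also have "\<dots> = p (\<zero>\<^bsub>N\<^esub>, i x)" using p0[OF x] pc[of "\<zero>\<^bsub>N\<^esub>" "i x"] ic[OF x] by simp
    finally show ?thesis using ic[OF x] wc[OF x] by simp
  qed
  have exact: "short_exact A N ?g Z f M"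
    unfolding short_exact_def
  proof (intro conjI g f(1))
    show "inj_on ?g (carrier N)"
    proof (rule inj_onI)
      fix n n' assume n: "n \<in> carrier N" "n' \<in> carrier N" "?g n = ?g n'"
      have c: "n \<ominus>\<^bsub>N\<^esub> n' \<in> carrier N" using n by simp
      have "?g (n \<ominus>\<^bsub>N\<^esub> n') = ?g n \<ominus>\<^bsub>Z\<^esub> ?g n'" by (rule mod_hom_diff[OF NL ZL g n(1,2)])
      also have "\<dots> = \<zero>\<^bsub>Z\<^esub>" using n pc by (simp add: a_minus_def Z.M.r_neg)
      finally have "p (n \<ominus>\<^bsub>N\<^esub> n', \<zero>\<^bsub>F\<^esub>) = \<zero>\<^bsub>Z\<^esub>" using c by simp
      then obtain x where x: "x \<in> carrier W" "(n \<ominus>\<^bsub>N\<^esub> n', \<zero>\<^bsub>F\<^esub>) = (w x, \<ominus>\<^bsub>F\<^esub> i x)"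
        using pk[of "(n \<ominus>\<^bsub>N\<^esub> n', \<zero>\<^bsub>F\<^esub>)"] c by auto
      then have "i x = \<ominus>\<^bsub>F\<^esub> \<zero>\<^bsub>F\<^esub>" using ic[OF x(1)] by simp
      then have "i x = i \<zero>\<^bsub>W\<^esub>" using mod_hom_zero[OF W FL E(1)] fz by simp
      then have "x = \<zero>\<^bsub>W\<^esub>" using E(3) x(1) by (auto dest: inj_onD)
      then have "n \<ominus>\<^bsub>N\<^esub> n' = \<zero>\<^bsub>N\<^esub>" using x(2) mod_hom_zero[OF W NL w] by simp
      then show "n = n'" by (rule diff_eq_zeroD[OF NL n(1,2)])
    qed
    show "f ` carrier Z = carrier M"
    proof
      show "f ` carrier Z \<subseteq> carrier M" using mod_hom_closed[OF f(1)] by blast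
      show "carrier M \<subseteq> f ` carrier Z"
      proof
        fix m assume "m \<in> carrier M"
        then obtain y where "y \<in> carrier F" "\<pi> y = m" using E(6) by blast
        then show "m \<in> f ` carrier Z" using fp[of "\<zero>\<^bsub>N\<^esub>" y] pc[of "\<zero>\<^bsub>N\<^esub>" y] by force
      qed
    qed
    show "?g ` carrier N = a_kernel Z M f"
    proof
      have "f (?g n) = \<zero>\<^bsub>M\<^esub>" if "n \<in> carrier N" for n
        using fp[OF that F.M.zero_closed] mod_hom_zero[OF FL M E(2)] that by simp
      then show "?g ` carrier N \<subseteq> a_kernel Z M f" using mod_hom_closed[OF g] by (auto simp: a_kernel_def')
      show "a_kernel Z M f \<subseteq> ?g ` carrier N"
      proof
        fix z assume "z \<in> a_kernel Z M f"
        then have z: "z \<in> carrier Z" "f z = \<zero>\<^bsub>M\<^esub>" by (auto simp: a_kernel_def')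
        then obtain d where d: "d \<in> carrier ?D" "z = p d" using ps by blast
        then obtain n y where ny: "z = p (n, y)" "n \<in> carrier N" "y \<in> carrier F" by auto
        then have "\<pi> y = \<zero>\<^bsub>M\<^esub>" using fp z(2) by simp
        then obtain x where x: "x \<in> carrier W" "y = i x" using E(5)[OF ny(3)] by blast
        have "z = p (n, \<zero>\<^bsub>F\<^esub>) \<oplus>\<^bsub>Z\<^esub> p (\<zero>\<^bsub>N\<^esub>, y)" using padd[of n "\<zero>\<^bsub>N\<^esub>" "\<zero>\<^bsub>F\<^esub>" y] ny by simp
        also have "p (\<zero>\<^bsub>N\<^esub>, y) = p (w x, \<zero>\<^bsub>F\<^esub>)" using ui[OF x(1)] x(2) ny(3) wc[OF x(1)] by simp
        also have "p (n, \<zero>\<^bsub>F\<^esub>) \<oplus>\<^bsub>Z\<^esub> p (w x, \<zero>\<^bsub>F\<^esub>) = p (n \<oplus>\<^bsub>N\<^esub> w x, \<zero>\<^bsub>F\<^esub>)"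
          using padd[of n "w x" "\<zero>\<^bsub>F\<^esub>" "\<zero>\<^bsub>F\<^esub>"] ny(2) wc[OF x(1)] by simp
        finally have "z = ?g (n \<oplus>\<^bsub>N\<^esub> w x)" using ny(2) wc[OF x(1)] by simp
        then show "z \<in> ?g ` carrier N" using ny(2) wc[OF x(1)] by blast
      qed
    qed
  qed
  have fu: "f (?u y) = \<pi> y" if "y \<in> carrier F" for y using fp[OF N.M.zero_closed that] that by simp
  show thesis using that[OF Z exact u fu ui] .
qed

end

section \<open>The opposite algebra and dual modules\<close>

lemma opp_simps [simp]:
  "carrier (opp R) = carrier R" "x \<otimes>\<^bsub>opp R\<^esub> y = y \<otimes>\<^bsub>R\<^esub> x" "\<one>\<^bsub>opp R\<^esub> = \<one>\<^bsub>R\<^esub>"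
  "ring.add (opp R) = ring.add R" "\<zero>\<^bsub>opp R\<^esub> = \<zero>\<^bsub>R\<^esub>"
  by (simp_all add: opp_def)

lemma opp_smult [simp]: "module.smult (opp M) = module.smult M"
  by (simp add: opp_def)

lemma finsum_cong_structure:
  assumes "carrier G = carrier H" "ring.add G = ring.add H" "\<zero>\<^bsub>G\<^esub> = \<zero>\<^bsub>H\<^esub>"
  shows "finsum G f S = finsum H f S"
  using assms by (simp add: finsum_def finprod_def)

context algebra_with_universe begin

lemma ring_opp: "ring (opp A)"
proof -
  interpret A: ring A by (rule ring_A)
  have "abelian_group (opp A)"
  proof (rule abelian_groupI)
    show "\<exists>y\<in>carrier (opp A). y \<oplus>\<^bsub>opp A\<^esub> x = \<zero>\<^bsub>opp A\<^esub>" if "x \<in> carrier (opp A)" for x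
      using that A.l_neg[of x] A.a_inv_closed[of x] by auto
  qed (auto simp: A.a_ac)
  moreover have "monoid (opp A)" by (rule monoidI) (auto simp: A.m_assoc)
  ultimately show ?thesis
    by (intro ringI) (auto simp: A.l_distr A.r_distr)
qed

lemma algebra_opp: "algebra_with_universe TYPE('m) K (opp A)"
proof -
  have ag: "abelian_group (opp A)" using ring_opp by (rule ring.is_abelian_group)
  have fg: "finitely_generated K (opp A)"
    using finite_dimensional
    unfolding finitely_generated_def by (simp add: finsum_cong_structure[of "opp A" A])
  show ?thesis
  proof (intro algebra_with_universe.intro fin_dim_algebra.intro fd_algebra.intro fd_algebra_axioms.intro
      algebra_with_universe_axioms.intro field_K ring_opp universe fg Module.module.intro module_axioms.intro)
    show "cring K" by unfold_locales
    show "abelian_group (opp A)" by (rule ag)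
  qed (auto simp: KA.smult_closed KA.smult_l_distr KA.smult_r_distr KA.smult_assoc1 KA.smult_one
      smult_mult_left smult_mult_right)
qed

lemmas opp_dual_basis = algebra_with_universe.dual_basis[OF algebra_opp]

text \<open>The dual of a right module, that is, of a left module over the opposite algebra. It is a left
  \<open>A\<close>-module because the opposite of the opposite algebra is \<open>A\<close>.\<close>

definition dualm :: "('a, 'b) module \<Rightarrow> ('a, 'b \<Rightarrow> 'a) module"
  where "dualm P = ring_dual (opp A) P"

lemma dualm_simps [simp]:
  "carrier (dualm P) = mod_hom (opp A) P (regular (opp A))"
  "f \<oplus>\<^bsub>dualm P\<^esub> g = (\<lambda>x\<in>carrier P. f x \<oplus>\<^bsub>A\<^esub> g x)"
  "\<zero>\<^bsub>dualm P\<^esub> = (\<lambda>x\<in>carrier P. \<zero>\<^bsub>A\<^esub>)"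
  "a \<odot>\<^bsub>dualm P\<^esub> f = (\<lambda>x\<in>carrier P. a \<otimes>\<^bsub>A\<^esub> f x)"
  by (simp_all add: dualm_def ring_dual_def hom_group_def)

lemma dualm_eq: "dualm P = (pow_mod (carrier P) (regular A))\<lparr>carrier := mod_hom (opp A) P (regular (opp A))\<rparr>"
  by (simp add: dualm_def ring_dual_def hom_group_def pow_mod_def mk_module_def regular_def)

lemma dual_elem:
  assumes "\<phi> \<in> mod_hom (opp A) P (regular (opp A))"
  shows "p \<in> carrier P \<Longrightarrow> \<phi> p \<in> carrier A"
    and "p \<in> carrier P \<Longrightarrow> r \<in> carrier P \<Longrightarrow> \<phi> (p \<oplus>\<^bsub>P\<^esub> r) = \<phi> p \<oplus>\<^bsub>A\<^esub> \<phi> r"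
    and "a \<in> carrier A \<Longrightarrow> p \<in> carrier P \<Longrightarrow> \<phi> (a \<odot>\<^bsub>P\<^esub> p) = \<phi> p \<otimes>\<^bsub>A\<^esub> a"
  using mod_homD[OF assms] by auto

lemma left_module_dualm:
  assumes P: "left_module (opp A) P" shows "left_module A (dualm P)"
proof -
  interpret P: left_module "opp A" P by fact
  interpret A: ring A by (rule ring_A)
  have "submod A (pow_mod (carrier P) (regular A)) (mod_hom (opp A) P (regular (opp A)))"
  proof (rule submodI)
    show "f \<in> mod_hom (opp A) P (regular (opp A)) \<Longrightarrow> f \<in> carrier (pow_mod (carrier P) (regular A))" for f
      using mod_hom_funcset by fastforce
    show "\<zero>\<^bsub>pow_mod (carrier P) (regular A)\<^esub> \<in> mod_hom (opp A) P (regular (opp A))"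
      unfolding pow_mod_simps by (rule mod_homI) (auto simp: P)
  next
    fix f g assume f: "f \<in> mod_hom (opp A) P (regular (opp A))" and g: "g \<in> mod_hom (opp A) P (regular (opp A))"
    show "f \<oplus>\<^bsub>pow_mod (carrier P) (regular A)\<^esub> g \<in> mod_hom (opp A) P (regular (opp A))"
      unfolding pow_mod_simps
      by (rule mod_homI) (auto simp: P dual_elem[OF f] dual_elem[OF g] A.l_distr A.a_ac)
  next
    fix a f assume a: "a \<in> carrier A" and f: "f \<in> mod_hom (opp A) P (regular (opp A))"
    show "a \<odot>\<^bsub>pow_mod (carrier P) (regular A)\<^esub> f \<in> mod_hom (opp A) P (regular (opp A))"
      unfolding pow_mod_simps
      by (rule mod_homI) (use a in \<open>auto simp: P dual_elem[OF f] A.r_distr A.m_assoc\<close>)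
  qed
  then show ?thesis
    unfolding dualm_eq by (rule left_module_submod[OF left_module_pow_mod[OF regular_A_module]])
qed

lemma dualm_eval:
  assumes P: "left_module (opp A) P" and p: "p \<in> carrier P"
  shows "(\<lambda>\<phi>\<in>carrier (dualm P). \<phi> p) \<in> mod_hom A (dualm P) (regular A)"
  by (rule mod_homI[OF _ _ _ left_module_dualm[OF P]]) (use p dual_elem in auto)

text \<open>The image of \<open>p \<otimes> x\<close> under the natural map \<open>P \<otimes> W \<rightarrow> Hom (P\<^sup>*, W)\<close>. For a finitely generated
  projective \<open>P\<close> this map is bijective, and the maps \<open>evh P W p x\<close> replace tensors throughout.\<close>

definition evh :: "('a, 'b) module \<Rightarrow> ('a, 'd) module \<Rightarrow> 'b \<Rightarrow> 'd \<Rightarrow> ('b \<Rightarrow> 'a) \<Rightarrow> 'd"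
  where "evh P W p x = (\<lambda>\<phi>\<in>carrier (dualm P). \<phi> p \<odot>\<^bsub>W\<^esub> x)"

lemma evh_apply: "\<phi> \<in> carrier (dualm P) \<Longrightarrow> evh P W p x \<phi> = \<phi> p \<odot>\<^bsub>W\<^esub> x"
  by (simp add: evh_def del: dualm_simps)

lemma evh_hom:
  assumes P: "left_module (opp A) P" and W: "left_module A W" and p: "p \<in> carrier P" and x: "x \<in> carrier W"
  shows "evh P W p x \<in> mod_hom A (dualm P) W"
proof -
  interpret W: left_module A W by fact
  have v: "\<phi> p \<in> carrier A" if "\<phi> \<in> mod_hom (opp A) P (regular (opp A))" for \<phi>
    by (rule dual_elem(1)[OF that p])
  show ?thesis
    unfolding evh_def
    by (rule mod_homI[OF _ _ _ left_module_dualm[OF P]])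
      (use p x in \<open>auto simp: v W.smult_closed W.smult_l_distr W.smult_assoc1\<close>)
qed

text \<open>A dual basis of \<open>P\<close> expands the elements of \<open>P\<^sup>*\<close> as well.\<close>

lemma dualm_expand:
  assumes P: "left_module (opp A) P" and S: "finite S" "y \<in> S \<rightarrow> carrier P"
    and c: "\<And>s. s \<in> S \<Longrightarrow> c s \<in> mod_hom (opp A) P (regular (opp A))"
    and exp: "\<And>x. x \<in> carrier P \<Longrightarrow> x = (\<Oplus>\<^bsub>P\<^esub>s\<in>S. c s x \<odot>\<^bsub>P\<^esub> y s)"
    and \<phi>: "\<phi> \<in> carrier (dualm P)"
  shows "\<phi> = (\<Oplus>\<^bsub>dualm P\<^esub>s\<in>S. \<phi> (y s) \<odot>\<^bsub>dualm P\<^esub> c s)"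
proof -
  note Q = left_module_dualm[OF P]
  interpret P: left_module "opp A" P by fact
  interpret Q: left_module A "dualm P" by (rule Q)
  interpret RA: left_module A "regular A" by (rule regular_A_module)
  note oR = left_module_regular[OF ring_opp]
  have \<phi>': "\<phi> \<in> mod_hom (opp A) P (regular (opp A))" using \<phi> by simp
  have ys: "y s \<in> carrier P" if "s \<in> S" for s using S(2) that by auto
  have v: "(\<lambda>s. \<phi> (y s) \<odot>\<^bsub>dualm P\<^esub> c s) \<in> S \<rightarrow> carrier (dualm P)"
    by (intro Pi_I Q.smult_closed) (use dual_elem(1)[OF \<phi>'] ys c in auto)
  have cl: "(\<Oplus>\<^bsub>dualm P\<^esub>s\<in>S. \<phi> (y s) \<odot>\<^bsub>dualm P\<^esub> c s) \<in> carrier (dualm P)" by (rule Q.M.finsum_closed[OF v])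
  have "\<phi> x = (\<Oplus>\<^bsub>dualm P\<^esub>s\<in>S. \<phi> (y s) \<odot>\<^bsub>dualm P\<^esub> c s) x" if x: "x \<in> carrier P" for x
  proof -
    have cx: "c s x \<in> carrier A" if "s \<in> S" for s using dual_elem(1)[OF c[OF that] x] .
    have cy: "(\<lambda>s. c s x \<odot>\<^bsub>P\<^esub> y s) \<in> S \<rightarrow> carrier P"
      by (intro Pi_I P.smult_closed) (use cx ys in auto)
    let ?e = "\<lambda>\<phi>\<in>carrier (dualm P). \<phi> x"
    have "(\<Oplus>\<^bsub>dualm P\<^esub>s\<in>S. \<phi> (y s) \<odot>\<^bsub>dualm P\<^esub> c s) x = ?e (\<Oplus>\<^bsub>dualm P\<^esub>s\<in>S. \<phi> (y s) \<odot>\<^bsub>dualm P\<^esub> c s)"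
      using restrict_apply'[OF cl] by (rule sym)
    also have "\<dots> = (\<Oplus>\<^bsub>regular A\<^esub>s\<in>S. ?e (\<phi> (y s) \<odot>\<^bsub>dualm P\<^esub> c s))"
      by (rule mod_hom_finsum[OF Q regular_A_module dualm_eval[OF P x] S(1) v])
    also have "\<dots> = (\<Oplus>\<^bsub>regular A\<^esub>s\<in>S. \<phi> (c s x \<odot>\<^bsub>P\<^esub> y s))"
    proof (rule RA.M.finsum_cong')
      fix s assume s: "s \<in> S"
      have "?e (\<phi> (y s) \<odot>\<^bsub>dualm P\<^esub> c s) = (\<phi> (y s) \<odot>\<^bsub>dualm P\<^esub> c s) x"
        by (rule restrict_apply'[OF funcset_mem[OF v s]])
      then show "?e (\<phi> (y s) \<odot>\<^bsub>dualm P\<^esub> c s) = \<phi> (c s x \<odot>\<^bsub>P\<^esub> y s)"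
        using x dual_elem(3)[OF \<phi>' cx[OF s] ys[OF s]] by simp
    qed (use dual_elem(1)[OF \<phi>'] cy in auto)
    also have "\<dots> = (\<Oplus>\<^bsub>regular (opp A)\<^esub>s\<in>S. \<phi> (c s x \<odot>\<^bsub>P\<^esub> y s))"
      by (rule finsum_cong_structure) simp_all
    also have "\<dots> = \<phi> (\<Oplus>\<^bsub>P\<^esub>s\<in>S. c s x \<odot>\<^bsub>P\<^esub> y s)"
      by (rule mod_hom_finsum[OF P oR \<phi>' S(1) cy, symmetric])
    also have "\<dots> = \<phi> x" using exp[OF x] by simp
    finally show ?thesis by simp
  qed
  moreover have "(\<Oplus>\<^bsub>dualm P\<^esub>s\<in>S. \<phi> (y s) \<odot>\<^bsub>dualm P\<^esub> c s) \<in> mod_hom (opp A) P (regular (opp A))" using cl by simp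
  ultimately show ?thesis using mod_hom_eqI[OF \<phi>'] by blast
qed

text \<open>With a dual basis \<open>y\<close>, \<open>c\<close> of \<open>P\<close>, every \<open>v : P\<^sup>* \<rightarrow> W\<close> is the sum of the maps
  \<open>evh P W (y s) (v (c s))\<close>. So whatever is closed under linear combinations has to be checked on
  the maps \<open>evh P W p x\<close> only.\<close>

lemma hom_from_dual_induct:
  fixes P :: "('a, 'm) module"
  assumes P: "fg_module (opp A) P" "projective (opp A) P" and W: "left_module A W"
    and N: "submod K (hom_space (dualm P) W) N"
    and ev: "\<And>p x. p \<in> carrier P \<Longrightarrow> x \<in> carrier W \<Longrightarrow> evh P W p x \<in> N"
    and v: "v \<in> mod_hom A (dualm P) W"
  shows "v \<in> N"
proof -
  obtain S :: "'m set" and y c where S: "finite S" "y \<in> S \<rightarrow> carrier P"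
    and c: "\<And>s. s \<in> S \<Longrightarrow> c s \<in> mod_hom (opp A) P (regular (opp A))"
    and exp: "\<And>x. x \<in> carrier P \<Longrightarrow> x = (\<Oplus>\<^bsub>P\<^esub>s\<in>S. c s x \<odot>\<^bsub>P\<^esub> y s)"
    by (rule opp_dual_basis[OF P]) (rule that)
  have PL: "left_module (opp A) P" using P(1) by (simp add: fg_module_def)
  note Q = left_module_dualm[OF PL]
  note H = left_module_hom_space[OF Q W]
  interpret Q: left_module A "dualm P" by (rule Q)
  interpret W: left_module A W by (rule W)
  interpret H: left_module K "hom_space (dualm P) W" by (rule H)
  have ys: "y s \<in> carrier P" if "s \<in> S" for s using S(2) that by auto
  have cs: "c s \<in> carrier (dualm P)" if "s \<in> S" for s using c[OF that] by simp
  have vc: "v (c s) \<in> carrier W" if "s \<in> S" for s by (rule mod_hom_closed[OF v cs[OF that]])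
  let ?E = "\<lambda>s. evh P W (y s) (v (c s))"
  have EN: "?E \<in> S \<rightarrow> N" using ev ys vc by blast
  then have EH: "?E \<in> S \<rightarrow> carrier (hom_space (dualm P) W)" using submod_sub[OF N] by blast
  have cl: "(\<Oplus>\<^bsub>hom_space (dualm P) W\<^esub>s\<in>S. ?E s) \<in> N" by (rule submod_finsum[OF H N S(1) EN])
  have cl': "(\<Oplus>\<^bsub>hom_space (dualm P) W\<^esub>s\<in>S. ?E s) \<in> mod_hom A (dualm P) W" using submod_sub[OF N cl] by simp
  have "v \<phi> = (\<Oplus>\<^bsub>hom_space (dualm P) W\<^esub>s\<in>S. ?E s) \<phi>" if \<phi>: "\<phi> \<in> carrier (dualm P)" for \<phi>
  proof -
    have \<phi>': "\<phi> \<in> mod_hom (opp A) P (regular (opp A))" using \<phi> by simp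
    have f: "(\<lambda>s. \<phi> (y s) \<odot>\<^bsub>dualm P\<^esub> c s) \<in> S \<rightarrow> carrier (dualm P)"
      by (intro Pi_I Q.smult_closed cs) (use dual_elem(1)[OF \<phi>'] ys in auto)
    let ?e = "\<lambda>f\<in>mod_hom A (dualm P) W. f \<phi>"
    have "v \<phi> = v (\<Oplus>\<^bsub>dualm P\<^esub>s\<in>S. \<phi> (y s) \<odot>\<^bsub>dualm P\<^esub> c s)"
      using arg_cong[OF dualm_expand[OF PL S c exp \<phi>], of v] by simp
    also have "\<dots> = (\<Oplus>\<^bsub>W\<^esub>s\<in>S. v (\<phi> (y s) \<odot>\<^bsub>dualm P\<^esub> c s))" by (rule mod_hom_finsum[OF Q W v S(1) f])
    also have "\<dots> = (\<Oplus>\<^bsub>W\<^esub>s\<in>S. ?e (?E s))"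
    proof (rule W.M.finsum_cong')
      fix s assume s: "s \<in> S"
      have "?e (?E s) = ?E s \<phi>" using EH s by auto
      also have "\<dots> = \<phi> (y s) \<odot>\<^bsub>W\<^esub> v (c s)" by (rule evh_apply[OF \<phi>])
      also have "\<dots> = v (\<phi> (y s) \<odot>\<^bsub>dualm P\<^esub> c s)"
        by (rule mod_hom_smult[OF v _ cs[OF s], symmetric]) (rule dual_elem(1)[OF \<phi>' ys[OF s]])
      finally show "v (\<phi> (y s) \<odot>\<^bsub>dualm P\<^esub> c s) = ?e (?E s)" by simp
    next
      show "(\<lambda>s. ?e (?E s)) \<in> S \<rightarrow> carrier W" using EH mod_hom_closed[OF _ \<phi>] by fastforce
    qed simp
    also have "\<dots> = (\<Oplus>\<^bsub>ksp W\<^esub>s\<in>S. ?e (?E s))" by (rule finsum_cong_structure) simp_all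
    also have "\<dots> = ?e (\<Oplus>\<^bsub>hom_space (dualm P) W\<^esub>s\<in>S. ?E s)"
      by (rule mod_hom_finsum[OF H left_module_ksp[OF W] hom_space_eval[OF Q W \<phi>] S(1) EH, symmetric])
    also have "\<dots> = (\<Oplus>\<^bsub>hom_space (dualm P) W\<^esub>s\<in>S. ?E s) \<phi>" by (rule restrict_apply'[OF cl'])
    finally show ?thesis .
  qed
  then have "v = (\<Oplus>\<^bsub>hom_space (dualm P) W\<^esub>s\<in>S. ?E s)" by (rule mod_hom_eqI[OF v cl'])
  then show ?thesis using cl by simp
qed

lemma kdual_simps [simp]:
  "carrier (kdual K A M) = mod_hom K (ksp M) (regular K)"
  "f \<oplus>\<^bsub>kdual K A M\<^esub> g = (\<lambda>x\<in>carrier M. f x \<oplus>\<^bsub>K\<^esub> g x)"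
  "\<zero>\<^bsub>kdual K A M\<^esub> = (\<lambda>x\<in>carrier M. \<zero>\<^bsub>K\<^esub>)"
  "a \<odot>\<^bsub>kdual K A M\<^esub> f = (\<lambda>x\<in>carrier M. f (a \<odot>\<^bsub>M\<^esub> x))"
  by (simp_all add: kdual_def hom_group_def Let_def)

lemma pairing_linear:
  assumes P: "left_module (opp A) P" and L: "left_module A L"
    and \<epsilon>: "\<epsilon> \<in> mod_hom (opp A) P (kdual K A L)" and l: "l \<in> carrier L"
  shows "(\<lambda>p\<in>carrier P. \<epsilon> p l) \<in> mod_hom K (underlying_space (opp A) P) (regular K)"
proof -
  interpret oA: fin_dim_algebra K "opp A" using algebra_opp by (rule algebra_with_universe.axioms)
  interpret L: left_module A L by fact
  interpret P: left_module "opp A" P by fact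
  have e: "\<epsilon> p \<in> mod_hom K (ksp L) (regular K)" if "p \<in> carrier P" for p
    using mod_hom_closed[OF \<epsilon> that] by simp
  have "(\<lambda>p\<in>carrier (underlying_space (opp A) P). \<epsilon> p l) \<in> mod_hom K (underlying_space (opp A) P) (regular K)"
  proof (rule mod_homI[OF _ _ _ oA.left_module_ksp[OF P]])
    show "\<epsilon> p l \<in> carrier (regular K)" if "p \<in> carrier (underlying_space (opp A) P)" for p
      using mod_hom_closed[OF e, of p l] that l by simp
    show "\<epsilon> (p \<oplus>\<^bsub>underlying_space (opp A) P\<^esub> r) l = \<epsilon> p l \<oplus>\<^bsub>regular K\<^esub> \<epsilon> r l"
      if "p \<in> carrier (underlying_space (opp A) P)" "r \<in> carrier (underlying_space (opp A) P)" for p r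
      using mod_hom_add[OF \<epsilon>, of p r] that l by simp
    show "\<epsilon> (c \<odot>\<^bsub>underlying_space (opp A) P\<^esub> p) l = c \<odot>\<^bsub>regular K\<^esub> \<epsilon> p l"
      if "c \<in> carrier K" "p \<in> carrier (underlying_space (opp A) P)" for c p
      using mod_hom_smult[OF \<epsilon>, of "emb c" p] mod_hom_smult[OF e, of p c l] that l emb_closed by simp
  qed
  then show ?thesis by simp
qed

text \<open>A homomorphism \<open>\<epsilon> : P \<rightarrow> D L\<close> is a pairing with \<open>\<epsilon> (p a) (l) = \<epsilon> (p) (a l)\<close>, hence induces a
  functional on \<open>P \<otimes> L\<close>, here on \<open>Hom (P\<^sup>*, L)\<close>. With a dual basis \<open>y\<close>, \<open>c\<close> of \<open>P\<close> it is the
  trace-like sum of \<open>\<epsilon> (y s) (w (c s))\<close>, and the values on the maps \<open>evh P L p l\<close> do not depend on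
  the dual basis.\<close>

lemma trace_exists:
  fixes P :: "('a, 'm) module"
  assumes P: "fg_module (opp A) P" "projective (opp A) P" and L: "left_module A L"
    and \<epsilon>: "\<epsilon> \<in> mod_hom (opp A) P (kdual K A L)"
  shows "\<exists>\<Phi>\<in>mod_hom K (hom_space (dualm P) L) (regular K).
    \<forall>p\<in>carrier P. \<forall>l\<in>carrier L. \<Phi> (evh P L p l) = \<epsilon> p l"
proof -
  obtain S :: "'m set" and y c where S: "finite S" "y \<in> S \<rightarrow> carrier P"
    and c: "\<And>s. s \<in> S \<Longrightarrow> c s \<in> mod_hom (opp A) P (regular (opp A))"
    and exp: "\<And>x. x \<in> carrier P \<Longrightarrow> x = (\<Oplus>\<^bsub>P\<^esub>s\<in>S. c s x \<odot>\<^bsub>P\<^esub> y s)"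
    by (rule opp_dual_basis[OF P]) (rule that)
  have PL: "left_module (opp A) P" using P(1) by (simp add: fg_module_def)
  interpret oA: fin_dim_algebra K "opp A" using algebra_opp by (rule algebra_with_universe.axioms)
  note Q = left_module_dualm[OF PL]
  let ?H = "hom_space (dualm P) L"
  have H: "left_module K ?H" by (rule left_module_hom_space[OF Q L])
  note D = left_module_dual_space[OF H]
  interpret P: left_module "opp A" P by (rule PL)
  interpret L: left_module A L by (rule L)
  interpret RK: left_module K "regular K" by (rule regular_K_module)
  interpret D: left_module K "dual_space ?H" by (rule D)
  have ys: "y s \<in> carrier P" if "s \<in> S" for s using S(2) that by auto
  have cs: "c s \<in> carrier (dualm P)" if "s \<in> S" for s using c[OF that] by simp
  have e: "\<epsilon> p \<in> mod_hom K (ksp L) (regular K)" if "p \<in> carrier P" for p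
    using mod_hom_closed[OF \<epsilon> that] by simp
  let ?F = "\<lambda>s. compose (mod_hom A (dualm P) L) (\<epsilon> (y s)) (\<lambda>w\<in>mod_hom A (dualm P) L. w (c s))"
  have F: "?F s \<in> mod_hom K ?H (regular K)" if s: "s \<in> S" for s
    using mod_hom_compose[OF H hom_space_eval[OF Q L cs[OF s]] e[OF ys[OF s]]] by simp
  then have FD: "?F \<in> S \<rightarrow> carrier (dual_space ?H)" by simp
  define \<Phi> where "\<Phi> = (\<Oplus>\<^bsub>dual_space ?H\<^esub>s\<in>S. ?F s)"
  have \<Phi>: "\<Phi> \<in> mod_hom K ?H (regular K)" using D.M.finsum_closed[OF FD] by (simp add: \<Phi>_def)
  have val: "\<Phi> w = (\<Oplus>\<^bsub>regular K\<^esub>s\<in>S. \<epsilon> (y s) (w (c s)))" if w: "w \<in> mod_hom A (dualm P) L" for w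
  proof -
    let ?e = "\<lambda>f\<in>carrier (dual_space ?H). f w"
    have eh: "?e \<in> mod_hom K (dual_space ?H) (regular K)"
      by (rule mod_homI[OF _ _ _ D]) (use w mod_hom_closed in fastforce)+
    have "\<Phi> w = ?e \<Phi>" using \<Phi> by simp
    also have "\<dots> = (\<Oplus>\<^bsub>regular K\<^esub>s\<in>S. ?e (?F s))"
      unfolding \<Phi>_def by (rule mod_hom_finsum[OF D regular_K_module eh S(1) FD])
    also have "\<dots> = (\<Oplus>\<^bsub>regular K\<^esub>s\<in>S. \<epsilon> (y s) (w (c s)))"
    proof (rule RK.M.finsum_cong')
      fix s assume s: "s \<in> S"
      have "?e (?F s) = ?F s w" by (rule restrict_apply'[OF funcset_mem[OF FD s]])
      then show "?e (?F s) = \<epsilon> (y s) (w (c s))" using w by (simp add: compose_eq)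
    next
      show "(\<lambda>s. \<epsilon> (y s) (w (c s))) \<in> S \<rightarrow> carrier (regular K)"
        using mod_hom_closed[OF e[OF ys]] mod_hom_closed[OF w cs] by simp
    qed simp
    finally show ?thesis .
  qed
  have "\<Phi> (evh P L p l) = \<epsilon> p l" if p: "p \<in> carrier P" and l: "l \<in> carrier L" for p l
  proof -
    have cp: "c s p \<in> carrier A" if "s \<in> S" for s using dual_elem(1)[OF c[OF that] p] .
    have v: "(\<lambda>s. c s p \<odot>\<^bsub>P\<^esub> y s) \<in> S \<rightarrow> carrier P"
      by (intro Pi_I P.smult_closed) (use cp ys in auto)
    let ?e = "\<lambda>p\<in>carrier P. \<epsilon> p l"
    have "\<Phi> (evh P L p l) = (\<Oplus>\<^bsub>regular K\<^esub>s\<in>S. \<epsilon> (y s) (evh P L p l (c s)))" by (rule val[OF evh_hom[OF PL L p l]])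
    also have "\<dots> = (\<Oplus>\<^bsub>regular K\<^esub>s\<in>S. ?e (c s p \<odot>\<^bsub>P\<^esub> y s))"
    proof (rule RK.M.finsum_cong')
      fix s assume s: "s \<in> S"
      have "\<epsilon> (c s p \<odot>\<^bsub>P\<^esub> y s) l = \<epsilon> (y s) (c s p \<odot>\<^bsub>L\<^esub> l)"
        using mod_hom_smult[OF \<epsilon>, of "c s p" "y s"] cp[OF s] ys[OF s] l by simp
      then show "\<epsilon> (y s) (evh P L p l (c s)) = ?e (c s p \<odot>\<^bsub>P\<^esub> y s)"
        using funcset_mem[OF v s] by (simp add: evh_apply[OF cs[OF s]])
    next
      show "(\<lambda>s. ?e (c s p \<odot>\<^bsub>P\<^esub> y s)) \<in> S \<rightarrow> carrier (regular K)"
        using mod_hom_closed[OF e[OF funcset_mem[OF v]]] l funcset_mem[OF v] by simp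
    qed simp
    also have "\<dots> = ?e (\<Oplus>\<^bsub>underlying_space (opp A) P\<^esub>s\<in>S. c s p \<odot>\<^bsub>P\<^esub> y s)"
      by (rule mod_hom_finsum[OF oA.left_module_ksp[OF PL] regular_K_module pairing_linear[OF PL L \<epsilon> l] S(1), symmetric])
        (use v in simp)
    also have "\<dots> = ?e (\<Oplus>\<^bsub>P\<^esub>s\<in>S. c s p \<odot>\<^bsub>P\<^esub> y s)"
      by (subst finsum_cong_structure[of "underlying_space (opp A) P" P]) simp_all
    also have "\<dots> = \<epsilon> p l" using exp[OF p] p by simp
    finally show ?thesis .
  qed
  then show ?thesis using \<Phi> by blast
qed

end

lemma submod_equalizer:
  assumes V: "left_module R V" and W: "left_module R W" and f: "f \<in> mod_hom R V W" and g: "g \<in> mod_hom R V W"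
  shows "submod R V {v \<in> carrier V. f v = g v}"
proof -
  interpret V: left_module R V by fact
  show ?thesis
    by (rule submodI)
      (auto simp: V.smult_closed mod_hom_add[OF f] mod_hom_add[OF g] mod_hom_smult[OF f] mod_hom_smult[OF g]
        mod_hom_zero[OF V W f] mod_hom_zero[OF V W g])
qed

context fin_dim_algebra begin

lemma precomp_hom:
  assumes U: "left_module A U" and V: "left_module A V" and W: "left_module A W" and u: "u \<in> mod_hom A U V"
  shows "(\<lambda>f\<in>mod_hom A V W. compose (carrier U) f u) \<in> mod_hom K (hom_space V W) (hom_space U W)"
proof -
  note H = left_module_hom_space[OF V W]
  have uc: "u x \<in> carrier V" if "x \<in> carrier U" for x by (rule mod_hom_closed[OF u that])
  have "(\<lambda>f\<in>carrier (hom_space V W). compose (carrier U) f u) \<in> mod_hom K (hom_space V W) (hom_space U W)"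
    by (rule mod_homI[OF _ _ _ H]) (auto simp: mod_hom_compose[OF U u, unfolded compose_def] compose_def uc)
  then show ?thesis by simp
qed

lemma postcomp_hom:
  assumes U: "left_module A U" and V: "left_module A V" and W: "left_module A W" and v: "v \<in> mod_hom A V W"
  shows "(\<lambda>f\<in>mod_hom A U V. compose (carrier U) v f) \<in> mod_hom K (hom_space U V) (hom_space U W)"
proof -
  note H = left_module_hom_space[OF U V]
  have "(\<lambda>f\<in>carrier (hom_space U V). compose (carrier U) v f) \<in> mod_hom K (hom_space U V) (hom_space U W)"
    by (rule mod_homI[OF _ _ _ H])
      (auto simp: mod_hom_compose[OF U _ v, unfolded compose_def] compose_def mod_hom_add[OF v] mod_hom_smult[OF v] emb_closed mod_hom_closed)
  then show ?thesis by simp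
qed

end

context algebra_with_universe begin

lemma ring_dual_map_hom:
  assumes P: "left_module (opp A) P" and Q: "left_module (opp A) Q" and d: "d \<in> mod_hom (opp A) Q P"
  shows "ring_dual_map (opp A) Q P d \<in> mod_hom A (dualm P) (dualm Q)"
    and "\<phi> \<in> carrier (dualm P) \<Longrightarrow> p \<in> carrier Q \<Longrightarrow> ring_dual_map (opp A) Q P d \<phi> p = \<phi> (d p)"
proof -
  have dc: "d p \<in> carrier P" if "p \<in> carrier Q" for p by (rule mod_hom_closed[OF d that])
  have eq: "ring_dual_map (opp A) Q P d = (\<lambda>\<phi>\<in>carrier (dualm P). compose (carrier Q) \<phi> d)"
    by (simp add: ring_dual_map_def)
  show "ring_dual_map (opp A) Q P d \<in> mod_hom A (dualm P) (dualm Q)"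
    unfolding eq
    by (rule mod_homI[OF _ _ _ left_module_dualm[OF P]]) (auto simp: mod_hom_compose[OF Q d, unfolded compose_def] compose_def dc)
  show "\<phi> \<in> carrier (dualm P) \<Longrightarrow> p \<in> carrier Q \<Longrightarrow> ring_dual_map (opp A) Q P d \<phi> p = \<phi> (d p)"
    by (simp add: eq compose_eq)
qed

lemma evh_linear:
  assumes P: "left_module (opp A) P" and W: "left_module A W" and x: "x \<in> carrier W"
  shows "(\<lambda>p\<in>carrier P. evh P W p x) \<in> mod_hom K (underlying_space (opp A) P) (hom_space (dualm P) W)"
proof -
  interpret oA: fin_dim_algebra K "opp A" using algebra_opp by (rule algebra_with_universe.axioms)
  interpret W: left_module A W by fact
  interpret P: left_module "opp A" P by fact
  interpret A: ring A by (rule ring_A)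
  have "(\<lambda>p\<in>carrier (underlying_space (opp A) P). evh P W p x)
      \<in> mod_hom K (underlying_space (opp A) P) (hom_space (dualm P) W)"
  proof (rule mod_homI[OF _ _ _ oA.left_module_ksp[OF P]])
    fix p assume "p \<in> carrier (underlying_space (opp A) P)"
    then have p: "p \<in> carrier P" by simp
    have v: "\<phi> p \<in> carrier A" if "\<phi> \<in> mod_hom (opp A) P (regular (opp A))" for \<phi>
      by (rule dual_elem(1)[OF that p])
    show "evh P W p x \<in> carrier (hom_space (dualm P) W)" using evh_hom[OF P W p x] by simp
    show "evh P W (c \<odot>\<^bsub>underlying_space (opp A) P\<^esub> p) x = c \<odot>\<^bsub>hom_space (dualm P) W\<^esub> evh P W p x"
      if c: "c \<in> carrier K" for c
      unfolding evh_def hom_space_simps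
    proof (rule restrict_ext)
      fix \<phi> assume \<phi>: "\<phi> \<in> carrier (dualm P)"
      then have \<phi>': "\<phi> \<in> mod_hom (opp A) P (regular (opp A))" by simp
      have "\<phi> (emb c \<odot>\<^bsub>P\<^esub> p) = emb c \<otimes>\<^bsub>A\<^esub> \<phi> p"
        using dual_elem(3)[OF \<phi>' emb_closed[OF c] p] emb_mult_left[OF c v[OF \<phi>']] emb_mult_right[OF c v[OF \<phi>']] by simp
      then show "\<phi> (c \<odot>\<^bsub>underlying_space (opp A) P\<^esub> p) \<odot>\<^bsub>W\<^esub> x
          = emb c \<odot>\<^bsub>W\<^esub> (\<lambda>\<phi>\<in>carrier (dualm P). \<phi> p \<odot>\<^bsub>W\<^esub> x) \<phi>"
        using \<phi> W.smult_assoc1[OF emb_closed[OF c] v[OF \<phi>'] x] by simp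
    qed
    fix r assume "r \<in> carrier (underlying_space (opp A) P)"
    then have r: "r \<in> carrier P" by simp
    show "evh P W (p \<oplus>\<^bsub>underlying_space (opp A) P\<^esub> r) x = evh P W p x \<oplus>\<^bsub>hom_space (dualm P) W\<^esub> evh P W r x"
      unfolding evh_def hom_space_simps
    proof (rule restrict_ext)
      fix \<phi> assume \<phi>: "\<phi> \<in> carrier (dualm P)"
      then have \<phi>': "\<phi> \<in> mod_hom (opp A) P (regular (opp A))" by simp
      show "\<phi> (p \<oplus>\<^bsub>underlying_space (opp A) P\<^esub> r) \<odot>\<^bsub>W\<^esub> x
          = (\<lambda>\<phi>\<in>carrier (dualm P). \<phi> p \<odot>\<^bsub>W\<^esub> x) \<phi> \<oplus>\<^bsub>W\<^esub> (\<lambda>\<phi>\<in>carrier (dualm P). \<phi> r \<odot>\<^bsub>W\<^esub> x) \<phi>"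
        using \<phi> dual_elem(2)[OF \<phi>' p r] W.smult_l_distr[OF v[OF \<phi>'] dual_elem(1)[OF \<phi>' r] x] by simp
    qed
  qed
  then show ?thesis by simp
qed

end

section \<open>The Auslander-Reiten formula\<close>

text \<open>A presentation \<open>P1 \<rightarrow> P0 \<rightarrow> D L \<rightarrow> 0\<close> by projective right modules, together with \<open>q : P1\<^sup>* \<rightarrow> T\<close> that
  makes \<open>P0\<^sup>* \<rightarrow> P1\<^sup>* \<rightarrow> T \<rightarrow> 0\<close> exact.\<close>

locale transpose_data = algebra_with_universe K A universe_type
  for universe_type :: "'m itself" and K :: "('k, 'c) ring_scheme" and A :: "('k, 'a) module" +
  fixes L T P0 P1 :: "('a, 'm) module" and d :: "'m \<Rightarrow> 'm" and \<epsilon> :: "'m \<Rightarrow> 'm \<Rightarrow> 'k"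
    and q :: "('m \<Rightarrow> 'a) \<Rightarrow> 'm"
  assumes L_fg: "fg_module A L" and T_fg: "fg_module A T"
    and P0_fg: "fg_module (opp A) P0" and P0_proj: "projective (opp A) P0"
    and P1_fg: "fg_module (opp A) P1" and P1_proj: "projective (opp A) P1"
    and d_hom: "d \<in> mod_hom (opp A) P1 P0"
    and eps_hom: "\<epsilon> \<in> mod_hom (opp A) P0 (kdual K A L)"
    and eps_surj: "\<epsilon> ` carrier P0 = carrier (kdual K A L)"
    and d_image: "d ` carrier P1 = a_kernel P0 (kdual K A L) \<epsilon>"
    and q_hom: "q \<in> mod_hom A (dualm P1) T"
    and q_surj: "q ` carrier (dualm P1) = carrier T"
    and q_kernel: "a_kernel (dualm P1) T q = ring_dual_map (opp A) P1 P0 d ` carrier (dualm P0)"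
begin

abbreviation (input) "A0 \<equiv> dualm P0"
abbreviation (input) "A1 \<equiv> dualm P1"
abbreviation (input) "dd \<equiv> ring_dual_map (opp A) P1 P0 d"

declare dualm_simps [simp del]

lemma L_mod: "left_module A L" and T_mod: "left_module A T"
  and P0_mod: "left_module (opp A) P0" and P1_mod: "left_module (opp A) P1"
  using L_fg T_fg P0_fg P1_fg by (simp_all add: fg_module_def)

lemmas A0_mod = left_module_dualm[OF P0_mod]
lemmas A1_mod = left_module_dualm[OF P1_mod]
lemmas dd_hom = ring_dual_map_hom(1)[OF P0_mod P1_mod d_hom]
lemmas dd_apply = ring_dual_map_hom(2)[OF P0_mod P1_mod d_hom]
lemmas dd_closed = mod_hom_closed[OF dd_hom]

lemma eps_mem: "p \<in> carrier P0 \<Longrightarrow> \<epsilon> p \<in> mod_hom K (ksp L) (regular K)"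
  using mod_hom_closed[OF eps_hom] by simp

lemma eps_closed: "p \<in> carrier P0 \<Longrightarrow> l \<in> carrier L \<Longrightarrow> \<epsilon> p l \<in> carrier K"
  using mod_hom_closed[OF eps_mem] by simp

lemma q_dd: "\<phi> \<in> carrier A0 \<Longrightarrow> q (dd \<phi>) = \<zero>\<^bsub>T\<^esub>"
  using q_kernel by (auto simp: a_kernel_def')

lemma factor_through_T:
  assumes M: "left_module A M" and \<rho>: "\<rho> \<in> mod_hom A A1 M"
    and z: "\<And>\<phi>. \<phi> \<in> carrier A0 \<Longrightarrow> \<rho> (dd \<phi>) = \<zero>\<^bsub>M\<^esub>"
  obtains t where "t \<in> mod_hom A T M" "\<And>\<psi>. \<psi> \<in> carrier A1 \<Longrightarrow> t (q \<psi>) = \<rho> \<psi>"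
proof -
  have "\<rho> \<psi> = \<zero>\<^bsub>M\<^esub>" if "\<psi> \<in> carrier A1" "q \<psi> = \<zero>\<^bsub>T\<^esub>" for \<psi>
  proof -
    have "\<psi> \<in> a_kernel A1 T q" using that by (auto simp: a_kernel_def')
    then show ?thesis using q_kernel z by auto
  qed
  then show thesis
    by (rule factor_through_surj[OF A1_mod T_mod M q_hom q_surj \<rho>]) (assumption | rule that)+
qed

text \<open>\<open>\<epsilon>\<close> is onto \<open>D L\<close>, and the functionals on \<open>L\<close> separate its elements.\<close>

lemma eps_separates:
  assumes l: "l \<in> carrier L" and l': "l' \<in> carrier L" and eq: "\<And>p. p \<in> carrier P0 \<Longrightarrow> \<epsilon> p l = \<epsilon> p l'"
  shows "l = l'"
proof (rule ccontr)
  interpret L: left_module A L by (rule L_mod)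
  note KL = left_module_ksp[OF L_mod]
  let ?z = "l \<ominus>\<^bsub>L\<^esub> l'"
  assume "l \<noteq> l'"
  then have nz: "?z \<noteq> \<zero>\<^bsub>L\<^esub>" using diff_eq_zeroD[OF L_mod l l'] by blast
  have zc: "?z \<in> carrier L" using l l' by simp
  have s: "submod K (ksp L) {\<zero>\<^bsub>ksp L\<^esub>}" using smult_zero[OF KL] by (auto simp: submod_def)
  obtain \<xi> where \<xi>: "\<xi> \<in> mod_hom K (ksp L) (regular K)" "\<xi> ?z = \<one>\<^bsub>K\<^esub>"
    using functional_separating[OF field_K KL s, of ?z] zc nz by auto
  then obtain p where p: "p \<in> carrier P0" "\<xi> = \<epsilon> p" using eps_surj by auto
  have "l = ?z \<oplus>\<^bsub>L\<^esub> l'" using l l' by (simp add: a_minus_def L.M.a_assoc L.M.l_neg)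
  then have "\<epsilon> p l = \<epsilon> p ?z \<oplus>\<^bsub>K\<^esub> \<epsilon> p l'" using mod_hom_add[OF eps_mem[OF p(1)], of ?z l'] zc l' by simp
  then have "\<epsilon> p l' = \<one>\<^bsub>K\<^esub> \<oplus>\<^bsub>K\<^esub> \<epsilon> p l'" using \<xi>(2) p(2) eq[OF p(1)] by simp
  then have "\<one>\<^bsub>K\<^esub> \<oplus>\<^bsub>K\<^esub> \<epsilon> p l' = \<zero>\<^bsub>K\<^esub> \<oplus>\<^bsub>K\<^esub> \<epsilon> p l'" using eps_closed[OF p(1) l'] by simp
  then have "\<one>\<^bsub>K\<^esub> = \<zero>\<^bsub>K\<^esub>" using K.add.right_cancel eps_closed[OF p(1) l'] by blast
  then show False by simp
qed

text \<open>The functional that the pairing \<open>\<epsilon>\<close> induces on \<open>Hom (P0\<^sup>*, L)\<close>. It is determined by its values on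
  the maps \<open>evh P0 L p l\<close>, so the choice is immaterial.\<close>

definition tr :: "(('m \<Rightarrow> 'a) \<Rightarrow> 'm) \<Rightarrow> 'k"
  where "tr = (SOME \<Phi>. \<Phi> \<in> mod_hom K (hom_space A0 L) (regular K) \<and>
    (\<forall>p\<in>carrier P0. \<forall>l\<in>carrier L. \<Phi> (evh P0 L p l) = \<epsilon> p l))"

lemma tr_hom: "tr \<in> mod_hom K (hom_space A0 L) (regular K)"
  and tr_evh: "p \<in> carrier P0 \<Longrightarrow> l \<in> carrier L \<Longrightarrow> tr (evh P0 L p l) = \<epsilon> p l"
proof -
  have "\<exists>\<Phi>. \<Phi> \<in> mod_hom K (hom_space A0 L) (regular K) \<and>
      (\<forall>p\<in>carrier P0. \<forall>l\<in>carrier L. \<Phi> (evh P0 L p l) = \<epsilon> p l)"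
    using trace_exists[OF P0_fg P0_proj L_mod eps_hom] by blast
  from someI_ex[OF this] show "tr \<in> mod_hom K (hom_space A0 L) (regular K)"
    "p \<in> carrier P0 \<Longrightarrow> l \<in> carrier L \<Longrightarrow> tr (evh P0 L p l) = \<epsilon> p l"
    unfolding tr_def by blast+
qed

text \<open>Restriction along \<open>P0\<^sup>* \<rightarrow> P1\<^sup>*\<close> is \<open>d \<otimes> W\<close> in terms of tensors.\<close>

lemma evh_dd:
  assumes W: "left_module A W" and p: "p \<in> carrier P1" and x: "x \<in> carrier W"
  shows "compose (carrier A0) (evh P1 W p x) dd = evh P0 W (d p) x"
  by (rule extensionalityI[of _ "carrier A0"])
    (auto simp: compose_eq evh_apply dd_apply p dd_closed compose_extensional, simp add: evh_def)

lemma evh_compose: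
  assumes P: "left_module (opp A) P" and r: "r \<in> mod_hom A W V" and p: "p \<in> carrier P" and x: "x \<in> carrier W"
  shows "compose (carrier (dualm P)) r (evh P W p x) = evh P V p (r x)"
proof (rule extensionalityI[of _ "carrier (dualm P)"])
  fix \<phi> assume \<phi>: "\<phi> \<in> carrier (dualm P)"
  then have "\<phi> p \<in> carrier A" using dual_elem(1)[OF _ p] by (simp add: dualm_simps)
  then show "compose (carrier (dualm P)) r (evh P W p x) \<phi> = evh P V p (r x) \<phi>"
    using \<phi> x by (simp add: compose_eq evh_apply mod_hom_smult[OF r])
qed (auto simp: evh_def)

lemma d_closed: "p \<in> carrier P1 \<Longrightarrow> d p \<in> carrier P0"
  by (rule mod_hom_closed[OF d_hom])

lemma eps_d: "p \<in> carrier P1 \<Longrightarrow> l \<in> carrier L \<Longrightarrow> \<epsilon> (d p) l = \<zero>\<^bsub>K\<^esub>"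
proof -
  assume p: "p \<in> carrier P1" and l: "l \<in> carrier L"
  have "d p \<in> a_kernel P0 (kdual K A L) \<epsilon>" using d_image p by blast
  then have "\<epsilon> (d p) = (\<lambda>x\<in>carrier L. \<zero>\<^bsub>K\<^esub>)" by (simp add: a_kernel_def')
  then show ?thesis using l by simp
qed

text \<open>This is \<open>\<epsilon> d = 0\<close>, tested on the maps \<open>evh P1 L p l\<close>.\<close>

lemma tr_dd:
  assumes \<rho>: "\<rho> \<in> mod_hom A A1 L"
  shows "tr (compose (carrier A0) \<rho> dd) = \<zero>\<^bsub>K\<^esub>"
proof -
  let ?c = "\<lambda>\<rho>\<in>mod_hom A A1 L. compose (carrier A0) \<rho> dd"
  note H = left_module_hom_space[OF A1_mod L_mod]
  let ?f = "compose (carrier (hom_space A1 L)) tr ?c"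
  have f: "?f \<in> mod_hom K (hom_space A1 L) (regular K)"
    by (rule mod_hom_compose[OF H precomp_hom[OF A0_mod A1_mod L_mod dd_hom] tr_hom])
  have "\<rho> \<in> a_kernel (hom_space A1 L) (regular K) ?f"
  proof (rule hom_from_dual_induct[OF P1_fg P1_proj L_mod submod_kernel[OF H regular_K_module f] _ \<rho>])
    fix p l assume p: "p \<in> carrier P1" and l: "l \<in> carrier L"
    have "?f (evh P1 L p l) = \<epsilon> (d p) l"
      using evh_hom[OF P1_mod L_mod p l] evh_dd[OF L_mod p l] tr_evh[OF d_closed[OF p] l] by (simp add: compose_eq)
    then show "evh P1 L p l \<in> a_kernel (hom_space A1 L) (regular K) ?f"
      using evh_hom[OF P1_mod L_mod p l] eps_d[OF p l] by (simp add: a_kernel_def')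
  qed
  then show ?thesis using \<rho> by (simp add: a_kernel_def' compose_eq)
qed

text \<open>Tensoring \<open>P1 \<rightarrow> P0 \<rightarrow> D L \<rightarrow> 0\<close> with \<open>W\<close> shows that \<open>\<Psi>\<close> is a functional on \<open>D L \<otimes> W\<close>, and these are
  the maps from \<open>W\<close> to \<open>L\<close>, the double dual of \<open>L\<close>. Explicitly, for fixed \<open>x\<close> the functional
  \<open>p \<mapsto> \<Psi> (evh P0 W p x)\<close> vanishes where \<open>\<epsilon>\<close> does, so it is the evaluation \<open>p \<mapsto> \<epsilon> p (r x)\<close> at an
  element \<open>r x\<close> of the finite dimensional space \<open>L\<close>. This element is unique, whence \<open>r\<close> is linear.\<close>

lemma functional_represented:
  assumes W: "left_module A W" and \<Psi>: "\<Psi> \<in> mod_hom K (hom_space A0 W) (regular K)"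
    and van: "\<And>\<rho>. \<rho> \<in> mod_hom A A1 W \<Longrightarrow> \<Psi> (compose (carrier A0) \<rho> dd) = \<zero>\<^bsub>K\<^esub>"
  obtains r where "r \<in> mod_hom A W L" "\<And>v. v \<in> mod_hom A A0 W \<Longrightarrow> tr (compose (carrier A0) r v) = \<Psi> v"
proof -
  interpret oA: fin_dim_algebra K "opp A" using algebra_opp by (rule algebra_with_universe.axioms)
  interpret W: left_module A W by fact
  interpret L: left_module A L by (rule L_mod)
  interpret P0: left_module "opp A" P0 by (rule P0_mod)
  note Y = oA.left_module_ksp[OF P0_mod] and KL = left_module_ksp[OF L_mod]
  obtain vs where vs: "set vs \<subseteq> carrier (ksp L)" "lspan K (ksp L) vs = carrier L"
    using fin_span_ksp[OF L_fg] by (auto simp: fin_span_def)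
  let ?Y = "underlying_space (opp A) P0"
  have ex: "\<exists>l\<in>carrier L. \<forall>p\<in>carrier P0. \<Psi> (evh P0 W p x) = \<epsilon> p l" if x: "x \<in> carrier W" for x
  proof -
    let ?F = "compose (carrier ?Y) \<Psi> (\<lambda>p\<in>carrier P0. evh P0 W p x)"
    have F: "?F \<in> mod_hom K ?Y (regular K)" by (rule mod_hom_compose[OF Y evh_linear[OF P0_mod W x] \<Psi>])
    have Fv: "?F p = \<Psi> (evh P0 W p x)" if "p \<in> carrier P0" for p using that by (simp add: compose_eq)
    have "\<exists>l\<in>carrier (ksp L). \<forall>y\<in>carrier ?Y. ?F y = \<epsilon> y l"
    proof (rule functional_is_evaluation[OF field_K Y KL vs(1) _ _ F])
      show "\<epsilon> y \<in> mod_hom K (ksp L) (regular K)" if "y \<in> carrier ?Y" for y using eps_mem that by simp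
      show "(\<lambda>y\<in>carrier ?Y. \<epsilon> y v) \<in> mod_hom K ?Y (regular K)" if "v \<in> carrier (ksp L)" for v
        using pairing_linear[OF P0_mod L_mod eps_hom] that by simp
      fix y assume "y \<in> carrier ?Y" and z: "\<forall>v\<in>set vs. \<epsilon> y v = \<zero>\<^bsub>K\<^esub>"
      then have y: "y \<in> carrier P0" by simp
      have "lspan K (ksp L) vs \<subseteq> a_kernel (ksp L) (regular K) (\<epsilon> y)"
        by (rule lspan_least[OF submod_kernel[OF KL regular_K_module eps_mem[OF y]]])
          (use z vs(1) in \<open>auto simp: a_kernel_def'\<close>)
      then have e0: "\<epsilon> y l = \<zero>\<^bsub>K\<^esub>" if "l \<in> carrier L" for l using vs(2) that by (auto simp: a_kernel_def')
      have "\<epsilon> y = \<zero>\<^bsub>kdual K A L\<^esub>"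
        by (rule extensionalityI[of _ "carrier L"]) (use e0 mod_hom_extensional[OF eps_mem[OF y]] in auto)
      then have "y \<in> d ` carrier P1" using d_image y by (simp add: a_kernel_def')
      then obtain p where p: "p \<in> carrier P1" "y = d p" by blast
      have "?F y = \<Psi> (compose (carrier A0) (evh P1 W p x) dd)" using Fv[OF y] evh_dd[OF W p(1) x] p(2) by simp
      then show "?F y = \<zero>\<^bsub>K\<^esub>" using van[OF evh_hom[OF P1_mod W p(1) x]] by simp
    qed
    then obtain l where l: "l \<in> carrier L" "\<And>y. y \<in> carrier P0 \<Longrightarrow> ?F y = \<epsilon> y l" by auto
    then have "\<forall>p\<in>carrier P0. \<Psi> (evh P0 W p x) = \<epsilon> p l" using Fv by simp
    then show ?thesis using l(1) by blast
  qed
  then obtain r0 where r0: "\<And>x. x \<in> carrier W \<Longrightarrow> r0 x \<in> carrier L"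
    "\<And>x p. x \<in> carrier W \<Longrightarrow> p \<in> carrier P0 \<Longrightarrow> \<Psi> (evh P0 W p x) = \<epsilon> p (r0 x)" by metis
  let ?r = "\<lambda>x\<in>carrier W. r0 x"
  have r: "?r \<in> mod_hom A W L"
  proof (rule mod_homI[OF _ _ _ W])
    fix x assume x: "x \<in> carrier W"
    show "r0 x \<in> carrier L" by (rule r0(1)[OF x])
    show "r0 (a \<odot>\<^bsub>W\<^esub> x) = a \<odot>\<^bsub>L\<^esub> r0 x" if a: "a \<in> carrier A" for a
    proof (rule eps_separates[OF r0(1)[OF W.smult_closed[OF a x]] L.smult_closed[OF a r0(1)[OF x]]])
      fix p assume p: "p \<in> carrier P0"
      have ap: "a \<odot>\<^bsub>P0\<^esub> p \<in> carrier P0" using P0.smult_closed[of a p] a p by simp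
      have "evh P0 W p (a \<odot>\<^bsub>W\<^esub> x) = evh P0 W (a \<odot>\<^bsub>P0\<^esub> p) x"
        unfolding evh_def
      proof (rule restrict_ext)
        fix \<phi> assume "\<phi> \<in> carrier A0"
        then have \<phi>': "\<phi> \<in> mod_hom (opp A) P0 (regular (opp A))" by (simp add: dualm_simps)
        show "\<phi> p \<odot>\<^bsub>W\<^esub> (a \<odot>\<^bsub>W\<^esub> x) = \<phi> (a \<odot>\<^bsub>P0\<^esub> p) \<odot>\<^bsub>W\<^esub> x"
          using W.smult_assoc1[OF dual_elem(1)[OF \<phi>' p] a x] dual_elem(3)[OF \<phi>' a p] by simp
      qed
      then have "\<epsilon> p (r0 (a \<odot>\<^bsub>W\<^esub> x)) = \<epsilon> (a \<odot>\<^bsub>P0\<^esub> p) (r0 x)"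
        using r0(2)[OF W.smult_closed[OF a x] p] r0(2)[OF x ap] by simp
      also have "\<dots> = \<epsilon> p (a \<odot>\<^bsub>L\<^esub> r0 x)"
        using mod_hom_smult[OF eps_hom, of a p] a p r0(1)[OF x] by simp
      finally show "\<epsilon> p (r0 (a \<odot>\<^bsub>W\<^esub> x)) = \<epsilon> p (a \<odot>\<^bsub>L\<^esub> r0 x)" .
    qed
    fix y assume y: "y \<in> carrier W"
    have xy: "x \<oplus>\<^bsub>W\<^esub> y \<in> carrier W" using x y by simp
    show "r0 (x \<oplus>\<^bsub>W\<^esub> y) = r0 x \<oplus>\<^bsub>L\<^esub> r0 y"
    proof (rule eps_separates[OF r0(1)[OF xy] L.M.a_closed[OF r0(1)[OF x] r0(1)[OF y]]])
      fix p assume p: "p \<in> carrier P0"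
      have "evh P0 W p (x \<oplus>\<^bsub>W\<^esub> y) = evh P0 W p x \<oplus>\<^bsub>hom_space A0 W\<^esub> evh P0 W p y"
        unfolding evh_def hom_space_simps
      proof (rule restrict_ext)
        fix \<phi> assume \<phi>: "\<phi> \<in> carrier A0"
        then have "\<phi> p \<in> carrier A" using dual_elem(1)[OF _ p] by (simp add: dualm_simps)
        then show "\<phi> p \<odot>\<^bsub>W\<^esub> (x \<oplus>\<^bsub>W\<^esub> y) = (\<lambda>\<phi>\<in>carrier A0. \<phi> p \<odot>\<^bsub>W\<^esub> x) \<phi> \<oplus>\<^bsub>W\<^esub> (\<lambda>\<phi>\<in>carrier A0. \<phi> p \<odot>\<^bsub>W\<^esub> y) \<phi>"
          using \<phi> W.smult_r_distr x y by simp
      qed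
      then have "\<epsilon> p (r0 (x \<oplus>\<^bsub>W\<^esub> y)) = \<epsilon> p (r0 x) \<oplus>\<^bsub>K\<^esub> \<epsilon> p (r0 y)"
        using r0(2)[OF xy p] r0(2)[OF x p] r0(2)[OF y p]
          mod_hom_add[OF \<Psi>, of "evh P0 W p x" "evh P0 W p y"] evh_hom[OF P0_mod W p] x y by simp
      then show "\<epsilon> p (r0 (x \<oplus>\<^bsub>W\<^esub> y)) = \<epsilon> p (r0 x \<oplus>\<^bsub>L\<^esub> r0 y)"
        using mod_hom_add[OF eps_mem[OF p], of "r0 x" "r0 y"] r0(1)[OF x] r0(1)[OF y] by simp
    qed
  qed
  let ?H = "hom_space A0 W" and ?c = "\<lambda>v\<in>mod_hom A A0 W. compose (carrier A0) ?r v"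
  note H = left_module_hom_space[OF A0_mod W]
  let ?f = "compose (carrier ?H) tr ?c"
  have f: "?f \<in> mod_hom K ?H (regular K)"
    by (rule mod_hom_compose[OF H postcomp_hom[OF A0_mod W L_mod r] tr_hom])
  have "tr (compose (carrier A0) ?r v) = \<Psi> v" if v: "v \<in> mod_hom A A0 W" for v
  proof -
    have "v \<in> {v \<in> carrier ?H. ?f v = \<Psi> v}"
    proof (rule hom_from_dual_induct[OF P0_fg P0_proj W submod_equalizer[OF H regular_K_module f \<Psi>] _ v])
      fix p x assume p: "p \<in> carrier P0" and x: "x \<in> carrier W"
      have "?f (evh P0 W p x) = \<Psi> (evh P0 W p x)"
        using evh_hom[OF P0_mod W p x] evh_compose[OF P0_mod r p x] x tr_evh[OF p r0(1)[OF x]] r0(2)[OF x p]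
        by (simp add: compose_eq)
      then show "evh P0 W p x \<in> {v \<in> carrier ?H. ?f v = \<Psi> v}" using evh_hom[OF P0_mod W p x] by simp
    qed
    then show ?thesis using v by (simp add: compose_eq)
  qed
  then show thesis using that r by blast
qed

text \<open>\<open>P1\<^sup>*\<close> is projective, but it lives on another type than the modules on which projectivity is
  tested. That the maps \<open>evh P1 M p m\<close> lift is obvious, and they span.\<close>

lemma lift_from_A1:
  assumes W: "left_module A W" and M: "left_module A M" and f: "f \<in> mod_hom A W M" "f ` carrier W = carrier M"
    and \<tau>: "\<tau> \<in> mod_hom A A1 M"
  obtains \<rho> where "\<rho> \<in> mod_hom A A1 W" "\<And>\<psi>. \<psi> \<in> carrier A1 \<Longrightarrow> f (\<rho> \<psi>) = \<tau> \<psi>"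
proof -
  let ?c = "\<lambda>\<rho>\<in>mod_hom A A1 W. compose (carrier A1) f \<rho>"
  note H = left_module_hom_space[OF A1_mod W] and H' = left_module_hom_space[OF A1_mod M]
  have c: "?c \<in> mod_hom K (hom_space A1 W) (hom_space A1 M)" by (rule postcomp_hom[OF A1_mod W M f(1)])
  have "\<tau> \<in> ?c ` carrier (hom_space A1 W)"
  proof (rule hom_from_dual_induct[OF P1_fg P1_proj M submod_image[OF H H' c submod_carrier[OF H]] _ \<tau>])
    fix p m assume p: "p \<in> carrier P1" and "m \<in> carrier M"
    then obtain x where x: "x \<in> carrier W" "m = f x" using f(2) by blast
    have e: "evh P1 W p x \<in> carrier (hom_space A1 W)" using evh_hom[OF P1_mod W p x(1)] by simp
    have "evh P1 M p m = ?c (evh P1 W p x)" using evh_compose[OF P1_mod f(1) p x(1)] x(2) e by simp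
    then show "evh P1 M p m \<in> ?c ` carrier (hom_space A1 W)" using e by (rule image_eqI)
  qed
  then obtain \<rho> where \<rho>: "\<rho> \<in> mod_hom A A1 W" "\<tau> = compose (carrier A1) f \<rho>" by auto
  then show thesis using that[of \<rho>] by (simp add: compose_eq)
qed

text \<open>The diagram chase of the snake lemma: \<open>\<rho>\<close> lifts \<open>t q\<close> to \<open>W\<close>, and the restriction of \<open>\<rho>\<close> to \<open>P0\<^sup>*\<close>
  is \<open>w\<close> followed by \<open>g : L \<rightarrow> W\<close>.\<close>

definition diagram :: "('m \<Rightarrow> 'e) \<Rightarrow> ('a, 'e) module \<Rightarrow> ('e \<Rightarrow> 'f) \<Rightarrow> ('a, 'f) module \<Rightarrow>
    ('m \<Rightarrow> 'f) \<Rightarrow> (('m \<Rightarrow> 'a) \<Rightarrow> 'e) \<Rightarrow> (('m \<Rightarrow> 'a) \<Rightarrow> 'm) \<Rightarrow> bool"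
  where "diagram g W f M t \<rho> w \<longleftrightarrow>
    t \<in> mod_hom A T M \<and> \<rho> \<in> mod_hom A A1 W \<and> w \<in> mod_hom A A0 L \<and>
    (\<forall>\<psi>\<in>carrier A1. f (\<rho> \<psi>) = t (q \<psi>)) \<and> (\<forall>\<phi>\<in>carrier A0. g (w \<phi>) = \<rho> (dd \<phi>))"

text \<open>\<open>\<rho>\<close> and \<open>w\<close> are not determined by \<open>t\<close>, so all of them are required to give the same value.\<close>

definition connecting :: "('m \<Rightarrow> 'e) \<Rightarrow> ('a, 'e) module \<Rightarrow> ('e \<Rightarrow> 'f) \<Rightarrow> ('a, 'f) module \<Rightarrow> (('m \<Rightarrow> 'f) \<Rightarrow> 'k) \<Rightarrow> bool"
  where "connecting g W f M \<xi> \<longleftrightarrow> \<xi> \<in> mod_hom K (hom_space T M) (regular K) \<and>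
    (\<forall>t \<rho> w. diagram g W f M t \<rho> w \<longrightarrow> \<xi> t = tr w)"

lemma diagram_exists:
  assumes W: "left_module A W" and M: "left_module A M" and E: "short_exact A L g W f M"
    and t: "t \<in> mod_hom A T M"
  obtains \<rho> w where "diagram g W f M t \<rho> w"
proof -
  note e = short_exactD[OF E]
  obtain \<rho> where \<rho>: "\<rho> \<in> mod_hom A A1 W" "\<And>\<psi>. \<psi> \<in> carrier A1 \<Longrightarrow> f (\<rho> \<psi>) = compose (carrier A1) t q \<psi>"
    by (rule lift_from_A1[OF W M e(2) e(7) mod_hom_compose[OF A1_mod q_hom t]]) (assumption | rule that)+
  have \<rho>q: "f (\<rho> \<psi>) = t (q \<psi>)" if "\<psi> \<in> carrier A1" for \<psi> using \<rho>(2)[OF that] that by (simp add: compose_eq)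
  have fz: "f (compose (carrier A0) \<rho> dd \<phi>) = \<zero>\<^bsub>M\<^esub>" if "\<phi> \<in> carrier A0" for \<phi>
    using \<rho>q[OF dd_closed[OF that]] q_dd[OF that] mod_hom_zero[OF T_mod M t] that by (simp add: compose_eq)
  obtain w where w: "w \<in> mod_hom A A0 L" "\<And>\<phi>. \<phi> \<in> carrier A0 \<Longrightarrow> g (w \<phi>) = compose (carrier A0) \<rho> dd \<phi>"
    by (rule short_exact_kernel_lift[OF L_mod W M A0_mod E mod_hom_compose[OF A0_mod dd_hom \<rho>(1)] fz])
      (assumption | rule that)+
  have "diagram g W f M t \<rho> w"
    unfolding diagram_def using t \<rho>(1) \<rho>q w by (simp add: compose_eq)
  then show thesis by (rule that)
qed

text \<open>Instead of choosing lifts, functionals are moved through the diagram. As \<open>g\<close> is injective, \<open>tr\<close>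
  extends along \<open>Hom (P0\<^sup>*, L) \<rightarrow> Hom (P0\<^sup>*, W)\<close> to a functional \<open>\<tau>\<close>. Composed with the restriction
  from \<open>P1\<^sup>*\<close> to \<open>P0\<^sup>*\<close> it vanishes on the maps \<open>P1\<^sup>* \<rightarrow> L\<close>, by \<open>tr_dd\<close>, hence descends along
  \<open>Hom (P1\<^sup>*, W) \<rightarrow> Hom (P1\<^sup>*, M)\<close> to a functional \<open>\<Xi>\<close>. Composed with \<open>Hom (T, M) \<rightarrow> Hom (P1\<^sup>*, M)\<close> it
  becomes \<open>\<xi>\<close>.\<close>

lemma connecting_exists:
  assumes W: "left_module A W" and M: "left_module A M" and E: "short_exact A L g W f M"
  obtains \<xi> where "connecting g W f M \<xi>"
proof -
  note e = short_exactD[OF E]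
  note H0L = left_module_hom_space[OF A0_mod L_mod] and H0W = left_module_hom_space[OF A0_mod W]
    and H1W = left_module_hom_space[OF A1_mod W] and H1M = left_module_hom_space[OF A1_mod M]
    and HTM = left_module_hom_space[OF T_mod M]
  let ?g = "\<lambda>w\<in>mod_hom A A0 L. compose (carrier A0) g w"
  let ?f = "\<lambda>\<rho>\<in>mod_hom A A1 W. compose (carrier A1) f \<rho>"
  let ?d = "\<lambda>\<rho>\<in>mod_hom A A1 W. compose (carrier A0) \<rho> dd"
  let ?q = "\<lambda>t\<in>mod_hom A T M. compose (carrier A1) t q"
  have gh: "?g \<in> mod_hom K (hom_space A0 L) (hom_space A0 W)" by (rule postcomp_hom[OF A0_mod L_mod W e(1)])
  have fh: "?f \<in> mod_hom K (hom_space A1 W) (hom_space A1 M)" by (rule postcomp_hom[OF A1_mod W M e(2)])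
  have dh: "?d \<in> mod_hom K (hom_space A1 W) (hom_space A0 W)" by (rule precomp_hom[OF A0_mod A1_mod W dd_hom])
  have qh: "?q \<in> mod_hom K (hom_space T M) (hom_space A1 M)" by (rule precomp_hom[OF A1_mod T_mod M q_hom])
  have inj: "u = v" if "g u = g v" "u \<in> carrier L" "v \<in> carrier L" for u v
    using that e(3) by (auto dest: inj_onD)
  have ker_g: "tr w = \<zero>\<^bsub>K\<^esub>" if w: "w \<in> carrier (hom_space A0 L)" "?g w = \<zero>\<^bsub>hom_space A0 W\<^esub>" for w
  proof -
    have wh: "w \<in> mod_hom A A0 L" using w(1) by simp
    have "w \<phi> = \<zero>\<^bsub>L\<^esub>" if \<phi>: "\<phi> \<in> carrier A0" for \<phi>
    proof (rule inj)
      show "g (w \<phi>) = g \<zero>\<^bsub>L\<^esub>"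
        using fun_cong[OF w(2), of \<phi>] wh \<phi> mod_hom_zero[OF L_mod W e(1)] by (simp add: compose_eq)
    qed (use mod_hom_closed[OF wh \<phi>] submod_zero[OF submod_carrier[OF L_mod]] in auto)
    then have "w = \<zero>\<^bsub>hom_space A0 L\<^esub>" using mod_hom_eqI[OF wh hom_zero_in[OF A0_mod L_mod]] by simp
    then show ?thesis using mod_hom_zero[OF H0L regular_K_module tr_hom] by simp
  qed
  obtain \<tau> where \<tau>: "\<tau> \<in> mod_hom K (hom_space A0 W) (regular K)"
    "\<And>w. w \<in> carrier (hom_space A0 L) \<Longrightarrow> \<tau> (?g w) = tr w"
    by (rule functional_factor[OF field_K H0W H0L gh tr_hom ker_g]) (assumption | rule that)+
  let ?\<beta> = "compose (carrier (hom_space A1 W)) \<tau> ?d"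
  have \<beta>: "?\<beta> \<in> mod_hom K (hom_space A1 W) (regular K)" by (rule mod_hom_compose[OF H1W dh \<tau>(1)])
  have \<beta>_val: "?\<beta> \<rho> = tr w"
    if "\<rho> \<in> mod_hom A A1 W" "w \<in> mod_hom A A0 L" "\<And>\<phi>. \<phi> \<in> carrier A0 \<Longrightarrow> g (w \<phi>) = \<rho> (dd \<phi>)" for \<rho> w
  proof -
    have "compose (carrier A0) \<rho> dd = compose (carrier A0) g w" using that(3) by (auto simp: compose_def)
    then show ?thesis using \<tau>(2)[of w] that(1,2) by (simp add: compose_eq)
  qed
  have ker_f: "?\<beta> \<rho> = \<zero>\<^bsub>K\<^esub>" if \<rho>: "\<rho> \<in> carrier (hom_space A1 W)" "?f \<rho> = \<zero>\<^bsub>hom_space A1 M\<^esub>" for \<rho>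
  proof -
    have \<rho>h: "\<rho> \<in> mod_hom A A1 W" using \<rho>(1) by simp
    have z: "f (\<rho> \<psi>) = \<zero>\<^bsub>M\<^esub>" if "\<psi> \<in> carrier A1" for \<psi>
      using fun_cong[OF \<rho>(2), of \<psi>] \<rho>h that by (simp add: compose_eq)
    obtain k where k: "k \<in> mod_hom A A1 L" "\<And>\<psi>. \<psi> \<in> carrier A1 \<Longrightarrow> g (k \<psi>) = \<rho> \<psi>"
      by (rule short_exact_kernel_lift[OF L_mod W M A1_mod E \<rho>h z]) (assumption | rule that)+
    have "?\<beta> \<rho> = tr (compose (carrier A0) k dd)"
      by (rule \<beta>_val[OF \<rho>h mod_hom_compose[OF A0_mod dd_hom k(1)]]) (simp add: compose_eq k(2) dd_closed)
    then show ?thesis using tr_dd[OF k(1)] by simp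
  qed
  obtain \<Xi> where \<Xi>: "\<Xi> \<in> mod_hom K (hom_space A1 M) (regular K)"
    "\<And>\<rho>. \<rho> \<in> carrier (hom_space A1 W) \<Longrightarrow> \<Xi> (?f \<rho>) = ?\<beta> \<rho>"
    by (rule functional_factor[OF field_K H1M H1W fh \<beta> ker_f]) (assumption | rule that)+
  let ?\<xi> = "compose (carrier (hom_space T M)) \<Xi> ?q"
  have "?\<xi> t = tr w" if D: "diagram g W f M t \<rho> w" for t \<rho> w
  proof -
    have h: "t \<in> mod_hom A T M" "\<rho> \<in> mod_hom A A1 W" "w \<in> mod_hom A A0 L" using D by (auto simp: diagram_def)
    have "compose (carrier A1) t q = compose (carrier A1) f \<rho>" using D by (auto simp: diagram_def compose_def)
    then have "?\<xi> t = ?\<beta> \<rho>" using \<Xi>(2)[of \<rho>] h by (simp add: compose_eq)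
    also have "\<dots> = tr w" by (rule \<beta>_val[OF h(2,3)]) (use D in \<open>simp add: diagram_def\<close>)
    finally show ?thesis .
  qed
  then have "connecting g W f M ?\<xi>" unfolding connecting_def using mod_hom_compose[OF HTM qh \<Xi>(1)] by blast
  then show thesis by (rule that)
qed

text \<open>A diagram for the first sequence is also one for the second, with the same \<open>w\<close>.\<close>

lemma connecting_natural:
  assumes W: "left_module A W" and M: "left_module A M" and E: "short_exact A L g W f M"
    and c: "connecting g W f M \<xi>" and c': "connecting g' W' f' M' \<xi>'"
    and u: "u \<in> mod_hom A W W'" and a: "a \<in> mod_hom A M M'"
    and ug: "\<And>l. l \<in> carrier L \<Longrightarrow> u (g l) = g' l" and fu: "\<And>x. x \<in> carrier W \<Longrightarrow> f' (u x) = a (f x)"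
    and t: "t \<in> mod_hom A T M"
  shows "\<xi>' (compose (carrier T) a t) = \<xi> t"
proof -
  obtain \<rho> w where D: "diagram g W f M t \<rho> w" by (rule diagram_exists[OF W M E t])
  then have \<rho>: "\<rho> \<in> mod_hom A A1 W" and w: "w \<in> mod_hom A A0 L"
    and 1: "\<And>\<psi>. \<psi> \<in> carrier A1 \<Longrightarrow> f (\<rho> \<psi>) = t (q \<psi>)" and 2: "\<And>\<phi>. \<phi> \<in> carrier A0 \<Longrightarrow> g (w \<phi>) = \<rho> (dd \<phi>)"
    by (auto simp: diagram_def)
  have "diagram g' W' f' M' (compose (carrier T) a t) (compose (carrier A1) u \<rho>) w"
    unfolding diagram_def
  proof (intro conjI ballI w mod_hom_compose[OF T_mod t a] mod_hom_compose[OF A1_mod \<rho> u])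
    fix \<psi> assume \<psi>: "\<psi> \<in> carrier A1"
    show "f' (compose (carrier A1) u \<rho> \<psi>) = compose (carrier T) a t (q \<psi>)"
      using \<psi> fu[OF mod_hom_closed[OF \<rho> \<psi>]] 1[OF \<psi>] mod_hom_closed[OF q_hom \<psi>] by (simp add: compose_eq)
  next
    fix \<phi> assume \<phi>: "\<phi> \<in> carrier A0"
    show "g' (w \<phi>) = compose (carrier A1) u \<rho> (dd \<phi>)"
      using ug[OF mod_hom_closed[OF w \<phi>]] 2[OF \<phi>] dd_closed[OF \<phi>] by (simp add: compose_eq)
  qed
  then have "\<xi>' (compose (carrier T) a t) = tr w" using c' unfolding connecting_def by blast
  then show ?thesis using c D unfolding connecting_def by simp
qed

text \<open>If \<open>\<xi> = 0\<close>, then \<open>tr\<close> on \<open>Hom (P0\<^sup>*, L)\<close> is compatible with zero on \<open>Hom (P1\<^sup>*, W)\<close> inside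
  \<open>Hom (P0\<^sup>*, W)\<close>. The glued functional \<open>\<Psi>\<close> is represented by some \<open>r : W \<rightarrow> L\<close>, and
  \<open>tr (r g w) = tr (w)\<close> for all \<open>w\<close> means \<open>r g = 1\<close>, because \<open>\<epsilon>\<close> separates the elements of \<open>L\<close>.\<close>

lemma connecting_zero_split:
  assumes W: "left_module A W" and M: "left_module A M" and E: "short_exact A L g W f M"
    and c: "connecting g W f M \<xi>" and z: "\<And>t. t \<in> mod_hom A T M \<Longrightarrow> \<xi> t = \<zero>\<^bsub>K\<^esub>"
  obtains r where "r \<in> mod_hom A W L" "\<And>l. l \<in> carrier L \<Longrightarrow> r (g l) = l"
proof -
  note e = short_exactD[OF E]
  note H0L = left_module_hom_space[OF A0_mod L_mod] and H0W = left_module_hom_space[OF A0_mod W]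
    and H1W = left_module_hom_space[OF A1_mod W]
  let ?g = "\<lambda>w\<in>mod_hom A A0 L. compose (carrier A0) g w"
  let ?d = "\<lambda>\<rho>\<in>mod_hom A A1 W. compose (carrier A0) \<rho> dd"
  have compat: "tr w = \<zero>\<^bsub>K\<^esub>"
    if "w \<in> carrier (hom_space A0 L)" "\<rho> \<in> carrier (hom_space A1 W)" and eq: "?g w = ?d \<rho>" for w \<rho>
  proof -
    have w: "w \<in> mod_hom A A0 L" and \<rho>: "\<rho> \<in> mod_hom A A1 W" using that by simp_all
    have gw: "g (w \<phi>) = \<rho> (dd \<phi>)" if "\<phi> \<in> carrier A0" for \<phi>
      using fun_cong[OF eq, of \<phi>] w \<rho> that by (simp add: compose_eq)
    have fz: "compose (carrier A1) f \<rho> (dd \<phi>) = \<zero>\<^bsub>M\<^esub>" if "\<phi> \<in> carrier A0" for \<phi>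
      using gw[OF that, symmetric] e(4) mod_hom_closed[OF w that] dd_closed[OF that] by (simp add: compose_eq)
    obtain t where t: "t \<in> mod_hom A T M" "\<And>\<psi>. \<psi> \<in> carrier A1 \<Longrightarrow> t (q \<psi>) = compose (carrier A1) f \<rho> \<psi>"
      by (rule factor_through_T[OF M mod_hom_compose[OF A1_mod \<rho> e(2)] fz]) (assumption | rule that)+
    have "diagram g W f M t \<rho> w" unfolding diagram_def using t \<rho> w gw by (simp add: compose_eq)
    then have "\<xi> t = tr w" using c unfolding connecting_def by blast
    then show ?thesis using z[OF t(1)] by simp
  qed
  obtain \<Psi> where \<Psi>: "\<Psi> \<in> mod_hom K (hom_space A0 W) (regular K)"
    "\<And>w. w \<in> carrier (hom_space A0 L) \<Longrightarrow> \<Psi> (?g w) = tr w"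
    "\<And>\<rho>. \<rho> \<in> carrier (hom_space A1 W) \<Longrightarrow> \<Psi> (?d \<rho>) = \<zero>\<^bsub>K\<^esub>"
    by (rule functional_glue[OF field_K H0W H0L H1W postcomp_hom[OF A0_mod L_mod W e(1)]
          precomp_hom[OF A0_mod A1_mod W dd_hom] tr_hom compat]) (assumption | rule that)+
  have van: "\<Psi> (compose (carrier A0) \<rho> dd) = \<zero>\<^bsub>K\<^esub>" if "\<rho> \<in> mod_hom A A1 W" for \<rho>
    using \<Psi>(3)[of \<rho>] that by simp
  obtain r where r: "r \<in> mod_hom A W L" "\<And>v. v \<in> mod_hom A A0 W \<Longrightarrow> tr (compose (carrier A0) r v) = \<Psi> v"
    by (rule functional_represented[OF W \<Psi>(1) van]) (assumption | rule that)+
  have "r (g l) = l" if l: "l \<in> carrier L" for l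
  proof (rule eps_separates[OF mod_hom_closed[OF r(1) mod_hom_closed[OF e(1) l]] l])
    fix p assume p: "p \<in> carrier P0"
    have gl: "g l \<in> carrier W" by (rule mod_hom_closed[OF e(1) l])
    note v = evh_hom[OF P0_mod W p gl] and w = evh_hom[OF P0_mod L_mod p l]
    have "\<epsilon> p l = \<Psi> (?g (evh P0 L p l))" using \<Psi>(2)[of "evh P0 L p l"] w tr_evh[OF p l] by simp
    also have "\<dots> = \<Psi> (evh P0 W p (g l))" using evh_compose[OF P0_mod e(1) p l] w by simp
    also have "\<dots> = tr (evh P0 L p (r (g l)))" using r(2)[OF v] evh_compose[OF P0_mod r(1) p gl] by simp
    also have "\<dots> = \<epsilon> p (r (g l))" by (rule tr_evh[OF p mod_hom_closed[OF r(1) gl]])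
    finally show "\<epsilon> p (r (g l)) = \<epsilon> p l" by simp
  qed
  then show thesis using that r(1) by blast
qed

text \<open>The lift \<open>\<rho> = s q\<close> vanishes on \<open>P0\<^sup>*\<close>, so that \<open>w = 0\<close>.\<close>

lemma connecting_lift_zero:
  assumes W: "left_module A W" and M: "left_module A M" and E: "short_exact A L g W f M"
    and c: "connecting g W f M \<xi>" and s: "s \<in> mod_hom A T W"
  shows "\<xi> (compose (carrier T) f s) = \<zero>\<^bsub>K\<^esub>"
proof -
  note e = short_exactD[OF E]
  have "diagram g W f M (compose (carrier T) f s) (compose (carrier A1) s q) (\<lambda>x\<in>carrier A0. \<zero>\<^bsub>L\<^esub>)"
    unfolding diagram_def
    using mod_hom_compose[OF T_mod s e(2)] mod_hom_compose[OF A1_mod q_hom s] hom_zero_in[OF A0_mod L_mod]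
      mod_hom_closed[OF q_hom] dd_closed mod_hom_zero[OF L_mod W e(1)] q_dd mod_hom_zero[OF T_mod W s]
    by (simp add: compose_eq)
  then have "\<xi> (compose (carrier T) f s) = tr (\<lambda>x\<in>carrier A0. \<zero>\<^bsub>L\<^esub>)" using c unfolding connecting_def by blast
  then show ?thesis
    using mod_hom_zero[OF left_module_hom_space[OF A0_mod L_mod] regular_K_module tr_hom] by simp
qed

text \<open>By naturality the pullback of the sequence along \<open>b\<close> has connecting functional \<open>\<xi> (b -) = 0\<close>. So
  it splits, and a section of the pullback is a lift of \<open>b\<close>.\<close>

lemma connecting_lift:
  assumes W: "left_module A W" and M: "left_module A M" and N: "left_module A N" and E: "short_exact A L g W f M"
    and c: "connecting g W f M \<xi>" and b: "b \<in> mod_hom A N M"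
    and z: "\<And>t. t \<in> mod_hom A T N \<Longrightarrow> \<xi> (compose (carrier T) b t) = \<zero>\<^bsub>K\<^esub>"
  obtains s where "s \<in> mod_hom A N W" "\<And>n. n \<in> carrier N \<Longrightarrow> f (s n) = b n"
proof -
  interpret W: left_module A W by fact
  interpret N: left_module A N by fact
  note e = short_exactD[OF E]
  let ?D = "direct_sum W N"
  note D = left_module_direct_sum[OF W N]
  let ?f = "\<lambda>p\<in>carrier ?D. f (fst p)" and ?b = "\<lambda>p\<in>carrier ?D. b (snd p)"
  have f': "?f \<in> mod_hom A ?D M" by (rule mod_homI[OF _ _ _ D]) (auto simp: mod_homD[OF e(2)])
  have b': "?b \<in> mod_hom A ?D M" by (rule mod_homI[OF _ _ _ D]) (auto simp: mod_homD[OF b])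
  \<comment> \<open>the carrier of the pullback of \<open>f\<close> and \<open>b\<close>\<close>
  define V where "V = {p \<in> carrier ?D. ?f p = ?b p}"
  have Vs: "submod A ?D V" unfolding V_def by (rule submod_equalizer[OF D M f' b'])
  have Vm: "(x, n) \<in> V \<longleftrightarrow> x \<in> carrier W \<and> n \<in> carrier N \<and> f x = b n" for x n
    by (auto simp: V_def)
  let ?V = "?D\<lparr>carrier := V\<rparr>"
  have V: "left_module A ?V" by (rule left_module_submod[OF D Vs])
  let ?g = "\<lambda>l\<in>carrier L. (g l, \<zero>\<^bsub>N\<^esub>)" and ?p1 = "\<lambda>p\<in>carrier ?V. fst p" and ?p2 = "\<lambda>p\<in>carrier ?V. snd p"
  have g: "?g \<in> mod_hom A L ?V"
    by (rule mod_homI[OF _ _ _ L_mod])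
      (auto simp: Vm mod_homD[OF e(1)] e(4) mod_hom_zero[OF N M b] smult_zero[OF N])
  have p1: "?p1 \<in> mod_hom A ?V W" by (rule mod_homI[OF _ _ _ V]) (auto simp: Vm)
  have p2: "?p2 \<in> mod_hom A ?V N" by (rule mod_homI[OF _ _ _ V]) (auto simp: Vm)
  have E': "short_exact A L ?g ?V ?p2 N"
    unfolding short_exact_def
  proof (intro conjI g p2)
    show "inj_on ?g (carrier L)" using e(3) by (auto simp: inj_on_def)
    show "?g ` carrier L = a_kernel ?V N ?p2"
    proof
      show "?g ` carrier L \<subseteq> a_kernel ?V N ?p2" using mod_hom_closed[OF g] by (auto simp: a_kernel_def')
      show "a_kernel ?V N ?p2 \<subseteq> ?g ` carrier L"
      proof
        fix p assume "p \<in> a_kernel ?V N ?p2"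
        then have p: "p \<in> V" "snd p = \<zero>\<^bsub>N\<^esub>" by (auto simp: a_kernel_def')
        obtain x where x: "p = (x, \<zero>\<^bsub>N\<^esub>)" "x \<in> carrier W" "f x = \<zero>\<^bsub>M\<^esub>"
          using p mod_hom_zero[OF N M b] by (cases p) (auto simp: Vm)
        then obtain l where "l \<in> carrier L" "x = g l" using e(5) by blast
        then show "p \<in> ?g ` carrier L" using x(1) by auto
      qed
    qed
    show "?p2 ` carrier ?V = carrier N"
    proof
      show "?p2 ` carrier ?V \<subseteq> carrier N" using mod_hom_closed[OF p2] by blast
      show "carrier N \<subseteq> ?p2 ` carrier ?V"
      proof
        fix n assume n: "n \<in> carrier N"
        then obtain x where "x \<in> carrier W" "f x = b n" using e(6) mod_hom_closed[OF b] by blast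
        then have xn: "(x, n) \<in> carrier ?V" using n Vm by simp
        have "n = ?p2 (x, n)" using xn by simp
        then show "n \<in> ?p2 ` carrier ?V" using xn by (rule image_eqI)
      qed
    qed
  qed
  obtain \<xi>' where c': "connecting ?g ?V ?p2 N \<xi>'" by (rule connecting_exists[OF V N E'])
  have "\<xi>' t = \<zero>\<^bsub>K\<^esub>" if t: "t \<in> mod_hom A T N" for t
  proof -
    have "\<xi> (compose (carrier T) b t) = \<xi>' t"
    proof (rule connecting_natural[OF V N E' c' c p1 b _ _ t])
      show "?p1 (?g l) = g l" if "l \<in> carrier L" for l using mod_hom_closed[OF g that] that by simp
      show "f (?p1 x) = b (?p2 x)" if "x \<in> carrier ?V" for x using that by (cases x) (simp add: Vm)
    qed
    then show ?thesis using z[OF t] by simp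
  qed
  then obtain r where r: "r \<in> mod_hom A ?V L" "\<And>l. l \<in> carrier L \<Longrightarrow> r (?g l) = l"
    by (rule connecting_zero_split[OF V N E' c']) (assumption | rule that)+
  obtain s where s: "s \<in> mod_hom A N ?V" "\<And>n. n \<in> carrier N \<Longrightarrow> ?p2 (s n) = n"
    by (rule section_of_retraction[OF L_mod V N E' r]) (assumption | rule that)+
  have "f (compose (carrier N) ?p1 s n) = b n" if n: "n \<in> carrier N" for n
  proof -
    have sn: "s n \<in> V" using mod_hom_closed[OF s(1) n] by simp
    then have "f (fst (s n)) = b (snd (s n))" by (cases "s n") (simp add: Vm)
    then show ?thesis using s(2)[OF n] sn n by (simp add: compose_eq)
  qed
  then show thesis using that mod_hom_compose[OF N s(1) p1] by blast
qed

text \<open>Let \<open>\<Omega>\<close> be the kernel of a free cover \<open>\<pi> : F \<rightarrow> M\<close>. Extend \<open>\<xi>\<close> to a functional \<open>\<Xi>\<close> on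
  \<open>Hom (P1\<^sup>*, M)\<close>. The functional \<open>\<Xi> (\<pi> -)\<close> on \<open>Hom (P1\<^sup>*, F)\<close> vanishes on maps that are zero on
  \<open>P0\<^sup>*\<close>, for these come from maps \<open>T \<rightarrow> F\<close>, and \<open>\<xi>\<close> kills what factors through \<open>F\<close>. So it is the
  restriction to \<open>P0\<^sup>*\<close> followed by a functional \<open>\<Psi>\<close> on \<open>Hom (P0\<^sup>*, F)\<close>. On \<open>Hom (P0\<^sup>*, \<Omega>)\<close> the
  functional \<open>\<Psi>\<close> vanishes on restrictions of maps \<open>P1\<^sup>* \<rightarrow> \<Omega>\<close>, so it is represented by some
  \<open>w : \<Omega> \<rightarrow> L\<close>. The pushout of \<open>0 \<rightarrow> \<Omega> \<rightarrow> F \<rightarrow> M \<rightarrow> 0\<close> along \<open>w\<close> has the connecting functional \<open>\<xi>\<close>.\<close>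

lemma connecting_realize:
  fixes M :: "('a, 'm) module"
  assumes M_fg: "fg_module A M" and \<xi>: "\<xi> \<in> mod_hom K (hom_space T M) (regular K)"
    and van: "\<And>t. t \<in> proj_factor A T M \<Longrightarrow> \<xi> t = \<zero>\<^bsub>K\<^esub>"
  obtains Z :: "('a, 'm) module" and g f where "fg_module A Z" "short_exact A L g Z f M" "connecting g Z f M \<xi>"
proof -
  have M: "left_module A M" using M_fg by (rule fg_left_module)
  obtain S :: "'m set" and F :: "('a, 'm) module" and \<pi> y c where F_fg: "fg_module A F" and F_proj: "projective A F"
    and \<pi>: "\<pi> \<in> mod_hom A F M" "\<pi> ` carrier F = carrier M"
    by (rule free_cover[OF M_fg]) (rule that)
  have F: "left_module A F" using F_fg by (rule fg_left_module)
  let ?k = "a_kernel F M \<pi>"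
  let ?\<Omega> = "F\<lparr>carrier := ?k\<rparr>"
  have ks: "submod A F ?k" by (rule submod_kernel[OF F M \<pi>(1)])
  have \<Omega>: "left_module A ?\<Omega>" by (rule left_module_submod[OF F ks])
  let ?i = "\<lambda>x\<in>?k. x"
  have i: "?i \<in> mod_hom A ?\<Omega> F" by (rule mod_hom_incl[OF F ks])
  have E0: "short_exact A ?\<Omega> ?i F \<pi> M" by (rule kernel_short_exact[OF F M \<pi>])
  note HTM = left_module_hom_space[OF T_mod M] and H1M = left_module_hom_space[OF A1_mod M]
    and H1F = left_module_hom_space[OF A1_mod F] and H0F = left_module_hom_space[OF A0_mod F]
    and H0O = left_module_hom_space[OF A0_mod \<Omega>]
  let ?q = "\<lambda>t\<in>mod_hom A T M. compose (carrier A1) t q"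
  let ?p = "\<lambda>\<rho>\<in>mod_hom A A1 F. compose (carrier A1) \<pi> \<rho>"
  let ?d = "\<lambda>\<rho>\<in>mod_hom A A1 F. compose (carrier A0) \<rho> dd"
  let ?j = "\<lambda>v\<in>mod_hom A A0 ?\<Omega>. compose (carrier A0) ?i v"
  have qh: "?q \<in> mod_hom K (hom_space T M) (hom_space A1 M)" by (rule precomp_hom[OF A1_mod T_mod M q_hom])
  have ph: "?p \<in> mod_hom K (hom_space A1 F) (hom_space A1 M)" by (rule postcomp_hom[OF A1_mod F M \<pi>(1)])
  have dh: "?d \<in> mod_hom K (hom_space A1 F) (hom_space A0 F)" by (rule precomp_hom[OF A0_mod A1_mod F dd_hom])
  have jh: "?j \<in> mod_hom K (hom_space A0 ?\<Omega>) (hom_space A0 F)" by (rule postcomp_hom[OF A0_mod \<Omega> F i])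
  have ker_q: "\<xi> t = \<zero>\<^bsub>K\<^esub>" if t: "t \<in> carrier (hom_space T M)" "?q t = \<zero>\<^bsub>hom_space A1 M\<^esub>" for t
  proof -
    have th: "t \<in> mod_hom A T M" using t(1) by simp
    have "t x = \<zero>\<^bsub>M\<^esub>" if x: "x \<in> carrier T" for x
    proof -
      obtain \<psi> where "\<psi> \<in> carrier A1" "x = q \<psi>" using q_surj x by blast
      then show ?thesis using fun_cong[OF t(2), of \<psi>] th by (simp add: compose_eq)
    qed
    then have "t = \<zero>\<^bsub>hom_space T M\<^esub>" using mod_hom_eqI[OF th hom_zero_in[OF T_mod M]] by simp
    then show ?thesis using mod_hom_zero[OF HTM regular_K_module \<xi>] by simp
  qed
  obtain \<Xi> where \<Xi>: "\<Xi> \<in> mod_hom K (hom_space A1 M) (regular K)"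
    "\<And>t. t \<in> carrier (hom_space T M) \<Longrightarrow> \<Xi> (?q t) = \<xi> t"
    by (rule functional_factor[OF field_K H1M HTM qh \<xi> ker_q]) (assumption | rule that)+
  have ker_d: "compose (carrier (hom_space A1 F)) \<Xi> ?p \<rho> = \<zero>\<^bsub>K\<^esub>"
    if \<rho>: "\<rho> \<in> carrier (hom_space A1 F)" "?d \<rho> = \<zero>\<^bsub>hom_space A0 F\<^esub>" for \<rho>
  proof -
    have \<rho>h: "\<rho> \<in> mod_hom A A1 F" using \<rho>(1) by simp
    have z: "\<rho> (dd \<phi>) = \<zero>\<^bsub>F\<^esub>" if "\<phi> \<in> carrier A0" for \<phi>
      using fun_cong[OF \<rho>(2), of \<phi>] \<rho>h that by (simp add: compose_eq)
    obtain h where h: "h \<in> mod_hom A T F" "\<And>\<psi>. \<psi> \<in> carrier A1 \<Longrightarrow> h (q \<psi>) = \<rho> \<psi>"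
      by (rule factor_through_T[OF F \<rho>h z]) (assumption | rule that)+
    let ?t = "compose (carrier T) \<pi> h"
    have t: "?t \<in> mod_hom A T M" by (rule mod_hom_compose[OF T_mod h(1) \<pi>(1)])
    have "compose (carrier A1) \<pi> \<rho> = compose (carrier A1) ?t q"
      using h(2) mod_hom_closed[OF q_hom] by (auto simp: compose_def)
    then have "compose (carrier (hom_space A1 F)) \<Xi> ?p \<rho> = \<xi> ?t"
      using \<Xi>(2)[of ?t] t \<rho>h by (simp add: compose_eq)
    also have "\<dots> = \<zero>\<^bsub>K\<^esub>"
      by (rule van) (use F_fg F_proj h(1) \<pi>(1) in \<open>unfold proj_factor_def, blast\<close>)
    finally show ?thesis .
  qed
  obtain \<Psi> where \<Psi>: "\<Psi> \<in> mod_hom K (hom_space A0 F) (regular K)"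
    "\<And>\<rho>. \<rho> \<in> carrier (hom_space A1 F) \<Longrightarrow> \<Psi> (?d \<rho>) = compose (carrier (hom_space A1 F)) \<Xi> ?p \<rho>"
    by (rule functional_factor[OF field_K H0F H1F dh mod_hom_compose[OF H1F ph \<Xi>(1)] ker_d])
      (assumption | rule that)+
  have \<Psi>_val: "\<Psi> (compose (carrier A0) \<rho> dd) = \<Xi> (compose (carrier A1) \<pi> \<rho>)" if "\<rho> \<in> mod_hom A A1 F" for \<rho>
    using \<Psi>(2)[of \<rho>] that by (simp add: compose_eq)
  let ?\<Psi> = "compose (carrier (hom_space A0 ?\<Omega>)) \<Psi> ?j"
  have zz: "?\<Psi> (compose (carrier A0) \<rho> dd) = \<zero>\<^bsub>K\<^esub>" if \<rho>: "\<rho> \<in> mod_hom A A1 ?\<Omega>" for \<rho>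
  proof -
    have \<rho>k: "\<rho> \<psi> \<in> ?k" if "\<psi> \<in> carrier A1" for \<psi> using mod_hom_closed[OF \<rho> that] by simp
    have "?\<Psi> (compose (carrier A0) \<rho> dd) = \<Psi> (compose (carrier A0) (compose (carrier A1) ?i \<rho>) dd)"
      using mod_hom_compose[OF A0_mod dd_hom \<rho>] compose_assoc_hom[OF dd_hom, of ?i \<rho>] by (simp add: compose_eq)
    also have "\<dots> = \<Xi> (compose (carrier A1) \<pi> (compose (carrier A1) ?i \<rho>))"
      by (rule \<Psi>_val[OF mod_hom_compose[OF A1_mod \<rho> i]])
    also have "compose (carrier A1) \<pi> (compose (carrier A1) ?i \<rho>) = \<zero>\<^bsub>hom_space A1 M\<^esub>"
      using \<rho>k by (auto simp: compose_def a_kernel_def')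
    also have "\<Xi> \<dots> = \<zero>\<^bsub>K\<^esub>" using mod_hom_zero[OF H1M regular_K_module \<Xi>(1)] by simp
    finally show ?thesis .
  qed
  obtain w where w: "w \<in> mod_hom A ?\<Omega> L" "\<And>v. v \<in> mod_hom A A0 ?\<Omega> \<Longrightarrow> tr (compose (carrier A0) w v) = ?\<Psi> v"
    by (rule functional_represented[OF \<Omega> mod_hom_compose[OF H0O jh \<Psi>(1)] zz]) (assumption | rule that)+
  obtain Z :: "('a, 'm) module" and g u f where Z: "fg_module A Z" and E: "short_exact A L g Z f M"
    and u: "u \<in> mod_hom A F Z" and fu: "\<And>y. y \<in> carrier F \<Longrightarrow> f (u y) = \<pi> y"
    and ui: "\<And>x. x \<in> carrier ?\<Omega> \<Longrightarrow> u (?i x) = g (w x)"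
    by (rule pushout[OF L_fg F_fg \<Omega> M E0 w(1)]) (rule that)
  have ZL: "left_module A Z" using Z by (rule fg_left_module)
  obtain \<xi>' where \<xi>': "connecting g Z f M \<xi>'" by (rule connecting_exists[OF ZL M E])
  have eq: "\<xi> t = \<xi>' t" if t: "t \<in> mod_hom A T M" for t
  proof -
    obtain \<rho> where \<rho>: "\<rho> \<in> mod_hom A A1 F" "\<And>\<psi>. \<psi> \<in> carrier A1 \<Longrightarrow> \<pi> (\<rho> \<psi>) = compose (carrier A1) t q \<psi>"
      by (rule lift_from_A1[OF F M \<pi> mod_hom_compose[OF A1_mod q_hom t]]) (assumption | rule that)+
    have \<rho>q: "\<pi> (\<rho> \<psi>) = t (q \<psi>)" if "\<psi> \<in> carrier A1" for \<psi> using \<rho>(2)[OF that] that by (simp add: compose_eq)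
    have \<rho>k: "\<rho> (dd \<phi>) \<in> ?k" if "\<phi> \<in> carrier A0" for \<phi>
      using \<rho>q[OF dd_closed[OF that]] q_dd[OF that] mod_hom_zero[OF T_mod M t] mod_hom_closed[OF \<rho>(1) dd_closed[OF that]]
      by (simp add: a_kernel_def')
    let ?v = "compose (carrier A0) \<rho> dd"
    have v: "?v \<in> mod_hom A A0 ?\<Omega>"
      by (rule mod_hom_into_submod[OF mod_hom_compose[OF A0_mod dd_hom \<rho>(1)]]) (use \<rho>k in \<open>simp add: compose_eq\<close>)
    have "compose (carrier A1) \<pi> \<rho> = compose (carrier A1) t q" using \<rho>q by (auto simp: compose_def)
    then have "\<xi> t = \<Psi> ?v" using \<Psi>_val[OF \<rho>(1)] \<Xi>(2)[of t] t by simp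
    also have "\<Psi> ?v = ?\<Psi> ?v"
    proof -
      have "compose (carrier A0) ?i ?v = ?v" using \<rho>k by (auto simp: compose_def)
      then show ?thesis using v by (simp add: compose_eq)
    qed
    also have "\<dots> = tr (compose (carrier A0) w ?v)" using w(2)[OF v] by simp
    also have "\<dots> = \<xi>' t"
    proof -
      have "diagram g Z f M t (compose (carrier A1) u \<rho>) (compose (carrier A0) w ?v)"
        unfolding diagram_def
      proof (intro conjI ballI t mod_hom_compose[OF A1_mod \<rho>(1) u] mod_hom_compose[OF A0_mod v w(1)])
        show "f (compose (carrier A1) u \<rho> \<psi>) = t (q \<psi>)" if "\<psi> \<in> carrier A1" for \<psi>
          using that fu mod_hom_closed[OF \<rho>(1) that] \<rho>q by (simp add: compose_eq)
        show "g (compose (carrier A0) w ?v \<phi>) = compose (carrier A1) u \<rho> (dd \<phi>)" if "\<phi> \<in> carrier A0" for \<phi>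
          using that ui[of "\<rho> (dd \<phi>)"] \<rho>k[OF that] dd_closed[OF that] by (simp add: compose_eq)
      qed
      then show ?thesis using \<xi>' unfolding connecting_def by simp
    qed
    finally show ?thesis .
  qed
  have "\<xi>' \<in> mod_hom K (hom_space T M) (regular K)" using \<xi>' unfolding connecting_def by simp
  then have "\<xi> = \<xi>'" by (rule mod_hom_eqI[OF \<xi>]) (simp add: eq)
  then show thesis using that[OF Z E] \<xi>' by simp
qed

end

section \<open>The projective stable category\<close>

lemma coset_eq_iff_add:
  assumes N: "left_module R N" and I: "submod R N I" and x: "x \<in> carrier N" and y: "y \<in> carrier N"
  shows "I +>\<^bsub>N\<^esub> x = I +>\<^bsub>N\<^esub> y \<longleftrightarrow> (\<exists>i\<in>I. x = i \<oplus>\<^bsub>N\<^esub> y)"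
proof -
  interpret left_module R N by fact
  have "x \<ominus>\<^bsub>N\<^esub> y \<in> I \<longleftrightarrow> (\<exists>i\<in>I. x = i \<oplus>\<^bsub>N\<^esub> y)"
  proof
    assume "x \<ominus>\<^bsub>N\<^esub> y \<in> I"
    moreover have "x = (x \<ominus>\<^bsub>N\<^esub> y) \<oplus>\<^bsub>N\<^esub> y" using x y by (simp add: a_minus_def M.a_assoc M.l_neg)
    ultimately show "\<exists>i\<in>I. x = i \<oplus>\<^bsub>N\<^esub> y" by (rule bexI[rotated])
  next
    assume "\<exists>i\<in>I. x = i \<oplus>\<^bsub>N\<^esub> y"
    then obtain i where i: "i \<in> I" "x = i \<oplus>\<^bsub>N\<^esub> y" by blast
    then have "x \<ominus>\<^bsub>N\<^esub> y = i" using submod_sub[OF I i(1)] y by (simp add: a_minus_def M.a_assoc M.r_neg)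
    then show "x \<ominus>\<^bsub>N\<^esub> y \<in> I" using i by simp
  qed
  then show ?thesis using a_r_coset_eq_iff[OF N I x y] by simp
qed

lemma proj_factorI:
  fixes Q M N :: "('a, 'b) module"
  assumes "fg_module R Q" "projective R Q" "u \<in> mod_hom R M Q" "v \<in> mod_hom R Q N"
  shows "compose (carrier M) v u \<in> proj_factor R M N"
  using assms unfolding proj_factor_def by blast

lemma proj_factorE:
  fixes M N :: "('a, 'b) module"
  assumes "p \<in> proj_factor R M N"
  obtains Q :: "('a, 'b) module" and u v where "fg_module R Q" "projective R Q" "u \<in> mod_hom R M Q" "v \<in> mod_hom R Q N"
    "p = compose (carrier M) v u"
  using assms unfolding proj_factor_def by blast

lemma proj_factor_postcomp:
  fixes M N N' :: "('a, 'b) module"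
  assumes M: "left_module R M" and p: "p \<in> proj_factor R M N" and g: "g \<in> mod_hom R N N'"
  shows "compose (carrier M) g p \<in> proj_factor R M N'"
proof -
  obtain Q :: "('a, 'b) module" and u v where Q: "fg_module R Q" "projective R Q" and u: "u \<in> mod_hom R M Q" and v: "v \<in> mod_hom R Q N"
    and p: "p = compose (carrier M) v u" by (rule proj_factorE[OF p]) (rule that; assumption)
  have QL: "left_module R Q" using Q by (simp add: fg_module_def)
  show ?thesis unfolding p compose_assoc_hom[OF u]
    by (rule proj_factorI[OF Q u mod_hom_compose[OF QL v g]])
qed

lemma proj_factor_precomp:
  fixes M M' N :: "('a, 'b) module"
  assumes M': "left_module R M'" and p: "p \<in> proj_factor R M N" and g: "g \<in> mod_hom R M' M"
  shows "compose (carrier M') p g \<in> proj_factor R M' N"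
proof -
  obtain Q :: "('a, 'b) module" and u v where Q: "fg_module R Q" "projective R Q" and u: "u \<in> mod_hom R M Q" and v: "v \<in> mod_hom R Q N"
    and p: "p = compose (carrier M) v u" by (rule proj_factorE[OF p]) (rule that; assumption)
  show ?thesis unfolding p compose_assoc_hom[OF g, symmetric]
    by (rule proj_factorI[OF Q mod_hom_compose[OF M' g u] v])
qed

context algebra_with_universe begin

text \<open>Every map that factors through a projective also factors through one fixed free cover \<open>F\<close> of \<open>N\<close>,
  so these maps are the image of \<open>Hom (M, F)\<close>. In particular they are closed under addition.\<close>

lemma submod_proj_factor:
  fixes M N :: "('a, 'm) module"
  assumes M: "left_module A M" and N_fg: "fg_module A N"
  shows "submod K (hom_space M N) (proj_factor A M N)"
proof -
  have N: "left_module A N" using N_fg by (rule fg_left_module)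
  obtain S :: "'m set" and F :: "('a, 'm) module" and \<pi> y c where F_fg: "fg_module A F" and F_proj: "projective A F"
    and \<pi>: "\<pi> \<in> mod_hom A F N" "\<pi> ` carrier F = carrier N"
    by (rule free_cover[OF N_fg]) (rule that)
  have F: "left_module A F" using F_fg by (rule fg_left_module)
  let ?c = "\<lambda>h\<in>mod_hom A M F. compose (carrier M) \<pi> h"
  have c: "?c \<in> mod_hom K (hom_space M F) (hom_space M N)" by (rule postcomp_hom[OF M F N \<pi>(1)])
  have "proj_factor A M N = ?c ` carrier (hom_space M F)"
  proof
    show "?c ` carrier (hom_space M F) \<subseteq> proj_factor A M N"
      using proj_factorI[OF F_fg F_proj _ \<pi>(1)] by auto
    show "proj_factor A M N \<subseteq> ?c ` carrier (hom_space M F)"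
    proof
      fix p assume "p \<in> proj_factor A M N"
      then obtain Q :: "('a, 'm) module" and u v where Q: "fg_module A Q" "projective A Q" and u: "u \<in> mod_hom A M Q"
        and v: "v \<in> mod_hom A Q N" and p: "p = compose (carrier M) v u" by (rule proj_factorE) (rule that; assumption)
      obtain h where h: "h \<in> mod_hom A Q F" "v = compose (carrier Q) \<pi> h"
        by (rule projectiveD[OF Q(2) F N \<pi> v]) (rule that)
      have 1: "compose (carrier M) h u \<in> carrier (hom_space M F)" using mod_hom_compose[OF M u h(1)] by simp
      have "p = ?c (compose (carrier M) h u)"
        unfolding p h(2) using 1 compose_assoc_hom[OF u, of \<pi> h] by simp
      then show "p \<in> ?c ` carrier (hom_space M F)" using 1 by (rule image_eqI)
    qed
  qed
  then show ?thesis
    using submod_image[OF left_module_hom_space[OF M F] left_module_hom_space[OF M N] c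
        submod_carrier[OF left_module_hom_space[OF M F]]] by simp
qed

definition stable_class :: "('a, 'm) module \<Rightarrow> ('a, 'm) module \<Rightarrow> ('m \<Rightarrow> 'm) \<Rightarrow> ('m \<Rightarrow> 'm) set"
  where "stable_class M N f = proj_factor A M N +>\<^bsub>hom_space M N\<^esub> f"

lemma stable_class_eq: "proj_factor A M N #>\<^bsub>hom_group A M N\<^esub> f = stable_class M N f"
  by (simp add: stable_class_def a_r_coset_def' r_coset_def hom_group_def)

lemma stable_class_mem:
  assumes "left_module A M" "fg_module A N" "f \<in> mod_hom A M N"
  shows "f \<in> stable_class M N f"
proof -
  interpret H: left_module K "hom_space M N" by (rule left_module_hom_space[OF assms(1) fg_left_module[OF assms(2)]])
  have "f = \<zero>\<^bsub>hom_space M N\<^esub> \<oplus>\<^bsub>hom_space M N\<^esub> f" using H.M.l_zero[of f] assms(3) by simp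
  then show ?thesis
    using submod_zero[OF submod_proj_factor[OF assms(1,2)]] unfolding stable_class_def a_r_coset_char by blast
qed

lemma stable_class_eq_iff:
  assumes "left_module A M" "fg_module A N" "f \<in> mod_hom A M N" "g \<in> mod_hom A M N"
  shows "stable_class M N f = stable_class M N g \<longleftrightarrow> (\<exists>p\<in>proj_factor A M N. f = p \<oplus>\<^bsub>hom_space M N\<^esub> g)"
  unfolding stable_class_def
  by (rule coset_eq_iff_add[OF left_module_hom_space[OF assms(1) fg_left_module[OF assms(2)]]
        submod_proj_factor[OF assms(1,2)]]) (use assms in simp_all)

lemma stable_Mor: "Mor (stable_category A) M N = stable_class M N ` mod_hom A M N"
proof -
  have c: "carrier (hom_group A M N) = mod_hom A M N" by (simp add: hom_group_def)
  have "Mor (stable_category A) M N = (\<Union>f\<in>mod_hom A M N. {stable_class M N f})"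
    unfolding stable_category_def by (simp add: FactGroup_def RCOSETS_def stable_class_eq c)
  then show ?thesis by blast
qed

text \<open>Other representatives \<open>p + a\<close> and \<open>r + c\<close> change the composite by maps that factor through
  projectives, so the union in the definition of the composition consists of a single class.\<close>

lemma stable_Comp:
  assumes M: "left_module A M" and N: "fg_module A N" and P: "fg_module A P"
    and a: "a \<in> mod_hom A N P" and c: "c \<in> mod_hom A M N"
  shows "Comp (stable_category A) M N P (stable_class N P a) (stable_class M N c) =
    stable_class M P (compose (carrier M) a c)"
proof -
  have NL: "left_module A N" and PL: "left_module A P" using N P by (auto intro: fg_left_module)
  note sMN = submod_proj_factor[OF M N] and sNP = submod_proj_factor[OF NL P] and sMP = submod_proj_factor[OF M P]
  have ac: "compose (carrier M) a c \<in> mod_hom A M P" by (rule mod_hom_compose[OF M c a])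
  have "stable_class M P (compose (carrier M) g f) = stable_class M P (compose (carrier M) a c)"
    if gm: "g \<in> stable_class N P a" and fm: "f \<in> stable_class M N c" for g f
  proof -
    obtain p where p: "p \<in> proj_factor A N P" "g = p \<oplus>\<^bsub>hom_space N P\<^esub> a"
      using gm unfolding stable_class_def a_r_coset_char by blast
    obtain r where r: "r \<in> proj_factor A M N" "f = r \<oplus>\<^bsub>hom_space M N\<^esub> c"
      using fm unfolding stable_class_def a_r_coset_char by blast
    have ph: "p \<in> mod_hom A N P" using submod_sub[OF sNP p(1)] by simp
    have rh: "r \<in> mod_hom A M N" using submod_sub[OF sMN r(1)] by simp
    have gh: "g \<in> mod_hom A N P" using hom_add_in[OF NL PL ph a] p(2) by simp
    have fh: "f \<in> mod_hom A M N" using hom_add_in[OF M NL rh c] r(2) by simp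
    interpret P: left_module A P by (rule PL)
    have "compose (carrier M) g f = (compose (carrier M) p f \<oplus>\<^bsub>hom_space M P\<^esub> compose (carrier M) a r)
        \<oplus>\<^bsub>hom_space M P\<^esub> compose (carrier M) a c"
    proof (rule extensionalityI[of _ "carrier M"])
      fix x assume x: "x \<in> carrier M"
      have cl: "f x \<in> carrier N" "r x \<in> carrier N" "c x \<in> carrier N"
        using mod_hom_closed[OF fh x] mod_hom_closed[OF rh x] mod_hom_closed[OF c x] by auto
      have fx: "f x = r x \<oplus>\<^bsub>N\<^esub> c x" using r(2) x by simp
      have "g (f x) = p (f x) \<oplus>\<^bsub>P\<^esub> a (f x)" using p(2) cl by simp
      also have "a (f x) = a (r x) \<oplus>\<^bsub>P\<^esub> a (c x)" unfolding fx by (rule mod_hom_add[OF a cl(2,3)])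
      finally show "compose (carrier M) g f x = ((compose (carrier M) p f \<oplus>\<^bsub>hom_space M P\<^esub> compose (carrier M) a r)
        \<oplus>\<^bsub>hom_space M P\<^esub> compose (carrier M) a c) x"
        using x mod_hom_closed[OF ph cl(1)] mod_hom_closed[OF a cl(2)] mod_hom_closed[OF a cl(3)]
        by (simp add: compose_eq P.M.a_assoc)
    qed (auto simp: compose_def)
    moreover have "compose (carrier M) p f \<oplus>\<^bsub>hom_space M P\<^esub> compose (carrier M) a r \<in> proj_factor A M P"
      by (rule submod_add[OF sMP proj_factor_precomp[OF M p(1) fh] proj_factor_postcomp[OF M r(1) a]])
    ultimately show ?thesis
      using stable_class_eq_iff[OF M P mod_hom_compose[OF M fh gh] ac] by blast
  qed
  moreover have "a \<in> stable_class N P a" "c \<in> stable_class M N c"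
    by (rule stable_class_mem[OF NL P a], rule stable_class_mem[OF M N c])
  ultimately have "(\<Union>g\<in>stable_class N P a. \<Union>f\<in>stable_class M N c. stable_class M P (compose (carrier M) g f))
      = stable_class M P (compose (carrier M) a c)" by blast
  then show ?thesis by (simp add: stable_category_def stable_class_eq)
qed

text \<open>Classes of homomorphisms are replaced by representatives: a map factors through the class of \<open>c\<close>
  if it does so up to a map that factors through a projective.\<close>

lemma preenvelope_iff:
  fixes T :: "('a, 'm) module"
  assumes T: "fg_module A T" and \<L>: "\<L> \<subseteq> {M. fg_module A M}"
  shows "(\<exists>C c. preenvelope (stable_category A) \<L> T C c) \<longleftrightarrow>
    (\<exists>C\<in>\<L>. \<exists>c\<in>mod_hom A T C. \<forall>U\<in>\<L>. \<forall>h\<in>mod_hom A T U. \<exists>a\<in>mod_hom A C U. \<exists>p\<in>proj_factor A T U.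
      h = p \<oplus>\<^bsub>hom_space T U\<^esub> compose (carrier T) a c)" (is "?l \<longleftrightarrow> ?r")
proof -
  have TL: "left_module A T" using T by (rule fg_left_module)
  have fg: "fg_module A U" and lm: "left_module A U" if "U \<in> \<L>" for U
    using that \<L> fg_left_module by auto
  have Ob: "Obj (stable_category A) = {M. fg_module A M}" by (simp add: stable_category_def)
  show ?thesis
  proof
    assume ?l
    then obtain C k where pe: "preenvelope (stable_category A) \<L> T C k" by (elim exE) (rule that)
    then have C: "C \<in> \<L>" "k \<in> Mor (stable_category A) T C"
      and u: "\<forall>U\<in>\<L>. \<forall>h\<in>Mor (stable_category A) T U.
        \<exists>h'\<in>Mor (stable_category A) C U. h = Comp (stable_category A) T C U h' k"
      unfolding preenvelope_def by simp_all
    obtain c where c: "c \<in> mod_hom A T C" "k = stable_class T C c" using C(2) unfolding stable_Mor by blast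
    have "\<exists>a\<in>mod_hom A C U. \<exists>p\<in>proj_factor A T U. h = p \<oplus>\<^bsub>hom_space T U\<^esub> compose (carrier T) a c"
      if U: "U \<in> \<L>" and h: "h \<in> mod_hom A T U" for U h
    proof -
      have "stable_class T U h \<in> Mor (stable_category A) T U" using h unfolding stable_Mor by (rule imageI)
      from bspec[OF bspec[OF u U] this] obtain k' where k': "k' \<in> Mor (stable_category A) C U"
        "stable_class T U h = Comp (stable_category A) T C U k' k" by (elim bexE) (rule that; assumption)
      obtain a where "a \<in> mod_hom A C U" "k' = stable_class C U a"
        using k'(1) unfolding stable_Mor by (elim imageE) (rule that; assumption)
      with k'(2) have a: "a \<in> mod_hom A C U"
        "stable_class T U h = Comp (stable_category A) T C U (stable_class C U a) k" by simp_all
      have "stable_class T U h = stable_class T U (compose (carrier T) a c)"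
        using a(2) stable_Comp[OF TL fg[OF C(1)] fg[OF U] a(1) c(1)] c(2) by simp
      then show ?thesis
        using stable_class_eq_iff[OF TL fg[OF U] h mod_hom_compose[OF TL c(1) a(1)]] a(1) by blast
    qed
    then show ?r using C(1) c(1) by blast
  next
    assume ?r
    then obtain C c where C: "C \<in> \<L>" and c: "c \<in> mod_hom A T C"
      and u: "\<forall>U\<in>\<L>. \<forall>h\<in>mod_hom A T U. \<exists>a\<in>mod_hom A C U. \<exists>p\<in>proj_factor A T U.
        h = p \<oplus>\<^bsub>hom_space T U\<^esub> compose (carrier T) a c" by (elim bexE) (rule that; assumption)
    have "preenvelope (stable_category A) \<L> T C (stable_class T C c)"
      unfolding preenvelope_def Ob
    proof (intro conjI ballI \<L> C)
      show "T \<in> {M. fg_module A M}" using T by simp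
      show "stable_class T C c \<in> Mor (stable_category A) T C" using c unfolding stable_Mor by blast
      fix U k assume U: "U \<in> \<L>" and "k \<in> Mor (stable_category A) T U"
      then obtain h where h: "h \<in> mod_hom A T U" "k = stable_class T U h" unfolding stable_Mor by blast
      obtain a p where a: "a \<in> mod_hom A C U" "p \<in> proj_factor A T U" "h = p \<oplus>\<^bsub>hom_space T U\<^esub> compose (carrier T) a c"
        using bspec[OF bspec[OF u U] h(1)] by (elim bexE) (rule that; assumption)
      have "k = stable_class T U (compose (carrier T) a c)"
        using stable_class_eq_iff[OF TL fg[OF U] h(1) mod_hom_compose[OF TL c a(1)]] a h(2) by blast
      also have "\<dots> = Comp (stable_category A) T C U (stable_class C U a) (stable_class T C c)"
        by (rule stable_Comp[OF TL fg[OF C] fg[OF U] a(1) c, symmetric])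
      finally show "\<exists>h'\<in>Mor (stable_category A) C U. k = Comp (stable_category A) T C U h' (stable_class T C c)"
        using a(1) unfolding stable_Mor by blast
    qed
    then show ?l by blast
  qed
qed

section \<open>Extensions from \<open>Ext\<^sup>1\<close> and presentations of the transpose\<close>

text \<open>A cocycle \<open>f : Q 1 \<rightarrow> L\<close> that is not a coboundary induces a map \<open>w\<close> on the kernel of \<open>\<eta>\<close>, and the
  extension is the pushout along \<open>w\<close>. A retraction \<open>r\<close> would make \<open>f\<close> a coboundary, namely that of
  the composite of \<open>r\<close> with \<open>u : Q 0 \<rightarrow> Z\<close>.\<close>

lemma Ext1_nonzero_extension:
  fixes L L' :: "('a, 'm) module" and Q :: "nat \<Rightarrow> ('a, 'm) module"
  assumes L: "fg_module A L" and L': "fg_module A L'" and res: "projective_resolution A Q e \<eta> L'"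
    and nz: "carrier (Ext1 A Q e L) \<noteq> {\<one>\<^bsub>Ext1 A Q e L\<^esub>}"
  obtains Z :: "('a, 'm) module" and g f where "fg_module A Z" "short_exact A L g Z f L'"
    "\<And>r. r \<in> mod_hom A Z L \<Longrightarrow> \<exists>l\<in>carrier L. r (g l) \<noteq> l"
proof -
  have LL: "left_module A L" and L'L: "left_module A L'" using L L' by (auto intro: fg_left_module)
  have Qfg: "fg_module A (Q n)" for n using res by (simp add: projective_resolution_def)
  have Qm: "left_module A (Q n)" for n by (rule fg_left_module[OF Qfg])
  have e: "e n \<in> mod_hom A (Q (Suc n)) (Q n)" for n using res by (simp add: projective_resolution_def)
  have \<eta>: "\<eta> \<in> mod_hom A (Q 0) L'" "\<eta> ` carrier (Q 0) = carrier L'" using res by (auto simp: projective_resolution_def)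
  have ex1: "e 1 ` carrier (Q 2) = a_kernel (Q 1) (Q 0) (e 0)"
    using res unfolding projective_resolution_def by (metis One_nat_def Suc_1)
  have ex0: "e 0 ` carrier (Q 1) = a_kernel (Q 0) L' \<eta>" using res by (simp add: projective_resolution_def)
  have e0: "e 0 \<in> mod_hom A (Q 1) (Q 0)" using e[of 0] by simp
  define H where "H = hom_space (Q 1) L"
  have H: "left_module K H" unfolding H_def by (rule left_module_hom_space[OF Qm LL])
  define c where "c = (\<lambda>g\<in>mod_hom A (Q 0) L. compose (carrier (Q 1)) g (e 0))"
  have c: "c \<in> mod_hom K (hom_space (Q 0) L) H"
    unfolding c_def H_def by (rule precomp_hom[OF Qm Qm LL e0])
  define B where "B = (\<lambda>g. compose (carrier (Q 1)) g (e 0)) ` mod_hom A (Q 0) L"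
  have Bc: "B = c ` carrier (hom_space (Q 0) L)" by (auto simp: B_def c_def)
  have B: "submod K H B" unfolding Bc
    by (rule submod_image[OF left_module_hom_space[OF Qm LL] H c submod_carrier[OF left_module_hom_space[OF Qm LL]]])
  define Z1 where "Z1 = {f \<in> mod_hom A (Q 1) L. compose (carrier (Q 2)) f (e 1) = \<one>\<^bsub>hom_group A (Q 2) L\<^esub>}"
  have coset: "B #>\<^bsub>(hom_group A (Q 1) L)\<lparr>carrier := Z1\<rparr>\<^esub> f = B +>\<^bsub>H\<^esub> f" for f
    by (simp add: a_r_coset_def' r_coset_def hom_group_def H_def)
  have car: "carrier (Ext1 A Q e L) = (\<lambda>f. B +>\<^bsub>H\<^esub> f) ` Z1" and one: "\<one>\<^bsub>Ext1 A Q e L\<^esub> = B"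
  proof -
    have E1: "Ext1 A Q e L = (hom_group A (Q 1) L)\<lparr>carrier := Z1\<rparr> Mod B"
      unfolding Ext1_def Z1_def B_def by (rule refl)
    show "\<one>\<^bsub>Ext1 A Q e L\<^esub> = B" unfolding E1 by (simp add: FactGroup_def)
    have "carrier (Ext1 A Q e L) = (\<Union>f\<in>Z1. {B +>\<^bsub>H\<^esub> f})"
      unfolding E1 FactGroup_def RCOSETS_def coset by simp
    then show "carrier (Ext1 A Q e L) = (\<lambda>f. B +>\<^bsub>H\<^esub> f) ` Z1" by blast
  qed
  have "\<exists>f\<in>Z1. f \<notin> B"
  proof (rule ccontr)
    assume "\<not> ?thesis"
    then have all: "f \<in> B" if "f \<in> Z1" for f using that by blast
    interpret H: left_module K H by (rule H)
    have B0: "B +>\<^bsub>H\<^esub> \<zero>\<^bsub>H\<^esub> = B" using submod_sub[OF B] by (force simp: a_r_coset_char)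
    have "B +>\<^bsub>H\<^esub> f = B" if "f \<in> Z1" for f
    proof -
      have fH: "f \<in> carrier H" using submod_sub[OF B all[OF that]] .
      have "f = f \<oplus>\<^bsub>H\<^esub> \<zero>\<^bsub>H\<^esub>" using fH by simp
      then have "B +>\<^bsub>H\<^esub> f = B +>\<^bsub>H\<^esub> \<zero>\<^bsub>H\<^esub>"
        using coset_eq_iff_add[OF H B fH H.M.zero_closed] all[OF that] by blast
      then show ?thesis using B0 by simp
    qed
    moreover have "(\<lambda>x\<in>carrier (Q 1). \<zero>\<^bsub>L\<^esub>) \<in> Z1"
      unfolding Z1_def using hom_zero_in[OF Qm LL, of 1] mod_hom_closed[OF e, of _ 1]
      by (auto simp: hom_group_def compose_def numeral_2_eq_2)
    ultimately have "carrier (Ext1 A Q e L) = {\<one>\<^bsub>Ext1 A Q e L\<^esub>}" unfolding car one by force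
    then show False using nz by simp
  qed
  then obtain f where f: "f \<in> mod_hom A (Q 1) L" "compose (carrier (Q 2)) f (e 1) = \<one>\<^bsub>hom_group A (Q 2) L\<^esub>" "f \<notin> B"
    unfolding Z1_def by blast
  let ?k = "a_kernel (Q 0) L' \<eta>"
  let ?O = "Q 0\<lparr>carrier := ?k\<rparr>"
  have ks: "submod A (Q 0) ?k" by (rule submod_kernel[OF Qm L'L \<eta>(1)])
  have O: "left_module A ?O" by (rule left_module_submod[OF Qm ks])
  note E0 = kernel_short_exact[OF Qm L'L \<eta>]
  have e0': "e 0 \<in> mod_hom A (Q 1) ?O" by (rule mod_hom_into_submod[OF e0]) (use ex0 in blast)
  have e0s: "e 0 ` carrier (Q 1) = carrier ?O" using ex0 by simp
  have fz: "f y = \<zero>\<^bsub>L\<^esub>" if "y \<in> carrier (Q 1)" "e 0 y = \<zero>\<^bsub>?O\<^esub>" for y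
  proof -
    have "y \<in> a_kernel (Q 1) (Q 0) (e 0)" using that by (simp add: a_kernel_def')
    then obtain z where z: "z \<in> carrier (Q 2)" "y = e 1 z" unfolding ex1[symmetric] by blast
    have "compose (carrier (Q 2)) f (e 1) z = \<zero>\<^bsub>L\<^esub>" using f(2) z(1) by (simp add: hom_group_def)
    then show ?thesis using z by (simp add: compose_eq)
  qed
  obtain w where w: "w \<in> mod_hom A ?O L" "\<And>y. y \<in> carrier (Q 1) \<Longrightarrow> w (e 0 y) = f y"
    by (rule factor_through_surj[OF Qm O LL e0' e0s f(1) fz]) (assumption | rule that)+
  obtain Z :: "('a, 'm) module" and g u p where Z: "fg_module A Z" and E: "short_exact A L g Z p L'"
    and u: "u \<in> mod_hom A (Q 0) Z" and ui: "\<And>x. x \<in> carrier ?O \<Longrightarrow> u ((\<lambda>x\<in>?k. x) x) = g (w x)"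
    by (rule pushout[OF L Qfg O L'L E0 w(1)]) (rule that)
  have "\<exists>l\<in>carrier L. r (g l) \<noteq> l" if r: "r \<in> mod_hom A Z L" for r
  proof (rule ccontr)
    assume "\<not> ?thesis"
    then have rg: "r (g l) = l" if "l \<in> carrier L" for l using that by blast
    have ru: "compose (carrier (Q 0)) r u \<in> mod_hom A (Q 0) L" by (rule mod_hom_compose[OF Qm u r])
    have "f = compose (carrier (Q 1)) (compose (carrier (Q 0)) r u) (e 0)"
    proof (rule mod_hom_eqI[OF f(1) mod_hom_compose[OF Qm e0 ru]])
      fix y assume y: "y \<in> carrier (Q 1)"
      have ey: "e 0 y \<in> ?k" using ex0 y by blast
      have "u (e 0 y) = g (f y)" using ui[of "e 0 y"] ey w(2)[OF y] by simp
      then have "r (u (e 0 y)) = f y" using rg mod_hom_closed[OF f(1) y] by simp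
      then show "f y = compose (carrier (Q 1)) (compose (carrier (Q 0)) r u) (e 0) y"
        using y mod_hom_closed[OF e0 y] by (simp add: compose_eq)
    qed
    then have "f \<in> B" unfolding B_def using ru by blast
    then show False using f(3) by simp
  qed
  then show thesis using that[OF Z E] by blast
qed

lemma transpose_presentation:
  fixes L T :: "('a, 'm) module"
  assumes L: "fg_module A L" and T: "is_transpose (opp A) (kdual K A L) T"
  obtains P0 P1 d \<epsilon> q where "transpose_data K A L T P0 P1 d \<epsilon> q"
proof -
  have Tfg: "fg_module A T" using T by (simp add: is_transpose_def opp_opp)
  obtain P :: "nat \<Rightarrow> ('a, 'm) module" and d \<epsilon> where res: "projective_resolution (opp A) P d \<epsilon> (kdual K A L)"
    and iso: "mod_iso A T (cokernel (dualm (P 0)) (dualm (P 1)) (ring_dual_map (opp A) (P 1) (P 0) (d 0)))"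
    using T unfolding is_transpose_def opp_opp dualm_def by blast
  have Pfg: "fg_module (opp A) (P n)" and Ppr: "projective (opp A) (P n)" for n
    using res by (auto simp: projective_resolution_def)
  have Pm: "left_module (opp A) (P n)" for n using Pfg by (simp add: fg_module_def)
  have d: "d 0 \<in> mod_hom (opp A) (P 1) (P 0)" using res by (simp add: projective_resolution_def)
  let ?dd = "ring_dual_map (opp A) (P 1) (P 0) (d 0)"
  let ?C = "cokernel (dualm (P 0)) (dualm (P 1)) ?dd"
  note A0 = left_module_dualm[OF Pm, of 0] and A1 = left_module_dualm[OF Pm, of 1]
  have dd: "?dd \<in> mod_hom A (dualm (P 0)) (dualm (P 1))" by (rule ring_dual_map_hom(1)[OF Pm Pm d])
  define pr where "pr = (\<lambda>x\<in>carrier (dualm (P 1)). (?dd ` carrier (dualm (P 0))) +>\<^bsub>dualm (P 1)\<^esub> x)"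
  note q = cokernel_module[OF A0 A1 dd, folded pr_def]
  obtain \<phi> where \<phi>: "\<phi> \<in> mod_hom A T ?C" "bij_betw \<phi> (carrier T) (carrier ?C)" using iso by (auto simp: mod_iso_def)
  have TL: "left_module A T" using Tfg by (rule fg_left_module)
  obtain \<psi> where \<psi>: "\<psi> \<in> mod_hom A ?C T" "\<And>x. x \<in> carrier T \<Longrightarrow> \<psi> (\<phi> x) = x"
    "\<And>y. y \<in> carrier ?C \<Longrightarrow> \<phi> (\<psi> y) = y"
    by (rule mod_hom_inverse[OF TL q(1) \<phi>]) (rule that)
  let ?q = "compose (carrier (dualm (P 1))) \<psi> pr"
  have qh: "?q \<in> mod_hom A (dualm (P 1)) T" by (rule mod_hom_compose[OF A1 q(2) \<psi>(1)])
  have qs: "?q ` carrier (dualm (P 1)) = carrier T"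
  proof
    show "?q ` carrier (dualm (P 1)) \<subseteq> carrier T" using mod_hom_closed[OF qh] by blast
    show "carrier T \<subseteq> ?q ` carrier (dualm (P 1))"
    proof
      fix x assume x: "x \<in> carrier T"
      then obtain y where y: "y \<in> carrier (dualm (P 1))" "pr y = \<phi> x" using q(3) mod_hom_closed[OF \<phi>(1) x] by (metis imageE)
      have "x = ?q y" using \<psi>(2)[OF x] y by (simp only: compose_eq)
      then show "x \<in> ?q ` carrier (dualm (P 1))" using y(1) by (rule image_eqI)
    qed
  qed
  have "?q y = \<zero>\<^bsub>T\<^esub> \<longleftrightarrow> pr y = \<zero>\<^bsub>?C\<^esub>" if y: "y \<in> carrier (dualm (P 1))" for y
  proof -
    have c: "pr y \<in> carrier ?C" by (rule mod_hom_closed[OF q(2) y])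
    have "\<psi> (pr y) = \<zero>\<^bsub>T\<^esub> \<Longrightarrow> pr y = \<zero>\<^bsub>?C\<^esub>" using \<psi>(3)[OF c] mod_hom_zero[OF TL q(1) \<phi>(1)] by simp
    moreover have "\<psi> \<zero>\<^bsub>?C\<^esub> = \<zero>\<^bsub>T\<^esub>" by (rule mod_hom_zero[OF q(1) TL \<psi>(1)])
    ultimately show ?thesis unfolding compose_eq[OF y] by metis
  qed
  then have qk: "a_kernel (dualm (P 1)) T ?q = ?dd ` carrier (dualm (P 0))"
    unfolding q(5)[symmetric] a_kernel_def' by blast
  have "transpose_data K A L T (P 0) (P 1) (d 0) \<epsilon> ?q"
    by (intro transpose_data.intro transpose_data_axioms.intro algebra_with_universe_axioms L Tfg Pfg Ppr d qh qs qk)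
      (use res in \<open>auto simp: projective_resolution_def\<close>)
  then show thesis by (rule that)
qed

end

section \<open>Decompositions\<close>

lemma internal_direct_sum:
  assumes M: "left_module R M" and I: "submod R M I" and N: "submod R M N"
    and sum: "\<And>x. x \<in> carrier M \<Longrightarrow> \<exists>y\<in>I. x \<ominus>\<^bsub>M\<^esub> y \<in> N" and int: "\<And>y. y \<in> I \<Longrightarrow> y \<in> N \<Longrightarrow> y = \<zero>\<^bsub>M\<^esub>"
  obtains h where "h \<in> mod_hom R M (direct_sum (M\<lparr>carrier := I\<rparr>) (M\<lparr>carrier := N\<rparr>))"
    "bij_betw h (carrier M) (carrier (direct_sum (M\<lparr>carrier := I\<rparr>) (M\<lparr>carrier := N\<rparr>)))"
    "\<And>x. x \<in> carrier M \<Longrightarrow> x = fst (h x) \<oplus>\<^bsub>M\<^esub> snd (h x)"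
proof -
  interpret left_module R M by fact
  let ?D = "direct_sum (M\<lparr>carrier := I\<rparr>) (M\<lparr>carrier := N\<rparr>)"
  have D: "left_module R ?D" by (rule left_module_direct_sum[OF left_module_submod[OF M I] left_module_submod[OF M N]])
  note i = submodD[OF I] and n = submodD[OF N]
  let ?s = "\<lambda>p\<in>carrier ?D. fst p \<oplus>\<^bsub>M\<^esub> snd p"
  have s: "?s \<in> mod_hom R ?D M"
  proof (rule mod_homI[OF _ _ _ D])
    fix p assume "p \<in> carrier ?D"
    then obtain a b where p: "p = (a, b)" "a \<in> I" "b \<in> N" by auto
    show "fst p \<oplus>\<^bsub>M\<^esub> snd p \<in> carrier M" using p i(1) n(1) by simp
    show "fst (c \<odot>\<^bsub>?D\<^esub> p) \<oplus>\<^bsub>M\<^esub> snd (c \<odot>\<^bsub>?D\<^esub> p) = c \<odot>\<^bsub>M\<^esub> (fst p \<oplus>\<^bsub>M\<^esub> snd p)" if "c \<in> carrier R" for c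
      using that p i(1) n(1) by (simp add: smult_r_distr)
    fix p' assume "p' \<in> carrier ?D"
    then obtain a' b' where p': "p' = (a', b')" "a' \<in> I" "b' \<in> N" by auto
    show "fst (p \<oplus>\<^bsub>?D\<^esub> p') \<oplus>\<^bsub>M\<^esub> snd (p \<oplus>\<^bsub>?D\<^esub> p') = (fst p \<oplus>\<^bsub>M\<^esub> snd p) \<oplus>\<^bsub>M\<^esub> (fst p' \<oplus>\<^bsub>M\<^esub> snd p')"
      using p p' i(1) n(1) by (simp add: M.a_ac)
  qed
  have "bij_betw ?s (carrier ?D) (carrier M)"
    unfolding bij_betw_def
  proof
    show "inj_on ?s (carrier ?D)"
    proof (rule inj_onI)
      fix p p' assume pp: "p \<in> carrier ?D" "p' \<in> carrier ?D" "?s p = ?s p'"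
      obtain a b a' b' where p: "p = (a, b)" "a \<in> I" "b \<in> N" "p' = (a', b')" "a' \<in> I" "b' \<in> N" using pp by auto
      have c: "a \<in> carrier M" "b \<in> carrier M" "a' \<in> carrier M" "b' \<in> carrier M" using p i(1) n(1) by auto
      have eq: "a \<oplus>\<^bsub>M\<^esub> b = a' \<oplus>\<^bsub>M\<^esub> b'" using pp(3) p by simp
      have "a \<ominus>\<^bsub>M\<^esub> a' = (a \<oplus>\<^bsub>M\<^esub> b) \<oplus>\<^bsub>M\<^esub> (\<ominus>\<^bsub>M\<^esub> b \<oplus>\<^bsub>M\<^esub> \<ominus>\<^bsub>M\<^esub> a')"
        using c by (simp add: a_minus_def M.a_ac M.r_neg M.r_neg2 M.r_neg1)
      also have "\<dots> = (b' \<oplus>\<^bsub>M\<^esub> a') \<oplus>\<^bsub>M\<^esub> (\<ominus>\<^bsub>M\<^esub> a' \<oplus>\<^bsub>M\<^esub> \<ominus>\<^bsub>M\<^esub> b)"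
        unfolding eq by (subst M.a_comm[OF c(3,4)], subst M.a_comm[of "\<ominus>\<^bsub>M\<^esub> b"]) (use c in simp_all)
      also have "\<dots> = b' \<ominus>\<^bsub>M\<^esub> b" using c by (simp add: a_minus_def M.a_assoc M.r_neg2)
      finally have "a \<ominus>\<^bsub>M\<^esub> a' = b' \<ominus>\<^bsub>M\<^esub> b" .
      then have "a \<ominus>\<^bsub>M\<^esub> a' = \<zero>\<^bsub>M\<^esub>" "b' \<ominus>\<^bsub>M\<^esub> b = \<zero>\<^bsub>M\<^esub>"
        using int[of "a \<ominus>\<^bsub>M\<^esub> a'"] submod_diff[OF M I p(2,5)] submod_diff[OF M N p(6,3)] by simp_all
      then show "p = p'" using p diff_eq_zeroD[OF M c(1,3)] diff_eq_zeroD[OF M c(4,2)] by simp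
    qed
    show "?s ` carrier ?D = carrier M"
    proof
      show "?s ` carrier ?D \<subseteq> carrier M" using mod_hom_closed[OF s] by blast
      show "carrier M \<subseteq> ?s ` carrier ?D"
      proof
        fix x assume x: "x \<in> carrier M"
        then obtain y where y: "y \<in> I" "x \<ominus>\<^bsub>M\<^esub> y \<in> N" using sum by blast
        have "x = y \<oplus>\<^bsub>M\<^esub> (x \<ominus>\<^bsub>M\<^esub> y)" using x i(1)[OF y(1)] by (simp add: a_minus_def M.a_ac M.r_neg)
        then show "x \<in> ?s ` carrier ?D" using y by (intro image_eqI[of _ _ "(y, x \<ominus>\<^bsub>M\<^esub> y)"]) simp_all
      qed
    qed
  qed
  then obtain h where h: "h \<in> mod_hom R M ?D" "\<And>y. y \<in> carrier M \<Longrightarrow> ?s (h y) = y" "bij_betw h (carrier M) (carrier ?D)"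
    by (rule mod_hom_inverse[OF D M s]) (rule that)
  have "x = fst (h x) \<oplus>\<^bsub>M\<^esub> snd (h x)" if x: "x \<in> carrier M" for x
    using h(2)[OF x] mod_hom_closed[OF h(1) x] by simp
  then show thesis using that h(1,3) by blast
qed

context algebra_with_universe begin

lemma ksp_minus: "x \<ominus>\<^bsub>ksp M\<^esub> y = x \<ominus>\<^bsub>M\<^esub> y"
  by (simp add: a_minus_def a_inv_def m_inv_def)

text \<open>Fitting's lemma over \<open>K\<close> applies, and the kernel and image of a power of an \<open>A\<close>-linear map are
  submodules.\<close>

lemma fitting_decomposition:
  assumes M_fg: "fg_module A M" and f: "f \<in> mod_hom A M M"
  obtains n I N h where "submod A M I" "submod A M N" "bij_betw f I I"
    "N = {x \<in> carrier M. (f ^^ n) x = \<zero>\<^bsub>M\<^esub>}" "I = (f ^^ n) ` carrier M"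
    "h \<in> mod_hom A M (direct_sum (M\<lparr>carrier := I\<rparr>) (M\<lparr>carrier := N\<rparr>))"
    "bij_betw h (carrier M) (carrier (direct_sum (M\<lparr>carrier := I\<rparr>) (M\<lparr>carrier := N\<rparr>)))"
    "\<And>x. x \<in> carrier M \<Longrightarrow> x = fst (h x) \<oplus>\<^bsub>M\<^esub> snd (h x)"
proof -
  have M: "left_module A M" using M_fg by (rule fg_left_module)
  interpret M: left_module A M by fact
  have fin: "fin_span K (ksp M) (carrier (ksp M))" using fin_span_ksp[OF M_fg] by simp
  obtain n where n: "bij_betw f ((f ^^ n) ` carrier M) ((f ^^ n) ` carrier M)"
    and dec: "\<And>x. x \<in> carrier M \<Longrightarrow> \<exists>y\<in>(f ^^ n) ` carrier M. (f ^^ n) (x \<ominus>\<^bsub>M\<^esub> y) = \<zero>\<^bsub>M\<^esub>"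
    and int: "\<And>y. \<lbrakk>y \<in> (f ^^ n) ` carrier M; (f ^^ n) y = \<zero>\<^bsub>M\<^esub>\<rbrakk> \<Longrightarrow> y = \<zero>\<^bsub>M\<^esub>"
    using fitting[OF field_K left_module_ksp[OF M] fin mod_hom_ksp[OF f], unfolded ksp_simps ksp_minus] by metis
  define p where "p = (\<lambda>x\<in>carrier M. (f ^^ n) x)"
  have p: "p \<in> mod_hom A M M" unfolding p_def by (rule mod_hom_funpow[OF M f])
  define I where "I = (f ^^ n) ` carrier M"
  define N where "N = {x \<in> carrier M. (f ^^ n) x = \<zero>\<^bsub>M\<^esub>}"
  have "I = p ` carrier M" by (auto simp: I_def p_def)
  then have I: "submod A M I" using submod_image[OF M M p submod_carrier[OF M]] by simp
  have "N = a_kernel M M p" by (auto simp: N_def p_def a_kernel_def')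
  then have N: "submod A M N" using submod_kernel[OF M M p] by simp
  have 1: "\<exists>y\<in>I. x \<ominus>\<^bsub>M\<^esub> y \<in> N" if x: "x \<in> carrier M" for x
  proof -
    obtain y where y: "y \<in> I" "(f ^^ n) (x \<ominus>\<^bsub>M\<^esub> y) = \<zero>\<^bsub>M\<^esub>" using dec[OF x] unfolding I_def by blast
    have "x \<ominus>\<^bsub>M\<^esub> y \<in> carrier M" using x submod_sub[OF I y(1)] by simp
    then show ?thesis using y unfolding N_def by blast
  qed
  have 2: "y = \<zero>\<^bsub>M\<^esub>" if "y \<in> I" "y \<in> N" for y using int that unfolding I_def N_def by blast
  obtain h where h: "h \<in> mod_hom A M (direct_sum (M\<lparr>carrier := I\<rparr>) (M\<lparr>carrier := N\<rparr>))"
    "bij_betw h (carrier M) (carrier (direct_sum (M\<lparr>carrier := I\<rparr>) (M\<lparr>carrier := N\<rparr>)))"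
    "\<And>x. x \<in> carrier M \<Longrightarrow> x = fst (h x) \<oplus>\<^bsub>M\<^esub> snd (h x)"
    by (rule internal_direct_sum[OF M I N 1 2]) (assumption | rule that)+
  show thesis by (rule that[OF I N n[folded I_def] N_def I_def h])
qed

lemma fitting_indecomposable:
  assumes M_fg: "fg_module A M" and ind: "indecomposable A M" and f: "f \<in> mod_hom A M M"
  shows "bij_betw f (carrier M) (carrier M) \<or> (\<exists>n. \<forall>x\<in>carrier M. (f ^^ n) x = \<zero>\<^bsub>M\<^esub>)"
proof -
  have M: "left_module A M" using M_fg by (rule fg_left_module)
  interpret M: left_module A M by fact
  obtain n I N h where I: "submod A M I" and N: "submod A M N" and b: "bij_betw f I I"
    and N_def: "N = {x \<in> carrier M. (f ^^ n) x = \<zero>\<^bsub>M\<^esub>}" and I_def: "I = (f ^^ n) ` carrier M"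
    and h: "h \<in> mod_hom A M (direct_sum (M\<lparr>carrier := I\<rparr>) (M\<lparr>carrier := N\<rparr>))"
    "bij_betw h (carrier M) (carrier (direct_sum (M\<lparr>carrier := I\<rparr>) (M\<lparr>carrier := N\<rparr>)))"
    "\<And>x. x \<in> carrier M \<Longrightarrow> x = fst (h x) \<oplus>\<^bsub>M\<^esub> snd (h x)"
    by (rule fitting_decomposition[OF M_fg f]) (rule that)
  have IM: "left_module A (M\<lparr>carrier := I\<rparr>)" and NM: "left_module A (M\<lparr>carrier := N\<rparr>)"
    using left_module_submod[OF M] I N by auto
  have "mod_iso A M (direct_sum (M\<lparr>carrier := I\<rparr>) (M\<lparr>carrier := N\<rparr>))"
    unfolding mod_iso_def using M left_module_direct_sum[OF IM NM] h(1,2) by blast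
  then have "carrier (M\<lparr>carrier := I\<rparr>) = {\<zero>\<^bsub>M\<lparr>carrier := I\<rparr>\<^esub>} \<or> carrier (M\<lparr>carrier := N\<rparr>) = {\<zero>\<^bsub>M\<lparr>carrier := N\<rparr>\<^esub>}"
    using ind IM NM unfolding indecomposable_def by blast
  then consider "I = {\<zero>\<^bsub>M\<^esub>}" | "N = {\<zero>\<^bsub>M\<^esub>}" by auto
  then show ?thesis
  proof cases
    case 1
    then have "\<forall>x\<in>carrier M. (f ^^ n) x = \<zero>\<^bsub>M\<^esub>" using I_def by blast
    then show ?thesis by blast
  next
    case 2
    have "x \<in> I" if x: "x \<in> carrier M" for x
    proof -
      have "fst (h x) \<in> I" "snd (h x) \<in> N" using mod_hom_closed[OF h(1) x] by auto
      then show ?thesis using h(3)[OF x] 2 submod_sub[OF I] by simp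
    qed
    then have "I = carrier M" using submod_sub[OF I] by blast
    then show ?thesis using b by simp
  qed
qed

text \<open>This is the locality of the endomorphism ring. Otherwise \<open>f\<close> and \<open>g = 1 - f\<close> are both nilpotent.
  But \<open>g x = 0\<close> means \<open>f x = x\<close>, so \<open>x = 0\<close> as \<open>f\<close> is nilpotent. Thus \<open>g\<close> is injective as well as
  nilpotent, and the module is zero.\<close>

lemma indecomposable_local:
  assumes M_fg: "fg_module A M" and ind: "indecomposable A M"
    and f: "f \<in> mod_hom A M M" and g: "g \<in> mod_hom A M M"
    and sum: "\<And>x. x \<in> carrier M \<Longrightarrow> x = f x \<oplus>\<^bsub>M\<^esub> g x"
  shows "bij_betw f (carrier M) (carrier M) \<or> bij_betw g (carrier M) (carrier M)"
proof (rule ccontr)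
  have M: "left_module A M" using M_fg by (rule fg_left_module)
  interpret M: left_module A M by fact
  assume "\<not> ?thesis"
  then obtain n m where n: "\<And>x. x \<in> carrier M \<Longrightarrow> (f ^^ n) x = \<zero>\<^bsub>M\<^esub>" and m: "\<And>x. x \<in> carrier M \<Longrightarrow> (g ^^ m) x = \<zero>\<^bsub>M\<^esub>"
    using fitting_indecomposable[OF M_fg ind f] fitting_indecomposable[OF M_fg ind g] by blast
  have inj0: "x = \<zero>\<^bsub>M\<^esub>" if x: "x \<in> carrier M" "g x = \<zero>\<^bsub>M\<^esub>" for x
  proof -
    have fx: "f x = x" using sum[OF x(1)] x mod_hom_closed[OF f x(1)] by simp
    have "(f ^^ k) x = x" for k by (induction k) (use fx in auto)
    then show ?thesis using n[OF x(1)] by simp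
  qed
  have gk: "(g ^^ k) x \<in> carrier M" if "x \<in> carrier M" for k x
    by (induction k) (use that mod_hom_closed[OF g] in auto)
  have "x = \<zero>\<^bsub>M\<^esub>" if x: "x \<in> carrier M" "(g ^^ k) x = \<zero>\<^bsub>M\<^esub>" for x k
    using x(2)
  proof (induction k)
    case 0 then show ?case by simp
  next
    case (Suc k)
    then have "g ((g ^^ k) x) = \<zero>\<^bsub>M\<^esub>" by simp
    then show ?case using inj0[OF gk[OF x(1)]] Suc.IH by blast
  qed
  then have "carrier M = {\<zero>\<^bsub>M\<^esub>}" using m M.M.zero_closed by blast
  then show False using ind by (simp add: indecomposable_def)
qed

end

section \<open>Functionals with a minimal orbit\<close>

context transpose_data begin

text \<open>The functional \<open>\<delta> (a -)\<close>; in terms of extensions this is the pullback along \<open>a\<close>.\<close>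

definition pull :: "('a, 'm) module \<Rightarrow> ('m \<Rightarrow> 'm) \<Rightarrow> (('m \<Rightarrow> 'm) \<Rightarrow> 'k) \<Rightarrow> ('m \<Rightarrow> 'm) \<Rightarrow> 'k"
  where "pull M a \<delta> = (\<lambda>t\<in>mod_hom A T M. \<delta> (compose (carrier T) a t))"

lemma pull_apply [simp]: "t \<in> mod_hom A T M \<Longrightarrow> pull M a \<delta> t = \<delta> (compose (carrier T) a t)"
  by (simp add: pull_def)

lemma pull_hom:
  assumes M: "left_module A M" and C: "left_module A C" and a: "a \<in> mod_hom A M C"
    and \<delta>: "\<delta> \<in> mod_hom K (hom_space T C) (regular K)"
  shows "pull M a \<delta> \<in> mod_hom K (hom_space T M) (regular K)"
proof -
  have "compose (carrier (hom_space T M)) \<delta> (\<lambda>f\<in>mod_hom A T M. compose (carrier T) a f)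
      \<in> mod_hom K (hom_space T M) (regular K)"
    by (rule mod_hom_compose[OF left_module_hom_space[OF T_mod M] postcomp_hom[OF T_mod M C a] \<delta>])
  also have "compose (carrier (hom_space T M)) \<delta> (\<lambda>f\<in>mod_hom A T M. compose (carrier T) a f) = pull M a \<delta>"
    by (auto simp: pull_def compose_def)
  finally show ?thesis .
qed

lemma pull_linear:
  assumes M: "left_module A M" and C: "left_module A C" and \<delta>: "\<delta> \<in> mod_hom K (hom_space T C) (regular K)"
  shows "(\<lambda>a\<in>mod_hom A M C. pull M a \<delta>) \<in> mod_hom K (hom_space M C) (dual_space (hom_space T M))"
proof -
  have cl: "compose (carrier T) a t \<in> mod_hom A T C" if "a \<in> mod_hom A M C" "t \<in> mod_hom A T M" for a t
    by (rule mod_hom_compose[OF T_mod that(2,1)])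
  have "(\<lambda>a\<in>carrier (hom_space M C). pull M a \<delta>) \<in> mod_hom K (hom_space M C) (dual_space (hom_space T M))"
  proof (rule mod_homI[OF _ _ _ left_module_hom_space[OF M C]])
    fix a assume "a \<in> carrier (hom_space M C)"
    then have a: "a \<in> mod_hom A M C" by simp
    show "pull M a \<delta> \<in> carrier (dual_space (hom_space T M))" using pull_hom[OF M C a \<delta>] by simp
    show "pull M (c \<odot>\<^bsub>hom_space M C\<^esub> a) \<delta> = c \<odot>\<^bsub>dual_space (hom_space T M)\<^esub> pull M a \<delta>" if c: "c \<in> carrier K" for c
    proof (rule extensionalityI[of _ "mod_hom A T M"])
      fix t assume t: "t \<in> mod_hom A T M"
      have "compose (carrier T) (c \<odot>\<^bsub>hom_space M C\<^esub> a) t = c \<odot>\<^bsub>hom_space T C\<^esub> compose (carrier T) a t"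
        using mod_hom_closed[OF t] by (auto simp: compose_def)
      then show "pull M (c \<odot>\<^bsub>hom_space M C\<^esub> a) \<delta> t = (c \<odot>\<^bsub>dual_space (hom_space T M)\<^esub> pull M a \<delta>) t"
        using t mod_hom_smult[OF \<delta> c, of "compose (carrier T) a t"] cl[OF a t] by simp
    qed (auto simp: pull_def)
    fix b assume "b \<in> carrier (hom_space M C)"
    then have b: "b \<in> mod_hom A M C" by simp
    show "pull M (a \<oplus>\<^bsub>hom_space M C\<^esub> b) \<delta> = pull M a \<delta> \<oplus>\<^bsub>dual_space (hom_space T M)\<^esub> pull M b \<delta>"
    proof (rule extensionalityI[of _ "mod_hom A T M"])
      fix t assume t: "t \<in> mod_hom A T M"
      have "compose (carrier T) (a \<oplus>\<^bsub>hom_space M C\<^esub> b) t = compose (carrier T) a t \<oplus>\<^bsub>hom_space T C\<^esub> compose (carrier T) b t"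
        using mod_hom_closed[OF t] by (auto simp: compose_def)
      then show "pull M (a \<oplus>\<^bsub>hom_space M C\<^esub> b) \<delta> t = (pull M a \<delta> \<oplus>\<^bsub>dual_space (hom_space T M)\<^esub> pull M b \<delta>) t"
        using t mod_hom_add[OF \<delta>, of "compose (carrier T) a t" "compose (carrier T) b t"] cl[OF a t] cl[OF b t] by simp
    qed (auto simp: pull_def)
  qed
  then show ?thesis by simp
qed

lemma compose_id_left: "t \<in> mod_hom A M C \<Longrightarrow> compose (carrier M) (mod_id C) t = t"
  by (rule extensionalityI[of _ "carrier M"])
    (auto simp: compose_eq mod_id_apply mod_hom_closed dest: mod_hom_extensional)

text \<open>For finitely generated \<open>C\<close> the Auslander-Reiten formula identifies these functionals with the
  nonzero elements of \<open>Ext\<^sup>1 (C, L)\<close>.\<close>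

definition stable_functional :: "('a, 'm) module \<Rightarrow> (('m \<Rightarrow> 'm) \<Rightarrow> 'k) \<Rightarrow> bool"
  where "stable_functional C \<delta> \<longleftrightarrow> \<delta> \<in> mod_hom K (hom_space T C) (regular K) \<and>
    (\<forall>p\<in>proj_factor A T C. \<delta> p = \<zero>\<^bsub>K\<^esub>) \<and> (\<exists>t\<in>mod_hom A T C. \<delta> t \<noteq> \<zero>\<^bsub>K\<^esub>)"

text \<open>After any map \<open>b : M \<rightarrow> C\<close> that does not kill \<open>\<delta>\<close> one can return to \<open>\<delta>\<close> by some \<open>a : C \<rightarrow> M\<close>. For
  \<open>M = C\<close> this says that \<open>\<delta>\<close> generates a simple module over the endomorphism ring of \<open>C\<close>.\<close>

definition recurrent :: "('a, 'm) module set \<Rightarrow> ('a, 'm) module \<Rightarrow> (('m \<Rightarrow> 'm) \<Rightarrow> 'k) \<Rightarrow> bool"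
  where "recurrent \<L> C \<delta> \<longleftrightarrow> C \<in> \<L> \<and> stable_functional C \<delta> \<and>
    (\<forall>M\<in>\<L>. \<forall>b\<in>mod_hom A M C. (\<exists>t\<in>mod_hom A T M. \<delta> (compose (carrier T) b t) \<noteq> \<zero>\<^bsub>K\<^esub>) \<longrightarrow>
      (\<exists>a\<in>mod_hom A C M. \<forall>s\<in>mod_hom A T C. \<delta> (compose (carrier T) (compose (carrier C) b a) s) = \<delta> s))"

text \<open>Every functional on some \<open>Hom (T, U)\<close> that kills the maps through projectives and is nonzero at
  \<open>h = p + a c\<close> is also nonzero at \<open>a c\<close>. So it pulls back along \<open>a : C \<rightarrow> U\<close> to a functional that is
  nonzero at \<open>c\<close>. This is applied to \<open>\<xi>0\<close> to see that \<open>C\<close> carries such functionals at all, and to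
  \<open>\<delta> (b -)\<close>, where \<open>\<delta>\<close> has an orbit \<open>S \<delta>\<close> under \<open>End (C)\<close> of minimal dimension. In the latter case
  \<open>\<delta>' = \<delta> (b a -)\<close> is nonzero with \<open>S \<delta>' \<subseteq> S \<delta>\<close>, so the two orbits agree and \<open>\<delta>\<close> itself is of the
  form \<open>\<delta>' (\<theta>' -)\<close>.\<close>

lemma recurrent_exists:
  assumes \<L>: "\<L> \<subseteq> {M. fg_module A M}" and C: "C \<in> \<L>" and c: "c \<in> mod_hom A T C"
    and env: "\<And>U h. U \<in> \<L> \<Longrightarrow> h \<in> mod_hom A T U \<Longrightarrow> \<exists>a\<in>mod_hom A C U. \<exists>p\<in>proj_factor A T U.
      h = p \<oplus>\<^bsub>hom_space T U\<^esub> compose (carrier T) a c"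
    and M0: "M0 \<in> \<L>" "stable_functional M0 \<xi>0"
  obtains \<delta> where "recurrent \<L> C \<delta>"
proof -
  have fg: "fg_module A U" and lm: "left_module A U" if "U \<in> \<L>" for U
    using that \<L> fg_left_module by auto
  have Cm: "left_module A C" by (rule lm[OF C])
  have pfh: "p \<in> mod_hom A T U" if "U \<in> \<L>" "p \<in> proj_factor A T U" for p U
    using submod_sub[OF submod_proj_factor[OF T_mod fg[OF that(1)]] that(2)] by simp
  have through_c: "\<exists>a\<in>mod_hom A C U. \<xi> (compose (carrier T) a c) = \<xi> h"
    if U: "U \<in> \<L>" and \<xi>: "\<xi> \<in> mod_hom K (hom_space T U) (regular K)"
      and z: "\<And>p. p \<in> proj_factor A T U \<Longrightarrow> \<xi> p = \<zero>\<^bsub>K\<^esub>" and h: "h \<in> mod_hom A T U" for U \<xi> h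
  proof -
    obtain a p where a: "a \<in> mod_hom A C U" "p \<in> proj_factor A T U" "h = p \<oplus>\<^bsub>hom_space T U\<^esub> compose (carrier T) a c"
      using env[OF U h] by (elim bexE) (rule that; assumption)
    have ac: "compose (carrier T) a c \<in> mod_hom A T U" by (rule mod_hom_compose[OF T_mod c a(1)])
    have "\<xi> h = \<xi> p \<oplus>\<^bsub>K\<^esub> \<xi> (compose (carrier T) a c)"
      unfolding a(3) using mod_hom_add[OF \<xi>, of p "compose (carrier T) a c"] pfh[OF U a(2)] ac by simp
    then have "\<xi> (compose (carrier T) a c) = \<xi> h" using z[OF a(2)] mod_hom_closed[OF \<xi>, of "compose (carrier T) a c"] ac by simp
    then show ?thesis using a(1) by blast
  qed
  have pullz: "pull C a \<xi> p = \<zero>\<^bsub>K\<^esub>"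
    if "U \<in> \<L>" "\<And>p. p \<in> proj_factor A T U \<Longrightarrow> \<xi> p = \<zero>\<^bsub>K\<^esub>" "a \<in> mod_hom A C U" "p \<in> proj_factor A T C" for U \<xi> a p
    using pfh[OF C that(4)] that(2)[OF proj_factor_postcomp[OF T_mod that(4,3)]] by simp
  define S where "S \<delta> = (\<lambda>a\<in>mod_hom A C C. pull C a \<delta>) ` mod_hom A C C" for \<delta>
  let ?DS = "dual_space (hom_space T C)"
  note HS = left_module_hom_space[OF T_mod Cm] and HC = left_module_hom_space[OF Cm Cm]
  note DS = left_module_dual_space[OF HS]
  have finD: "fin_span K ?DS (carrier ?DS)"
    using fin_span_dual_space[OF HS] fin_span_hom_space[OF T_fg fg[OF C]] by simp
  have S: "submod K ?DS (S \<delta>)" if "\<delta> \<in> mod_hom K (hom_space T C) (regular K)" for \<delta>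
    unfolding S_def using submod_image[OF HC DS pull_linear[OF Cm Cm that] submod_carrier[OF HC]] by simp
  have "\<exists>\<delta>. stable_functional C \<delta>"
  proof -
    obtain h where \<xi>0: "\<xi>0 \<in> mod_hom K (hom_space T M0) (regular K)" "\<And>p. p \<in> proj_factor A T M0 \<Longrightarrow> \<xi>0 p = \<zero>\<^bsub>K\<^esub>"
      and h: "h \<in> mod_hom A T M0" "\<xi>0 h \<noteq> \<zero>\<^bsub>K\<^esub>"
      using M0(2) unfolding stable_functional_def by blast
    obtain a where a: "a \<in> mod_hom A C M0" "\<xi>0 (compose (carrier T) a c) = \<xi>0 h"
      using through_c[OF M0(1) \<xi>0 h(1)] by blast
    have pz: "pull C a \<xi>0 p = \<zero>\<^bsub>K\<^esub>" if "p \<in> proj_factor A T C" for p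
      by (rule pullz[OF M0(1) _ a(1) that]) (rule \<xi>0(2))
    have "pull C a \<xi>0 c \<noteq> \<zero>\<^bsub>K\<^esub>" using a(2) h(2) c by simp
    then have "stable_functional C (pull C a \<xi>0)"
      unfolding stable_functional_def
      using pull_hom[OF Cm lm[OF M0(1)] a(1) \<xi>0(1)] pz c by blast
    then show ?thesis by blast
  qed
  then obtain \<delta> where \<delta>: "stable_functional C \<delta>"
    and min: "\<And>\<delta>'. stable_functional C \<delta>' \<Longrightarrow> vdim K ?DS (S \<delta>) \<le> vdim K ?DS (S \<delta>')"
    using ex_has_least_nat[of "stable_functional C" _ "\<lambda>\<delta>. vdim K ?DS (S \<delta>)"] by metis
  have \<delta>h: "\<delta> \<in> mod_hom K (hom_space T C) (regular K)" and \<delta>z: "\<And>p. p \<in> proj_factor A T C \<Longrightarrow> \<delta> p = \<zero>\<^bsub>K\<^esub>"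
    using \<delta> unfolding stable_functional_def by auto
  have "\<exists>a\<in>mod_hom A C M. \<forall>s\<in>mod_hom A T C. \<delta> (compose (carrier T) (compose (carrier C) b a) s) = \<delta> s"
    if M: "M \<in> \<L>" and b: "b \<in> mod_hom A M C" and t: "t \<in> mod_hom A T M" "\<delta> (compose (carrier T) b t) \<noteq> \<zero>\<^bsub>K\<^esub>" for M b t
  proof -
    have Mm: "left_module A M" by (rule lm[OF M])
    have bz: "pull M b \<delta> p = \<zero>\<^bsub>K\<^esub>" if "p \<in> proj_factor A T M" for p
      using pfh[OF M that] \<delta>z[OF proj_factor_postcomp[OF T_mod that b]] by simp
    obtain a where a: "a \<in> mod_hom A C M" "pull M b \<delta> (compose (carrier T) a c) = pull M b \<delta> t"
      using through_c[OF M pull_hom[OF Mm Cm b \<delta>h] bz t(1)] by blast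
    define \<theta> where "\<theta> = compose (carrier C) b a"
    have \<theta>: "\<theta> \<in> mod_hom A C C" unfolding \<theta>_def by (rule mod_hom_compose[OF Cm a(1) b])
    have \<theta>c: "\<delta> (compose (carrier T) \<theta> c) \<noteq> \<zero>\<^bsub>K\<^esub>"
      using a(2) t mod_hom_compose[OF T_mod c a(1)] compose_assoc_hom[OF c, of b a] by (simp add: \<theta>_def)
    let ?\<delta>' = "pull C \<theta> \<delta>"
    have pz: "?\<delta>' p = \<zero>\<^bsub>K\<^esub>" if "p \<in> proj_factor A T C" for p
      by (rule pullz[OF C _ \<theta> that]) (rule \<delta>z)
    have "?\<delta>' c \<noteq> \<zero>\<^bsub>K\<^esub>" using \<theta>c c by simp
    then have \<delta>': "stable_functional C ?\<delta>'"
      unfolding stable_functional_def using pull_hom[OF Cm Cm \<theta> \<delta>h] pz c by blast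
    have \<delta>'h: "?\<delta>' \<in> mod_hom K (hom_space T C) (regular K)" by (rule pull_hom[OF Cm Cm \<theta> \<delta>h])
    have pp: "pull C \<theta>' ?\<delta>' = pull C (compose (carrier C) \<theta> \<theta>') \<delta>" if "\<theta>' \<in> mod_hom A C C" for \<theta>'
    proof (rule extensionalityI[of _ "mod_hom A T C"])
      fix s assume s: "s \<in> mod_hom A T C"
      show "pull C \<theta>' ?\<delta>' s = pull C (compose (carrier C) \<theta> \<theta>') \<delta> s"
        using s mod_hom_compose[OF T_mod s that] compose_assoc_hom[OF s, of \<theta> \<theta>'] by simp
    qed (auto simp: pull_def)
    have sub: "S ?\<delta>' \<subseteq> S \<delta>"
    proof
      fix z assume "z \<in> S ?\<delta>'"
      then obtain \<theta>' where \<theta>': "\<theta>' \<in> mod_hom A C C" "z = pull C \<theta>' ?\<delta>'" unfolding S_def by auto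
      then show "z \<in> S \<delta>" using pp[OF \<theta>'(1)] mod_hom_compose[OF Cm \<theta>'(1) \<theta>] unfolding S_def by auto
    qed
    have Sfin: "fin_span K ?DS (S \<delta>)"
      by (rule fin_span_subspace[OF field_K DS finD S[OF \<delta>h]]) (use submod_sub[OF S[OF \<delta>h]] in blast)
    have "S ?\<delta>' = S \<delta>"
      using vdim_proper_subspace[OF field_K DS Sfin S[OF \<delta>'h]] sub min[OF \<delta>'] by fastforce
    moreover have "\<delta> \<in> S \<delta>"
    proof -
      have "pull C (mod_id C) \<delta> = \<delta>"
        by (rule extensionalityI[of _ "mod_hom A T C"])
          (use mod_hom_extensional[OF \<delta>h] in \<open>auto simp: compose_id_left pull_def\<close>)
      then show ?thesis unfolding S_def using mod_hom_id[OF Cm] by (intro image_eqI[of _ _ "mod_id C"]) simp_all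
    qed
    ultimately obtain \<theta>' where \<theta>': "\<theta>' \<in> mod_hom A C C" "\<delta> = pull C \<theta>' ?\<delta>'" unfolding S_def by auto
    let ?a = "compose (carrier C) a \<theta>'"
    have a': "?a \<in> mod_hom A C M" by (rule mod_hom_compose[OF Cm \<theta>'(1) a(1)])
    have "compose (carrier C) b ?a = compose (carrier C) \<theta> \<theta>'"
      unfolding \<theta>_def by (rule compose_assoc_hom[OF \<theta>'(1)])
    moreover have "\<delta> (compose (carrier T) (compose (carrier C) \<theta> \<theta>') s) = \<delta> s" if s: "s \<in> mod_hom A T C" for s
      using fun_cong[OF \<theta>'(2), of s] fun_cong[OF pp[OF \<theta>'(1)], of s] s by simp
    ultimately show ?thesis using a' by (intro bexI[of _ ?a]) auto
  qed
  then have "recurrent \<L> C \<delta>" unfolding recurrent_def using C \<delta> by blast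
  then show thesis by (rule that)
qed

end

lemma iterate_fixed:
  assumes "\<And>s. s \<in> B \<Longrightarrow> \<phi> s \<in> B" "\<And>s. s \<in> B \<Longrightarrow> \<delta> (\<phi> s) = \<delta> s" "s \<in> B"
  shows "\<delta> ((\<phi> ^^ n) s) = \<delta> s"
proof -
  have "(\<phi> ^^ n) s \<in> B \<and> \<delta> ((\<phi> ^^ n) s) = \<delta> s" by (induction n) (use assms in auto)
  then show ?thesis by simp
qed

context transpose_data begin

text \<open>Choose \<open>C\<close> of minimal dimension among the modules with a recurrent functional. If \<open>\<delta> (\<phi> -) = \<delta>\<close>,
  then \<open>\<delta>\<close> vanishes on maps into the part \<open>N\<close> of \<open>C\<close> on which \<open>\<phi>\<close> is nilpotent, so it is determined
  by its restriction to maps into the Fitting complement \<open>I\<close>, and that restriction is again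
  recurrent. By minimality \<open>I = C\<close>.\<close>

lemma recurrent_minimal:
  assumes \<L>: "\<L> \<subseteq> {M. fg_module A M}" and summands: "closed_under_summands A \<L>"
    and rec: "recurrent \<L> C0 \<delta>0"
  obtains C \<delta> where "recurrent \<L> C \<delta>"
    "\<forall>\<phi>\<in>mod_hom A C C. (\<forall>s\<in>mod_hom A T C. \<delta> (compose (carrier T) \<phi> s) = \<delta> s) \<longrightarrow>
      bij_betw \<phi> (carrier C) (carrier C)"
proof -
  define P where "P p \<longleftrightarrow> recurrent \<L> (fst p) (snd p)" for p
  have "P (C0, \<delta>0)" using rec by (simp add: P_def)
  then obtain p where "P p" and minp: "\<And>p'. P p' \<Longrightarrow>
      vdim K (ksp (fst p)) (carrier (fst p)) \<le> vdim K (ksp (fst p')) (carrier (fst p'))"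
    using ex_has_least_nat[of P _ "\<lambda>p. vdim K (ksp (fst p)) (carrier (fst p))"] by metis
  then obtain C \<delta> where rec: "recurrent \<L> C \<delta>"
    and min: "\<And>C' \<delta>'. recurrent \<L> C' \<delta>' \<Longrightarrow> vdim K (ksp C) (carrier C) \<le> vdim K (ksp C') (carrier C')"
    unfolding P_def by (metis fst_conv snd_conv)
  have C: "C \<in> \<L>" and \<delta>: "\<delta> \<in> mod_hom K (hom_space T C) (regular K)"
    and \<delta>z: "\<And>p. p \<in> proj_factor A T C \<Longrightarrow> \<delta> p = \<zero>\<^bsub>K\<^esub>"
    using rec unfolding recurrent_def stable_functional_def by auto
  obtain t0 where t0: "t0 \<in> mod_hom A T C" "\<delta> t0 \<noteq> \<zero>\<^bsub>K\<^esub>"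
    using rec unfolding recurrent_def stable_functional_def by blast
  have rec': "\<exists>a\<in>mod_hom A C M. \<forall>s\<in>mod_hom A T C. \<delta> (compose (carrier T) (compose (carrier C) b a) s) = \<delta> s"
    if "M \<in> \<L>" "b \<in> mod_hom A M C" "t \<in> mod_hom A T M" "\<delta> (compose (carrier T) b t) \<noteq> \<zero>\<^bsub>K\<^esub>" for M b t
    using rec that unfolding recurrent_def by blast
  have Cfg: "fg_module A C" using C \<L> by auto
  have Cm: "left_module A C" using Cfg by (rule fg_left_module)
  interpret C: left_module A C by (rule Cm)
  have "bij_betw \<phi> (carrier C) (carrier C)"
    if \<phi>: "\<phi> \<in> mod_hom A C C" and inv\<phi>: "\<And>s. s \<in> mod_hom A T C \<Longrightarrow> \<delta> (compose (carrier T) \<phi> s) = \<delta> s" for \<phi>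
  proof -
    obtain n I N h where I: "submod A C I" and N: "submod A C N" and bI: "bij_betw \<phi> I I"
      and N_def: "N = {x \<in> carrier C. (\<phi> ^^ n) x = \<zero>\<^bsub>C\<^esub>}" and I_def: "I = (\<phi> ^^ n) ` carrier C"
      and h: "h \<in> mod_hom A C (direct_sum (C\<lparr>carrier := I\<rparr>) (C\<lparr>carrier := N\<rparr>))"
      "bij_betw h (carrier C) (carrier (direct_sum (C\<lparr>carrier := I\<rparr>) (C\<lparr>carrier := N\<rparr>)))"
      "\<And>x. x \<in> carrier C \<Longrightarrow> x = fst (h x) \<oplus>\<^bsub>C\<^esub> snd (h x)"
      by (rule fitting_decomposition[OF Cfg \<phi>]) (rule that)
    let ?I = "C\<lparr>carrier := I\<rparr>" and ?N = "C\<lparr>carrier := N\<rparr>"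
    have Im: "left_module A ?I" and Nm: "left_module A ?N" using left_module_submod[OF Cm] I N by auto
    have hc: "fst (h x) \<in> I" "snd (h x) \<in> N" if "x \<in> carrier C" for x
      using mod_hom_closed[OF h(1) that] by auto
    have Ic: "x \<in> carrier C" if "x \<in> I" for x using submod_sub[OF I that] .
    have Nc: "x \<in> carrier C" if "x \<in> N" for x using submod_sub[OF N that] .
    have "direct_summand A ?I C"
      unfolding direct_summand_def mod_iso_def using Im Nm Cm left_module_direct_sum[OF Im Nm] h(1,2) by blast
    then have IL: "?I \<in> \<L>" using summands C unfolding closed_under_summands_def by blast
    let ?i = "\<lambda>x\<in>I. x"
    have i: "?i \<in> mod_hom A ?I C" by (rule mod_hom_incl[OF Cm I])
    let ?pI = "\<lambda>x\<in>carrier C. fst (h x)" and ?pN = "\<lambda>x\<in>carrier C. snd (h x)"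
    have hadd: "h (x \<oplus>\<^bsub>C\<^esub> y) = (fst (h x) \<oplus>\<^bsub>C\<^esub> fst (h y), snd (h x) \<oplus>\<^bsub>C\<^esub> snd (h y))"
      if "x \<in> carrier C" "y \<in> carrier C" for x y
      using mod_hom_add[OF h(1) that] by (cases "h x"; cases "h y") simp
    have hsm: "h (a \<odot>\<^bsub>C\<^esub> x) = (a \<odot>\<^bsub>C\<^esub> fst (h x), a \<odot>\<^bsub>C\<^esub> snd (h x))" if "a \<in> carrier A" "x \<in> carrier C" for a x
      using mod_hom_smult[OF h(1) that] by (cases "h x") simp
    have pI: "?pI \<in> mod_hom A C ?I" by (rule mod_homI[OF _ _ _ Cm]) (use hc in \<open>simp_all add: hadd hsm\<close>)
    have pN: "?pN \<in> mod_hom A C C" by (rule mod_homI[OF _ _ _ Cm]) (use hc Nc in \<open>simp_all add: hadd hsm\<close>)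
    have pIC: "?pI \<in> mod_hom A C C" by (rule mod_homI[OF _ _ _ Cm]) (use hc Ic in \<open>simp_all add: hadd hsm\<close>)
    note H = left_module_hom_space[OF T_mod Cm]
    \<comment> \<open>\<open>\<delta>\<close> vanishes on maps into the part of \<open>C\<close> on which \<open>\<phi>\<close> is nilpotent\<close>
    have Nz: "\<delta> s = \<zero>\<^bsub>K\<^esub>" if s: "s \<in> mod_hom A T C" "\<And>x. x \<in> carrier T \<Longrightarrow> s x \<in> N" for s
    proof -
      let ?\<Phi> = "\<lambda>s. compose (carrier T) \<phi> s"
      have it: "(?\<Phi> ^^ k) s \<in> mod_hom A T C \<and> (\<forall>x\<in>carrier T. (?\<Phi> ^^ k) s x = (\<phi> ^^ k) (s x))" for k
        by (induction k) (use s mod_hom_compose[OF T_mod _ \<phi>] in \<open>auto simp: compose_eq\<close>)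
      have "\<delta> s = \<delta> ((?\<Phi> ^^ n) s)"
        using iterate_fixed[of "mod_hom A T C" ?\<Phi> \<delta> s n] mod_hom_compose[OF T_mod _ \<phi>] inv\<phi> s(1) by simp
      also have "(?\<Phi> ^^ n) s = (\<lambda>x\<in>carrier T. \<zero>\<^bsub>C\<^esub>)"
        using it[of n] s(2) by (intro mod_hom_eqI[OF _ hom_zero_in[OF T_mod Cm]]) (auto simp: N_def)
      also have "\<delta> (\<lambda>x\<in>carrier T. \<zero>\<^bsub>C\<^esub>) = \<zero>\<^bsub>K\<^esub>" using mod_hom_zero[OF H regular_K_module \<delta>] by simp
      finally show ?thesis .
    qed
    have \<delta>I: "\<delta> t = \<delta> (compose (carrier T) ?i (compose (carrier T) ?pI t))" if t: "t \<in> mod_hom A T C" for t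
    proof -
      have tc: "t x \<in> carrier C" if "x \<in> carrier T" for x by (rule mod_hom_closed[OF t that])
      have n1: "compose (carrier T) ?pN t \<in> mod_hom A T C" by (rule mod_hom_compose[OF T_mod t pN])
      have i1: "compose (carrier T) ?i (compose (carrier T) ?pI t) \<in> mod_hom A T C"
        by (rule mod_hom_compose[OF T_mod mod_hom_compose[OF T_mod t pI] i])
      have "t = compose (carrier T) ?i (compose (carrier T) ?pI t) \<oplus>\<^bsub>hom_space T C\<^esub> compose (carrier T) ?pN t"
      proof (rule extensionalityI[of _ "carrier T"])
        fix x assume x: "x \<in> carrier T"
        show "t x = (compose (carrier T) ?i (compose (carrier T) ?pI t) \<oplus>\<^bsub>hom_space T C\<^esub> compose (carrier T) ?pN t) x"
          using x h(3)[OF tc[OF x]] tc[OF x] hc[OF tc[OF x]] by (simp add: compose_eq)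
      qed (use mod_hom_extensional[OF t] in auto)
      then have "\<delta> t = \<delta> (compose (carrier T) ?i (compose (carrier T) ?pI t)) \<oplus>\<^bsub>K\<^esub> \<delta> (compose (carrier T) ?pN t)"
        using mod_hom_add[OF \<delta>, of "compose (carrier T) ?i (compose (carrier T) ?pI t)" "compose (carrier T) ?pN t"] n1 i1
        by simp
      moreover have "\<delta> (compose (carrier T) ?pN t) = \<zero>\<^bsub>K\<^esub>"
        by (rule Nz[OF n1]) (use tc hc in \<open>simp add: compose_eq\<close>)
      ultimately show ?thesis using mod_hom_closed[OF \<delta>, of "compose (carrier T) ?i (compose (carrier T) ?pI t)"] i1 by simp
    qed
    let ?\<delta>' = "pull ?I ?i \<delta>"
    have "recurrent \<L> ?I ?\<delta>'"
      unfolding recurrent_def stable_functional_def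
    proof (intro conjI IL ballI impI)
      show "?\<delta>' \<in> mod_hom K (hom_space T ?I) (regular K)" by (rule pull_hom[OF Im Cm i \<delta>])
      show "?\<delta>' p = \<zero>\<^bsub>K\<^esub>" if p: "p \<in> proj_factor A T ?I" for p
      proof -
        have Ifg: "fg_module A ?I" using IL \<L> by blast
        have "p \<in> mod_hom A T ?I" using submod_sub[OF submod_proj_factor[OF T_mod Ifg] p] by simp
        then show ?thesis using \<delta>z[OF proj_factor_postcomp[OF T_mod p i]] by simp
      qed
      show "\<exists>t\<in>mod_hom A T ?I. ?\<delta>' t \<noteq> \<zero>\<^bsub>K\<^esub>"
        using \<delta>I[OF t0(1)] t0(2) mod_hom_compose[OF T_mod t0(1) pI]
        by (intro bexI[of _ "compose (carrier T) ?pI t0"]) simp_all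
      fix M b assume M: "M \<in> \<L>" and b: "b \<in> mod_hom A M ?I"
        and "\<exists>t\<in>mod_hom A T M. ?\<delta>' (compose (carrier T) b t) \<noteq> \<zero>\<^bsub>K\<^esub>"
      then obtain t where t: "t \<in> mod_hom A T M" "?\<delta>' (compose (carrier T) b t) \<noteq> \<zero>\<^bsub>K\<^esub>" by blast
      have Mm: "left_module A M" using M \<L> fg_left_module by blast
      have ib: "compose (carrier M) ?i b \<in> mod_hom A M C" by (rule mod_hom_compose[OF Mm b i])
      have "\<delta> (compose (carrier T) (compose (carrier M) ?i b) t) \<noteq> \<zero>\<^bsub>K\<^esub>"
        using t(2) mod_hom_compose[OF T_mod t(1) b] compose_assoc_hom[OF t(1), of ?i b] by simp
      then obtain a where a: "a \<in> mod_hom A C M"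
        "\<And>s. s \<in> mod_hom A T C \<Longrightarrow> \<delta> (compose (carrier T) (compose (carrier C) (compose (carrier M) ?i b) a) s) = \<delta> s"
        using rec'[OF M ib t(1)] by blast
      have ai: "compose I a ?i \<in> mod_hom A ?I M" using mod_hom_compose[OF Im i a(1)] by simp
      have "?\<delta>' (compose (carrier T) (compose (carrier ?I) b (compose I a ?i)) s) = ?\<delta>' s"
        if s: "s \<in> mod_hom A T ?I" for s
      proof -
        have bai: "compose (carrier ?I) b (compose I a ?i) \<in> mod_hom A ?I ?I"
          using mod_hom_compose[OF Im ai b] by simp
        have ist: "compose (carrier T) ?i s \<in> mod_hom A T C" by (rule mod_hom_compose[OF T_mod s i])
        have "compose (carrier T) ?i (compose (carrier T) (compose (carrier ?I) b (compose I a ?i)) s)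
            = compose (carrier T) (compose (carrier C) (compose (carrier M) ?i b) a) (compose (carrier T) ?i s)"
          using mod_hom_closed[OF s] Ic mod_hom_closed[OF a(1)] by (auto simp: compose_def)
        then show ?thesis using a(2)[OF ist] s mod_hom_compose[OF T_mod s bai] by simp
      qed
      then show "\<exists>a\<in>mod_hom A ?I M. \<forall>s\<in>mod_hom A T ?I. ?\<delta>' (compose (carrier T) (compose (carrier ?I) b a) s) = ?\<delta>' s"
        using ai by blast
    qed
    then have le: "vdim K (ksp C) (carrier C) \<le> vdim K (ksp ?I) I" using min by fastforce
    note KC = left_module_ksp[OF Cm]
    have finC: "fin_span K (ksp C) (carrier C)" by (rule fin_span_ksp[OF Cfg])
    have finI: "fin_span K (ksp C) I"
      by (rule fin_span_subspace[OF field_K KC finC submod_ksp[OF I]]) (use Ic in blast)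
    obtain vs where vs: "length vs = vdim K (ksp C) I" "set vs \<subseteq> carrier (ksp C)" "lspan K (ksp C) vs = I"
      by (rule vdim_attained[OF finI]) (rule that)
    have "vdim K (ksp ?I) I \<le> length vs"
    proof (rule vdim_le)
      show "set vs \<subseteq> carrier (ksp ?I)" using lspan_superset[OF KC vs(2)] vs(3) by simp
      show "lspan K (ksp ?I) vs = I" using lspan_cong[of "ksp ?I" "ksp C" K vs] vs(3)
        by (simp add: ksp_carrier_update)
    qed
    then have "\<not> I \<subset> carrier C"
      using le vs(1) vdim_proper_subspace[OF field_K KC finC submod_ksp[OF I]] by linarith
    then have "I = carrier C" using Ic by blast
    then show ?thesis using bI by simp
  qed
  then show thesis using that rec by blast
qed

section \<open>The two implications\<close>

text \<open>The sequence is the extension with connecting functional \<open>\<delta>\<close>. A map into \<open>C\<close> that does not lift to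
  \<open>B\<close> does not kill \<open>\<delta>\<close>, so \<open>C\<close> can be recovered from it. For the right almost split property this
  makes the map a split epimorphism; for the left one it is applied to the pushout \<open>\<pi> : B' \<rightarrow> C\<close>
  along \<open>h\<close>.\<close>

lemma AR_sequence_of_recurrent:
  assumes \<L>: "\<L> \<subseteq> {M. fg_module A M}" and ext: "closed_under_extensions A \<L>"
    and L: "L \<in> \<L>" "indecomposable A L" and rec: "recurrent \<L> C \<delta>"
    and bij: "\<forall>\<phi>\<in>mod_hom A C C. (\<forall>s\<in>mod_hom A T C. \<delta> (compose (carrier T) \<phi> s) = \<delta> s) \<longrightarrow>
      bij_betw \<phi> (carrier C) (carrier C)"
  shows "\<exists>B g f. AR_sequence A \<L> L g B f C"
proof -
  have fg: "fg_module A U" and lm: "left_module A U" if "U \<in> \<L>" for U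
    using that \<L> fg_left_module by auto
  have C: "C \<in> \<L>" and \<delta>: "\<delta> \<in> mod_hom K (hom_space T C) (regular K)"
    and \<delta>z: "\<And>p. p \<in> proj_factor A T C \<Longrightarrow> \<delta> p = \<zero>\<^bsub>K\<^esub>"
    using rec unfolding recurrent_def stable_functional_def by auto
  obtain t0 where t0: "t0 \<in> mod_hom A T C" "\<delta> t0 \<noteq> \<zero>\<^bsub>K\<^esub>"
    using rec unfolding recurrent_def stable_functional_def by blast
  have rec': "\<exists>a\<in>mod_hom A C M. \<forall>s\<in>mod_hom A T C. \<delta> (compose (carrier T) (compose (carrier C) b a) s) = \<delta> s"
    if "M \<in> \<L>" "b \<in> mod_hom A M C" "t \<in> mod_hom A T M" "\<delta> (compose (carrier T) b t) \<noteq> \<zero>\<^bsub>K\<^esub>" for M b t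
    using rec that unfolding recurrent_def by blast
  have Cm: "left_module A C" by (rule lm[OF C])
  obtain B :: "('a, 'm) module" and g f where Bfg: "fg_module A B" and E: "short_exact A L g B f C"
    and con: "connecting g B f C \<delta>"
    by (rule connecting_realize[OF fg[OF C] \<delta> \<delta>z]) (assumption | rule that)+
  have Bm: "left_module A B" using Bfg by (rule fg_left_module)
  have B: "B \<in> \<L>" using ext L(1) C Bfg E unfolding closed_under_extensions_def by blast
  interpret C: left_module A C by (rule Cm)
  interpret B: left_module A B by (rule Bm)
  interpret L: left_module A L by (rule L_mod)
  note e = short_exactD[OF E]
  have nosec: False if s: "s \<in> mod_hom A C B" "\<And>x. x \<in> carrier C \<Longrightarrow> f (s x) = x" for s
  proof -
    have "compose (carrier T) f (compose (carrier T) s t0) = t0"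
      by (rule extensionalityI[of _ "carrier T"])
        (use s(2) mod_hom_closed[OF t0(1)] mod_hom_extensional[OF t0(1)] in \<open>auto simp: compose_eq\<close>)
    then have "\<delta> t0 = \<zero>\<^bsub>K\<^esub>"
      using connecting_lift_zero[OF Bm Cm E con mod_hom_compose[OF T_mod t0(1) s(1)]] by simp
    then show False using t0(2) by simp
  qed
  have noret: False if r: "r \<in> mod_hom A B L" "\<And>x. x \<in> carrier L \<Longrightarrow> r (g x) = x" for r
  proof -
    obtain s where "s \<in> mod_hom A C B" "\<And>m. m \<in> carrier C \<Longrightarrow> f (s m) = m"
      by (rule section_of_retraction[OF L_mod Bm Cm E r]) (assumption | rule that)+
    then show False by (rule nosec)
  qed
  have left: "left_almost_split A \<L> L B g"
    unfolding left_almost_split_def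
  proof (intro conjI L(1) B e(1) ballI impI)
    show "\<not> split_mono A L B g"
    proof
      assume "split_mono A L B g"
      then obtain r where r: "r \<in> mod_hom A B L" "compose (carrier L) r g = mod_id L" unfolding split_mono_def by blast
      have "r (g x) = x" if "x \<in> carrier L" for x
        using fun_cong[OF r(2), of x] that by (simp add: compose_eq mod_id_apply)
      then show False using noret r(1) by blast
    qed
    fix A' h assume A': "A' \<in> \<L>" and h: "h \<in> mod_hom A L A'" and nh: "\<not> split_mono A L A' h"
    have A'm: "left_module A A'" by (rule lm[OF A'])
    interpret A': left_module A A' by (rule A'm)
    obtain B' :: "('a, 'm) module" and \<iota> \<rho> \<pi> where B'fg: "fg_module A B'" and E': "short_exact A A' \<iota> B' \<pi> C"
      and \<rho>: "\<rho> \<in> mod_hom A B B'" and \<pi>\<rho>: "\<And>y. y \<in> carrier B \<Longrightarrow> \<pi> (\<rho> y) = f y"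
      and \<rho>g: "\<And>x. x \<in> carrier L \<Longrightarrow> \<rho> (g x) = \<iota> (h x)"
      by (rule pushout[OF fg[OF A'] Bfg L_mod Cm E h]) (rule that)
    have B': "B' \<in> \<L>" using ext A' C B'fg E' unfolding closed_under_extensions_def by blast
    have B'm: "left_module A B'" by (rule lm[OF B'])
    interpret B': left_module A B' by (rule B'm)
    note e' = short_exactD[OF E']
    \<comment> \<open>If \<open>\<pi>\<close> lifted to \<open>B\<close>, then \<open>1 = m h + k g\<close> on \<open>L\<close>, and \<open>h\<close> or \<open>g\<close> would split.\<close>
    have nolift: False if s: "s \<in> mod_hom A B' B" "\<And>x. x \<in> carrier B' \<Longrightarrow> f (s x) = \<pi> x" for s
    proof -
      have sc: "s x \<in> carrier B" if "x \<in> carrier B'" for x by (rule mod_hom_closed[OF s(1) that])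
      have \<rho>c: "\<rho> y \<in> carrier B'" if "y \<in> carrier B" for y by (rule mod_hom_closed[OF \<rho> that])
      let ?d = "\<lambda>y\<in>carrier B. mod_id B y \<ominus>\<^bsub>B\<^esub> compose (carrier B) s \<rho> y"
      have d: "?d \<in> mod_hom A B B"
        by (rule hom_diff_in[OF Bm Bm mod_hom_id[OF Bm] mod_hom_compose[OF Bm \<rho> s(1)]])
      have "f (?d y) = \<zero>\<^bsub>C\<^esub>" if y: "y \<in> carrier B" for y
        using mod_hom_diff[OF Bm Cm e(2) y sc[OF \<rho>c[OF y]]] s(2)[OF \<rho>c[OF y]] \<pi>\<rho>[OF y] mod_hom_closed[OF e(2) y] y
        by (simp add: mod_id_apply compose_eq a_minus_def C.M.r_neg)
      then obtain k where k: "k \<in> mod_hom A B L" "\<And>y. y \<in> carrier B \<Longrightarrow> g (k y) = ?d y"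
        by (rule short_exact_kernel_lift[OF L_mod Bm Cm Bm E d]) (assumption | rule that)+
      have s\<iota>: "compose (carrier A') s \<iota> \<in> mod_hom A A' B" by (rule mod_hom_compose[OF A'm e'(1) s(1)])
      have "f (compose (carrier A') s \<iota> z) = \<zero>\<^bsub>C\<^esub>" if z: "z \<in> carrier A'" for z
        using s(2)[OF mod_hom_closed[OF e'(1) z]] e'(4)[OF z] z by (simp add: compose_eq)
      then obtain m where m: "m \<in> mod_hom A A' L" "\<And>z. z \<in> carrier A' \<Longrightarrow> g (m z) = compose (carrier A') s \<iota> z"
        by (rule short_exact_kernel_lift[OF L_mod Bm Cm A'm E s\<iota>]) (assumption | rule that)+
      let ?mh = "compose (carrier L) m h" and ?kg = "compose (carrier L) k g"
      have mh: "?mh \<in> mod_hom A L L" by (rule mod_hom_compose[OF L_mod h m(1)])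
      have kg: "?kg \<in> mod_hom A L L" by (rule mod_hom_compose[OF L_mod e(1) k(1)])
      have sum: "x = ?mh x \<oplus>\<^bsub>L\<^esub> ?kg x" if x: "x \<in> carrier L" for x
      proof -
        have c: "g x \<in> carrier B" "h x \<in> carrier A'" using mod_hom_closed[OF e(1) x] mod_hom_closed[OF h x] by auto
        have c2: "m (h x) \<in> carrier L" "k (g x) \<in> carrier L" using mod_hom_closed[OF m(1) c(2)] mod_hom_closed[OF k(1) c(1)] by auto
        have 1: "g (m (h x)) = s (\<rho> (g x))" using m(2)[OF c(2)] \<rho>g[OF x] c(2) by (simp add: compose_eq)
        have 2: "g (k (g x)) = g x \<ominus>\<^bsub>B\<^esub> s (\<rho> (g x))" using k(2)[OF c(1)] c(1) by (simp add: compose_eq mod_id_apply)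
        have "g (m (h x) \<oplus>\<^bsub>L\<^esub> k (g x)) = s (\<rho> (g x)) \<oplus>\<^bsub>B\<^esub> (g x \<ominus>\<^bsub>B\<^esub> s (\<rho> (g x)))"
          using mod_hom_add[OF e(1) c2] 1 2 by simp
        also have "\<dots> = g x" using c(1) sc[OF \<rho>c[OF c(1)]] by (simp add: a_minus_def B.M.a_ac B.M.r_neg)
        finally have "m (h x) \<oplus>\<^bsub>L\<^esub> k (g x) = x"
          using e(3) x c2 by (auto dest: inj_onD)
        then show ?thesis using x by (simp add: compose_eq)
      qed
      \<comment> \<open>if an endomorphism \<open>n j\<close> of \<open>L\<close> is bijective, then \<open>j\<close> has a retraction\<close>
      have retr: "\<exists>r\<in>mod_hom A V L. \<forall>x\<in>carrier L. r (j x) = x"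
        if V: "left_module A V" and j: "j \<in> mod_hom A L V" and n: "n \<in> mod_hom A V L"
          and b: "bij_betw (compose (carrier L) n j) (carrier L) (carrier L)" for V :: "('a, 'm) module" and j n
      proof -
        obtain w where w: "w \<in> mod_hom A L L" "\<And>x. x \<in> carrier L \<Longrightarrow> w (compose (carrier L) n j x) = x"
          by (rule mod_hom_inverse[OF L_mod L_mod mod_hom_compose[OF L_mod j n] b]) (rule that)
        have "compose (carrier V) w n (j x) = x" if "x \<in> carrier L" for x
          using w(2)[OF that] that mod_hom_closed[OF j that] by (simp add: compose_eq)
        then show ?thesis using mod_hom_compose[OF V n w(1)] by blast
      qed
      consider "bij_betw ?mh (carrier L) (carrier L)" | "bij_betw ?kg (carrier L) (carrier L)"
        using indecomposable_local[OF L_fg L(2) mh kg sum] by blast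
      then show False
      proof cases
        case 1
        then obtain r where r: "r \<in> mod_hom A A' L" "\<forall>x\<in>carrier L. r (h x) = x" using retr[OF A'm h m(1)] by blast
        have "compose (carrier L) r h = mod_id L"
          by (rule mod_hom_eqI[OF mod_hom_compose[OF L_mod h r(1)] mod_hom_id[OF L_mod]])
            (use r(2) in \<open>simp add: compose_eq mod_id_apply\<close>)
        then show False using nh h r(1) unfolding split_mono_def by blast
      next
        case 2
        then obtain r where "r \<in> mod_hom A B L" "\<forall>x\<in>carrier L. r (g x) = x" using retr[OF Bm e(1) k(1)] by blast
        then show False using noret by blast
      qed
    qed
    have "\<exists>t\<in>mod_hom A T B'. \<delta> (compose (carrier T) \<pi> t) \<noteq> \<zero>\<^bsub>K\<^esub>"
    proof (rule ccontr)
      assume "\<not> ?thesis"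
      then have z: "\<delta> (compose (carrier T) \<pi> t) = \<zero>\<^bsub>K\<^esub>" if "t \<in> mod_hom A T B'" for t using that by blast
      obtain s where "s \<in> mod_hom A B' B" "\<And>n. n \<in> carrier B' \<Longrightarrow> f (s n) = \<pi> n"
        by (rule connecting_lift[OF Bm Cm B'm E con e'(2) z]) (assumption | rule that)+
      then show False by (rule nolift)
    qed
    then obtain t where t: "t \<in> mod_hom A T B'" "\<delta> (compose (carrier T) \<pi> t) \<noteq> \<zero>\<^bsub>K\<^esub>" by blast
    obtain a where a: "a \<in> mod_hom A C B'"
      "\<And>s. s \<in> mod_hom A T C \<Longrightarrow> \<delta> (compose (carrier T) (compose (carrier C) \<pi> a) s) = \<delta> s"
      using rec'[OF B' e'(2) t] by blast
    let ?\<pi>a = "compose (carrier C) \<pi> a"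
    have \<pi>a: "?\<pi>a \<in> mod_hom A C C" by (rule mod_hom_compose[OF Cm a(1) e'(2)])
    \<comment> \<open>\<open>1 - \<pi> a\<close> is killed by \<open>\<delta>\<close>, so it lifts to \<open>s : C \<rightarrow> B\<close>, and \<open>a + \<rho> s\<close> is a section of \<open>\<pi>\<close>\<close>
    let ?b = "\<lambda>x\<in>carrier C. mod_id C x \<ominus>\<^bsub>C\<^esub> ?\<pi>a x"
    have b: "?b \<in> mod_hom A C C" by (rule hom_diff_in[OF Cm Cm mod_hom_id[OF Cm] \<pi>a])
    have bz: "\<delta> (compose (carrier T) ?b s) = \<zero>\<^bsub>K\<^esub>" if s: "s \<in> mod_hom A T C" for s
    proof -
      have bs: "compose (carrier T) ?b s \<in> mod_hom A T C" by (rule mod_hom_compose[OF T_mod s b])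
      have ps: "compose (carrier T) ?\<pi>a s \<in> mod_hom A T C" by (rule mod_hom_compose[OF T_mod s \<pi>a])
      have "s = compose (carrier T) ?b s \<oplus>\<^bsub>hom_space T C\<^esub> compose (carrier T) ?\<pi>a s"
      proof (rule extensionalityI[of _ "carrier T"])
        fix x assume x: "x \<in> carrier T"
        have sx: "s x \<in> carrier C" "?\<pi>a (s x) \<in> carrier C"
          using mod_hom_closed[OF s x] mod_hom_closed[OF \<pi>a mod_hom_closed[OF s x]] by auto
        have "?b (s x) \<oplus>\<^bsub>C\<^esub> ?\<pi>a (s x) = s x"
          using sx by (simp add: mod_id_apply a_minus_def C.M.a_assoc C.M.l_neg)
        then show "s x = (compose (carrier T) ?b s \<oplus>\<^bsub>hom_space T C\<^esub> compose (carrier T) ?\<pi>a s) x"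
          using x by (simp add: compose_eq)
      qed (use mod_hom_extensional[OF s] in auto)
      then have "\<delta> s = \<delta> (compose (carrier T) ?b s) \<oplus>\<^bsub>K\<^esub> \<delta> s"
        using mod_hom_add[OF \<delta>, of "compose (carrier T) ?b s" "compose (carrier T) ?\<pi>a s"] bs ps a(2)[OF s] by simp
      moreover have "\<delta> s \<in> carrier K" "\<delta> (compose (carrier T) ?b s) \<in> carrier K"
        using mod_hom_closed[OF \<delta>] s bs by simp_all
      ultimately show ?thesis by (metis K.add.r_cancel_one)
    qed
    obtain s where s: "s \<in> mod_hom A C B" "\<And>n. n \<in> carrier C \<Longrightarrow> f (s n) = ?b n"
      by (rule connecting_lift[OF Bm Cm Cm E con b bz]) (assumption | rule that)+
    let ?s = "a \<oplus>\<^bsub>hom_space C B'\<^esub> compose (carrier C) \<rho> s"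
    have \<rho>s: "compose (carrier C) \<rho> s \<in> mod_hom A C B'" by (rule mod_hom_compose[OF Cm s(1) \<rho>])
    have sh: "?s \<in> mod_hom A C B'" using hom_add_in[OF Cm B'm a(1) \<rho>s] by simp
    have sec: "\<pi> (?s x) = x" if x: "x \<in> carrier C" for x
    proof -
      have c: "a x \<in> carrier B'" "s x \<in> carrier B" "\<rho> (s x) \<in> carrier B'"
        using mod_hom_closed[OF a(1) x] mod_hom_closed[OF s(1) x] mod_hom_closed[OF \<rho> mod_hom_closed[OF s(1) x]] by auto
      have px: "\<pi> (a x) \<in> carrier C" using mod_hom_closed[OF e'(2) c(1)] .
      have "\<pi> (?s x) = \<pi> (a x) \<oplus>\<^bsub>C\<^esub> ?b x"
        using mod_hom_add[OF e'(2) c(1,3)] \<pi>\<rho>[OF c(2)] s(2)[OF x] x by (simp add: compose_eq)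
      also have "\<dots> = x" using x px by (simp add: mod_id_apply compose_eq a_minus_def C.M.a_ac C.M.r_neg)
      finally show ?thesis .
    qed
    obtain r where r: "r \<in> mod_hom A B' A'" "\<And>n. n \<in> carrier A' \<Longrightarrow> r (\<iota> n) = n"
      by (rule retraction_of_section[OF A'm B'm Cm E' sh sec]) (assumption | rule that)+
    have r\<rho>: "compose (carrier B) r \<rho> \<in> mod_hom A B A'" by (rule mod_hom_compose[OF Bm \<rho> r(1)])
    have "h = compose (carrier L) (compose (carrier B) r \<rho>) g"
      by (rule mod_hom_eqI[OF h mod_hom_compose[OF L_mod e(1) r\<rho>]])
        (use \<rho>g r(2) mod_hom_closed[OF h] mod_hom_closed[OF e(1)] in \<open>simp add: compose_eq\<close>)
    then show "\<exists>h'\<in>mod_hom A B A'. h = compose (carrier L) h' g" using r\<rho> by blast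
  qed
  have right: "right_almost_split A \<L> B C f"
    unfolding right_almost_split_def
  proof (intro conjI B C e(2) ballI impI)
    show "\<not> split_epi A B C f"
    proof
      assume "split_epi A B C f"
      then obtain s where s: "s \<in> mod_hom A C B" "compose (carrier C) f s = mod_id C" unfolding split_epi_def by blast
      have "f (s x) = x" if "x \<in> carrier C" for x
        using fun_cong[OF s(2), of x] that by (simp add: compose_eq mod_id_apply)
      then show False using nosec s(1) by blast
    qed
    fix C' h assume C': "C' \<in> \<L>" and h: "h \<in> mod_hom A C' C" and nh: "\<not> split_epi A C' C h"
    have C'm: "left_module A C'" by (rule lm[OF C'])
    have z: "\<delta> (compose (carrier T) h t) = \<zero>\<^bsub>K\<^esub>" if t: "t \<in> mod_hom A T C'" for t
    proof (rule ccontr)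
      assume "\<delta> (compose (carrier T) h t) \<noteq> \<zero>\<^bsub>K\<^esub>"
      then obtain a where a: "a \<in> mod_hom A C C'"
        "\<And>s. s \<in> mod_hom A T C \<Longrightarrow> \<delta> (compose (carrier T) (compose (carrier C) h a) s) = \<delta> s"
        using rec'[OF C' h t] by blast
      let ?ha = "compose (carrier C) h a"
      have ha: "?ha \<in> mod_hom A C C" by (rule mod_hom_compose[OF Cm a(1) h])
      have b: "bij_betw ?ha (carrier C) (carrier C)" using bij ha a(2) by blast
      obtain w where w: "w \<in> mod_hom A C C" "\<And>y. y \<in> carrier C \<Longrightarrow> ?ha (w y) = y"
        by (rule mod_hom_inverse[OF Cm Cm ha b]) (rule that)
      have aw: "compose (carrier C) a w \<in> mod_hom A C C'" by (rule mod_hom_compose[OF Cm w(1) a(1)])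
      have "compose (carrier C) h (compose (carrier C) a w) = mod_id C"
        by (rule mod_hom_eqI[OF mod_hom_compose[OF Cm aw h] mod_hom_id[OF Cm]])
          (use w(2) mod_hom_closed[OF w(1)] in \<open>simp add: compose_eq mod_id_apply\<close>)
      then show False using nh h aw unfolding split_epi_def by blast
    qed
    obtain s where s: "s \<in> mod_hom A C' B" "\<And>n. n \<in> carrier C' \<Longrightarrow> f (s n) = h n"
      by (rule connecting_lift[OF Bm Cm C'm E con h z]) (assumption | rule that)+
    have "h = compose (carrier C') f s"
      by (rule mod_hom_eqI[OF h mod_hom_compose[OF C'm s(1) e(2)]]) (use s(2) in \<open>simp add: compose_eq\<close>)
    then show "\<exists>h'\<in>mod_hom A C' B. h = compose (carrier C') f h'" using s(1) by blast
  qed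
  show ?thesis unfolding AR_sequence_def using L(1) B C E left right by blast
qed

text \<open>Any \<open>c\<close> on which the connecting functional of the sequence does not vanish will do. A map \<open>h\<close> that
  did not factor through \<open>c\<close> in the stable category would be detected by a functional, that is, by a
  non-split extension of \<open>U\<close> by \<open>L\<close>, and the left almost split property compares this extension with
  the given sequence.\<close>

lemma preenvelope_of_AR_sequence:
  assumes \<L>: "\<L> \<subseteq> {M. fg_module A M}" and ext: "closed_under_extensions A \<L>"
    and AR: "AR_sequence A \<L> L g B f C"
  shows "\<exists>c\<in>mod_hom A T C. \<forall>U\<in>\<L>. \<forall>h\<in>mod_hom A T U. \<exists>a\<in>mod_hom A C U. \<exists>p\<in>proj_factor A T U.
    h = p \<oplus>\<^bsub>hom_space T U\<^esub> compose (carrier T) a c"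
proof -
  have fg: "fg_module A U" and lm: "left_module A U" if "U \<in> \<L>" for U
    using that \<L> fg_left_module by auto
  have L: "L \<in> \<L>" and B: "B \<in> \<L>" and C: "C \<in> \<L>" and E: "short_exact A L g B f C"
    and left: "left_almost_split A \<L> L B g"
    using AR unfolding AR_sequence_def by auto
  have Bm: "left_module A B" and Cm: "left_module A C" using lm B C by auto
  note e = short_exactD[OF E]
  obtain \<delta> where con: "connecting g B f C \<delta>" by (rule connecting_exists[OF Bm Cm E])
  have "\<exists>c\<in>mod_hom A T C. \<delta> c \<noteq> \<zero>\<^bsub>K\<^esub>"
  proof (rule ccontr)
    assume "\<not> ?thesis"
    then have z: "\<delta> t = \<zero>\<^bsub>K\<^esub>" if "t \<in> mod_hom A T C" for t using that by blast
    obtain r where r: "r \<in> mod_hom A B L" "\<And>l. l \<in> carrier L \<Longrightarrow> r (g l) = l"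
      by (rule connecting_zero_split[OF Bm Cm E con z]) (assumption | rule that)+
    have "compose (carrier L) r g = mod_id L"
      by (rule mod_hom_eqI[OF mod_hom_compose[OF L_mod e(1) r(1)] mod_hom_id[OF L_mod]])
        (use r(2) in \<open>simp add: compose_eq mod_id_apply\<close>)
    then show False using left e(1) r(1) unfolding left_almost_split_def split_mono_def by blast
  qed
  then obtain c where c: "c \<in> mod_hom A T C" "\<delta> c \<noteq> \<zero>\<^bsub>K\<^esub>" by blast
  have "\<exists>a\<in>mod_hom A C U. \<exists>p\<in>proj_factor A T U. h = p \<oplus>\<^bsub>hom_space T U\<^esub> compose (carrier T) a c"
    if U: "U \<in> \<L>" and h: "h \<in> mod_hom A T U" for U h
  proof (rule ccontr)
    assume no: "\<not> ?thesis"
    have Um: "left_module A U" by (rule lm[OF U])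
    let ?H = "hom_space T U"
    note H = left_module_hom_space[OF T_mod Um] and HC = left_module_hom_space[OF Cm Um]
    have pf: "submod K ?H (proj_factor A T U)" by (rule submod_proj_factor[OF T_mod fg[OF U]])
    let ?pre = "\<lambda>a\<in>mod_hom A C U. compose (carrier T) a c"
    have pre: "?pre \<in> mod_hom K (hom_space C U) ?H" by (rule precomp_hom[OF T_mod Cm Um c(1)])
    let ?J = "?pre ` carrier (hom_space C U)"
    have J: "submod K ?H ?J" by (rule submod_image[OF HC H pre submod_carrier[OF HC]])
    \<comment> \<open>the maps \<open>T \<rightarrow> U\<close> that factor through \<open>c\<close> in the stable category\<close>
    define W where "W = {x \<oplus>\<^bsub>?H\<^esub> y | x y. x \<in> proj_factor A T U \<and> y \<in> ?J}"
    note W = submod_sum[OF H pf J, folded W_def]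
    have hW: "h \<in> carrier ?H" "h \<notin> W" using h no unfolding W_def by auto
    obtain \<xi> where \<xi>: "\<xi> \<in> mod_hom K ?H (regular K)" "\<And>w. w \<in> W \<Longrightarrow> \<xi> w = \<zero>\<^bsub>K\<^esub>" "\<xi> h = \<one>\<^bsub>K\<^esub>"
      by (rule functional_separating[OF field_K H W(1) hW]) (rule that)
    have \<xi>z: "\<xi> p = \<zero>\<^bsub>K\<^esub>" if "p \<in> proj_factor A T U" for p by (rule \<xi>(2)[OF W(2)[OF that]])
    have \<xi>c: "\<xi> (compose (carrier T) a c) = \<zero>\<^bsub>K\<^esub>" if "a \<in> mod_hom A C U" for a
      by (rule \<xi>(2)[OF W(3)]) (use that in auto)
    obtain Z :: "('a, 'm) module" and g' f' where Z: "fg_module A Z" and E': "short_exact A L g' Z f' U"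
      and con': "connecting g' Z f' U \<xi>"
      by (rule connecting_realize[OF fg[OF U] \<xi>(1) \<xi>z]) (assumption | rule that)+
    have ZL: "Z \<in> \<L>" using ext L U Z E' unfolding closed_under_extensions_def by blast
    have Zm: "left_module A Z" by (rule lm[OF ZL])
    note e' = short_exactD[OF E']
    have "\<not> split_mono A L Z g'"
    proof
      assume "split_mono A L Z g'"
      then obtain r where r: "r \<in> mod_hom A Z L" "compose (carrier L) r g' = mod_id L" unfolding split_mono_def by blast
      have rg: "r (g' x) = x" if "x \<in> carrier L" for x
        using fun_cong[OF r(2), of x] that by (simp add: compose_eq mod_id_apply)
      obtain s where s: "s \<in> mod_hom A U Z" "\<And>m. m \<in> carrier U \<Longrightarrow> f' (s m) = m"
        by (rule section_of_retraction[OF L_mod Zm Um E' r(1) rg]) (assumption | rule that)+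
      have "compose (carrier T) f' (compose (carrier T) s h) = h"
        by (rule extensionalityI[of _ "carrier T"])
          (use s(2) mod_hom_closed[OF h] mod_hom_extensional[OF h] in \<open>auto simp: compose_eq\<close>)
      then have "\<xi> h = \<zero>\<^bsub>K\<^esub>"
        using connecting_lift_zero[OF Zm Um E' con' mod_hom_compose[OF T_mod h s(1)]] by simp
      then show False using \<xi>(3) by simp
    qed
    then obtain u where u: "u \<in> mod_hom A B Z" "g' = compose (carrier L) u g"
      using left ZL e'(1) unfolding left_almost_split_def by blast
    have ug: "u (g l) = g' l" if "l \<in> carrier L" for l using fun_cong[OF u(2), of l] that by (simp add: compose_eq)
    have fu: "compose (carrier B) f' u \<in> mod_hom A B U" by (rule mod_hom_compose[OF Bm u(1) e'(2)])
    have "compose (carrier B) f' u y = \<zero>\<^bsub>U\<^esub>" if y: "y \<in> carrier B" "f y = \<zero>\<^bsub>C\<^esub>" for y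
    proof -
      obtain l where "l \<in> carrier L" "y = g l" using e(5)[OF y] by blast
      then show ?thesis using ug e'(4) y(1) by (simp add: compose_eq)
    qed
    then obtain a where a: "a \<in> mod_hom A C U" "\<And>y. y \<in> carrier B \<Longrightarrow> a (f y) = compose (carrier B) f' u y"
      by (rule factor_through_surj[OF Bm Cm Um e(2) e(7) fu]) (assumption | rule that)+
    have "\<xi> (compose (carrier T) a c) = \<delta> c"
      by (rule connecting_natural[OF Bm Cm E con con' u(1) a(1) ug _ c(1)])
        (assumption | simp add: a(2) compose_eq)+
    then show False using \<xi>c[OF a(1)] c(2) by simp
  qed
  then show ?thesis using c(1) by blast
qed

text \<open>A map through a projective lifts along \<open>f\<close>, so its value under the connecting functional is zero.\<close>

lemma stable_functional_of_nonsplit: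
  fixes M Z :: "('a, 'm) module"
  assumes M: "fg_module A M" and Z: "fg_module A Z" and E: "short_exact A L g Z f M"
    and ns: "\<And>r. r \<in> mod_hom A Z L \<Longrightarrow> \<exists>l\<in>carrier L. r (g l) \<noteq> l"
  obtains \<xi> where "stable_functional M \<xi>"
proof -
  have Mm: "left_module A M" and Zm: "left_module A Z" using M Z by (auto intro: fg_left_module)
  note e = short_exactD[OF E]
  obtain \<xi> where con: "connecting g Z f M \<xi>" by (rule connecting_exists[OF Zm Mm E])
  have "\<exists>t\<in>mod_hom A T M. \<xi> t \<noteq> \<zero>\<^bsub>K\<^esub>"
  proof (rule ccontr)
    assume "\<not> ?thesis"
    then have z: "\<xi> t = \<zero>\<^bsub>K\<^esub>" if "t \<in> mod_hom A T M" for t using that by blast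
    obtain r where "r \<in> mod_hom A Z L" "\<And>l. l \<in> carrier L \<Longrightarrow> r (g l) = l"
      by (rule connecting_zero_split[OF Zm Mm E con z]) (assumption | rule that)+
    then show False using ns by blast
  qed
  moreover have "\<xi> p = \<zero>\<^bsub>K\<^esub>" if p: "p \<in> proj_factor A T M" for p
  proof -
    obtain Q :: "('a, 'm) module" and u v where Q: "fg_module A Q" "projective A Q" and u: "u \<in> mod_hom A T Q"
      and v: "v \<in> mod_hom A Q M" and p_eq: "p = compose (carrier T) v u"
      by (rule proj_factorE[OF p]) (rule that; assumption)
    obtain h where h: "h \<in> mod_hom A Q Z" "v = compose (carrier Q) f h"
      by (rule projectiveD[OF Q(2) Zm Mm e(2) e(7) v]) (rule that)
    have "p = compose (carrier T) f (compose (carrier T) h u)" unfolding p_eq h(2) by (rule compose_assoc_hom[OF u, symmetric])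
    then show ?thesis using connecting_lift_zero[OF Zm Mm E con mod_hom_compose[OF T_mod u h(1)]] by simp
  qed
  ultimately have "stable_functional M \<xi>" unfolding stable_functional_def using con unfolding connecting_def by blast
  then show thesis by (rule that)
qed

end

theorem theorem5p5:
  fixes K :: "('k, 'x) ring_scheme"
    and \<Lambda> :: "('k, 'l) module"
    and \<L> :: "('l, 'm) module set"
    and L L' T :: "('l, 'm) module"
    and Q :: "nat \<Rightarrow> ('l, 'm) module"
    and e :: "nat \<Rightarrow> 'm \<Rightarrow> 'm"
    and \<eta> :: "'m \<Rightarrow> 'm"
  assumes "fd_algebra K \<Lambda>"
    \<comment> \<open>the type \<open>'m\<close> carries a copy of every finitely generated module\<close>
    and "lists (carrier K) \<lesssim> (UNIV :: 'm set)"
    and "\<L> \<subseteq> {M. fg_module \<Lambda> M}"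
    and "closed_under_extensions \<Lambda> \<L>"
    and "closed_under_summands \<Lambda> \<L>"
    and "L \<in> \<L>" and "indecomposable \<Lambda> L"
    \<comment> \<open>\<open>Ext\<^sup>1 (L', L) \<noteq> 0\<close> for some \<open>L'\<close> in \<open>\<L>\<close>\<close>
    and "L' \<in> \<L>" and "projective_resolution \<Lambda> Q e \<eta> L'"
    and "carrier (Ext1 \<Lambda> Q e L) \<noteq> {\<one>\<^bsub>Ext1 \<Lambda> Q e L\<^esub>}"
    \<comment> \<open>\<open>T = Tr D L\<close>\<close>
    and "is_transpose (opp \<Lambda>) (kdual K \<Lambda> L) T"
  shows "(\<exists>C c. preenvelope (stable_category \<Lambda>) \<L> T C c) \<longleftrightarrow>
         (\<exists>B A g f. AR_sequence \<Lambda> \<L> L g B f A)"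
proof -
  interpret algebra_with_universe K \<Lambda> "TYPE('m)"
    by (intro algebra_with_universe.intro fin_dim_algebra.intro algebra_with_universe_axioms.intro assms(1,2))
  have fg: "fg_module \<Lambda> U" if "U \<in> \<L>" for U using that assms(3) by auto
  obtain P0 P1 d \<epsilon> q where "transpose_data K \<Lambda> L T P0 P1 d \<epsilon> q"
    by (rule transpose_presentation[OF fg[OF assms(6)] assms(11)])
  then interpret D: transpose_data "TYPE('m)" K \<Lambda> L T P0 P1 d \<epsilon> q .
  note env = preenvelope_iff[OF D.T_fg assms(3)]
  show ?thesis
  proof
    assume "\<exists>C c. preenvelope (stable_category \<Lambda>) \<L> T C c"
    then obtain C c where C: "C \<in> \<L>" and c: "c \<in> mod_hom \<Lambda> T C"
      and u: "\<forall>U\<in>\<L>. \<forall>h\<in>mod_hom \<Lambda> T U. \<exists>a\<in>mod_hom \<Lambda> C U. \<exists>p\<in>proj_factor \<Lambda> T U.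
        h = p \<oplus>\<^bsub>hom_space T U\<^esub> compose (carrier T) a c"
      unfolding env by (elim bexE) (rule that; assumption)
    obtain Z :: "('l, 'm) module" and g f where Z: "fg_module \<Lambda> Z" "short_exact \<Lambda> L g Z f L'"
      "\<And>r. r \<in> mod_hom \<Lambda> Z L \<Longrightarrow> \<exists>l\<in>carrier L. r (g l) \<noteq> l"
      by (rule Ext1_nonzero_extension[OF fg[OF assms(6)] fg[OF assms(8)] assms(9,10)]) (rule that)
    obtain \<xi> where \<xi>: "D.stable_functional L' \<xi>"
      by (rule D.stable_functional_of_nonsplit[OF fg[OF assms(8)] Z(1,2) Z(3)]) (assumption | rule that)+
    obtain \<delta>0 where \<delta>0: "D.recurrent \<L> C \<delta>0"
      by (rule D.recurrent_exists[OF assms(3) C c bspec[OF bspec[OF u]] assms(8) \<xi>]) (assumption | rule that)+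
    obtain C' \<delta> where rec: "D.recurrent \<L> C' \<delta>"
      and bij: "\<forall>\<phi>\<in>mod_hom \<Lambda> C' C'. (\<forall>s\<in>mod_hom \<Lambda> T C'. \<delta> (compose (carrier T) \<phi> s) = \<delta> s) \<longrightarrow>
        bij_betw \<phi> (carrier C') (carrier C')"
      by (rule D.recurrent_minimal[OF assms(3,5) \<delta>0]) (rule that)
    have "\<exists>B g f. AR_sequence \<Lambda> \<L> L g B f C'"
      by (rule D.AR_sequence_of_recurrent[OF assms(3,4,6,7) rec bij])
    then show "\<exists>B A g f. AR_sequence \<Lambda> \<L> L g B f A" by blast
  next
    assume "\<exists>B A g f. AR_sequence \<Lambda> \<L> L g B f A"
    then obtain B C g f where AR: "AR_sequence \<Lambda> \<L> L g B f C" by blast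
    then have "C \<in> \<L>" unfolding AR_sequence_def by blast
    then show "\<exists>C c. preenvelope (stable_category \<Lambda>) \<L> T C c"
      unfolding env using D.preenvelope_of_AR_sequence[OF assms(3,4) AR] by (rule bexI[rotated])
  qed
qed

end
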